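(* The association $M\mapsto\mathbf{G}(M)$ is functorial with respect to $\mathbb{F}_1$-algebra homomorphisms. Much like the case of rings, the association $M\mapsto\mathtt{FG}(M)$ is only pseudofunctorial, i.e., it respects the composition of morphisms only up to an isomorphism.
   Context: An $\mathbb{F}_1$-algebra is a pointed monoid $M$ (a unital, not necessarily commutative monoid with an absorbing element $0$); homomorphisms preserve $1$, $0$ and products. A (right, unital) $M$-module is a pointed set $(S,0_S)$ with a right unital $M$-action by pointed maps such that $0\in M$ acts as the constant map to $0_S$; homomorphisms are $M$-equivariant pointed maps. $\mathtt{FG}(M)$ is the category of finitely generated $M$-modules (those of the form $\bigcup_{s\in S'}sM$ with $S'$ finite), regarded as a Waldhausen category: cofibrations are the split monomorphisms of $M$-modules $S_1\to S_2$ (having an $M$-module retraction) with $S_2/S_1$ in $\mathtt{FG}(M)$; weak equivalences are isomorphisms. $\mathbf{G}(M)$ is the Waldhausen $\mathrm{K}$-theory spectrum of $\mathtt{FG}(M)$. Waldhausen $\mathrm{K}$-theory is a functor from the category of (small) Waldhausen categories and Waldhausen exact functors to the category of spectra, such that any natural isomorphism between exact functors induces a homotopy between the associated maps of spectra. For a right $M$-module $S$ and a left $M$-module $S'$, $S\wedge_M S'=S\times S'/\{(sm,s')\sim(s,ms')\mid m\in M,\ s\in S,\ s'\in S'\}$. For an $\mathbb{F}_1$-algebra homomorphism $\alpha:M\to N$, $N$ is a left $M$-module via $\alpha$, and $S\wedge_M N$ is a right $N$-module via $(s,n)n'=(s,nn')$. The homomorphism $\alpha$ acts via the base change functor $\alpha_*:\mathtt{FG}(M)\to\mathtt{FG}(N)$,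 given by $S\mapsto S\wedge_M N$ on objects and $f\mapsto f\wedge\mathrm{id}$ on morphisms; this functor is Waldhausen exact. *)

theory Defs
  imports "HOL-Algebra.Group"
begin

section \<open>Categories, functors, natural isomorphisms\<close>

record ('o, 'm) category =
  Obj :: "'o set"
  Arr :: "'m set"
  Src :: "'m \<Rightarrow> 'o"
  Tgt :: "'m \<Rightarrow> 'o"
  Idn :: "'o \<Rightarrow> 'm"
  Cmp :: "'m \<Rightarrow> 'm \<Rightarrow> 'm"  \<comment> \<open>\<open>Cmp C g f\<close> is \<open>g\<close> after \<open>f\<close>\<close>

definition is_category :: "('o, 'm, 'z) category_scheme \<Rightarrow> bool" where
  "is_category C \<longleftrightarrow>
     (\<forall>f \<in> Arr C. Src C f \<in> Obj C \<and> Tgt C f \<in> Obj C) \<and>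
     (\<forall>A \<in> Obj C. Idn C A \<in> Arr C \<and> Src C (Idn C A) = A \<and> Tgt C (Idn C A) = A) \<and>
     (\<forall>f \<in> Arr C. \<forall>g \<in> Arr C. Src C g = Tgt C f \<longrightarrow>
        Cmp C g f \<in> Arr C \<and> Src C (Cmp C g f) = Src C f \<and> Tgt C (Cmp C g f) = Tgt C g) \<and>
     (\<forall>f \<in> Arr C. Cmp C f (Idn C (Src C f)) = f \<and> Cmp C (Idn C (Tgt C f)) f = f) \<and>
     (\<forall>f \<in> Arr C. \<forall>g \<in> Arr C. \<forall>h \<in> Arr C. Src C g = Tgt C f \<and> Src C h = Tgt C g \<longrightarrow>
        Cmp C h (Cmp C g f) = Cmp C (Cmp C h g) f)"

definition iso_arrow :: "('o, 'm, 'z) category_scheme \<Rightarrow> 'm \<Rightarrow> bool" where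
  "iso_arrow C f \<longleftrightarrow> f \<in> Arr C \<and>
     (\<exists>g \<in> Arr C. Src C g = Tgt C f \<and> Tgt C g = Src C f \<and>
        Cmp C g f = Idn C (Src C f) \<and> Cmp C f g = Idn C (Tgt C f))"

definition zero_object :: "('o, 'm, 'z) category_scheme \<Rightarrow> 'o \<Rightarrow> bool" where
  "zero_object C Z \<longleftrightarrow> Z \<in> Obj C \<and>
     (\<forall>A \<in> Obj C. (\<exists>!f. f \<in> Arr C \<and> Src C f = Z \<and> Tgt C f = A) \<and>
                   (\<exists>!f. f \<in> Arr C \<and> Src C f = A \<and> Tgt C f = Z))"

text \<open>\<open>is_pushout C a b c d\<close>: the square with \<open>a : X \<rightarrow> Y\<close>, \<open>b : X \<rightarrow> Z\<close>, \<open>c : Y \<rightarrow> P\<close>,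
  \<open>d : Z \<rightarrow> P\<close> is a pushout square.\<close>

definition is_pushout :: "('o, 'm, 'z) category_scheme \<Rightarrow> 'm \<Rightarrow> 'm \<Rightarrow> 'm \<Rightarrow> 'm \<Rightarrow> bool" where
  "is_pushout C a b c d \<longleftrightarrow>
     a \<in> Arr C \<and> b \<in> Arr C \<and> c \<in> Arr C \<and> d \<in> Arr C \<and>
     Src C b = Src C a \<and> Src C c = Tgt C a \<and> Src C d = Tgt C b \<and> Tgt C d = Tgt C c \<and>
     Cmp C c a = Cmp C d b \<and>
     (\<forall>c' \<in> Arr C. \<forall>d' \<in> Arr C.
        Src C c' = Tgt C a \<and> Src C d' = Tgt C b \<and> Tgt C d' = Tgt C c' \<and>
        Cmp C c' a = Cmp C d' b \<longrightarrow>
        (\<exists>!u. u \<in> Arr C \<and> Src C u = Tgt C c \<and> Tgt C u = Tgt C c' \<and>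
              Cmp C u c = c' \<and> Cmp C u d = d'))"

record ('o, 'm, 'p, 'n) cat_functor =
  on_obj :: "'o \<Rightarrow> 'p"
  on_arr :: "'m \<Rightarrow> 'n"

definition is_functor ::
  "('o, 'm, 'z) category_scheme \<Rightarrow> ('p, 'n, 'y) category_scheme \<Rightarrow> ('o, 'm, 'p, 'n) cat_functor \<Rightarrow> bool" where
  "is_functor C D F \<longleftrightarrow>
     is_category C \<and> is_category D \<and>
     (\<forall>A \<in> Obj C. on_obj F A \<in> Obj D \<and> on_arr F (Idn C A) = Idn D (on_obj F A)) \<and>
     (\<forall>f \<in> Arr C. on_arr F f \<in> Arr D \<and>
        Src D (on_arr F f) = on_obj F (Src C f) \<and> Tgt D (on_arr F f) = on_obj F (Tgt C f)) \<and>
     (\<forall>f \<in> Arr C. \<forall>g \<in> Arr C. Src C g = Tgt C f \<longrightarrow>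
        on_arr F (Cmp C g f) = Cmp D (on_arr F g) (on_arr F f))"

definition id_functor :: "('o, 'm, 'o, 'm) cat_functor" where
  "id_functor = \<lparr>on_obj = (\<lambda>A. A), on_arr = (\<lambda>f. f)\<rparr>"

definition comp_functor ::
  "('p, 'n, 'q, 'k) cat_functor \<Rightarrow> ('o, 'm, 'p, 'n) cat_functor \<Rightarrow> ('o, 'm, 'q, 'k) cat_functor" where
  "comp_functor G F = \<lparr>on_obj = on_obj G \<circ> on_obj F, on_arr = on_arr G \<circ> on_arr F\<rparr>"

definition natural_iso ::
  "('o, 'm, 'z) category_scheme \<Rightarrow> ('p, 'n, 'y) category_scheme \<Rightarrow>
   ('o, 'm, 'p, 'n) cat_functor \<Rightarrow> ('o, 'm, 'p, 'n) cat_functor \<Rightarrow> ('o \<Rightarrow> 'n) \<Rightarrow> bool" where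
  "natural_iso C D F G \<eta> \<longleftrightarrow>
     (\<forall>A \<in> Obj C. iso_arrow D (\<eta> A) \<and> Src D (\<eta> A) = on_obj F A \<and> Tgt D (\<eta> A) = on_obj G A) \<and>
     (\<forall>f \<in> Arr C. Cmp D (\<eta> (Tgt C f)) (on_arr F f) = Cmp D (on_arr G f) (\<eta> (Src C f)))"

text \<open>Functors from the poset \<open>(I, leq)\<close> to \<open>C\<close>; \<open>f x y\<close> is the arrow assigned to \<open>x \<le> y\<close>.\<close>

definition is_diagram ::
  "('o, 'm, 'z) category_scheme \<Rightarrow> 'i set \<Rightarrow> ('i \<Rightarrow> 'i \<Rightarrow> bool) \<Rightarrow> ('i \<Rightarrow> 'o) \<Rightarrow> ('i \<Rightarrow> 'i \<Rightarrow> 'm) \<Rightarrow> bool" where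
  "is_diagram C I leq A f \<longleftrightarrow>
     (\<forall>x \<in> I. A x \<in> Obj C \<and> f x x = Idn C (A x)) \<and>
     (\<forall>x \<in> I. \<forall>y \<in> I. leq x y \<longrightarrow> f x y \<in> Arr C \<and> Src C (f x y) = A x \<and> Tgt C (f x y) = A y) \<and>
     (\<forall>x \<in> I. \<forall>y \<in> I. \<forall>z \<in> I. leq x y \<and> leq y z \<longrightarrow> Cmp C (f y z) (f x y) = f x z)"

text \<open>Arrows of concrete categories carry their source and target.\<close>

datatype ('o, 'f) arrow = Arrow (arrow_src: 'o) (arrow_fun: 'f) (arrow_tgt: 'o)


section \<open>Waldhausen categories and exact functors\<close>

record ('o, 'm) waldhausen = "('o, 'm) category" +
  Zob :: 'o
  Cof :: "'m set"
  Weq :: "'m set"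

definition is_waldhausen :: "('o, 'm, 'z) waldhausen_scheme \<Rightarrow> bool" where
  "is_waldhausen C \<longleftrightarrow>
     is_category C \<and> zero_object C (Zob C) \<and> Cof C \<subseteq> Arr C \<and> Weq C \<subseteq> Arr C \<and>
     (\<forall>f. iso_arrow C f \<longrightarrow> f \<in> Cof C \<and> f \<in> Weq C) \<and>
     (\<forall>f \<in> Cof C. \<forall>g \<in> Cof C. Src C g = Tgt C f \<longrightarrow> Cmp C g f \<in> Cof C) \<and>
     (\<forall>f \<in> Weq C. \<forall>g \<in> Weq C. Src C g = Tgt C f \<longrightarrow> Cmp C g f \<in> Weq C) \<and>
     (\<forall>f \<in> Arr C. Src C f = Zob C \<longrightarrow> f \<in> Cof C) \<and>
     (\<forall>a \<in> Cof C. \<forall>b \<in> Arr C. Src C b = Src C a \<longrightarrow> (\<exists>c d. is_pushout C a b c d)) \<and>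
     (\<forall>a b c d. a \<in> Cof C \<and> is_pushout C a b c d \<longrightarrow> d \<in> Cof C) \<and>
     (\<forall>a b c d a' b' c' d' x y z w.
        a \<in> Cof C \<and> a' \<in> Cof C \<and> is_pushout C a b c d \<and> is_pushout C a' b' c' d' \<and>
        x \<in> Weq C \<and> Src C x = Src C a \<and> Tgt C x = Src C a' \<and>
        y \<in> Weq C \<and> Src C y = Tgt C a \<and> Tgt C y = Tgt C a' \<and>
        z \<in> Weq C \<and> Src C z = Tgt C b \<and> Tgt C z = Tgt C b' \<and>
        Cmp C y a = Cmp C a' x \<and> Cmp C z b = Cmp C b' x \<and>
        w \<in> Arr C \<and> Src C w = Tgt C c \<and> Tgt C w = Tgt C c' \<and>
        Cmp C w c = Cmp C c' y \<and> Cmp C w d = Cmp C d' z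
        \<longrightarrow> w \<in> Weq C)"

definition exact_functor ::
  "('o, 'm, 'z) waldhausen_scheme \<Rightarrow> ('p, 'n, 'y) waldhausen_scheme \<Rightarrow> ('o, 'm, 'p, 'n) cat_functor \<Rightarrow> bool" where
  "exact_functor C D F \<longleftrightarrow>
     is_functor C D F \<and> on_obj F (Zob C) = Zob D \<and>
     (\<forall>f \<in> Cof C. on_arr F f \<in> Cof D) \<and> (\<forall>f \<in> Weq C. on_arr F f \<in> Weq D) \<and>
     (\<forall>a b c d. a \<in> Cof C \<and> is_pushout C a b c d \<longrightarrow>
        is_pushout D (on_arr F a) (on_arr F b) (on_arr F c) (on_arr F d))"

text \<open>Pseudofunctors from a category \<open>B\<close> to the strict 2-category of Waldhausen categories, exact
  functors and natural isomorphisms, with unit constraints \<open>\<upsilon> b : Id \<Rightarrow> P (id\<^sub>b)\<close> and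
  composition constraints \<open>\<mu> g f : P g \<circ> P f \<Rightarrow> P (g \<circ> f)\<close>. The last three conditions are the
  two unit axioms and the associativity axiom.\<close>

definition is_pseudofunctor ::
  "('b, 'f, 'z) category_scheme \<Rightarrow> ('b \<Rightarrow> ('o, 'm) waldhausen) \<Rightarrow>
   ('f \<Rightarrow> ('o, 'm, 'o, 'm) cat_functor) \<Rightarrow> ('b \<Rightarrow> 'o \<Rightarrow> 'm) \<Rightarrow> ('f \<Rightarrow> 'f \<Rightarrow> 'o \<Rightarrow> 'm) \<Rightarrow> bool" where
  "is_pseudofunctor B W P \<upsilon> \<mu> \<longleftrightarrow>
     is_category B \<and>
     (\<forall>b \<in> Obj B. is_waldhausen (W b)) \<and>
     (\<forall>f \<in> Arr B. exact_functor (W (Src B f)) (W (Tgt B f)) (P f)) \<and>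
     (\<forall>b \<in> Obj B. natural_iso (W b) (W b) id_functor (P (Idn B b)) (\<upsilon> b)) \<and>
     (\<forall>f \<in> Arr B. \<forall>g \<in> Arr B. Src B g = Tgt B f \<longrightarrow>
        natural_iso (W (Src B f)) (W (Tgt B g)) (comp_functor (P g) (P f)) (P (Cmp B g f)) (\<mu> g f)) \<and>
     (\<forall>f \<in> Arr B. \<forall>A \<in> Obj (W (Src B f)).
        Cmp (W (Tgt B f)) (\<mu> f (Idn B (Src B f)) A) (on_arr (P f) (\<upsilon> (Src B f) A))
          = Idn (W (Tgt B f)) (on_obj (P f) A)) \<and>
     (\<forall>f \<in> Arr B. \<forall>A \<in> Obj (W (Src B f)).
        Cmp (W (Tgt B f)) (\<mu> (Idn B (Tgt B f)) f A) (\<upsilon> (Tgt B f) (on_obj (P f) A))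
          = Idn (W (Tgt B f)) (on_obj (P f) A)) \<and>
     (\<forall>f \<in> Arr B. \<forall>g \<in> Arr B. \<forall>h \<in> Arr B. Src B g = Tgt B f \<and> Src B h = Tgt B g \<longrightarrow>
        (\<forall>A \<in> Obj (W (Src B f)).
          Cmp (W (Tgt B h)) (\<mu> h (Cmp B g f) A) (on_arr (P h) (\<mu> g f A))
            = Cmp (W (Tgt B h)) (\<mu> (Cmp B h g) f A) (\<mu> h g (on_obj (P f) A))))"


section \<open>Algebras over the field with one element and their modules\<close>

record 'a f1_algebra = "'a monoid" +
  absorb :: 'a

definition is_f1_algebra :: "('a, 'z) f1_algebra_scheme \<Rightarrow> bool" where
  "is_f1_algebra M \<longleftrightarrow> monoid M \<and> absorb M \<in> carrier M \<and>
     (\<forall>m \<in> carrier M. m \<otimes>\<^bsub>M\<^esub> absorb M = absorb M \<and> absorb M \<otimes>\<^bsub>M\<^esub> m = absorb M)"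

definition f1_homs :: "('a, 'y) f1_algebra_scheme \<Rightarrow> ('b, 'z) f1_algebra_scheme \<Rightarrow> ('a \<Rightarrow> 'b) set" where
  "f1_homs M N = {\<alpha>. \<alpha> \<in> hom M N \<and> \<alpha> \<in> extensional (carrier M) \<and>
     \<alpha> \<one>\<^bsub>M\<^esub> = \<one>\<^bsub>N\<^esub> \<and> \<alpha> (absorb M) = absorb N}"

definition f1_category :: "('a f1_algebra, ('a f1_algebra, 'a \<Rightarrow> 'a) arrow) category" where
  "f1_category = \<lparr>
     Obj = {M. is_f1_algebra M},
     Arr = {Arrow M \<alpha> N | M \<alpha> N. is_f1_algebra M \<and> is_f1_algebra N \<and> \<alpha> \<in> f1_homs M N},
     Src = arrow_src,
     Tgt = arrow_tgt,
     Idn = (\<lambda>M. Arrow M (\<lambda>m \<in> carrier M. m) M),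
     Cmp = (\<lambda>g f. Arrow (arrow_src f)
              (compose (carrier (arrow_src f)) (arrow_fun g) (arrow_fun f)) (arrow_tgt g))\<rparr>"

record ('a, 's) rmodule = "'s partial_object" +
  base :: 's
  ract :: "'s \<Rightarrow> 'a \<Rightarrow> 's"

text \<open>The last condition fixes the values of the action outside its domain, so that modules with
  the same carrier, base point and action are equal.\<close>

definition is_rmodule :: "('a, 'z) f1_algebra_scheme \<Rightarrow> ('a, 's, 'y) rmodule_scheme \<Rightarrow> bool" where
  "is_rmodule M S \<longleftrightarrow>
     base S \<in> carrier S \<and>
     (\<forall>s \<in> carrier S. \<forall>m \<in> carrier M. ract S s m \<in> carrier S) \<and>
     (\<forall>s \<in> carrier S. ract S s \<one>\<^bsub>M\<^esub> = s) \<and>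
     (\<forall>s \<in> carrier S. \<forall>m \<in> carrier M. \<forall>n \<in> carrier M.
        ract S (ract S s m) n = ract S s (m \<otimes>\<^bsub>M\<^esub> n)) \<and>
     (\<forall>m \<in> carrier M. ract S (base S) m = base S) \<and>
     (\<forall>s \<in> carrier S. ract S s (absorb M) = base S) \<and>
     (\<forall>s m. s \<notin> carrier S \<or> m \<notin> carrier M \<longrightarrow> ract S s m = undefined)"

definition rmodule_homs ::
  "('a, 'z) f1_algebra_scheme \<Rightarrow> ('a, 's, 'y) rmodule_scheme \<Rightarrow> ('a, 't, 'x) rmodule_scheme \<Rightarrow> ('s \<Rightarrow> 't) set" where
  "rmodule_homs M S T = {f. f \<in> carrier S \<rightarrow>\<^sub>E carrier T \<and> f (base S) = base T \<and>
     (\<forall>s \<in> carrier S. \<forall>m \<in> carrier M. f (ract S s m) = ract T (f s) m)}"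

definition fin_generated :: "('a, 'z) f1_algebra_scheme \<Rightarrow> ('a, 's, 'y) rmodule_scheme \<Rightarrow> bool" where
  "fin_generated M S \<longleftrightarrow>
     (\<exists>G. finite G \<and> G \<subseteq> carrier S \<and> carrier S = (\<Union>s \<in> G. ract S s ` carrier M))"

text \<open>The quotient of \<open>S\<close> by the submodule \<open>I\<close>, which is collapsed to the base point.\<close>

definition quot_rmodule :: "('a, 'z) f1_algebra_scheme \<Rightarrow> ('a, 's) rmodule \<Rightarrow> 's set \<Rightarrow> ('a, 's) rmodule" where
  "quot_rmodule M S I =
     (let Q = insert (base S) (carrier S - I) in
      \<lparr>carrier = Q, base = base S,
       ract = (\<lambda>s m. if s \<in> Q \<and> m \<in> carrier M
                     then (if ract S s m \<in> I then base S else ract S s m) else undefined)\<rparr>)"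

text \<open>\<open>S \<and>\<^sub>M N\<close>, where \<open>N\<close> is a left \<open>M\<close>-module via \<open>\<alpha>\<close>: the carrier is the
  quotient of \<open>S \<times> N\<close> by the equivalence relation generated by \<open>(sm, n) \<sim> (s, \<alpha>(m)n)\<close>.\<close>

definition smash_rel ::
  "'a f1_algebra \<Rightarrow> ('a \<Rightarrow> 'b) \<Rightarrow> 'b f1_algebra \<Rightarrow> ('a, 's) rmodule \<Rightarrow> (('s \<times> 'b) \<times> ('s \<times> 'b)) set" where
  "smash_rel M \<alpha> N S = {(p, q). p \<in> carrier S \<times> carrier N \<and> q \<in> carrier S \<times> carrier N \<and>
     equivclp (\<lambda>x y. \<exists>s \<in> carrier S. \<exists>m \<in> carrier M. \<exists>n \<in> carrier N.
                 x = (ract S s m, n) \<and> y = (s, \<alpha> m \<otimes>\<^bsub>N\<^esub> n)) p q}"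

definition smash ::
  "'a f1_algebra \<Rightarrow> ('a \<Rightarrow> 'b) \<Rightarrow> 'b f1_algebra \<Rightarrow> ('a, 's) rmodule \<Rightarrow> ('b, ('s \<times> 'b) set) rmodule" where
  "smash M \<alpha> N S =
     (let R = smash_rel M \<alpha> N S; Q = (carrier S \<times> carrier N) // R in
      \<lparr>carrier = Q, base = R `` {(base S, absorb N)},
       ract = (\<lambda>X n'. if X \<in> Q \<and> n' \<in> carrier N
                      then (\<Union>(s, n) \<in> X. R `` {(s, n \<otimes>\<^bsub>N\<^esub> n')}) else undefined)\<rparr>)"

definition smash_map ::
  "'a f1_algebra \<Rightarrow> ('a \<Rightarrow> 'b) \<Rightarrow> 'b f1_algebra \<Rightarrow> ('a, 's) rmodule \<Rightarrow> ('s \<Rightarrow> 't) \<Rightarrow> ('a, 't) rmodule \<Rightarrow>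
   ('s \<times> 'b) set \<Rightarrow> ('t \<times> 'b) set" where
  "smash_map M \<alpha> N S f T =
     (\<lambda>X \<in> carrier (smash M \<alpha> N S). \<Union>(s, n) \<in> X. smash_rel M \<alpha> N T `` {(f s, n)})"

definition transport_rmodule ::
  "('a, 'z) f1_algebra_scheme \<Rightarrow> ('s \<Rightarrow> 't) \<Rightarrow> ('a, 's) rmodule \<Rightarrow> ('a, 't) rmodule" where
  "transport_rmodule M h S =
     \<lparr>carrier = h ` carrier S, base = h (base S),
      ract = (\<lambda>x m. if x \<in> h ` carrier S \<and> m \<in> carrier M
                    then h (ract S (inv_into (carrier S) h x) m) else undefined)\<rparr>"


section \<open>The Waldhausen category of finitely generated modules\<close>

text \<open>A small model of the category of all finitely generated modules over \<open>\<F>\<^sub>1\<close>-algebras with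
  carrier in a type \<open>'a\<close>: the module carriers are subsets of the type \<open>'a elt\<close>, and every module
  has base point \<open>Pt\<close>. Every finitely generated module is isomorphic to one of these, see
  \<open>FG_all_modules\<close> below. The common base point makes \<open>{Pt}\<close> the zero object for all
  algebras, so that base change preserves it on the nose. The constructor \<open>Ten\<close> is needed to code
  the elements of \<open>S \<and>\<^sub>M N\<close>, which are equivalence classes of pairs, by elements of \<open>'a elt\<close>.\<close>

datatype 'a elt = Pt | Gen 'a | Ten "'a elt" 'a

definition FG_obj :: "'a f1_algebra \<Rightarrow> ('a, 'a elt) rmodule set" where
  "FG_obj M = {S. is_rmodule M S \<and> fin_generated M S \<and> base S = Pt}"

definition FG_arr :: "'a f1_algebra \<Rightarrow> (('a, 'a elt) rmodule, 'a elt \<Rightarrow> 'a elt) arrow set" where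
  "FG_arr M = {Arrow S f T | S f T. S \<in> FG_obj M \<and> T \<in> FG_obj M \<and> f \<in> rmodule_homs M S T}"

definition FG_cat ::
  "'a f1_algebra \<Rightarrow> (('a, 'a elt) rmodule, (('a, 'a elt) rmodule, 'a elt \<Rightarrow> 'a elt) arrow) category" where
  "FG_cat M = \<lparr>
     Obj = FG_obj M,
     Arr = FG_arr M,
     Src = arrow_src,
     Tgt = arrow_tgt,
     Idn = (\<lambda>S. Arrow S (\<lambda>s \<in> carrier S. s) S),
     Cmp = (\<lambda>g f. Arrow (arrow_src f)
              (compose (carrier (arrow_src f)) (arrow_fun g) (arrow_fun f)) (arrow_tgt g))\<rparr>"

definition FG ::
  "'a f1_algebra \<Rightarrow> (('a, 'a elt) rmodule, (('a, 'a elt) rmodule, 'a elt \<Rightarrow> 'a elt) arrow) waldhausen" where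
  "FG M = category.extend (FG_cat M)
     \<lparr>Zob = \<lparr>carrier = {Pt}, base = Pt,
             ract = (\<lambda>s m. if s = Pt \<and> m \<in> carrier M then Pt else undefined)\<rparr>,
      Cof = {Arrow S f T | S f T. Arrow S f T \<in> FG_arr M \<and>
               (\<exists>r \<in> rmodule_homs M T S. \<forall>s \<in> carrier S. r (f s) = s) \<and>
               quot_rmodule M T (f ` carrier S) \<in> FG_obj M},
      Weq = {f. iso_arrow (FG_cat M) f}\<rparr>"

lemma FG_all_modules:
  fixes M :: "'a f1_algebra" and S :: "('a, 's) rmodule"
  assumes M: "is_f1_algebra M" and S: "is_rmodule M S" and fg: "fin_generated M S"
  shows "\<exists>T \<in> FG_obj M. \<exists>f \<in> rmodule_homs M S T. bij_betw f (carrier S) (carrier T)"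
proof -
  define enc :: "nat \<Rightarrow> 'a \<Rightarrow> 'a elt" where "enc = (\<lambda>i m. ((\<lambda>e. Ten e m) ^^ i) (Gen m))"
  have enc_inj: "enc i m = enc j n \<Longrightarrow> i = j \<and> m = n" for i j m n
    by (induction i arbitrary: j; case_tac j; auto simp: enc_def)
  have enc_Pt: "enc i m \<noteq> Pt" for i m
    by (cases i) (auto simp: enc_def)
  obtain G where G: "finite G" "G \<subseteq> carrier S" "carrier S = (\<Union>s \<in> G. ract S s ` carrier M)"
    using fg by (auto simp: fin_generated_def)
  obtain gs where gs: "set gs = G" using G(1) finite_list by blast
  have "\<exists>p. x = ract S (gs ! fst p) (snd p)" if "x \<in> carrier S" for x
  proof -
    have "x \<in> (\<Union>s \<in> G. ract S s ` carrier M)" using that G(3) by blast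
    then obtain s m where "s \<in> G" "x = ract S s m" by blast
    then show ?thesis using gs by (metis in_set_conv_nth fst_conv snd_conv)
  qed
  then obtain c where c: "\<And>x. x \<in> carrier S \<Longrightarrow> x = ract S (gs ! fst (c x)) (snd (c x))"
    by metis
  define h where "h = (\<lambda>x. if x = base S then Pt else enc (fst (c x)) (snd (c x)))"
  have inj: "inj_on h (carrier S)"
    
  proof (rule inj_onI)
    fix x y assume xy: "x \<in> carrier S" "y \<in> carrier S" "h x = h y"
    show "x = y"
    proof (cases "x = base S \<or> y = base S")
      case True
      then show ?thesis using xy(3) enc_Pt by (metis enc_Pt h_def)
    next
      case False
      then have "c x = c y" using xy(3) enc_inj by (auto simp: h_def prod_eq_iff)
      then show ?thesis using c[OF xy(1)] c[OF xy(2)] by simp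
    qed
  qed
  define T where "T = transport_rmodule M h S"
  have T_carrier: "carrier T = h ` carrier S" and T_base: "base T = Pt"
    by (auto simp: T_def transport_rmodule_def h_def)
  have closed: "ract S s m \<in> carrier S" if "s \<in> carrier S" "m \<in> carrier M" for s m
    using S that by (simp add: is_rmodule_def)
  have base: "base S \<in> carrier S" "h (base S) = Pt" using S by (auto simp: is_rmodule_def h_def)
  have T_act: "ract T (h s) m = h (ract S s m)" if "s \<in> carrier S" "m \<in> carrier M" for s m
    using that inj by (simp add: T_def transport_rmodule_def)
  have T_ext: "ract T x m = undefined" if "x \<notin> h ` carrier S \<or> m \<notin> carrier M" for x m
    using that by (auto simp: T_def transport_rmodule_def)
  have Mc: "\<one>\<^bsub>M\<^esub> \<in> carrier M" "absorb M \<in> carrier M"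
    "\<And>m n. m \<in> carrier M \<Longrightarrow> n \<in> carrier M \<Longrightarrow> m \<otimes>\<^bsub>M\<^esub> n \<in> carrier M"
    using M by (simp_all add: is_f1_algebra_def monoid.one_closed monoid.m_closed)
  have hS: "Pt \<in> h ` carrier S" using base by (metis imageI)
  have "is_rmodule M T"
    unfolding is_rmodule_def T_carrier T_base
  proof (intro conjI ballI allI impI)
    show "Pt \<in> h ` carrier S" by (rule hS)
  next
    fix x m assume "x \<in> h ` carrier S" "m \<in> carrier M"
    then show "ract T x m \<in> h ` carrier S" using T_act closed by auto
  next
    fix x assume "x \<in> h ` carrier S"
    then show "ract T x \<one>\<^bsub>M\<^esub> = x" using T_act Mc S by (auto simp: is_rmodule_def)
  next
    fix x m n assume "x \<in> h ` carrier S" "m \<in> carrier M" "n \<in> carrier M"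
    then show "ract T (ract T x m) n = ract T x (m \<otimes>\<^bsub>M\<^esub> n)"
      using T_act Mc S closed by (auto simp: is_rmodule_def)
  next
    fix m assume "m \<in> carrier M"
    then have "ract T (h (base S)) m = h (ract S (base S) m)" using T_act base by blast
    also have "ract S (base S) m = base S" using \<open>m \<in> carrier M\<close> S by (simp add: is_rmodule_def)
    finally show "ract T Pt m = Pt" using base by simp
  next
    fix x assume "x \<in> h ` carrier S"
    then obtain s where s: "s \<in> carrier S" "x = h s" by blast
    then have "ract T x (absorb M) = h (ract S s (absorb M))" using T_act Mc by blast
    also have "ract S s (absorb M) = base S" using s S by (simp add: is_rmodule_def)
    finally show "ract T x (absorb M) = Pt" using base by simp
  next
    fix x m assume "x \<notin> h ` carrier S \<or> m \<notin> carrier M"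
    then show "ract T x m = undefined" by (rule T_ext)
  qed
  moreover have "fin_generated M T"
    unfolding fin_generated_def
  proof (intro exI conjI)
    show "finite (h ` G)" "h ` G \<subseteq> carrier T" using G(1,2) T_carrier by auto
    have "carrier T = h ` (\<Union>s \<in> G. ract S s ` carrier M)" using T_carrier G(3) by simp
    also have "\<dots> = (\<Union>s \<in> G. (\<lambda>m. h (ract S s m)) ` carrier M)" by blast
    also have "\<dots> = (\<Union>s \<in> G. ract T (h s) ` carrier M)"
      using G(2) T_act by (intro SUP_cong image_cong) auto
    also have "\<dots> = (\<Union>s \<in> h ` G. ract T s ` carrier M)" by blast
    finally show "carrier T = (\<Union>s \<in> h ` G. ract T s ` carrier M)" .
  qed
  ultimately have "T \<in> FG_obj M" using T_base by (simp add: FG_obj_def)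
  moreover have "restrict h (carrier S) \<in> rmodule_homs M S T"
    using closed base T_act T_base T_carrier by (auto simp: rmodule_homs_def)
  moreover have "bij_betw (restrict h (carrier S)) (carrier S) (carrier T)"
    using inj T_carrier by (auto simp: bij_betw_def inj_on_def)
  ultimately show ?thesis by blast
qed

text \<open>Codes for the elements of \<open>S \<and>\<^sub>M N\<close>: the base point goes to \<open>Pt\<close>, and every other
  equivalence class to \<open>Ten s n\<close> for a chosen representative \<open>(s, n)\<close>. The code is injective on
  the carrier, so \<open>base_change_obj\<close> is an isomorphic copy of \<open>S \<and>\<^sub>M N\<close>.\<close>

definition smash_code ::
  "'a f1_algebra \<Rightarrow> ('a \<Rightarrow> 'a) \<Rightarrow> 'a f1_algebra \<Rightarrow> ('a, 'a elt) rmodule \<Rightarrow> ('a elt \<times> 'a) set \<Rightarrow> 'a elt" where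
  "smash_code M \<alpha> N S X =
     (if X = base (smash M \<alpha> N S) then Pt else (case SOME p. p \<in> X of (s, n) \<Rightarrow> Ten s n))"

definition base_change_obj ::
  "'a f1_algebra \<Rightarrow> ('a \<Rightarrow> 'a) \<Rightarrow> 'a f1_algebra \<Rightarrow> ('a, 'a elt) rmodule \<Rightarrow> ('a, 'a elt) rmodule" where
  "base_change_obj M \<alpha> N S = transport_rmodule N (smash_code M \<alpha> N S) (smash M \<alpha> N S)"

definition base_change_fun ::
  "'a f1_algebra \<Rightarrow> ('a \<Rightarrow> 'a) \<Rightarrow> 'a f1_algebra \<Rightarrow> ('a, 'a elt) rmodule \<Rightarrow> ('a elt \<Rightarrow> 'a elt) \<Rightarrow>
   ('a, 'a elt) rmodule \<Rightarrow> 'a elt \<Rightarrow> 'a elt" where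
  "base_change_fun M \<alpha> N S f T =
     (\<lambda>x \<in> carrier (base_change_obj M \<alpha> N S).
        smash_code M \<alpha> N T (smash_map M \<alpha> N S f T
          (inv_into (carrier (smash M \<alpha> N S)) (smash_code M \<alpha> N S) x)))"

fun base_change ::
  "('a f1_algebra, 'a \<Rightarrow> 'a) arrow \<Rightarrow>
   (('a, 'a elt) rmodule, (('a, 'a elt) rmodule, 'a elt \<Rightarrow> 'a elt) arrow,
    ('a, 'a elt) rmodule, (('a, 'a elt) rmodule, 'a elt \<Rightarrow> 'a elt) arrow) cat_functor" where
  "base_change (Arrow M \<alpha> N) = \<lparr>
     on_obj = base_change_obj M \<alpha> N,
     on_arr = (\<lambda>a. Arrow (base_change_obj M \<alpha> N (arrow_src a))
                    (base_change_fun M \<alpha> N (arrow_src a) (arrow_fun a) (arrow_tgt a))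
                    (base_change_obj M \<alpha> N (arrow_tgt a)))\<rparr>"


section \<open>Spectra of simplicial sets\<close>

text \<open>The monotone maps from \<open>[p] = {0, \<dots>, p}\<close> to \<open>[q]\<close>.\<close>

definition Delta :: "nat \<Rightarrow> nat \<Rightarrow> (nat \<Rightarrow> nat) set" where
  "Delta p q = {\<theta>. \<theta> \<in> {..p} \<rightarrow>\<^sub>E {..q} \<and> mono_on {..p} \<theta>}"

text \<open>Pointed simplicial sets; \<open>act p q \<theta>\<close> is the map from \<open>q\<close>-simplices to \<open>p\<close>-simplices
  induced by \<open>\<theta> \<in> Delta p q\<close>.\<close>

record 'x sset =
  simplices :: "nat \<Rightarrow> 'x set"
  spt :: "nat \<Rightarrow> 'x"
  act :: "nat \<Rightarrow> nat \<Rightarrow> (nat \<Rightarrow> nat) \<Rightarrow> 'x \<Rightarrow> 'x"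

definition is_sset :: "'x sset \<Rightarrow> bool" where
  "is_sset X \<longleftrightarrow>
     (\<forall>q. spt X q \<in> simplices X q) \<and>
     (\<forall>p q. \<forall>\<theta> \<in> Delta p q. act X p q \<theta> (spt X q) = spt X p \<and>
        (\<forall>x \<in> simplices X q. act X p q \<theta> x \<in> simplices X p)) \<and>
     (\<forall>q. \<forall>x \<in> simplices X q. act X q q (\<lambda>i \<in> {..q}. i) x = x) \<and>
     (\<forall>r p q. \<forall>\<eta> \<in> Delta r p. \<forall>\<theta> \<in> Delta p q. \<forall>x \<in> simplices X q.
        act X r p \<eta> (act X p q \<theta> x) = act X r q (compose {..r} \<theta> \<eta>) x)"

text \<open>Sequential spectra. A structure map \<open>S\<^sup>1 \<and> X\<^sub>n \<rightarrow> X\<^sub>n\<^sub>+\<^sub>1\<close>, where \<open>S\<^sup>1\<close> is the standard 1-simplex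
  modulo its boundary, is given as a simplicial map on the product of the standard 1-simplex
  (with \<open>Delta q 1\<close> as set of \<open>q\<close>-simplices) and \<open>X\<^sub>n\<close>; it sends the constant maps \<open>[q] \<rightarrow> [1]\<close>,
  which make up the boundary, and the base point of \<open>X\<^sub>n\<close> to the base point.\<close>

record 'x spectrum =
  level :: "nat \<Rightarrow> 'x sset"
  susp :: "nat \<Rightarrow> nat \<Rightarrow> (nat \<Rightarrow> nat) \<Rightarrow> 'x \<Rightarrow> 'x"

definition is_spectrum :: "'x spectrum \<Rightarrow> bool" where
  "is_spectrum E \<longleftrightarrow>
     (\<forall>n. is_sset (level E n)) \<and>
     (\<forall>n q. \<forall>\<phi> \<in> Delta q 1. \<forall>x \<in> simplices (level E n) q.
        susp E n q \<phi> x \<in> simplices (level E (Suc n)) q \<and>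
        (\<forall>p. \<forall>\<theta> \<in> Delta p q. act (level E (Suc n)) p q \<theta> (susp E n q \<phi> x)
               = susp E n p (compose {..p} \<phi> \<theta>) (act (level E n) p q \<theta> x))) \<and>
     (\<forall>n q. \<forall>\<phi> \<in> Delta q 1. susp E n q \<phi> (spt (level E n) q) = spt (level E (Suc n)) q) \<and>
     (\<forall>n q. \<forall>\<phi> \<in> Delta q 1. \<forall>x \<in> simplices (level E n) q. \<phi> 0 = \<phi> q \<longrightarrow>
        susp E n q \<phi> x = spt (level E (Suc n)) q)"

text \<open>A map of spectra is a family \<open>f n q\<close> of maps on the \<open>q\<close>-simplices of the \<open>n\<close>-th levels.\<close>

definition spectrum_map :: "'x spectrum \<Rightarrow> 'y spectrum \<Rightarrow> (nat \<Rightarrow> nat \<Rightarrow> 'x \<Rightarrow> 'y) \<Rightarrow> bool" where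
  "spectrum_map E F f \<longleftrightarrow>
     (\<forall>n q. f n q (spt (level E n) q) = spt (level F n) q) \<and>
     (\<forall>n q. \<forall>x \<in> simplices (level E n) q.
        f n q x \<in> simplices (level F n) q \<and>
        (\<forall>p. \<forall>\<theta> \<in> Delta p q. f n p (act (level E n) p q \<theta> x) = act (level F n) p q \<theta> (f n q x)) \<and>
        (\<forall>\<phi> \<in> Delta q 1. f (Suc n) q (susp E n q \<phi> x) = susp F n q \<phi> (f n q x)))"

text \<open>Simplicial homotopies of maps of spectra, i.e. maps of spectra from the smash product of
  \<open>E\<close> with the standard 1-simplex with a disjoint base point.\<close>

definition simplicial_homotopy ::
  "'x spectrum \<Rightarrow> 'y spectrum \<Rightarrow> (nat \<Rightarrow> nat \<Rightarrow> 'x \<Rightarrow> 'y) \<Rightarrow> (nat \<Rightarrow> nat \<Rightarrow> 'x \<Rightarrow> 'y) \<Rightarrow>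
   (nat \<Rightarrow> nat \<Rightarrow> (nat \<Rightarrow> nat) \<Rightarrow> 'x \<Rightarrow> 'y) \<Rightarrow> bool" where
  "simplicial_homotopy E F f g H \<longleftrightarrow>
     (\<forall>n q. \<forall>\<phi> \<in> Delta q 1. H n q \<phi> (spt (level E n) q) = spt (level F n) q) \<and>
     (\<forall>n q. \<forall>x \<in> simplices (level E n) q.
        H n q (\<lambda>i \<in> {..q}. 0) x = f n q x \<and> H n q (\<lambda>i \<in> {..q}. 1) x = g n q x) \<and>
     (\<forall>n q. \<forall>\<phi> \<in> Delta q 1. \<forall>x \<in> simplices (level E n) q.
        H n q \<phi> x \<in> simplices (level F n) q \<and>
        (\<forall>p. \<forall>\<theta> \<in> Delta p q.
           H n p (compose {..p} \<phi> \<theta>) (act (level E n) p q \<theta> x) = act (level F n) p q \<theta> (H n q \<phi> x)) \<and>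
        (\<forall>\<psi> \<in> Delta q 1. H (Suc n) q \<phi> (susp E n q \<psi> x) = susp F n q \<psi> (H n q \<phi> x)))"

text \<open>Simplicial homotopy need not be symmetric or transitive; homotopy is the equivalence
  relation generated by it.\<close>

definition homotopic ::
  "'x spectrum \<Rightarrow> 'y spectrum \<Rightarrow> (nat \<Rightarrow> nat \<Rightarrow> 'x \<Rightarrow> 'y) \<Rightarrow> (nat \<Rightarrow> nat \<Rightarrow> 'x \<Rightarrow> 'y) \<Rightarrow> bool" where
  "homotopic E F =
     equivclp (\<lambda>f g. spectrum_map E F f \<and> spectrum_map E F g \<and> (\<exists>H. simplicial_homotopy E F f g H))"

definition homotopy_class ::
  "'x spectrum \<Rightarrow> 'y spectrum \<Rightarrow> (nat \<Rightarrow> nat \<Rightarrow> 'x \<Rightarrow> 'y) \<Rightarrow> (nat \<Rightarrow> nat \<Rightarrow> 'x \<Rightarrow> 'y) set" where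
  "homotopy_class E F f = {g. spectrum_map E F g \<and> homotopic E F f g}"

definition spectra_hcat ::
  "('x spectrum, ('x spectrum, (nat \<Rightarrow> nat \<Rightarrow> 'x \<Rightarrow> 'x) set) arrow) category" where
  "spectra_hcat = \<lparr>
     Obj = {E. is_spectrum E},
     Arr = {Arrow E (homotopy_class E F f) F | E F f.
              is_spectrum E \<and> is_spectrum F \<and> spectrum_map E F f},
     Src = arrow_src,
     Tgt = arrow_tgt,
     Idn = (\<lambda>E. Arrow E (homotopy_class E E (\<lambda>n q x. x)) E),
     Cmp = (\<lambda>b a. Arrow (arrow_src a)
              (\<Union>g \<in> arrow_fun b. \<Union>f \<in> arrow_fun a.
                 homotopy_class (arrow_src a) (arrow_tgt b) (\<lambda>n q. g n q \<circ> f n q))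
              (arrow_tgt b))\<rparr>"


section \<open>Waldhausen K-theory\<close>

text \<open>The objects and arrows of the iterated S-construction of \<open>C\<close> are iterated diagrams in \<open>C\<close>.
  To have them in a single type for all numbers of iterations, they are built by the following
  datatypes. The constructors \<open>VoidO\<close> and \<open>VoidA\<close> serve as the values of diagrams outside their
  index sets. The arguments of \<open>DiaA X Y t\<close> are the source, the target and the components of a
  natural transformation.\<close>

datatype ('o, 'm) dia_obj =
    VoidO
  | LeafO 'o
  | DiaO "nat \<times> nat \<Rightarrow> ('o, 'm) dia_obj" "nat \<times> nat \<Rightarrow> nat \<times> nat \<Rightarrow> ('o, 'm) dia_arr"
and ('o, 'm) dia_arr =
    VoidA
  | LeafA 'm
  | DiaA "('o, 'm) dia_obj" "('o, 'm) dia_obj" "nat \<times> nat \<Rightarrow> ('o, 'm) dia_arr"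

fun leafO :: "('o, 'm) dia_obj \<Rightarrow> 'o" where "leafO (LeafO A) = A"
fun leafA :: "('o, 'm) dia_arr \<Rightarrow> 'm" where "leafA (LeafA f) = f"
fun dia_ob :: "('o, 'm) dia_obj \<Rightarrow> nat \<times> nat \<Rightarrow> ('o, 'm) dia_obj" where "dia_ob (DiaO A f) = A"
fun dia_ar :: "('o, 'm) dia_obj \<Rightarrow> nat \<times> nat \<Rightarrow> nat \<times> nat \<Rightarrow> ('o, 'm) dia_arr" where "dia_ar (DiaO A f) = f"
fun dia_src :: "('o, 'm) dia_arr \<Rightarrow> ('o, 'm) dia_obj" where "dia_src (DiaA X Y t) = X"
fun dia_tgt :: "('o, 'm) dia_arr \<Rightarrow> ('o, 'm) dia_obj" where "dia_tgt (DiaA X Y t) = Y"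
fun dia_cmp :: "('o, 'm) dia_arr \<Rightarrow> nat \<times> nat \<Rightarrow> ('o, 'm) dia_arr" where "dia_cmp (DiaA X Y t) = t"

type_synonym ('o, 'm) dia_wald = "(('o, 'm) dia_obj, ('o, 'm) dia_arr) waldhausen"

definition leaf_wald :: "('o, 'm) waldhausen \<Rightarrow> ('o, 'm) dia_wald" where
  "leaf_wald C = \<lparr>
     Obj = LeafO ` Obj C,
     Arr = LeafA ` Arr C,
     Src = (\<lambda>f. LeafO (Src C (leafA f))),
     Tgt = (\<lambda>f. LeafO (Tgt C (leafA f))),
     Idn = (\<lambda>A. LeafA (Idn C (leafO A))),
     Cmp = (\<lambda>g f. LeafA (Cmp C (leafA g) (leafA f))),
     Zob = LeafO (Zob C),
     Cof = LeafA ` Cof C,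
     Weq = LeafA ` Weq C\<rparr>"

text \<open>The arrow category of \<open>[q]\<close>, as a poset.\<close>

definition Ar :: "nat \<Rightarrow> (nat \<times> nat) set" where
  "Ar q = {(i, j). i \<le> j \<and> j \<le> q}"

definition Ar_le :: "nat \<times> nat \<Rightarrow> nat \<times> nat \<Rightarrow> bool" where
  "Ar_le x y \<longleftrightarrow> fst x \<le> fst y \<and> snd x \<le> snd y"

definition S_obj :: "nat \<Rightarrow> ('o, 'm) dia_wald \<Rightarrow> ('o, 'm) dia_obj set" where
  "S_obj q D = {DiaO A f | A f.
     is_diagram D (Ar q) Ar_le A f \<and>
     (\<forall>x. x \<notin> Ar q \<longrightarrow> A x = VoidO) \<and>
     (\<forall>x y. \<not> (x \<in> Ar q \<and> y \<in> Ar q \<and> Ar_le x y) \<longrightarrow> f x y = VoidA) \<and>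
     (\<forall>i \<le> q. A (i, i) = Zob D) \<and>
     (\<forall>i j k. i \<le> j \<and> j \<le> k \<and> k \<le> q \<longrightarrow>
        f (i, j) (i, k) \<in> Cof D \<and>
        is_pushout D (f (i, j) (i, k)) (f (i, j) (j, j)) (f (i, k) (j, k)) (f (j, j) (j, k)))}"

definition S_arr :: "nat \<Rightarrow> ('o, 'm) dia_wald \<Rightarrow> ('o, 'm) dia_arr set" where
  "S_arr q D = {DiaA X Y t | X Y t.
     X \<in> S_obj q D \<and> Y \<in> S_obj q D \<and>
     (\<forall>x \<in> Ar q. t x \<in> Arr D \<and> Src D (t x) = dia_ob X x \<and> Tgt D (t x) = dia_ob Y x) \<and>
     (\<forall>x. x \<notin> Ar q \<longrightarrow> t x = VoidA) \<and>
     (\<forall>x \<in> Ar q. \<forall>y \<in> Ar q. Ar_le x y \<longrightarrow>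
        Cmp D (t y) (dia_ar X x y) = Cmp D (dia_ar Y x y) (t x))}"

text \<open>The Waldhausen category \<open>S\<^sub>q D\<close>. An arrow from \<open>A\<close> to \<open>B\<close> is a cofibration if, for all
  \<open>i \<le> j \<le> k\<close>, the maps \<open>A\<^sub>i\<^sub>j \<rightarrow> B\<^sub>i\<^sub>j\<close> and \<open>A\<^sub>i\<^sub>k \<union> B\<^sub>i\<^sub>j \<rightarrow> B\<^sub>i\<^sub>k\<close> are cofibrations in \<open>D\<close>, where
  the union is the pushout over \<open>A\<^sub>i\<^sub>j\<close>.\<close>

definition S_con :: "nat \<Rightarrow> ('o, 'm) dia_wald \<Rightarrow> ('o, 'm) dia_wald" where
  "S_con q D = \<lparr>
     Obj = S_obj q D,
     Arr = S_arr q D,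
     Src = dia_src,
     Tgt = dia_tgt,
     Idn = (\<lambda>X. DiaA X X (\<lambda>x. if x \<in> Ar q then Idn D (dia_ob X x) else VoidA)),
     Cmp = (\<lambda>g f. DiaA (dia_src f) (dia_tgt g)
              (\<lambda>x. if x \<in> Ar q then Cmp D (dia_cmp g x) (dia_cmp f x) else VoidA)),
     Zob = DiaO (\<lambda>x. if x \<in> Ar q then Zob D else VoidO)
                (\<lambda>x y. if x \<in> Ar q \<and> y \<in> Ar q \<and> Ar_le x y then Idn D (Zob D) else VoidA),
     Cof = {DiaA X Y t | X Y t. DiaA X Y t \<in> S_arr q D \<and>
              (\<forall>i j k. i \<le> j \<and> j \<le> k \<and> k \<le> q \<longrightarrow>
                 t (i, j) \<in> Cof D \<and>
                 (\<exists>c d. is_pushout D (dia_ar X (i, j) (i, k)) (t (i, j)) c d \<and>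
                    (\<exists>u \<in> Cof D. Src D u = Tgt D c \<and> Tgt D u = dia_ob Y (i, k) \<and>
                       Cmp D u c = t (i, k) \<and> Cmp D u d = dia_ar Y (i, j) (i, k))))},
     Weq = {DiaA X Y t | X Y t. DiaA X Y t \<in> S_arr q D \<and> (\<forall>x \<in> Ar q. t x \<in> Weq D)}\<rparr>"

text \<open>The \<open>n\<close>-fold iteration, with all simplicial degrees equal to \<open>q\<close>.\<close>

primrec S_iter :: "nat \<Rightarrow> nat \<Rightarrow> ('o, 'm) waldhausen \<Rightarrow> ('o, 'm) dia_wald" where
  "S_iter 0 q C = leaf_wald C"
| "S_iter (Suc n) q C = S_con q (S_iter n q C)"

text \<open>Restriction along \<open>\<theta> \<in> Delta p q\<close> in all \<open>n\<close> directions simultaneously.\<close>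

primrec pull_obj :: "nat \<Rightarrow> (nat \<Rightarrow> nat) \<Rightarrow> ('o, 'm) dia_obj \<Rightarrow> ('o, 'm) dia_obj"
  and pull_arr :: "nat \<Rightarrow> (nat \<Rightarrow> nat) \<Rightarrow> ('o, 'm) dia_arr \<Rightarrow> ('o, 'm) dia_arr" where
  "pull_obj p \<theta> VoidO = VoidO"
| "pull_obj p \<theta> (LeafO A) = LeafO A"
| "pull_obj p \<theta> (DiaO A f) = DiaO
     (\<lambda>x. if x \<in> Ar p then pull_obj p \<theta> (A (map_prod \<theta> \<theta> x)) else VoidO)
     (\<lambda>x y. if x \<in> Ar p \<and> y \<in> Ar p \<and> Ar_le x y
            then pull_arr p \<theta> (f (map_prod \<theta> \<theta> x) (map_prod \<theta> \<theta> y)) else VoidA)"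
| "pull_arr p \<theta> VoidA = VoidA"
| "pull_arr p \<theta> (LeafA f) = LeafA f"
| "pull_arr p \<theta> (DiaA X Y t) = DiaA (pull_obj p \<theta> X) (pull_obj p \<theta> Y)
     (\<lambda>x. if x \<in> Ar p then pull_arr p \<theta> (t (map_prod \<theta> \<theta> x)) else VoidA)"

text \<open>The \<open>n\<close>-th space of the K-theory spectrum is the diagonal of the nerve of the
  \<open>n\<close>-fold multisimplicial category of weak equivalences in the \<open>n\<close>-fold S-construction. A simplex
  \<open>(A, f)\<close> is a chain \<open>A 0 \<rightarrow> \<dots> \<rightarrow> A q\<close>, with composites \<open>f i j\<close>.\<close>

type_synonym ('o, 'm) ksimplex = "(nat \<Rightarrow> ('o, 'm) dia_obj) \<times> (nat \<Rightarrow> nat \<Rightarrow> ('o, 'm) dia_arr)"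

definition K_level :: "('o, 'm) waldhausen \<Rightarrow> nat \<Rightarrow> ('o, 'm) ksimplex sset" where
  "K_level C n = \<lparr>
     simplices = (\<lambda>q. {(A, f) | A f.
        is_diagram (S_iter n q C) {..q} (\<le>) A f \<and>
        (\<forall>i. i \<notin> {..q} \<longrightarrow> A i = VoidO) \<and>
        (\<forall>i j. if i \<le> j \<and> j \<le> q then f i j \<in> Weq (S_iter n q C) else f i j = VoidA)}),
     spt = (\<lambda>q.
       (\<lambda>i. if i \<le> q then Zob (S_iter n q C) else VoidO,
        \<lambda>i j. if i \<le> j \<and> j \<le> q then Idn (S_iter n q C) (Zob (S_iter n q C)) else VoidA)),
     act = (\<lambda>p q \<theta> (A, f).
       (\<lambda>i. if i \<le> p then pull_obj p \<theta> (A (\<theta> i)) else VoidO,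
        \<lambda>i j. if i \<le> j \<and> j \<le> p then pull_arr p \<theta> (f (\<theta> i) (\<theta> j)) else VoidA))\<rparr>"

text \<open>The structure maps come from \<open>D = S\<^sub>1 D\<close>, where an object \<open>X\<close> of \<open>D\<close> is identified with the
  diagram with value \<open>X\<close> at \<open>(0, 1)\<close> and zero at \<open>(0, 0)\<close> and \<open>(1, 1)\<close>: a map \<open>\<phi> : [q] \<rightarrow> [1]\<close>
  restricts this diagram to an object of \<open>S\<^sub>q D\<close>, with value \<open>X\<close> at the \<open>(i, j)\<close> such that
  \<open>\<phi> i = 0\<close> and \<open>\<phi> j = 1\<close>, and zero elsewhere. The arrows between two values are the identity of
  \<open>X\<close> if both are \<open>X\<close>, and otherwise unique.\<close>

definition cut :: "(nat \<Rightarrow> nat) \<Rightarrow> nat \<times> nat \<Rightarrow> bool" where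
  "cut \<phi> x \<longleftrightarrow> \<phi> (fst x) = 0 \<and> \<phi> (snd x) = 1"

definition susp_obj ::
  "('o, 'm) dia_wald \<Rightarrow> nat \<Rightarrow> (nat \<Rightarrow> nat) \<Rightarrow> ('o, 'm) dia_obj \<Rightarrow> ('o, 'm) dia_obj" where
  "susp_obj D q \<phi> X =
     (let A = (\<lambda>x. if cut \<phi> x then X else Zob D) in
      DiaO (\<lambda>x. if x \<in> Ar q then A x else VoidO)
        (\<lambda>x y. if x \<in> Ar q \<and> y \<in> Ar q \<and> Ar_le x y
               then (if cut \<phi> x \<and> cut \<phi> y then Idn D X
                     else (THE f. f \<in> Arr D \<and> Src D f = A x \<and> Tgt D f = A y))
               else VoidA))"

definition susp_arr ::
  "('o, 'm) dia_wald \<Rightarrow> nat \<Rightarrow> (nat \<Rightarrow> nat) \<Rightarrow> ('o, 'm) dia_arr \<Rightarrow> ('o, 'm) dia_arr" where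
  "susp_arr D q \<phi> f =
     DiaA (susp_obj D q \<phi> (Src D f)) (susp_obj D q \<phi> (Tgt D f))
       (\<lambda>x. if x \<in> Ar q then (if cut \<phi> x then f else Idn D (Zob D)) else VoidA)"

definition K_spectrum :: "('o, 'm) waldhausen \<Rightarrow> ('o, 'm) ksimplex spectrum" where
  "K_spectrum C = \<lparr>
     level = K_level C,
     susp = (\<lambda>n q \<phi> (A, f).
       (\<lambda>i. if i \<le> q then susp_obj (S_iter n q C) q \<phi> (A i) else VoidO,
        \<lambda>i j. if i \<le> j \<and> j \<le> q then susp_arr (S_iter n q C) q \<phi> (f i j) else VoidA))\<rparr>"

text \<open>Exact functors act on iterated diagrams entrywise.\<close>

definition K_map ::
  "('o, 'm, 'p, 'n) cat_functor \<Rightarrow> nat \<Rightarrow> nat \<Rightarrow> ('o, 'm) ksimplex \<Rightarrow> ('p, 'n) ksimplex" where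
  "K_map F n q = (\<lambda>(A, f).
     (\<lambda>i. map_dia_obj (on_obj F) (on_arr F) (A i),
      \<lambda>i j. map_dia_arr (on_obj F) (on_arr F) (f i j)))"

type_synonym 'a G_simplex =
  "(('a, 'a elt) rmodule, (('a, 'a elt) rmodule, 'a elt \<Rightarrow> 'a elt) arrow) ksimplex"

definition G_spectrum :: "'a f1_algebra \<Rightarrow> 'a G_simplex spectrum" where
  "G_spectrum M = K_spectrum (FG M)"

definition G_map ::
  "('a f1_algebra, 'a \<Rightarrow> 'a) arrow \<Rightarrow> nat \<Rightarrow> nat \<Rightarrow> 'a G_simplex \<Rightarrow> 'a G_simplex" where
  "G_map a = K_map (base_change a)"

definition G_functor ::
  "('a f1_algebra, ('a f1_algebra, 'a \<Rightarrow> 'a) arrow,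
    'a G_simplex spectrum,
    ('a G_simplex spectrum, (nat \<Rightarrow> nat \<Rightarrow> 'a G_simplex \<Rightarrow> 'a G_simplex) set) arrow) cat_functor" where
  "G_functor = \<lparr>
     on_obj = G_spectrum,
     on_arr = (\<lambda>a. Arrow (G_spectrum (arrow_src a))
                (homotopy_class (G_spectrum (arrow_src a)) (G_spectrum (arrow_tgt a)) (G_map a))
                (G_spectrum (arrow_tgt a)))\<rparr>"

end

theory Submission
  imports Defs
begin

text \<open>
  The module \<open>S \<and>\<^sub>M N\<close> is handled through its generators \<open>s \<and> n\<close> and through the fact that
  homomorphisms out of it are balanced maps. This gives the unit isomorphism \<open>s \<mapsto> s \<and> 1\<close> and the
  composition isomorphism \<open>(s \<and> n) \<and> l \<mapsto> s \<and> \<beta>(n)l\<close>, and every coherence law is an equation between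
  values on generators. Base change preserves pushouts although restriction of scalars need not
  preserve finite generation: a cocone on the restricted side factors through the finitely generated
  submodule generated by the images.

  In the categories of the iterated S-construction a pushout along a cofibration is computed
  entrywise, by pasting and cancelling pushout squares; hence exact functors act entrywise on the
  S-construction and the action is again exact. A natural isomorphism \<open>F \<cong> G\<close> gives a simplicial
  homotopy: over a simplex \<open>[q] \<rightarrow> [1]\<close> of the interval, apply \<open>F\<close> to the entries over \<open>0\<close> and \<open>G\<close> to
  those over \<open>1\<close>, and insert the isomorphism where the simplex jumps. Applied to the unit and
  composition isomorphisms this makes \<open>\<alpha> \<mapsto> G(\<alpha>)\<close> functorial up to homotopy. Composition is not
  strict on the level of modules because the elements of an iterated base change are classes of
  pairs whose first component is itself such a class.
\<close>

section \<open>Pushouts\<close>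

text \<open>The homotopy has to be pointed and has to commute with the structure maps, which fill
  diagrams with copies of the zero object. Both conditions concern the component of the isomorphism
  at that object. It is an identity, because exact functors send the chosen zero object to the
  chosen one and a zero object has only one endomorphism. Hence zero objects are preserved up to
  equality here, although everything else is only natural up to isomorphism.

  Pushouts are not chosen functorially, yet an object of \<open>S_con q D\<close> has
  \<open>Zob D\<close> itself on its diagonal. The entrywise pushout is therefore selected with this
  target over the diagonal, and every other pushout is compared with the selected one.

  The degree \<open>q\<close> is the same in all \<open>n\<close> directions, so a simplicial
  operator changes all of them at once. In an induction on \<open>n\<close> it acts on the entries
  as well as on the indices; this is why restriction and entrywise application of a functor are
  treated together.

  Composites of base changes agree only up to isomorphism, so the arrows in the target of
  \<open>G_functor\<close> are homotopy classes.\<close>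

locale cat =
  fixes C :: "('o, 'm, 'z) category_scheme"
  assumes is_cat: "is_category C"
begin

abbreviation cmp :: "'m \<Rightarrow> 'm \<Rightarrow> 'm" (infixr "\<cdot>" 75) where "g \<cdot> f \<equiv> Cmp C g f"

abbreviation arr :: "'m \<Rightarrow> 'o \<Rightarrow> 'o \<Rightarrow> bool" where
  "arr f X Y \<equiv> f \<in> Arr C \<and> Src C f = X \<and> Tgt C f = Y"

lemma src_obj: "f \<in> Arr C \<Longrightarrow> Src C f \<in> Obj C"
  and tgt_obj: "f \<in> Arr C \<Longrightarrow> Tgt C f \<in> Obj C"
  using is_cat by (auto simp: is_category_def)

lemma idn_arr [simp]: "A \<in> Obj C \<Longrightarrow> Idn C A \<in> Arr C"
  "A \<in> Obj C \<Longrightarrow> Src C (Idn C A) = A" "A \<in> Obj C \<Longrightarrow> Tgt C (Idn C A) = A"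
  using is_cat by (auto simp: is_category_def)

lemma cmp_arr [simp]:
  assumes "f \<in> Arr C" "g \<in> Arr C" "Src C g = Tgt C f"
  shows "g \<cdot> f \<in> Arr C" "Src C (g \<cdot> f) = Src C f" "Tgt C (g \<cdot> f) = Tgt C g"
  using is_cat assms by (auto simp: is_category_def)

lemma cmp_idn [simp]:
  assumes "f \<in> Arr C"
  shows "Src C f = A \<Longrightarrow> f \<cdot> Idn C A = f" "Tgt C f = A \<Longrightarrow> Idn C A \<cdot> f = f"
  using is_cat assms by (auto simp: is_category_def)

lemma assoc:
  assumes "f \<in> Arr C" "g \<in> Arr C" "h \<in> Arr C" "Src C g = Tgt C f" "Src C h = Tgt C g"
  shows "(h \<cdot> g) \<cdot> f = h \<cdot> (g \<cdot> f)"
  using is_cat assms unfolding is_category_def by metis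

text \<open>Composition is associative only under typing conditions, so an equation between two
  composites cannot be rewritten inside a longer right-nested one. This lemma and
  \<open>reassoc'\<close> carry such an equation past a further arrow \<open>x\<close> and leave the
  typing conditions to simplification.\<close>

lemma reassoc:
  assumes "g \<cdot> f = k \<cdot> l" "x \<in> Arr C" "f \<in> Arr C" "g \<in> Arr C" "k \<in> Arr C" "l \<in> Arr C"
    "Src C f = Tgt C x" "Src C g = Tgt C f" "Src C l = Tgt C x" "Src C k = Tgt C l"
  shows "g \<cdot> f \<cdot> x = k \<cdot> l \<cdot> x"
  using assms assoc by metis

lemma reassoc':
  assumes "g \<cdot> f = k" "x \<in> Arr C" "f \<in> Arr C" "g \<in> Arr C"
    "Src C f = Tgt C x" "Src C g = Tgt C f"
  shows "g \<cdot> f \<cdot> x = k \<cdot> x"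
  using assms assoc by metis

lemma isoE:
  assumes "iso_arrow C f" "arr f X Y"
  obtains g where "arr g Y X" "g \<cdot> f = Idn C X" "f \<cdot> g = Idn C Y"
  using assms by (auto simp: iso_arrow_def)

lemma isoI:
  assumes "arr f X Y" "arr g Y X" "g \<cdot> f = Idn C X" "f \<cdot> g = Idn C Y"
  shows "iso_arrow C f"
  using assms by (auto simp: iso_arrow_def)

lemma iso_idn: "A \<in> Obj C \<Longrightarrow> iso_arrow C (Idn C A)"
  by (rule isoI[of _ A A "Idn C A"]) simp_all

lemma iso_cmp:
  assumes "iso_arrow C f" "iso_arrow C g" "arr f X Y" "arr g Y Z"
  shows "iso_arrow C (g \<cdot> f)"
proof -
  obtain f' where f': "arr f' Y X" "f' \<cdot> f = Idn C X" "f \<cdot> f' = Idn C Y"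
    using isoE[OF assms(1,3)] .
  obtain g' where g': "arr g' Z Y" "g' \<cdot> g = Idn C Y" "g \<cdot> g' = Idn C Z"
    using isoE[OF assms(2,4)] .
  have 1: "g' \<cdot> g \<cdot> f = Idn C Y \<cdot> f" using assms(3,4) g' by (intro reassoc') auto
  have 2: "f \<cdot> f' \<cdot> g' = Idn C Y \<cdot> g'" using assms(3,4) g' f' by (intro reassoc') auto
  show ?thesis
    by (rule isoI[of _ X Z "f' \<cdot> g'"]) (use assms(3,4) f' g' 1 2 in \<open>simp_all add: assoc\<close>)
qed

section \<open>Calculus of pushout squares\<close>

lemma pushoutI:
  assumes "arr a X Y" "arr b X Z" "arr c Y P" "arr d Z P" "c \<cdot> a = d \<cdot> b"
    and "\<And>c' d' T. arr c' Y T \<Longrightarrow> arr d' Z T \<Longrightarrow> c' \<cdot> a = d' \<cdot> b \<Longrightarrow>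
           \<exists>u. arr u P T \<and> u \<cdot> c = c' \<and> u \<cdot> d = d'"
    and "\<And>u v T. arr u P T \<Longrightarrow> arr v P T \<Longrightarrow> u \<cdot> c = v \<cdot> c \<Longrightarrow> u \<cdot> d = v \<cdot> d \<Longrightarrow> u = v"
  shows "is_pushout C a b c d"
  unfolding is_pushout_def
proof (intro conjI ballI impI)
  fix c' d' assume cd: "c' \<in> Arr C" "d' \<in> Arr C"
    "Src C c' = Tgt C a \<and> Src C d' = Tgt C b \<and> Tgt C d' = Tgt C c' \<and> c' \<cdot> a = d' \<cdot> b"
  then obtain u where u: "arr u P (Tgt C c')" "u \<cdot> c = c'" "u \<cdot> d = d'"
    using assms(1,2) assms(6)[of c' "Tgt C c'" d'] by auto
  show "\<exists>!u. u \<in> Arr C \<and> Src C u = Tgt C c \<and> Tgt C u = Tgt C c' \<and> u \<cdot> c = c' \<and> u \<cdot> d = d'"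
  proof (intro ex1I[of _ u])
    show "v = u" if "v \<in> Arr C \<and> Src C v = Tgt C c \<and> Tgt C v = Tgt C c' \<and> v \<cdot> c = c' \<and> v \<cdot> d = d'" for v
      using that u assms(3) by (intro assms(7)[of v "Tgt C c'" u]) auto
  qed (use u assms(1-5) in auto)
qed (use assms(1-5) in auto)

lemma pushoutD:
  assumes "is_pushout C a b c d"
  shows "a \<in> Arr C" "b \<in> Arr C" "c \<in> Arr C" "d \<in> Arr C"
    "Src C b = Src C a" "Src C c = Tgt C a" "Src C d = Tgt C b" "Tgt C d = Tgt C c"
    "c \<cdot> a = d \<cdot> b"
  using assms by (auto simp: is_pushout_def)

lemma pushout_ex1:
  assumes "is_pushout C a b c d" "arr c' (Tgt C a) T" "arr d' (Tgt C b) T" "c' \<cdot> a = d' \<cdot> b"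
  shows "\<exists>!u. arr u (Tgt C c) T \<and> u \<cdot> c = c' \<and> u \<cdot> d = d'"
proof -
  have "\<forall>c' \<in> Arr C. \<forall>d' \<in> Arr C.
      Src C c' = Tgt C a \<and> Src C d' = Tgt C b \<and> Tgt C d' = Tgt C c' \<and> c' \<cdot> a = d' \<cdot> b \<longrightarrow>
      (\<exists>!u. u \<in> Arr C \<and> Src C u = Tgt C c \<and> Tgt C u = Tgt C c' \<and> u \<cdot> c = c' \<and> u \<cdot> d = d')"
    using assms(1) unfolding is_pushout_def by (elim conjE)
  from this[rule_format, of c' d'] show ?thesis using assms(2-) by simp
qed

lemma pushout_ex:
  assumes "is_pushout C a b c d" "arr c' (Tgt C a) T" "arr d' (Tgt C b) T" "c' \<cdot> a = d' \<cdot> b"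
  obtains u where "arr u (Tgt C c) T" "u \<cdot> c = c'" "u \<cdot> d = d'"
  using pushout_ex1[OF assms] that by blast

lemma pushout_eq:
  assumes po: "is_pushout C a b c d" and u: "arr u (Tgt C c) T" and v: "arr v (Tgt C c) T"
    and "u \<cdot> c = v \<cdot> c" "u \<cdot> d = v \<cdot> d"
  shows "u = v"
proof -
  note D = pushoutD[OF po]
  have "(v \<cdot> c) \<cdot> a = (v \<cdot> d) \<cdot> b" using D v by (simp add: assoc)
  then have "\<exists>!w. arr w (Tgt C c) T \<and> w \<cdot> c = v \<cdot> c \<and> w \<cdot> d = v \<cdot> d"
    using pushout_ex1[OF po, of "v \<cdot> c" T "v \<cdot> d"] D v by simp
  then show ?thesis using assms by blast
qed

lemma pushout_sym:
  assumes po: "is_pushout C a b c d"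
  shows "is_pushout C b a d c"
proof -
  note D = pushoutD[OF po]
  show ?thesis
  proof (rule pushoutI)
    fix c' d' T assume "arr c' (Tgt C b) T" "arr d' (Tgt C a) T" "c' \<cdot> b = d' \<cdot> a"
    then show "\<exists>u. arr u (Tgt C c) T \<and> u \<cdot> d = c' \<and> u \<cdot> c = d'"
      using pushout_ex[OF po, of d' T c'] by metis
  qed (use D pushout_eq[OF po] in auto)
qed

text \<open>Since \<open>c\<close> is invertible, a cocone \<open>(p, r)\<close> can only be
  mediated by \<open>p\<close> after the inverse of \<open>c\<close>. As \<open>b\<close> is
  invertible too, \<open>d\<close> is determined by \<open>a\<close>, \<open>b\<close> and
  \<open>c\<close>, and the equation on \<open>d\<close> follows from the cocone condition.\<close>

lemma pushout_iso:
  assumes "arr a X Y" "arr b X Z" "arr c Y P" "arr d Z P" "c \<cdot> a = d \<cdot> b"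
    and "iso_arrow C b" "iso_arrow C c"
  shows "is_pushout C a b c d"
proof -
  obtain b' where b': "arr b' Z X" "b' \<cdot> b = Idn C X" "b \<cdot> b' = Idn C Z"
    using isoE[OF assms(6,2)] .
  obtain c' where c': "arr c' P Y" "c' \<cdot> c = Idn C Y" "c \<cdot> c' = Idn C P"
    using isoE[OF assms(7,3)] .
  note obs = src_obj tgt_obj
  have d: "d = c \<cdot> a \<cdot> b'"
    using assms b' reassoc[of c a d b b'] by simp
  show ?thesis
  proof (rule pushoutI[OF assms(1-5)])
    fix p r T assume p: "arr p Y T" "arr r Z T" "p \<cdot> a = r \<cdot> b"
    have 1: "c' \<cdot> c \<cdot> a \<cdot> b' = Idn C Y \<cdot> (a \<cdot> b')" using assms(1-5) b' c' by (intro reassoc') auto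
    have 2: "p \<cdot> a \<cdot> b' = r \<cdot> b \<cdot> b'" using assms(1-5) b' c' p by (intro reassoc) auto
    show "\<exists>u. arr u P T \<and> u \<cdot> c = p \<and> u \<cdot> d = r"
      using assms(1-5) b' c' p 1 2 by (intro exI[of _ "p \<cdot> c'"]) (simp add: assoc d)
  next
    fix u v T assume uv: "arr u P T" "arr v P T" "u \<cdot> c = v \<cdot> c"
    have "u \<cdot> c \<cdot> c' = v \<cdot> c \<cdot> c'" using assms(1-5) c' uv by (intro reassoc) auto
    then show "u = v" using uv c' by simp
  qed
qed

text \<open>The two universal properties induce arrows in opposite directions, and uniqueness makes
  them inverse to each other.\<close>

lemma pushout_unique:
  assumes po: "is_pushout C a b c d" and po': "is_pushout C a b c' d'"
  obtains u where "arr u (Tgt C c) (Tgt C c')" "iso_arrow C u" "u \<cdot> c = c'" "u \<cdot> d = d'"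
proof -
  note D = pushoutD[OF po] pushoutD[OF po']
  obtain u where u: "arr u (Tgt C c) (Tgt C c')" "u \<cdot> c = c'" "u \<cdot> d = d'"
    using pushout_ex[OF po, of c' "Tgt C c'" d'] D by auto
  obtain v where v: "arr v (Tgt C c') (Tgt C c)" "v \<cdot> c' = c" "v \<cdot> d' = d"
    using pushout_ex[OF po', of c "Tgt C c" d] D by auto
  have "v \<cdot> u = Idn C (Tgt C c)"
    by (rule pushout_eq[OF po]) (use D u v in \<open>auto simp: assoc tgt_obj\<close>)
  moreover have "u \<cdot> v = Idn C (Tgt C c')"
    by (rule pushout_eq[OF po']) (use D u v in \<open>auto simp: assoc tgt_obj\<close>)
  ultimately have "iso_arrow C u" using isoI[OF u(1) v(1)] by blast
  then show ?thesis using that u by blast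
qed

lemma pushout_transport:
  assumes po: "is_pushout C a b c d" and w: "arr w (Tgt C c) Q" "iso_arrow C w"
  shows "is_pushout C a b (w \<cdot> c) (w \<cdot> d)"
proof -
  note D = pushoutD[OF po]
  obtain w' where w': "arr w' Q (Tgt C c)" "w' \<cdot> w = Idn C (Tgt C c)" "w \<cdot> w' = Idn C Q"
    using isoE[OF w(2,1)] .
  show ?thesis
  proof (rule pushoutI[of a _ _ b _ _ Q])
    fix p r T assume p: "arr p (Tgt C a) T" "arr r (Tgt C b) T" "p \<cdot> a = r \<cdot> b"
    obtain u where u: "arr u (Tgt C c) T" "u \<cdot> c = p" "u \<cdot> d = r" using pushout_ex[OF po p] .
    have 1: "w' \<cdot> w \<cdot> c = Idn C (Tgt C c) \<cdot> c" by (rule reassoc') (use w w' D in auto)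
    have 2: "w' \<cdot> w \<cdot> d = Idn C (Tgt C c) \<cdot> d" by (rule reassoc') (use w w' D in auto)
    from 1 2 show "\<exists>u. arr u Q T \<and> u \<cdot> w \<cdot> c = p \<and> u \<cdot> w \<cdot> d = r"
      using u w w' D by (intro exI[of _ "u \<cdot> w'"]) (simp add: assoc)
  next
    fix u v T assume uv: "arr u Q T" "arr v Q T" "u \<cdot> w \<cdot> c = v \<cdot> w \<cdot> c" "u \<cdot> w \<cdot> d = v \<cdot> w \<cdot> d"
    have "u \<cdot> w = v \<cdot> w"
      by (rule pushout_eq[OF po]) (use D uv w in \<open>auto simp: assoc\<close>)
    then have "u \<cdot> w \<cdot> w' = v \<cdot> w \<cdot> w'" using uv w w' by (intro reassoc) auto
    then show "u = v" using uv w' by simp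
  qed (use D w in \<open>auto simp: assoc\<close>)
qed

text \<open>The two squares share the side \<open>c\<close>. A cocone on the outer rectangle is
  mediated in two stages: \<open>(p \<cdot> e, r)\<close> over the first square gives
  \<open>u\<close>, and \<open>(p, u)\<close> over the second gives the mediating arrow.\<close>

lemma pushout_paste:
  assumes po: "is_pushout C a b c d" and po': "is_pushout C e c f g"
  shows "is_pushout C (e \<cdot> a) b f (g \<cdot> d)"
proof -
  note D = pushoutD[OF po] pushoutD[OF po']
  have sq: "g \<cdot> c \<cdot> a = f \<cdot> e \<cdot> a" by (rule reassoc) (use D in auto)
  show ?thesis
  proof (rule pushoutI)
    fix p r T assume p: "arr p (Tgt C e) T" "arr r (Tgt C b) T" "p \<cdot> e \<cdot> a = r \<cdot> b"
    obtain u where u: "arr u (Tgt C c) T" "u \<cdot> c = p \<cdot> e" "u \<cdot> d = r"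
      by (rule pushout_ex[OF po, of "p \<cdot> e" T r]) (use p D in \<open>auto simp: assoc\<close>)
    obtain v where v: "arr v (Tgt C f) T" "v \<cdot> f = p" "v \<cdot> g = u"
      by (rule pushout_ex[OF po', of p T u]) (use p D u in \<open>auto simp: assoc\<close>)
    show "\<exists>u. arr u (Tgt C f) T \<and> u \<cdot> f = p \<and> u \<cdot> g \<cdot> d = r"
    proof (intro exI conjI)
      have "v \<cdot> g \<cdot> d = u \<cdot> d" by (rule reassoc') (use v D in auto)
      then show "v \<cdot> g \<cdot> d = r" using u by simp
    qed (use v in auto)
  next
    fix u v T assume uv: "arr u (Tgt C f) T" "arr v (Tgt C f) T" "u \<cdot> f = v \<cdot> f" "u \<cdot> g \<cdot> d = v \<cdot> g \<cdot> d"
    have "u \<cdot> g = v \<cdot> g"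
    proof (rule pushout_eq[OF po])
      have "u \<cdot> f \<cdot> e = v \<cdot> f \<cdot> e" by (rule reassoc) (use uv D in auto)
      then show "(u \<cdot> g) \<cdot> c = (v \<cdot> g) \<cdot> c" using D uv by (simp add: assoc)
    qed (use D uv in \<open>auto simp: assoc\<close>)
    then show "u = v" by (rule pushout_eq[OF po' uv(1,2,3)])
  qed (use D sq in \<open>auto simp: assoc\<close>)
qed

text \<open>The outer rectangle supplies the mediating arrow \<open>u\<close>; that
  \<open>u \<cdot> g = r\<close> is tested on the two legs \<open>c\<close> and \<open>d\<close> of
  the first square.\<close>

lemma pushout_cancel:
  assumes po: "is_pushout C a b c d" and po': "is_pushout C (e \<cdot> a) b f (g \<cdot> d)"
    and e: "arr e (Tgt C a) Y" and g: "arr g (Tgt C c) (Tgt C f)" and eq: "g \<cdot> c = f \<cdot> e"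
  shows "is_pushout C e c f g"
proof -
  note D = pushoutD[OF po] pushoutD[OF po']
  have Y: "Src C f = Y" using D e by auto
  show ?thesis
  proof (rule pushoutI)
    fix p r T assume p: "arr p Y T" "arr r (Tgt C c) T" "p \<cdot> e = r \<cdot> c"
    have "p \<cdot> e \<cdot> a = r \<cdot> c \<cdot> a" by (rule reassoc) (use D e p in auto)
    then have po_eq: "p \<cdot> e \<cdot> a = (r \<cdot> d) \<cdot> b" using pushoutD[OF po] p by (simp add: assoc)
    obtain u where u: "arr u (Tgt C f) T" "u \<cdot> f = p" "u \<cdot> g \<cdot> d = r \<cdot> d"
      by (rule pushout_ex[OF po' _ _ po_eq that]) (use D e g p in \<open>auto simp: assoc\<close>)
    have "u \<cdot> g = r"
    proof (rule pushout_eq[OF po])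
      have "u \<cdot> f \<cdot> e = p \<cdot> e" by (rule reassoc') (use D e u in auto)
      then show "(u \<cdot> g) \<cdot> c = r \<cdot> c" using D g u p by (simp add: assoc eq)
    qed (use u D p g in \<open>auto simp: assoc\<close>)
    then show "\<exists>u. arr u (Tgt C f) T \<and> u \<cdot> f = p \<and> u \<cdot> g = r" using u by blast
  next
    fix u v T assume uv: "arr u (Tgt C f) T" "arr v (Tgt C f) T" "u \<cdot> f = v \<cdot> f" "u \<cdot> g = v \<cdot> g"
    have "u \<cdot> g \<cdot> d = v \<cdot> g \<cdot> d" by (rule reassoc) (use D g uv in auto)
    then show "u = v" by (rule pushout_eq[OF po' uv(1,2,3)])
  qed (use D e g eq Y in auto)
qed

text \<open>The inverses of \<open>x\<close>, \<open>y\<close>, \<open>z\<close> form a map of spans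
  in the opposite direction, and the arrow it induces is inverse to \<open>w\<close>. This is the
  gluing axiom when the weak equivalences are the isomorphisms.\<close>

lemma gluing_iso:
  assumes po: "is_pushout C a b c d" and po': "is_pushout C a' b' c' d'"
    and x: "iso_arrow C x" "arr x (Src C a) (Src C a')"
    and y: "iso_arrow C y" "arr y (Tgt C a) (Tgt C a')"
    and z: "iso_arrow C z" "arr z (Tgt C b) (Tgt C b')"
    and eqs: "y \<cdot> a = a' \<cdot> x" "z \<cdot> b = b' \<cdot> x"
    and w: "arr w (Tgt C c) (Tgt C c')" "w \<cdot> c = c' \<cdot> y" "w \<cdot> d = d' \<cdot> z"
  shows "iso_arrow C w"
proof -
  note D = pushoutD[OF po] pushoutD[OF po']
  obtain x' where x': "arr x' (Src C a') (Src C a)" "x' \<cdot> x = Idn C (Src C a)" "x \<cdot> x' = Idn C (Src C a')"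
    using isoE[OF x] .
  obtain y' where y': "arr y' (Tgt C a') (Tgt C a)" "y' \<cdot> y = Idn C (Tgt C a)" "y \<cdot> y' = Idn C (Tgt C a')"
    using isoE[OF y] .
  obtain z' where z': "arr z' (Tgt C b') (Tgt C b)" "z' \<cdot> z = Idn C (Tgt C b)" "z \<cdot> z' = Idn C (Tgt C b')"
    using isoE[OF z] .
  have "y \<cdot> a \<cdot> x' = a' \<cdot> x \<cdot> x'" by (rule reassoc) (use D x(2) x' y(2) eqs in auto)
  also have "\<dots> = a'" using D x' by simp
  finally have eq1: "y \<cdot> a \<cdot> x' = a'" .
  have "z \<cdot> b \<cdot> x' = b' \<cdot> x \<cdot> x'" by (rule reassoc) (use D x(2) x' z(2) eqs in auto)
  also have "\<dots> = b'" using D x' by simp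
  finally have eq1': "z \<cdot> b \<cdot> x' = b'" .
  have "y' \<cdot> y \<cdot> a \<cdot> x' = Idn C (Tgt C a) \<cdot> (a \<cdot> x')" by (rule reassoc') (use D x' y(2) y' in auto)
  then have eq2: "y' \<cdot> a' = a \<cdot> x'" unfolding eq1 using D x' by simp
  have "z' \<cdot> z \<cdot> b \<cdot> x' = Idn C (Tgt C b) \<cdot> (b \<cdot> x')" by (rule reassoc') (use D x' z(2) z' in auto)
  then have eq2': "z' \<cdot> b' = b \<cdot> x'" unfolding eq1' using D x' by simp
  have po_eq: "(c \<cdot> y') \<cdot> a' = (d \<cdot> z') \<cdot> b'"
    using D x' y' z' eq2 eq2' reassoc[of c a d b x'] by (simp add: assoc)
  obtain v where v: "arr v (Tgt C c') (Tgt C c)" "v \<cdot> c' = c \<cdot> y'" "v \<cdot> d' = d \<cdot> z'"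
    by (rule pushout_ex[OF po' _ _ po_eq that]) (use D y' z' in auto)
  have "v \<cdot> w = Idn C (Tgt C c)"
  proof (rule pushout_eq[OF po])
    have 1: "v \<cdot> c' \<cdot> y = c \<cdot> y' \<cdot> y" by (rule reassoc) (use D v y' y(2) in auto)
    have 2: "v \<cdot> d' \<cdot> z = d \<cdot> z' \<cdot> z" by (rule reassoc) (use D v z' z(2) in auto)
    from 1 2 show "(v \<cdot> w) \<cdot> c = Idn C (Tgt C c) \<cdot> c" "(v \<cdot> w) \<cdot> d = Idn C (Tgt C c) \<cdot> d"
      using D v w y' z' by (simp_all add: assoc)
  qed (use D v w in \<open>auto simp: tgt_obj\<close>)
  moreover have "w \<cdot> v = Idn C (Tgt C c')"
  proof (rule pushout_eq[OF po'])
    have 1: "w \<cdot> c \<cdot> y' = c' \<cdot> y \<cdot> y'" by (rule reassoc) (use D w y' y(2) in auto)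
    have 2: "w \<cdot> d \<cdot> z' = d' \<cdot> z \<cdot> z'" by (rule reassoc) (use D w z' z(2) in auto)
    from 1 2 show "(w \<cdot> v) \<cdot> c' = Idn C (Tgt C c') \<cdot> c'" "(w \<cdot> v) \<cdot> d' = Idn C (Tgt C c') \<cdot> d'"
      using D v w y' z' by (simp_all add: assoc)
  qed (use D v w in \<open>auto simp: tgt_obj\<close>)
  ultimately show ?thesis using isoI[OF w(1) v(1)] by blast
qed

end

section \<open>The S-construction\<close>

text \<open>The axioms of a Waldhausen category except the gluing axiom, which plays no role in
  iterating the S-construction.\<close>

locale prewald = cat D for D :: "('o, 'm) waldhausen" +
  assumes zero: "zero_object D (Zob D)"
    and cof_arr: "f \<in> Cof D \<Longrightarrow> f \<in> Arr D"
    and weq_arr: "f \<in> Weq D \<Longrightarrow> f \<in> Arr D"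
    and iso_cof: "iso_arrow D f \<Longrightarrow> f \<in> Cof D"
    and iso_weq: "iso_arrow D f \<Longrightarrow> f \<in> Weq D"
    and cof_cmp: "f \<in> Cof D \<Longrightarrow> g \<in> Cof D \<Longrightarrow> Src D g = Tgt D f \<Longrightarrow> Cmp D g f \<in> Cof D"
    and weq_cmp: "f \<in> Weq D \<Longrightarrow> g \<in> Weq D \<Longrightarrow> Src D g = Tgt D f \<Longrightarrow> Cmp D g f \<in> Weq D"
    and zero_cof: "f \<in> Arr D \<Longrightarrow> Src D f = Zob D \<Longrightarrow> f \<in> Cof D"
    and po_ex: "a \<in> Cof D \<Longrightarrow> b \<in> Arr D \<Longrightarrow> Src D b = Src D a \<Longrightarrow> \<exists>c d. is_pushout D a b c d"
    and po_cof: "a \<in> Cof D \<Longrightarrow> is_pushout D a b c d \<Longrightarrow> d \<in> Cof D"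

lemma waldhausen_prewald:
  assumes "is_waldhausen C"
  shows "prewald C"
proof -
  note w = assms[unfolded is_waldhausen_def]
  have 1: "is_category C" "zero_object C (Zob C)" "Cof C \<subseteq> Arr C" "Weq C \<subseteq> Arr C"
    "\<forall>f. iso_arrow C f \<longrightarrow> f \<in> Cof C \<and> f \<in> Weq C"
    using w by - (elim conjE, assumption)+
  have 2: "\<forall>f \<in> Cof C. \<forall>g \<in> Cof C. Src C g = Tgt C f \<longrightarrow> Cmp C g f \<in> Cof C"
    "\<forall>f \<in> Weq C. \<forall>g \<in> Weq C. Src C g = Tgt C f \<longrightarrow> Cmp C g f \<in> Weq C"
    "\<forall>f \<in> Arr C. Src C f = Zob C \<longrightarrow> f \<in> Cof C"
    using w by - (elim conjE, assumption)+
  have 3: "\<forall>a \<in> Cof C. \<forall>b \<in> Arr C. Src C b = Src C a \<longrightarrow> (\<exists>c d. is_pushout C a b c d)"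
    "\<forall>a b c d. a \<in> Cof C \<and> is_pushout C a b c d \<longrightarrow> d \<in> Cof C"
    using w by - (elim conjE, assumption)+
  show ?thesis
    by unfold_locales (use 1 2 3 in blast)+
qed

section \<open>Zero object and relative cofibrations\<close>

context prewald
begin

notation cmp (infixr "\<cdot>" 75)

lemma zob: "Zob D \<in> Obj D"
  using zero by (simp add: zero_object_def)

lemma from_zero: "A \<in> Obj D \<Longrightarrow> \<exists>f. arr f (Zob D) A"
  and to_zero: "A \<in> Obj D \<Longrightarrow> \<exists>f. arr f A (Zob D)"
  using zero unfolding zero_object_def by blast+

lemma from_zero_unique: "arr f (Zob D) A \<Longrightarrow> arr g (Zob D) A \<Longrightarrow> f = g"
  using zero tgt_obj unfolding zero_object_def by blast

lemma to_zero_unique: "arr f A (Zob D) \<Longrightarrow> arr g A (Zob D) \<Longrightarrow> f = g"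
  using zero src_obj unfolding zero_object_def by blast

lemma idn_cof: "A \<in> Obj D \<Longrightarrow> Idn D A \<in> Cof D"
  and idn_weq: "A \<in> Obj D \<Longrightarrow> Idn D A \<in> Weq D"
  using iso_idn iso_cof iso_weq by auto

lemma pushout_arr:
  assumes "is_pushout D a b c d" "arr a X Y" "arr b X Z"
  obtains P where "arr c Y P" "arr d Z P"
  using pushoutD(3,4,6-8)[OF assms(1)] assms(2,3) by simp

text \<open>For a square with horizontal arrows \<open>a\<close>, \<open>b\<close> and vertical
  arrows \<open>t\<close>, \<open>t'\<close>, this asks that the comparison map from the pushout of
  \<open>a\<close> and \<open>t\<close> to the target of \<open>b\<close> be a cofibration. It is
  the second half of the condition on cofibrations in \<open>S_con\<close>. Quantifying over some
  pushout avoids choosing one.\<close>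

definition rel_cof :: "'m \<Rightarrow> 'm \<Rightarrow> 'm \<Rightarrow> 'm \<Rightarrow> bool" where
  "rel_cof a t b t' \<longleftrightarrow> (\<exists>c d. is_pushout D a t c d \<and>
     (\<exists>u \<in> Cof D. Src D u = Tgt D c \<and> Tgt D u = Tgt D b \<and> u \<cdot> c = t' \<and> u \<cdot> d = b))"

lemma rel_cofI:
  assumes "is_pushout D a t c d" "u \<in> Cof D" "arr u (Tgt D c) (Tgt D b)" "u \<cdot> c = t'" "u \<cdot> d = b"
  shows "rel_cof a t b t'"
  using assms unfolding rel_cof_def by blast

lemma rel_cofE:
  assumes "rel_cof a t b t'"
  obtains c d u where "is_pushout D a t c d" "u \<in> Cof D" "arr u (Tgt D c) (Tgt D b)" "u \<cdot> c = t'" "u \<cdot> d = b"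
  using assms cof_arr unfolding rel_cof_def by blast

text \<open>The comparison map of the composite square factors through the pushout of
  \<open>b\<close> and \<open>s\<close>. The first factor \<open>h\<close> is a pushout of the
  comparison map \<open>v\<close> of the first square, the second factor is the comparison map
  \<open>v2\<close> of the second square.\<close>

lemma rel_cof_trans:
  assumes 1: "rel_cof a t b t'" and 2: "rel_cof b s e s'" and a: "a \<in> Cof D"
  shows "rel_cof a (s \<cdot> t) e (s' \<cdot> t')"
proof -
  obtain g f v where R: "is_pushout D a t g f" and v: "v \<in> Cof D" "arr v (Tgt D g) (Tgt D b)"
    and ve: "v \<cdot> g = t'" "v \<cdot> f = b"
    using rel_cofE[OF 1] .
  obtain e2 f2 v2 where R2: "is_pushout D b s e2 f2" and v2: "v2 \<in> Cof D" "arr v2 (Tgt D e2) (Tgt D e)"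
    and ve2: "v2 \<cdot> e2 = s'" "v2 \<cdot> f2 = e"
    using rel_cofE[OF 2] .
  note DR = pushoutD[OF R] pushoutD[OF R2]
  have "Src D (v \<cdot> f) = Src D f" using pushoutD(1-8)[OF R] v by simp
  then have Rs: "arr f (Src D b) (Tgt D g)" "Tgt D t = Src D b" using pushoutD(1-8)[OF R] ve by simp_all
  have "f \<in> Cof D" by (rule po_cof[OF a R])
  then obtain x y where R3: "is_pushout D f s x y" using po_ex[of f s] DR Rs by auto
  note D3 = pushoutD[OF R3]
  have "e2 \<cdot> v \<cdot> f = e2 \<cdot> b" using ve by simp
  then have po_eq: "(e2 \<cdot> v) \<cdot> f = f2 \<cdot> s" using DR v Rs by (simp add: assoc)
  obtain h where h: "arr h (Tgt D x) (Tgt D e2)" "h \<cdot> x = e2 \<cdot> v" "h \<cdot> y = f2"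
    by (rule pushout_ex[OF R3 _ _ po_eq that]) (use DR v Rs in auto)
  \<comment> \<open>The square on \<open>f\<close>, \<open>s\<close> and the larger one on
    \<open>b = v \<cdot> f\<close>, \<open>s\<close> are both pushouts; what remains after
    cancelling exhibits \<open>h\<close> as a pushout of \<open>v\<close>.\<close>
  have po: "is_pushout D v x e2 h"
    by (rule pushout_cancel[OF R3]) (use R2 ve h v Rs DR D3 in auto)
  have hc: "h \<in> Cof D" by (rule po_cof[OF v(1) po])
  have R4: "is_pushout D a (s \<cdot> t) (x \<cdot> g) y"
    using pushout_sym[OF pushout_paste[OF pushout_sym[OF R] pushout_sym[OF R3]]] .
  show ?thesis
  proof (rule rel_cofI[OF R4, of "v2 \<cdot> h"])
    show "v2 \<cdot> h \<in> Cof D" using cof_cmp[OF hc v2(1)] v2 h by simp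
    have "(v2 \<cdot> h) \<cdot> (x \<cdot> g) = v2 \<cdot> (h \<cdot> x) \<cdot> g" using v2 h(1) D3 DR Rs by (simp add: assoc)
    also have "\<dots> = (v2 \<cdot> e2) \<cdot> (v \<cdot> g)" unfolding h(2) using v2 v D3 DR Rs by (simp add: assoc)
    finally show "(v2 \<cdot> h) \<cdot> (x \<cdot> g) = s' \<cdot> t'" unfolding ve ve2 .
    show "(v2 \<cdot> h) \<cdot> y = e" using v2 h D3 ve2 by (simp add: assoc)
  qed (use v2 h D3 DR Rs in auto)
qed

text \<open>A commuting square with invertible vertical arrows is itself a pushout, so its
  comparison map is an identity.\<close>

lemma rel_cof_iso:
  assumes a: "arr a A A'" and t: "arr t A B" "iso_arrow D t" and t': "arr t' A' B'" "iso_arrow D t'"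
    and b: "arr b B B'" and eq: "t' \<cdot> a = b \<cdot> t"
  shows "rel_cof a t b t'"
proof -
  have po: "is_pushout D a t t' b"
    by (rule pushout_iso[OF a t(1) t'(1) b eq t(2) t'(2)])
  show ?thesis
    by (rule rel_cofI[OF po idn_cof[of B']]) (use b t' tgt_obj in auto)
qed

text \<open>A pushout along the identity of the zero object changes nothing, so the comparison map
  is \<open>b\<close> itself. Its compatibility with \<open>t'\<close> is the uniqueness of arrows
  out of the zero object.\<close>

lemma rel_cof_zero:
  assumes t: "arr t (Zob D) A" and t': "arr t' (Zob D) A'" and b: "arr b A A'" "b \<in> Cof D"
  shows "rel_cof (Idn D (Zob D)) t b t'"
proof -
  have po: "is_pushout D (Idn D (Zob D)) t t (Idn D A)"
    by (rule pushout_sym, rule pushout_iso[of _ "Zob D" A _ "Zob D" _ A])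
      (use t zob tgt_obj iso_idn in auto)
  show ?thesis
    by (rule rel_cofI[OF po b(2)]) (use b t t' in \<open>auto intro: from_zero_unique\<close>)
qed

text \<open>The comparison map \<open>u\<close> out of \<open>C' \<union>\<^sub>C P\<close> is the pushout of the comparison map
  \<open>v\<close> out of \<open>A' \<union>\<^sub>A B\<close>, by pasting and cancelling pushout squares.\<close>

lemma rel_cof_pushout:
  assumes rc: "rel_cof a t b t'" and k: "k \<in> Cof D"
    and po: "is_pushout D t s p q" and po': "is_pushout D t' s' p' q'"
    and ty: "arr a A A'" "arr t A B" "arr t' A' B'" "arr b B B'" "arr s A C" "arr s' A' C'" "arr k C C'"
      "arr p B P" "arr q C P" "arr p' B' P'" "arr q' C' P'" "arr w P P'"
    and sk: "s' \<cdot> a = k \<cdot> s" and w: "w \<cdot> p = p' \<cdot> b" "w \<cdot> q = q' \<cdot> k"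
  shows "rel_cof k q w q' \<and> w \<in> Cof D"
proof -
  obtain e f v where R: "is_pushout D a t e f" and v: "v \<in> Cof D" "arr v (Tgt D e) (Tgt D b)"
    and ve: "v \<cdot> e = t'" "v \<cdot> f = b"
    using rel_cofE[OF rc] .
  obtain X where tR: "arr e A' X" "arr f B X" using pushout_arr[OF R ty(1,2)] .
  have tv: "arr v X B'" using v tR ty(4) by simp
  obtain m n where Q: "is_pushout D k q m n" using po_ex[OF k, of q] ty by auto
  obtain Y where tQ: "arr m C' Y" "arr n P Y" using pushout_arr[OF Q ty(7,9)] .
  have po_eq: "q' \<cdot> k = w \<cdot> q" using w by simp
  obtain u where u: "arr u (Tgt D m) P'" "u \<cdot> m = q'" "u \<cdot> n = w"
    by (rule pushout_ex[OF Q _ _ po_eq that]) (use ty in simp_all)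
  have tu: "arr u Y P'" using u tQ by simp
  have nc: "n \<in> Cof D" by (rule po_cof[OF k Q])
  have "m \<cdot> s' \<cdot> a = m \<cdot> k \<cdot> s" using sk by simp
  also have "\<dots> = n \<cdot> q \<cdot> s" by (rule reassoc) (use tQ ty pushoutD(9)[OF Q] in simp_all)
  also have "\<dots> = n \<cdot> p \<cdot> t" using pushoutD(9)[OF po] by simp
  finally have po_eq: "(m \<cdot> s') \<cdot> a = (n \<cdot> p) \<cdot> t" using tQ ty by (simp add: assoc)
  obtain r where r: "arr r (Tgt D e) Y" "r \<cdot> e = m \<cdot> s'" "r \<cdot> f = n \<cdot> p"
    by (rule pushout_ex[OF R _ _ po_eq that]) (use tQ ty in simp_all)
  have tr: "arr r X Y" using r tR by simp
  \<comment> \<open>Pasting exhibits \<open>Y\<close> as the pushout of \<open>t\<close> and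
    \<open>k \<cdot> s = s' \<cdot> a\<close>. Cancelling \<open>R\<close> leaves the pushout of
    \<open>s'\<close> and \<open>e\<close>; cancelling this in turn from the pushout of
    \<open>t' = v \<cdot> e\<close> and \<open>s'\<close> leaves \<open>u\<close> as the pushout of
    \<open>v\<close> along \<open>r\<close>.\<close>
  have p1: "is_pushout D t (k \<cdot> s) (n \<cdot> p) m"
    using pushout_sym[OF pushout_paste[OF pushout_sym[OF po] Q]] .
  have p2: "is_pushout D s' e m r"
    by (rule pushout_cancel[OF R]) (use pushout_sym[OF p1] sk r(2,3) tr tQ tR ty in simp_all)
  have ur: "u \<cdot> r = p' \<cdot> v"
  proof (rule pushout_eq[OF R])
    have "(u \<cdot> r) \<cdot> e = u \<cdot> m \<cdot> s'" using tu tr tR r(2) by (simp add: assoc)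
    also have "\<dots> = q' \<cdot> s'" by (rule reassoc') (use u(2) tu tQ ty in simp_all)
    also have "\<dots> = p' \<cdot> v \<cdot> e" using pushoutD(9)[OF po'] ve by simp
    also have "\<dots> = (p' \<cdot> v) \<cdot> e" using ty tv tR by (simp add: assoc)
    finally show "(u \<cdot> r) \<cdot> e = (p' \<cdot> v) \<cdot> e" .
    have "(u \<cdot> r) \<cdot> f = u \<cdot> n \<cdot> p" using tu tr tR r(3) by (simp add: assoc)
    also have "\<dots> = w \<cdot> p" by (rule reassoc') (use u(3) tu tQ ty in simp_all)
    also have "\<dots> = p' \<cdot> v \<cdot> f" using w ve by simp
    also have "\<dots> = (p' \<cdot> v) \<cdot> f" using ty tv tR by (simp add: assoc)
    finally show "(u \<cdot> r) \<cdot> f = (p' \<cdot> v) \<cdot> f" .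
  qed (use tu tr tR tv ty in simp_all)
  have p3: "is_pushout D v r p' u"
    by (rule pushout_cancel[OF pushout_sym[OF p2]])
      (use po' u(2) ur tu tv ve tr tR ty tQ in simp_all)
  have uc: "u \<in> Cof D" by (rule po_cof[OF v(1) p3])
  have "rel_cof k q w q'" by (rule rel_cofI[OF Q uc]) (use u(2,3) tu tQ ty in simp_all)
  moreover have "w \<in> Cof D" using cof_cmp[OF nc uc] u(3) tu tQ by simp
  ultimately show ?thesis by blast
qed

text \<open>Colimits commute with colimits. A cocone \<open>(m, n)\<close> on \<open>w1\<close>,
  \<open>w2\<close> restricts to cocones on the squares \<open>g\<close> and \<open>h\<close> and so
  gives \<open>\<beta>\<close> and \<open>\<gamma>\<close>; these agree on \<open>A3\<close> because
  they do on \<open>A1\<close> and \<open>A2\<close>, and together they induce the arrow out of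
  \<open>P3\<close>. The index from \<open>0\<close> to \<open>3\<close> names the corner at which
  \<open>P\<close> is the pushout of \<open>B\<close> and \<open>C\<close> over
  \<open>A\<close>.\<close>

lemma pushout_cube:
  assumes A: "is_pushout D f1 f2 f3 f4" and B: "is_pushout D g1 g2 g3 g4" and C: "is_pushout D h1 h2 h3 h4"
    and P0: "is_pushout D a0 b0 c0 d0" and P1: "is_pushout D a1 b1 c1 d1"
    and P2: "is_pushout D a2 b2 c2 d2" and P3: "is_pushout D a3 b3 c3 d3"
    and f: "arr f1 A0 A1" "arr f2 A0 A2" "arr f3 A1 A3" "arr f4 A2 A3"
    and g: "arr g1 B0 B1" "arr g2 B0 B2" "arr g3 B1 B3" "arr g4 B2 B3"
    and h: "arr h1 C0 C1" "arr h2 C0 C2" "arr h3 C1 C3" "arr h4 C2 C3"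
    and w: "arr w1 P0 P1" "arr w2 P0 P2" "arr w3 P1 P3" "arr w4 P2 P3"
    and a: "arr a0 A0 B0" "arr a1 A1 B1" "arr a2 A2 B2" "arr a3 A3 B3"
    and b: "arr b0 A0 C0" "arr b1 A1 C1" "arr b2 A2 C2" "arr b3 A3 C3"
    and c: "arr c0 B0 P0" "arr c1 B1 P1" "arr c2 B2 P2" "arr c3 B3 P3"
    and d: "arr d0 C0 P0" "arr d1 C1 P1" "arr d2 C2 P2" "arr d3 C3 P3"
    and na: "a3 \<cdot> f3 = g3 \<cdot> a1" "a3 \<cdot> f4 = g4 \<cdot> a2"
    and nb: "b3 \<cdot> f3 = h3 \<cdot> b1" "b3 \<cdot> f4 = h4 \<cdot> b2"
    and nc: "c1 \<cdot> g1 = w1 \<cdot> c0" "c2 \<cdot> g2 = w2 \<cdot> c0" "c3 \<cdot> g3 = w3 \<cdot> c1" "c3 \<cdot> g4 = w4 \<cdot> c2"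
    and nd: "d1 \<cdot> h1 = w1 \<cdot> d0" "d2 \<cdot> h2 = w2 \<cdot> d0" "d3 \<cdot> h3 = w3 \<cdot> d1" "d3 \<cdot> h4 = w4 \<cdot> d2"
  shows "is_pushout D w1 w2 w3 w4"
proof -
  note ty = f g h w a b c d
  show ?thesis
  proof (rule pushoutI[OF w])
    have 1: "w3 \<cdot> c1 \<cdot> g1 = c3 \<cdot> g3 \<cdot> g1" by (rule reassoc) (use ty nc in simp_all)
    have 2: "w4 \<cdot> c2 \<cdot> g2 = c3 \<cdot> g4 \<cdot> g2" by (rule reassoc) (use ty nc in simp_all)
    have 3: "w3 \<cdot> d1 \<cdot> h1 = d3 \<cdot> h3 \<cdot> h1" by (rule reassoc) (use ty nd in simp_all)
    have 4: "w4 \<cdot> d2 \<cdot> h2 = d3 \<cdot> h4 \<cdot> h2" by (rule reassoc) (use ty nd in simp_all)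
    show "w3 \<cdot> w1 = w4 \<cdot> w2"
    proof (rule pushout_eq[OF P0])
      show "(w3 \<cdot> w1) \<cdot> c0 = (w4 \<cdot> w2) \<cdot> c0"
        using 1 2 pushoutD(9)[OF B] ty by (simp add: assoc flip: nc(1,2))
      show "(w3 \<cdot> w1) \<cdot> d0 = (w4 \<cdot> w2) \<cdot> d0"
        using 3 4 pushoutD(9)[OF C] ty by (simp add: assoc flip: nd(1,2))
    qed (use ty in simp_all)
  next
    fix m n T assume m: "arr m P1 T" and n: "arr n P2 T" and mn: "m \<cdot> w1 = n \<cdot> w2"
    have 1: "m \<cdot> w1 \<cdot> c0 = n \<cdot> w2 \<cdot> c0" by (rule reassoc) (use ty m n mn in simp_all)
    have 2: "m \<cdot> w1 \<cdot> d0 = n \<cdot> w2 \<cdot> d0" by (rule reassoc) (use ty m n mn in simp_all)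
    have po_eq: "(m \<cdot> c1) \<cdot> g1 = (n \<cdot> c2) \<cdot> g2" using 1 ty m n nc(1,2) by (simp add: assoc)
    obtain \<beta> where \<beta>: "arr \<beta> (Tgt D g3) T" "\<beta> \<cdot> g3 = m \<cdot> c1" "\<beta> \<cdot> g4 = n \<cdot> c2"
      by (rule pushout_ex[OF B _ _ po_eq that]) (use ty m n in simp_all)
    have po_eq: "(m \<cdot> d1) \<cdot> h1 = (n \<cdot> d2) \<cdot> h2" using 2 ty m n nd(1,2) by (simp add: assoc)
    obtain \<gamma> where \<gamma>: "arr \<gamma> (Tgt D h3) T" "\<gamma> \<cdot> h3 = m \<cdot> d1" "\<gamma> \<cdot> h4 = n \<cdot> d2"
      by (rule pushout_ex[OF C _ _ po_eq that]) (use ty m n in simp_all)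
    have t\<beta>: "arr \<beta> B3 T" and t\<gamma>: "arr \<gamma> C3 T" using \<beta>(1) \<gamma>(1) ty by simp_all
    have po_eq: "\<beta> \<cdot> a3 = \<gamma> \<cdot> b3"
    proof (rule pushout_eq[OF A])
      have 3: "\<beta> \<cdot> g3 \<cdot> a1 = (m \<cdot> c1) \<cdot> a1" by (rule reassoc') (use ty t\<beta> \<beta>(2) in simp_all)
      have 4: "\<gamma> \<cdot> h3 \<cdot> b1 = (m \<cdot> d1) \<cdot> b1" by (rule reassoc') (use ty t\<gamma> \<gamma>(2) in simp_all)
      show "(\<beta> \<cdot> a3) \<cdot> f3 = (\<gamma> \<cdot> b3) \<cdot> f3"
        using ty t\<beta> t\<gamma> m 3 4 na nb pushoutD(9)[OF P1] by (simp add: assoc)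
      have 5: "\<beta> \<cdot> g4 \<cdot> a2 = (n \<cdot> c2) \<cdot> a2" by (rule reassoc') (use ty t\<beta> \<beta>(3) in simp_all)
      have 6: "\<gamma> \<cdot> h4 \<cdot> b2 = (n \<cdot> d2) \<cdot> b2" by (rule reassoc') (use ty t\<gamma> \<gamma>(3) in simp_all)
      show "(\<beta> \<cdot> a3) \<cdot> f4 = (\<gamma> \<cdot> b3) \<cdot> f4"
        using ty t\<beta> t\<gamma> n 5 6 na nb pushoutD(9)[OF P2] by (simp add: assoc)
    qed (use ty t\<beta> t\<gamma> in simp_all)
    obtain u where u: "arr u (Tgt D c3) T" "u \<cdot> c3 = \<beta>" "u \<cdot> d3 = \<gamma>"
      by (rule pushout_ex[OF P3 _ _ po_eq that]) (use ty t\<beta> t\<gamma> in simp_all)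
    have tu: "arr u P3 T" using u(1) ty by simp
    have r1: "u \<cdot> c3 \<cdot> g3 = \<beta> \<cdot> g3" "u \<cdot> c3 \<cdot> g4 = \<beta> \<cdot> g4"
      by (rule reassoc'; use ty tu u(2) in simp)+
    have r2: "u \<cdot> d3 \<cdot> h3 = \<gamma> \<cdot> h3" "u \<cdot> d3 \<cdot> h4 = \<gamma> \<cdot> h4"
      by (rule reassoc'; use ty tu u(3) in simp)+
    have "u \<cdot> w3 = m"
      by (rule pushout_eq[OF P1]) (use ty tu m r1 r2 \<beta>(2) \<gamma>(2) nc(3) nd(3) in \<open>simp_all add: assoc\<close>)
    moreover have "u \<cdot> w4 = n"
      by (rule pushout_eq[OF P2]) (use ty tu n r1 r2 \<beta>(3) \<gamma>(3) nc(4) nd(4) in \<open>simp_all add: assoc\<close>)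
    ultimately show "\<exists>u. arr u P3 T \<and> u \<cdot> w3 = m \<and> u \<cdot> w4 = n" using tu by blast
  next
    fix u v T assume u: "arr u P3 T" and v: "arr v P3 T" and uv: "u \<cdot> w3 = v \<cdot> w3" "u \<cdot> w4 = v \<cdot> w4"
    have r1: "u \<cdot> w3 \<cdot> c1 = v \<cdot> w3 \<cdot> c1" "u \<cdot> w3 \<cdot> d1 = v \<cdot> w3 \<cdot> d1"
      by (rule reassoc[OF uv(1)]; use ty u v in simp)+
    have r2: "u \<cdot> w4 \<cdot> c2 = v \<cdot> w4 \<cdot> c2" "u \<cdot> w4 \<cdot> d2 = v \<cdot> w4 \<cdot> d2"
      by (rule reassoc[OF uv(2)]; use ty u v in simp)+
    show "u = v"
    proof (rule pushout_eq[OF P3])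
      show "u \<cdot> c3 = v \<cdot> c3"
        by (rule pushout_eq[OF B]) (use ty u v r1 r2 nc(3,4) in \<open>simp_all add: assoc\<close>)
      show "u \<cdot> d3 = v \<cdot> d3"
        by (rule pushout_eq[OF C]) (use ty u v r1 r2 nd(3,4) in \<open>simp_all add: assoc\<close>)
    qed (use ty u v in simp_all)
  qed
qed

end

section \<open>Diagrams on the arrow poset of \<open>[q]\<close>\<close>

lemma Ar_iff: "(i, j) \<in> Ar q \<longleftrightarrow> i \<le> j \<and> j \<le> q"
  by (simp add: Ar_def)

lemma Ar_le_refl [simp]: "Ar_le x x"
  by (simp add: Ar_le_def)

lemma Ar_le_trans: "Ar_le x y \<Longrightarrow> Ar_le y z \<Longrightarrow> Ar_le x z"
  by (auto simp: Ar_le_def)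

lemma S_con_sel [simp]:
  "Obj (S_con q D) = S_obj q D" "Arr (S_con q D) = S_arr q D"
  "Src (S_con q D) = dia_src" "Tgt (S_con q D) = dia_tgt"
  by (simp_all add: S_con_def)

lemma S_con_Idn [simp]:
  "dia_src (Idn (S_con q D) X) = X" "dia_tgt (Idn (S_con q D) X) = X"
  "dia_cmp (Idn (S_con q D) X) x = (if x \<in> Ar q then Idn D (dia_ob X x) else VoidA)"
  by (simp_all add: S_con_def)

lemma S_con_Cmp [simp]:
  "dia_src (Cmp (S_con q D) g f) = dia_src f" "dia_tgt (Cmp (S_con q D) g f) = dia_tgt g"
  "dia_cmp (Cmp (S_con q D) g f) x = (if x \<in> Ar q then Cmp D (dia_cmp g x) (dia_cmp f x) else VoidA)"
  by (simp_all add: S_con_def)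

lemma S_objD:
  assumes "X \<in> S_obj q D"
  shows "X = DiaO (dia_ob X) (dia_ar X)" "is_diagram D (Ar q) Ar_le (dia_ob X) (dia_ar X)"
    "x \<notin> Ar q \<Longrightarrow> dia_ob X x = VoidO"
    "\<not> (x \<in> Ar q \<and> y \<in> Ar q \<and> Ar_le x y) \<Longrightarrow> dia_ar X x y = VoidA"
    "i \<le> q \<Longrightarrow> dia_ob X (i, i) = Zob D"
    "i \<le> j \<Longrightarrow> j \<le> k \<Longrightarrow> k \<le> q \<Longrightarrow> dia_ar X (i, j) (i, k) \<in> Cof D"
    "i \<le> j \<Longrightarrow> j \<le> k \<Longrightarrow> k \<le> q \<Longrightarrow>
      is_pushout D (dia_ar X (i, j) (i, k)) (dia_ar X (i, j) (j, j)) (dia_ar X (i, k) (j, k)) (dia_ar X (j, j) (j, k))"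
  using assms unfolding S_obj_def by (auto simp del: split_paired_All)

lemma S_objI:
  assumes "is_diagram D (Ar q) Ar_le A f"
    "\<And>x. x \<notin> Ar q \<Longrightarrow> A x = VoidO"
    "\<And>x y. \<not> (x \<in> Ar q \<and> y \<in> Ar q \<and> Ar_le x y) \<Longrightarrow> f x y = VoidA"
    "\<And>i. i \<le> q \<Longrightarrow> A (i, i) = Zob D"
    "\<And>i j k. i \<le> j \<Longrightarrow> j \<le> k \<Longrightarrow> k \<le> q \<Longrightarrow> f (i, j) (i, k) \<in> Cof D"
    "\<And>i j k. i \<le> j \<Longrightarrow> j \<le> k \<Longrightarrow> k \<le> q \<Longrightarrow>
      is_pushout D (f (i, j) (i, k)) (f (i, j) (j, j)) (f (i, k) (j, k)) (f (j, j) (j, k))"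
  shows "DiaO A f \<in> S_obj q D"
  unfolding S_obj_def using assms by blast

lemma S_arrD:
  assumes "t \<in> S_arr q D"
  shows "t = DiaA (dia_src t) (dia_tgt t) (dia_cmp t)" "dia_src t \<in> S_obj q D" "dia_tgt t \<in> S_obj q D"
    "x \<in> Ar q \<Longrightarrow> dia_cmp t x \<in> Arr D"
    "x \<in> Ar q \<Longrightarrow> Src D (dia_cmp t x) = dia_ob (dia_src t) x"
    "x \<in> Ar q \<Longrightarrow> Tgt D (dia_cmp t x) = dia_ob (dia_tgt t) x"
    "x \<notin> Ar q \<Longrightarrow> dia_cmp t x = VoidA"
    "x \<in> Ar q \<Longrightarrow> y \<in> Ar q \<Longrightarrow> Ar_le x y \<Longrightarrow>
      Cmp D (dia_cmp t y) (dia_ar (dia_src t) x y) = Cmp D (dia_ar (dia_tgt t) x y) (dia_cmp t x)"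
  using assms unfolding S_arr_def by (auto simp del: split_paired_All)

lemma S_arrI:
  assumes "X \<in> S_obj q D" "Y \<in> S_obj q D"
    "\<And>x. x \<in> Ar q \<Longrightarrow> t x \<in> Arr D \<and> Src D (t x) = dia_ob X x \<and> Tgt D (t x) = dia_ob Y x"
    "\<And>x. x \<notin> Ar q \<Longrightarrow> t x = VoidA"
    "\<And>x y. x \<in> Ar q \<Longrightarrow> y \<in> Ar q \<Longrightarrow> Ar_le x y \<Longrightarrow>
      Cmp D (t y) (dia_ar X x y) = Cmp D (dia_ar Y x y) (t x)"
  shows "DiaA X Y t \<in> S_arr q D"
  unfolding S_arr_def using assms by blast

text \<open>Off \<open>Ar q\<close> both arrows have the value \<open>VoidA\<close>, so the entries
  on \<open>Ar q\<close> decide.\<close>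

lemma S_arr_eqI:
  assumes "f \<in> S_arr q D" "g \<in> S_arr q D" "dia_src f = dia_src g" "dia_tgt f = dia_tgt g"
    "\<And>x. x \<in> Ar q \<Longrightarrow> dia_cmp f x = dia_cmp g x"
  shows "f = g"
proof -
  have "dia_cmp f = dia_cmp g"
  proof
    fix x show "dia_cmp f x = dia_cmp g x"
      using assms(5) S_arrD(7)[OF assms(1)] S_arrD(7)[OF assms(2)] by (cases "x \<in> Ar q") auto
  qed
  then show ?thesis using S_arrD(1)[OF assms(1)] S_arrD(1)[OF assms(2)] assms(3,4) by metis
qed

lemma S_weq_iff: "f \<in> Weq (S_con q D) \<longleftrightarrow> f \<in> S_arr q D \<and> (\<forall>x \<in> Ar q. dia_cmp f x \<in> Weq D)"
proof
  assume R: "f \<in> S_arr q D \<and> (\<forall>x \<in> Ar q. dia_cmp f x \<in> Weq D)"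
  then obtain X Y t where f: "f = DiaA X Y t" using S_arrD(1) by blast
  from R show "f \<in> Weq (S_con q D)"
    unfolding f by (simp add: S_con_def)
qed (auto simp: S_con_def)

locale dia_prewald = prewald D for D :: "('o, 'm) dia_wald" +
  fixes q :: nat
begin

notation cmp (infixr "\<cdot>" 75)

abbreviation SD where "SD \<equiv> S_con q D"

text \<open>The definition of \<open>S_con\<close> lets the comparison map end at the entry
  \<open>(i, k)\<close> of the target, \<open>rel_cof\<close> at the target of a transition arrow.
  For a diagram these are the same object.\<close>

lemma S_cof_iff: "f \<in> Cof SD \<longleftrightarrow> f \<in> S_arr q D \<and> (\<forall>i j k. i \<le> j \<and> j \<le> k \<and> k \<le> q \<longrightarrow>
    dia_cmp f (i, j) \<in> Cof D \<and>
    rel_cof (dia_ar (dia_src f) (i, j) (i, k)) (dia_cmp f (i, j)) (dia_ar (dia_tgt f) (i, j) (i, k)) (dia_cmp f (i, k)))"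
    (is "?L = ?R")
proof
  have tgt: "Tgt D (dia_ar (dia_tgt f) (i, j) (i, k)) = dia_ob (dia_tgt f) (i, k)"
    if "f \<in> S_arr q D" "i \<le> j" "j \<le> k" "k \<le> q" for i j k
    using S_objD(2)[OF S_arrD(3)[OF that(1)]] that by (simp add: is_diagram_def Ar_le_def Ar_iff)
  {
    assume L: ?L
    then have a: "f \<in> S_arr q D" by (auto simp: S_con_def)
    show ?R
    proof (intro conjI a allI impI)
      fix i j k assume ijk: "i \<le> j \<and> j \<le> k \<and> k \<le> q"
      show "dia_cmp f (i, j) \<in> Cof D" using L ijk by (auto simp: S_con_def)
      show "rel_cof (dia_ar (dia_src f) (i, j) (i, k)) (dia_cmp f (i, j)) (dia_ar (dia_tgt f) (i, j) (i, k)) (dia_cmp f (i, k))"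
        using L ijk tgt[OF a, of i j k] unfolding rel_cof_def by (auto simp: S_con_def)
    qed
  }
  {
    assume R: ?R
    then obtain X Y t where f: "f = DiaA X Y t" using S_arrD(1) by blast
    have "\<forall>i j k. i \<le> j \<and> j \<le> k \<and> k \<le> q \<longrightarrow>
                 t (i, j) \<in> Cof D \<and>
                 (\<exists>c d. is_pushout D (dia_ar X (i, j) (i, k)) (t (i, j)) c d \<and>
                    (\<exists>u \<in> Cof D. Src D u = Tgt D c \<and> Tgt D u = dia_ob Y (i, k) \<and>
                       Cmp D u c = t (i, k) \<and> Cmp D u d = dia_ar Y (i, j) (i, k)))"
      using R tgt unfolding rel_cof_def f by simp blast
    then show ?L using R unfolding f by (simp add: S_con_def) blast
  }
qed

lemma ob_obj: "X \<in> S_obj q D \<Longrightarrow> x \<in> Ar q \<Longrightarrow> dia_ob X x \<in> Obj D"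
  and ar_idn: "X \<in> S_obj q D \<Longrightarrow> x \<in> Ar q \<Longrightarrow> dia_ar X x x = Idn D (dia_ob X x)"
  and ar_arr: "X \<in> S_obj q D \<Longrightarrow> x \<in> Ar q \<Longrightarrow> y \<in> Ar q \<Longrightarrow> Ar_le x y \<Longrightarrow> arr (dia_ar X x y) (dia_ob X x) (dia_ob X y)"
  and ar_cmp: "X \<in> S_obj q D \<Longrightarrow> x \<in> Ar q \<Longrightarrow> y \<in> Ar q \<Longrightarrow> z \<in> Ar q \<Longrightarrow> Ar_le x y \<Longrightarrow> Ar_le y z \<Longrightarrow>
    dia_ar X y z \<cdot> dia_ar X x y = dia_ar X x z"
  using S_objD(2) unfolding is_diagram_def by blast+

lemma S_cmp_arr: "f \<in> S_arr q D \<Longrightarrow> x \<in> Ar q \<Longrightarrow> arr (dia_cmp f x) (dia_ob (dia_src f) x) (dia_ob (dia_tgt f) x)"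
  by (simp add: S_arrD)

lemma S_Idn: "X \<in> S_obj q D \<Longrightarrow> Idn SD X \<in> S_arr q D"
  unfolding S_con_def using ob_obj ar_arr by (auto intro!: S_arrI)

lemma S_Cmp:
  assumes f: "f \<in> S_arr q D" and g: "g \<in> S_arr q D" and fg: "dia_src g = dia_tgt f"
  shows "Cmp SD g f \<in> S_arr q D"
proof -
  note tf = S_arrD(2-6)[OF f] and tg = S_arrD(2-6)[OF g]
  have "DiaA (dia_src f) (dia_tgt g) (\<lambda>x. if x \<in> Ar q then dia_cmp g x \<cdot> dia_cmp f x else VoidA) \<in> S_arr q D"
  proof (rule S_arrI)
    fix x y assume xy: "x \<in> Ar q" "y \<in> Ar q" "Ar_le x y"
    note ts = ar_arr[OF tf(1) xy] ar_arr[OF tf(2) xy] ar_arr[OF tg(2) xy] S_cmp_arr[OF f xy(1)]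
      S_cmp_arr[OF f xy(2)] S_cmp_arr[OF g xy(1), unfolded fg] S_cmp_arr[OF g xy(2), unfolded fg]
    have "(dia_cmp g y \<cdot> dia_cmp f y) \<cdot> dia_ar (dia_src f) x y = dia_cmp g y \<cdot> dia_ar (dia_tgt f) x y \<cdot> dia_cmp f x"
      using ts S_arrD(8)[OF f xy] by (simp add: assoc)
    also have "\<dots> = dia_ar (dia_tgt g) x y \<cdot> dia_cmp g x \<cdot> dia_cmp f x"
      by (rule reassoc) (use ts S_arrD(8)[OF g xy] fg in simp_all)
    finally show "(if y \<in> Ar q then dia_cmp g y \<cdot> dia_cmp f y else VoidA) \<cdot> dia_ar (dia_src f) x y
        = dia_ar (dia_tgt g) x y \<cdot> (if x \<in> Ar q then dia_cmp g x \<cdot> dia_cmp f x else VoidA)"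
      using xy ts by (simp add: assoc)
  qed (use tf tg fg in simp_all)
  then show ?thesis by (simp add: S_con_def)
qed

lemma S_category: "is_category SD"
  unfolding is_category_def S_con_sel
proof (intro conjI ballI impI)
  fix f assume f: "f \<in> S_arr q D"
  note tf = S_arrD(2-6)[OF f]
  show "Cmp SD f (Idn SD (dia_src f)) = f" "Cmp SD (Idn SD (dia_tgt f)) f = f"
    by (rule S_arr_eqI[OF S_Cmp]; use f tf S_Idn in simp)+
next
  fix f g h assume fgh: "f \<in> S_arr q D" "g \<in> S_arr q D" "h \<in> S_arr q D" "dia_src g = dia_tgt f \<and> dia_src h = dia_tgt g"
  show "Cmp SD h (Cmp SD g f) = Cmp SD (Cmp SD h g) f"
    by (rule S_arr_eqI[of _ q D]) (use fgh in \<open>simp_all add: S_Cmp S_arrD assoc\<close>)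
qed (simp_all add: S_Idn S_Cmp S_arrD)

text \<open>The mediating arrows of the entries form a natural transformation: both sides of a
  naturality square from \<open>x\<close> to \<open>y\<close> start at the pushout at
  \<open>x\<close>, so they are compared on its two legs.\<close>

lemma pointwise_pushout:
  assumes abcd: "a \<in> S_arr q D" "b \<in> S_arr q D" "c \<in> S_arr q D" "d \<in> S_arr q D"
    and ty: "dia_src b = dia_src a" "dia_src c = dia_tgt a" "dia_src d = dia_tgt b" "dia_tgt d = dia_tgt c"
    and po: "\<And>x. x \<in> Ar q \<Longrightarrow> is_pushout D (dia_cmp a x) (dia_cmp b x) (dia_cmp c x) (dia_cmp d x)"
  shows "is_pushout SD a b c d"
proof -
  interpret S: cat SD using S_category by unfold_locales
  note sc = S_cmp_arr[OF abcd(1)] S_cmp_arr[OF abcd(2), unfolded ty(1)]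
    S_cmp_arr[OF abcd(3), unfolded ty(2)] S_cmp_arr[OF abcd(4), unfolded ty(3,4)]
  have P: "dia_tgt c \<in> S_obj q D" using abcd S_arrD by blast
  show ?thesis
  proof (rule S.pushoutI[of a _ _ b _ c _ d])
    show "Cmp SD c a = Cmp SD d b"
      by (rule S_arr_eqI[OF S_Cmp S_Cmp]) (use abcd ty pushoutD(9)[OF po] in simp_all)
  next
    fix c' d' T assume c': "S.arr c' (dia_tgt a) T" and d': "S.arr d' (dia_tgt b) T"
      and eq: "Cmp SD c' a = Cmp SD d' b"
    have ca: "c' \<in> S_arr q D" "d' \<in> S_arr q D" using c' d' by simp_all
    have T: "T \<in> S_obj q D" using c' S_arrD(3) by auto
    have c'': "x \<in> Ar q \<Longrightarrow> arr (dia_cmp c' x) (dia_ob (dia_tgt a) x) (dia_ob T x)"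
      and d'': "x \<in> Ar q \<Longrightarrow> arr (dia_cmp d' x) (dia_ob (dia_tgt b) x) (dia_ob T x)" for x
      using S_cmp_arr[OF ca(1)] S_cmp_arr[OF ca(2)] c' d' by simp_all
    have "\<exists>u. arr u (dia_ob (dia_tgt c) x) (dia_ob T x) \<and> u \<cdot> dia_cmp c x = dia_cmp c' x \<and> u \<cdot> dia_cmp d x = dia_cmp d' x"
      if x: "x \<in> Ar q" for x
    proof -
      have po_eq: "dia_cmp c' x \<cdot> dia_cmp a x = dia_cmp d' x \<cdot> dia_cmp b x"
        using arg_cong[OF eq, of "\<lambda>f. dia_cmp f x"] x by simp
      obtain u where "arr u (Tgt D (dia_cmp c x)) (dia_ob T x)" "u \<cdot> dia_cmp c x = dia_cmp c' x" "u \<cdot> dia_cmp d x = dia_cmp d' x"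
        by (rule pushout_ex[OF po[OF x] _ _ po_eq that]) (use c'' d'' sc x in simp_all)
      then show ?thesis using sc x by (intro exI[of _ u]) simp
    qed
    then obtain u where u: "\<And>x. x \<in> Ar q \<Longrightarrow> arr (u x) (dia_ob (dia_tgt c) x) (dia_ob T x) \<and>
        u x \<cdot> dia_cmp c x = dia_cmp c' x \<and> u x \<cdot> dia_cmp d x = dia_cmp d' x"
      by metis
    define U where "U = DiaA (dia_tgt c) T (\<lambda>x. if x \<in> Ar q then u x else VoidA)"
    have "U \<in> S_arr q D"
      unfolding U_def
    proof (rule S_arrI)
      fix x y assume xy: "x \<in> Ar q" "y \<in> Ar q" "Ar_le x y"
      note ts = ar_arr[OF P xy] ar_arr[OF T xy] u[OF xy(1), THEN conjunct1] u[OF xy(2), THEN conjunct1]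
        sc[OF xy(1)] sc[OF xy(2)]
      have "u y \<cdot> dia_ar (dia_tgt c) x y = dia_ar T x y \<cdot> u x"
      proof (rule pushout_eq[OF po[OF xy(1)]])
        have tc: "arr (dia_ar (dia_tgt a) x y) (dia_ob (dia_tgt a) x) (dia_ob (dia_tgt a) y)"
          using ar_arr[OF S_arrD(3)[OF abcd(1)] xy] .
        have "(u y \<cdot> dia_ar (dia_tgt c) x y) \<cdot> dia_cmp c x = u y \<cdot> dia_cmp c y \<cdot> dia_ar (dia_tgt a) x y"
          using S_arrD(8)[OF abcd(3) xy] ts ty by (simp add: assoc)
        also have "\<dots> = dia_cmp c' y \<cdot> dia_ar (dia_tgt a) x y"
          by (rule reassoc') (use u[OF xy(2)] ts tc in simp_all)
        also have "\<dots> = dia_ar T x y \<cdot> dia_cmp c' x" using S_arrD(8)[OF ca(1) xy] c' by simp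
        also have "\<dots> = (dia_ar T x y \<cdot> u x) \<cdot> dia_cmp c x"
          using u[OF xy(1)] ts by (simp add: assoc)
        finally show "(u y \<cdot> dia_ar (dia_tgt c) x y) \<cdot> dia_cmp c x = (dia_ar T x y \<cdot> u x) \<cdot> dia_cmp c x" .
        have td: "arr (dia_ar (dia_tgt b) x y) (dia_ob (dia_tgt b) x) (dia_ob (dia_tgt b) y)"
          using ar_arr[OF S_arrD(3)[OF abcd(2)] xy] .
        have "(u y \<cdot> dia_ar (dia_tgt c) x y) \<cdot> dia_cmp d x = u y \<cdot> dia_cmp d y \<cdot> dia_ar (dia_tgt b) x y"
          using S_arrD(8)[OF abcd(4) xy] ts ty by (simp add: assoc)
        also have "\<dots> = dia_cmp d' y \<cdot> dia_ar (dia_tgt b) x y"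
          by (rule reassoc') (use u[OF xy(2)] ts td in simp_all)
        also have "\<dots> = dia_ar T x y \<cdot> dia_cmp d' x" using S_arrD(8)[OF ca(2) xy] d' by simp
        also have "\<dots> = (dia_ar T x y \<cdot> u x) \<cdot> dia_cmp d x"
          using u[OF xy(1)] ts by (simp add: assoc)
        finally show "(u y \<cdot> dia_ar (dia_tgt c) x y) \<cdot> dia_cmp d x = (dia_ar T x y \<cdot> u x) \<cdot> dia_cmp d x" .
      qed (use ts in simp_all)
      then show "(if y \<in> Ar q then u y else VoidA) \<cdot> dia_ar (dia_tgt c) x y = dia_ar T x y \<cdot> (if x \<in> Ar q then u x else VoidA)"
        using xy by simp
    qed (use u P T in simp_all)
    moreover have "Cmp SD U c = c'"
      by (rule S_arr_eqI[OF S_Cmp[OF abcd(3) calculation] ca(1)]) (use u c' ty in \<open>simp_all add: U_def\<close>)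
    moreover have "Cmp SD U d = d'"
      by (rule S_arr_eqI[OF S_Cmp[OF abcd(4) calculation(1)] ca(2)]) (use u d' ty in \<open>simp_all add: U_def\<close>)
    ultimately show "\<exists>u. S.arr u (dia_tgt c) T \<and> Cmp SD u c = c' \<and> Cmp SD u d = d'"
      by (intro exI[of _ U]) (simp add: U_def)
  next
    fix u v T assume u: "S.arr u (dia_tgt c) T" and v: "S.arr v (dia_tgt c) T"
      and eq: "Cmp SD u c = Cmp SD v c" "Cmp SD u d = Cmp SD v d"
    have ua: "u \<in> S_arr q D" "v \<in> S_arr q D" using u v by simp_all
    show "u = v"
    proof (rule S_arr_eqI[OF ua])
      fix x assume x: "x \<in> Ar q"
      have uv: "dia_cmp u x \<cdot> dia_cmp c x = dia_cmp v x \<cdot> dia_cmp c x" "dia_cmp u x \<cdot> dia_cmp d x = dia_cmp v x \<cdot> dia_cmp d x"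
        using arg_cong[OF eq(1), of "\<lambda>f. dia_cmp f x"] arg_cong[OF eq(2), of "\<lambda>f. dia_cmp f x"] x by simp_all
      show "dia_cmp u x = dia_cmp v x"
        by (rule pushout_eq[OF po[OF x] _ _ uv, of "dia_ob T x"])
          (use S_cmp_arr[OF ua(1) x] S_cmp_arr[OF ua(2) x] sc[OF x] u v in simp_all)
    qed (use u v in simp_all)
  qed (use abcd ty in simp_all)
qed

section \<open>Isomorphisms, cofibrations and pushouts of diagrams\<close>

lemma S_iso:
  assumes f: "iso_arrow SD f" and x: "x \<in> Ar q"
  shows "iso_arrow D (dia_cmp f x)"
proof -
  interpret S: cat SD using S_category by unfold_locales
  have fa: "f \<in> S_arr q D" using f by (simp add: iso_arrow_def)
  obtain g where g: "S.arr g (dia_tgt f) (dia_src f)"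
    "Cmp SD g f = Idn SD (dia_src f)" "Cmp SD f g = Idn SD (dia_tgt f)"
    by (rule S.isoE[OF f, of "dia_src f" "dia_tgt f"]) (use fa in simp_all)
  have gf: "dia_cmp g x \<cdot> dia_cmp f x = Idn D (dia_ob (dia_src f) x)"
    using arg_cong[OF g(2), of "\<lambda>f. dia_cmp f x"] x by simp
  have fg: "dia_cmp f x \<cdot> dia_cmp g x = Idn D (dia_ob (dia_tgt f) x)"
    using arg_cong[OF g(3), of "\<lambda>f. dia_cmp f x"] x by simp
  show ?thesis
    by (rule isoI[OF S_cmp_arr[OF fa x] _ gf fg]) (use S_cmp_arr[of g x] g(1) x in simp)
qed

lemma S_iso_cof:
  assumes f: "iso_arrow SD f"
  shows "f \<in> Cof SD"
  unfolding S_cof_iff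
proof (intro conjI allI impI)
  show fa: "f \<in> S_arr q D" using f by (simp add: iso_arrow_def)
  fix i j k assume ijk: "i \<le> j \<and> j \<le> k \<and> k \<le> q"
  then have x: "(i, j) \<in> Ar q" "(i, k) \<in> Ar q" "Ar_le (i, j) (i, k)" by (auto simp: Ar_iff Ar_le_def)
  show "dia_cmp f (i, j) \<in> Cof D" by (rule iso_cof[OF S_iso[OF f x(1)]])
  show "rel_cof (dia_ar (dia_src f) (i, j) (i, k)) (dia_cmp f (i, j)) (dia_ar (dia_tgt f) (i, j) (i, k)) (dia_cmp f (i, k))"
    by (rule rel_cof_iso[OF ar_arr[OF _ x] S_cmp_arr[OF fa x(1)] S_iso[OF f x(1)] S_cmp_arr[OF fa x(2)] S_iso[OF f x(2)]
          ar_arr[OF _ x] S_arrD(8)[OF fa x]]) (use S_arrD[OF fa] in simp_all)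
qed

text \<open>For each \<open>i\<close>, \<open>j\<close>, \<open>k\<close> this is
  \<open>rel_cof_trans\<close>; the cofibration that it asks for is a transition arrow of the source
  of \<open>f\<close>, by the conditions on objects.\<close>

lemma S_cof_Cmp:
  assumes f: "f \<in> Cof SD" and g: "g \<in> Cof SD" and fg: "dia_src g = dia_tgt f"
  shows "Cmp SD g f \<in> Cof SD"
  unfolding S_cof_iff
proof (intro conjI allI impI)
  have fa: "f \<in> S_arr q D" and ga: "g \<in> S_arr q D" using f g by (simp_all add: S_cof_iff)
  show "Cmp SD g f \<in> S_arr q D" by (rule S_Cmp[OF fa ga fg])
  fix i j k assume ijk: "i \<le> j \<and> j \<le> k \<and> k \<le> q"
  then have x: "(i, j) \<in> Ar q" "(i, k) \<in> Ar q" by (auto simp: Ar_iff)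
  note F = f[unfolded S_cof_iff, THEN conjunct2, rule_format, OF ijk]
    and G = g[unfolded S_cof_iff, THEN conjunct2, rule_format, OF ijk, unfolded fg]
  show "dia_cmp (Cmp SD g f) (i, j) \<in> Cof D"
    using cof_cmp[OF conjunct1[OF F] conjunct1[OF G]] x S_cmp_arr[OF fa x(1)] S_cmp_arr[OF ga x(1)] fg by simp
  show "rel_cof (dia_ar (dia_src (Cmp SD g f)) (i, j) (i, k)) (dia_cmp (Cmp SD g f) (i, j))
    (dia_ar (dia_tgt (Cmp SD g f)) (i, j) (i, k)) (dia_cmp (Cmp SD g f) (i, k))"
    using rel_cof_trans[OF conjunct2[OF F] conjunct2[OF G] S_objD(6)[OF S_arrD(2)[OF fa]]] x ijk by simp
qed

lemma S_weq_Cmp: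
  assumes f: "f \<in> Weq SD" and g: "g \<in> Weq SD" and fg: "dia_src g = dia_tgt f"
  shows "Cmp SD g f \<in> Weq SD"
  using f g fg S_Cmp[of f g] S_cmp_arr weq_cmp by (auto simp: S_weq_iff simp del: split_paired_All)

text \<open>The entrywise pushouts \<open>P x\<close> are assembled into an object. Their universal
  properties give the transition arrows \<open>w\<close>, relative cofibrancy of \<open>a\<close> is
  passed on to the new arrow by \<open>rel_cof_pushout\<close>, and \<open>pushout_cube\<close>
  provides the pushout squares.\<close>

lemma S_pushout_ex:
  assumes a: "a \<in> Cof SD" and b: "b \<in> S_arr q D" and ab: "dia_src b = dia_src a"
  obtains c d where "c \<in> S_arr q D" "d \<in> Cof SD" "dia_src c = dia_tgt a" "dia_src d = dia_tgt b" "dia_tgt d = dia_tgt c"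
    "\<forall>x \<in> Ar q. is_pushout D (dia_cmp a x) (dia_cmp b x) (dia_cmp c x) (dia_cmp d x)"
proof -
  have aa: "a \<in> S_arr q D" using a by (simp add: S_cof_iff)
  have aC: "dia_cmp a x \<in> Cof D" if "x \<in> Ar q" for x
    using a that by (cases x) (auto simp: S_cof_iff Ar_iff)
  define A B C t s where "A = dia_src a" and "B = dia_tgt a" and "C = dia_tgt b"
    and "t = dia_cmp a" and "s = dia_cmp b"
  have obs: "A \<in> S_obj q D" "B \<in> S_obj q D" "C \<in> S_obj q D"
    using S_arrD(2,3)[OF aa] S_arrD(3)[OF b] by (simp_all add: A_def B_def C_def)
  note tt = S_cmp_arr[OF aa, folded A_def B_def t_def]
    and ts = S_cmp_arr[OF b, unfolded ab, folded A_def C_def s_def]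
  note nt = S_arrD(8)[OF aa, folded A_def B_def t_def]
    and ns = S_arrD(8)[OF b, unfolded ab, folded A_def C_def s_def]
  \<comment> \<open>A diagonal entry of an object is \<open>Zob D\<close> and not just some zero
    object. There \<open>t x\<close> and \<open>s x\<close> are identities of \<open>Zob D\<close>,
    and the pushout is taken with identities as well.\<close>
  have "\<exists>c d. is_pushout D (t x) (s x) c d \<and> (fst x = snd x \<longrightarrow> Tgt D c = Zob D)" if x: "x \<in> Ar q" for x
  proof (cases "fst x = snd x")
    case True
    then obtain i where i: "x = (i, i)" "i \<le> q" using x by (cases x) (auto simp: Ar_iff)
    have z: "dia_ob A x = Zob D" "dia_ob B x = Zob D" "dia_ob C x = Zob D"
      using S_objD(5) obs i by blast+
    have "t x = Idn D (Zob D)" "s x = Idn D (Zob D)"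
      by (rule from_zero_unique[of _ "Zob D"]; use tt[OF x] ts[OF x] z zob in simp)+
    then have "is_pushout D (t x) (s x) (Idn D (Zob D)) (Idn D (Zob D))"
      by (intro pushout_iso[of _ "Zob D" "Zob D" _ "Zob D" _ "Zob D"]) (use zob iso_idn in simp_all)
    then show ?thesis using zob by (intro exI[of _ "Idn D (Zob D)"]) simp
  next
    case False
    then show ?thesis using po_ex[OF aC[OF x], of "s x"] tt[OF x] ts[OF x] by (simp add: t_def)
  qed
  then obtain p r where po: "\<And>x. x \<in> Ar q \<Longrightarrow> is_pushout D (t x) (s x) (p x) (r x)"
    and diag: "\<And>x. x \<in> Ar q \<Longrightarrow> fst x = snd x \<Longrightarrow> Tgt D (p x) = Zob D"
    by metis
  define P where "P = (\<lambda>x. Tgt D (p x))"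
  have tp: "arr (p x) (dia_ob B x) (P x)" and tr: "arr (r x) (dia_ob C x) (P x)" if "x \<in> Ar q" for x
    using pushoutD(3,4,6-8)[OF po[OF that]] tt[OF that] ts[OF that] by (simp_all add: P_def)
  have "\<exists>w. arr w (P x) (P y) \<and> w \<cdot> p x = p y \<cdot> dia_ar B x y \<and> w \<cdot> r x = r y \<cdot> dia_ar C x y"
    if xy: "x \<in> Ar q" "y \<in> Ar q" "Ar_le x y" for x y
  proof -
    note ty = ar_arr[OF obs(1) xy] ar_arr[OF obs(2) xy] ar_arr[OF obs(3) xy] tt[OF xy(1)] tt[OF xy(2)]
      ts[OF xy(1)] ts[OF xy(2)] tp[OF xy(1)] tp[OF xy(2)] tr[OF xy(1)] tr[OF xy(2)]
    have "p y \<cdot> t y \<cdot> dia_ar A x y = r y \<cdot> s y \<cdot> dia_ar A x y"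
      by (rule reassoc) (use ty pushoutD(9)[OF po[OF xy(2)]] in simp_all)
    then have po_eq: "(p y \<cdot> dia_ar B x y) \<cdot> t x = (r y \<cdot> dia_ar C x y) \<cdot> s x"
      using ty nt[OF xy] ns[OF xy] by (simp add: assoc)
    obtain w where "arr w (Tgt D (p x)) (P y)" "w \<cdot> p x = p y \<cdot> dia_ar B x y" "w \<cdot> r x = r y \<cdot> dia_ar C x y"
      by (rule pushout_ex[OF po[OF xy(1)] _ _ po_eq that]) (use ty in simp_all)
    then show ?thesis unfolding P_def by blast
  qed
  then obtain w where w: "\<And>x y. x \<in> Ar q \<Longrightarrow> y \<in> Ar q \<Longrightarrow> Ar_le x y \<Longrightarrow>
      arr (w x y) (P x) (P y) \<and> w x y \<cdot> p x = p y \<cdot> dia_ar B x y \<and> w x y \<cdot> r x = r y \<cdot> dia_ar C x y"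
    by metis
  have weq: "u = v" if "x \<in> Ar q" "arr u (P x) T" "arr v (P x) T" "u \<cdot> p x = v \<cdot> p x" "u \<cdot> r x = v \<cdot> r x" for u v x T
    using pushout_eq[OF po[OF that(1)] _ _ that(4,5)] that(2,3) by (simp add: P_def)
  define W where "W = (\<lambda>x y. if x \<in> Ar q \<and> y \<in> Ar q \<and> Ar_le x y then w x y else VoidA)"
  have W: "arr (W x y) (P x) (P y)" "W x y \<cdot> p x = p y \<cdot> dia_ar B x y" "W x y \<cdot> r x = r y \<cdot> dia_ar C x y"
    if "x \<in> Ar q" "y \<in> Ar q" "Ar_le x y" for x y
    using w[OF that] that by (simp_all add: W_def)
  \<comment> \<open>One application yields two things: the arrows from \<open>(i, j)\<close> to
    \<open>(i, k)\<close> in the new diagram are cofibrations, and the arrow from \<open>C\<close>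
    into it satisfies the relative condition.\<close>
  have rc: "rel_cof (dia_ar C (i, j) (i, k)) (r (i, j)) (W (i, j) (i, k)) (r (i, k)) \<and> W (i, j) (i, k) \<in> Cof D"
    if ijk: "i \<le> j" "j \<le> k" "k \<le> q" for i j k
  proof -
    have x: "(i, j) \<in> Ar q" "(i, k) \<in> Ar q" "Ar_le (i, j) (i, k)" using ijk by (auto simp: Ar_iff Ar_le_def)
    have 1: "rel_cof (dia_ar A (i, j) (i, k)) (t (i, j)) (dia_ar B (i, j) (i, k)) (t (i, k))"
      using a ijk unfolding S_cof_iff A_def B_def t_def by blast
    show ?thesis
      by (rule rel_cof_pushout[OF 1 S_objD(6)[OF obs(3) ijk] po[OF x(1)] po[OF x(2)] ar_arr[OF obs(1) x] tt[OF x(1)]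
        tt[OF x(2)] ar_arr[OF obs(2) x] ts[OF x(1)] ts[OF x(2)] ar_arr[OF obs(3) x]
        tp[OF x(1)] tr[OF x(1)] tp[OF x(2)] tr[OF x(2)] W(1)[OF x] ns[OF x] W(2,3)[OF x]])
  qed
  define Q where "Q = DiaO (\<lambda>x. if x \<in> Ar q then P x else VoidO) W"
  have Q_sel: "dia_ob Q x = (if x \<in> Ar q then P x else VoidO)" "dia_ar Q = W" for x
    by (simp_all add: Q_def)
  have Q: "Q \<in> S_obj q D"
    unfolding Q_def
  proof (rule S_objI)
    show "is_diagram D (Ar q) Ar_le (\<lambda>x. if x \<in> Ar q then P x else VoidO) W"
      unfolding is_diagram_def
    proof (intro conjI ballI impI)
      fix x assume x: "x \<in> Ar q"
      note xx = x x Ar_le_refl[of x]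
      show "(if x \<in> Ar q then P x else VoidO) \<in> Obj D" using x tp[OF x] tgt_obj[of "p x"] by simp
      then have Px: "P x \<in> Obj D" using x by simp
      have "W x x = Idn D (P x)"
        by (rule weq[OF x, of _ "P x"])
          (use Px W[OF xx] tp[OF x] tr[OF x] ar_idn[OF obs(2) x] ar_idn[OF obs(3) x] in simp_all)
      then show "W x x = Idn D (if x \<in> Ar q then P x else VoidO)" using x by simp
    next
      fix x y z assume x: "x \<in> Ar q" and y: "y \<in> Ar q" and z: "z \<in> Ar q" and le: "Ar_le x y \<and> Ar_le y z"
      have le': "Ar_le x y" "Ar_le y z" "Ar_le x z" using le Ar_le_trans by blast+
      note ty = W(1)[OF x y le'(1)] W(1)[OF y z le'(2)] W(1)[OF x z le'(3)] tp[OF x] tp[OF y] tp[OF z] tr[OF x] tr[OF y] tr[OF z]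
         ar_arr[OF obs(2) x y le'(1)] ar_arr[OF obs(2) y z le'(2)] ar_arr[OF obs(3) x y le'(1)] ar_arr[OF obs(3) y z le'(2)]
      have "W y z \<cdot> p y \<cdot> dia_ar B x y = p z \<cdot> dia_ar B y z \<cdot> dia_ar B x y"
        by (rule reassoc) (use W(2)[OF y z le'(2)] ty in simp_all)
      then have 1: "(W y z \<cdot> W x y) \<cdot> p x = W x z \<cdot> p x"
        using W(2)[OF x y le'(1)] W(2)[OF x z le'(3)] ty ar_cmp[OF obs(2) x y z le'(1,2)] by (simp add: assoc)
      have "W y z \<cdot> r y \<cdot> dia_ar C x y = r z \<cdot> dia_ar C y z \<cdot> dia_ar C x y"
        by (rule reassoc) (use W(3)[OF y z le'(2)] ty in simp_all)
      then have 2: "(W y z \<cdot> W x y) \<cdot> r x = W x z \<cdot> r x"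
        using W(3)[OF x y le'(1)] W(3)[OF x z le'(3)] ty ar_cmp[OF obs(3) x y z le'(1,2)] by (simp add: assoc)
      show "W y z \<cdot> W x y = W x z"
        by (rule weq[OF x _ _ 1 2, of "P z"]) (use ty in simp_all)
    qed (use W in simp_all)
    show "(if (i, i) \<in> Ar q then P (i, i) else VoidO) = Zob D" if "i \<le> q" for i
      using that diag[of "(i, i)"] by (simp add: P_def Ar_iff)
    fix i j k assume ijk: "i \<le> j" "j \<le> k" "k \<le> q"
    show "W (i, j) (i, k) \<in> Cof D" using rc[OF ijk] by blast
    have x: "(i, j) \<in> Ar q" "(i, k) \<in> Ar q" "(j, j) \<in> Ar q" "(j, k) \<in> Ar q"
      using ijk by (auto simp: Ar_iff)
    have l: "Ar_le (i, j) (i, k)" "Ar_le (i, j) (j, j)" "Ar_le (i, k) (j, k)" "Ar_le (j, j) (j, k)"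
      using ijk by (auto simp: Ar_le_def)
    note xl = x(1,2) l(1) and xl2 = x(1,3) l(2) and xl3 = x(2,4) l(3) and xl4 = x(3,4) l(4)
    \<comment> \<open>The corners of the cube are the indices \<open>(i, j)\<close>,
      \<open>(i, k)\<close>, \<open>(j, j)\<close>, \<open>(j, k)\<close>. The squares of
      \<open>A\<close>, \<open>B\<close> and \<open>C\<close> on these indices are pushouts since
      the three are objects.\<close>
    show "is_pushout D (W (i, j) (i, k)) (W (i, j) (j, j)) (W (i, k) (j, k)) (W (j, j) (j, k))"
      by (rule pushout_cube[OF S_objD(7)[OF obs(1) ijk] S_objD(7)[OF obs(2) ijk] S_objD(7)[OF obs(3) ijk]
          po[OF x(1)] po[OF x(2)] po[OF x(3)] po[OF x(4)]
          ar_arr[OF obs(1) xl] ar_arr[OF obs(1) xl2] ar_arr[OF obs(1) xl3] ar_arr[OF obs(1) xl4]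
          ar_arr[OF obs(2) xl] ar_arr[OF obs(2) xl2] ar_arr[OF obs(2) xl3] ar_arr[OF obs(2) xl4]
          ar_arr[OF obs(3) xl] ar_arr[OF obs(3) xl2] ar_arr[OF obs(3) xl3] ar_arr[OF obs(3) xl4]
          W(1)[OF xl] W(1)[OF xl2] W(1)[OF xl3] W(1)[OF xl4]
          tt[OF x(1)] tt[OF x(2)] tt[OF x(3)] tt[OF x(4)] ts[OF x(1)] ts[OF x(2)] ts[OF x(3)] ts[OF x(4)]
          tp[OF x(1)] tp[OF x(2)] tp[OF x(3)] tp[OF x(4)] tr[OF x(1)] tr[OF x(2)] tr[OF x(3)] tr[OF x(4)]
          nt[OF xl3] nt[OF xl4] ns[OF xl3] ns[OF xl4]
          W(2)[OF xl, symmetric] W(2)[OF xl2, symmetric] W(2)[OF xl3, symmetric] W(2)[OF xl4, symmetric]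
          W(3)[OF xl, symmetric] W(3)[OF xl2, symmetric] W(3)[OF xl3, symmetric] W(3)[OF xl4, symmetric]])
  qed (auto simp: W_def)
  define c d where "c = DiaA B Q (\<lambda>x. if x \<in> Ar q then p x else VoidA)"
    and "d = DiaA C Q (\<lambda>x. if x \<in> Ar q then r x else VoidA)"
  have c: "c \<in> S_arr q D" unfolding c_def
    by (rule S_arrI) (use obs Q tp W in \<open>simp_all add: Q_sel\<close>)
  have da: "d \<in> S_arr q D" unfolding d_def
    by (rule S_arrI) (use obs Q tr W in \<open>simp_all add: Q_sel\<close>)
  have d: "d \<in> Cof SD"
    unfolding S_cof_iff
  proof (intro conjI allI impI da)
    fix i j k assume ijk: "i \<le> j \<and> j \<le> k \<and> k \<le> q"
    then have x: "(i, j) \<in> Ar q" "(i, k) \<in> Ar q" by (auto simp: Ar_iff)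
    show "dia_cmp d (i, j) \<in> Cof D" using po_cof[OF _ po[OF x(1)]] aC[OF x(1)] x by (simp add: d_def t_def)
    show "rel_cof (dia_ar (dia_src d) (i, j) (i, k)) (dia_cmp d (i, j)) (dia_ar (dia_tgt d) (i, j) (i, k)) (dia_cmp d (i, k))"
      using rc ijk x by (simp add: d_def Q_sel)
  qed
  show ?thesis
    by (rule that[OF c d]) (use po in \<open>simp_all add: c_def d_def A_def B_def C_def t_def s_def\<close>)
qed

lemma Zob_S_con [simp]:
  "dia_ob (Zob SD) x = (if x \<in> Ar q then Zob D else VoidO)"
  "dia_ar (Zob SD) x y = (if x \<in> Ar q \<and> y \<in> Ar q \<and> Ar_le x y then Idn D (Zob D) else VoidA)"
  by (simp_all add: S_con_def)

lemma S_zob: "Zob SD \<in> S_obj q D"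
proof -
  have "is_pushout D (Idn D (Zob D)) (Idn D (Zob D)) (Idn D (Zob D)) (Idn D (Zob D))"
    by (rule pushout_iso[of _ "Zob D" "Zob D" _ "Zob D" _ "Zob D"]) (use zob iso_idn in simp_all)
  then have "DiaO (dia_ob (Zob SD)) (dia_ar (Zob SD)) \<in> S_obj q D"
    by (intro S_objI) (use zob idn_cof in \<open>auto simp: is_diagram_def Ar_iff Ar_le_def\<close>)
  then show ?thesis by (simp add: S_con_def)
qed

lemma S_from_zero: "A \<in> S_obj q D \<Longrightarrow> \<exists>f. f \<in> S_arr q D \<and> dia_src f = Zob SD \<and> dia_tgt f = A"
  and S_to_zero: "A \<in> S_obj q D \<Longrightarrow> \<exists>f. f \<in> S_arr q D \<and> dia_src f = A \<and> dia_tgt f = Zob SD"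
proof -
  assume A: "A \<in> S_obj q D"
  have "\<forall>x \<in> Ar q. \<exists>f. arr f (Zob D) (dia_ob A x)" using from_zero[OF ob_obj[OF A]] by simp
  then obtain f where f: "\<And>x. x \<in> Ar q \<Longrightarrow> arr (f x) (Zob D) (dia_ob A x)" using bchoice by metis
  have "DiaA (Zob SD) A (\<lambda>x. if x \<in> Ar q then f x else VoidA) \<in> S_arr q D"
  proof (rule S_arrI[OF S_zob A])
    fix x y assume xy: "x \<in> Ar q" "y \<in> Ar q" "Ar_le x y"
    note ty = f[OF xy(1)] f[OF xy(2)] ar_arr[OF A xy]
    show "(if y \<in> Ar q then f y else VoidA) \<cdot> dia_ar (Zob SD) x y = dia_ar A x y \<cdot> (if x \<in> Ar q then f x else VoidA)"
      by (rule from_zero_unique[of _ "dia_ob A y"]) (use ty xy zob in simp_all)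
  qed (use f in simp_all)
  then show "\<exists>f. f \<in> S_arr q D \<and> dia_src f = Zob SD \<and> dia_tgt f = A" by force
next
  assume A: "A \<in> S_obj q D"
  have "\<forall>x \<in> Ar q. \<exists>f. arr f (dia_ob A x) (Zob D)" using to_zero[OF ob_obj[OF A]] by simp
  then obtain f where f: "\<And>x. x \<in> Ar q \<Longrightarrow> arr (f x) (dia_ob A x) (Zob D)" using bchoice by metis
  have "DiaA A (Zob SD) (\<lambda>x. if x \<in> Ar q then f x else VoidA) \<in> S_arr q D"
  proof (rule S_arrI[OF A S_zob])
    fix x y assume xy: "x \<in> Ar q" "y \<in> Ar q" "Ar_le x y"
    note ty = f[OF xy(1)] f[OF xy(2)] ar_arr[OF A xy]
    show "(if y \<in> Ar q then f y else VoidA) \<cdot> dia_ar A x y = dia_ar (Zob SD) x y \<cdot> (if x \<in> Ar q then f x else VoidA)"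
      by (rule to_zero_unique[of _ "dia_ob A x"]) (use ty xy zob in simp_all)
  qed (use f in simp_all)
  then show "\<exists>f. f \<in> S_arr q D \<and> dia_src f = A \<and> dia_tgt f = Zob SD" by force
qed

lemma S_zero: "zero_object SD (Zob SD)"
  unfolding zero_object_def S_con_sel
proof (intro conjI ballI S_zob)
  fix A assume A: "A \<in> S_obj q D"
  show "\<exists>!f. f \<in> S_arr q D \<and> dia_src f = Zob SD \<and> dia_tgt f = A"
  proof (rule ex_ex1I[OF S_from_zero[OF A]])
    fix f g assume fg: "f \<in> S_arr q D \<and> dia_src f = Zob SD \<and> dia_tgt f = A" "g \<in> S_arr q D \<and> dia_src g = Zob SD \<and> dia_tgt g = A"
    show "f = g"
    proof (rule S_arr_eqI[of f q D g])
      fix x assume x: "x \<in> Ar q"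
      show "dia_cmp f x = dia_cmp g x"
        by (rule from_zero_unique[of _ "dia_ob A x"])
          (use S_cmp_arr[of f, OF _ x] S_cmp_arr[of g, OF _ x] fg x in simp_all)
    qed (use fg in simp_all)
  qed
  show "\<exists>!f. f \<in> S_arr q D \<and> dia_src f = A \<and> dia_tgt f = Zob SD"
  proof (rule ex_ex1I[OF S_to_zero[OF A]])
    fix f g assume fg: "f \<in> S_arr q D \<and> dia_src f = A \<and> dia_tgt f = Zob SD" "g \<in> S_arr q D \<and> dia_src g = A \<and> dia_tgt g = Zob SD"
    show "f = g"
    proof (rule S_arr_eqI[of f q D g])
      fix x assume x: "x \<in> Ar q"
      show "dia_cmp f x = dia_cmp g x"
        by (rule to_zero_unique[of _ "dia_ob A x"])
          (use S_cmp_arr[of f, OF _ x] S_cmp_arr[of g, OF _ x] fg x in simp_all)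
    qed (use fg in simp_all)
  qed
qed

lemma S_zero_cof:
  assumes f: "f \<in> S_arr q D" and Z: "dia_src f = Zob SD"
  shows "f \<in> Cof SD"
  unfolding S_cof_iff
proof (intro conjI allI impI f)
  fix i j k assume ijk: "i \<le> j \<and> j \<le> k \<and> k \<le> q"
  then have x: "(i, j) \<in> Ar q" "(i, k) \<in> Ar q" "Ar_le (i, j) (i, k)" by (auto simp: Ar_iff Ar_le_def)
  note t = S_cmp_arr[OF f, unfolded Z]
  show "dia_cmp f (i, j) \<in> Cof D" by (rule zero_cof) (use t[OF x(1)] x in simp_all)
  have "rel_cof (Idn D (Zob D)) (dia_cmp f (i, j)) (dia_ar (dia_tgt f) (i, j) (i, k)) (dia_cmp f (i, k))"
    by (rule rel_cof_zero[OF _ _ ar_arr[OF _ x]]) (use t x ijk S_arrD(3)[OF f] S_objD(6)[OF S_arrD(3)[OF f], of i j k] in simp_all)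
  then show "rel_cof (dia_ar (dia_src f) (i, j) (i, k)) (dia_cmp f (i, j)) (dia_ar (dia_tgt f) (i, j) (i, k)) (dia_cmp f (i, k))"
    using x by (simp add: Z)
qed

text \<open>The pushout formed entrywise differs from the given one by an isomorphism of diagrams,
  which is a cofibration and is invertible in each entry. So both properties pass to the given
  pushout.\<close>

lemma S_pushoutD:
  assumes a: "a \<in> Cof SD" and po: "is_pushout SD a b c d"
  shows "d \<in> Cof SD"
    "x \<in> Ar q \<Longrightarrow> is_pushout D (dia_cmp a x) (dia_cmp b x) (dia_cmp c x) (dia_cmp d x)"
proof -
  interpret S: cat SD using S_category by unfold_locales
  note po' = S.pushoutD[OF po, unfolded S_con_sel]
  obtain c0 d0 where c0: "c0 \<in> S_arr q D" and d0: "d0 \<in> Cof SD" and ty: "dia_src c0 = dia_tgt a"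
    "dia_src d0 = dia_tgt b" "dia_tgt d0 = dia_tgt c0"
    and pw': "\<forall>x \<in> Ar q. is_pushout D (dia_cmp a x) (dia_cmp b x) (dia_cmp c0 x) (dia_cmp d0 x)"
    using S_pushout_ex[OF a po'(2,5)] .
  note pw = bspec[OF pw']
  have d0a: "d0 \<in> S_arr q D" using d0 by (simp add: S_cof_iff)
  have "is_pushout SD a b c0 d0"
    by (rule pointwise_pushout[OF po'(1,2) c0 d0a po'(5) ty pw])
  then obtain u where u: "u \<in> S_arr q D" "dia_src u = dia_tgt c0" "iso_arrow SD u" "Cmp SD u c0 = c" "Cmp SD u d0 = d"
    using S.pushout_unique[OF _ po, of c0 d0] S_con_sel by metis
  show "d \<in> Cof SD" using S_cof_Cmp[OF d0 S_iso_cof[OF u(3)]] u ty by simp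
  assume x: "x \<in> Ar q"
  have "is_pushout D (dia_cmp a x) (dia_cmp b x) (dia_cmp u x \<cdot> dia_cmp c0 x) (dia_cmp u x \<cdot> dia_cmp d0 x)"
    by (rule pushout_transport[OF pw[OF x] _ S_iso[OF u(3) x], of "dia_ob (dia_tgt u) x"])
      (use S_cmp_arr[OF u(1) x] S_cmp_arr[OF c0 x] u(2) in simp)
  then show "is_pushout D (dia_cmp a x) (dia_cmp b x) (dia_cmp c x) (dia_cmp d x)"
    using x by (simp flip: u(4,5))
qed

text \<open>The S-construction leads back to a category of the same kind, which is what allows it to
  be iterated.\<close>

lemma S_prewald: "prewald SD"
proof (unfold_locales, rule S_category)
  show "zero_object SD (Zob SD)" by (rule S_zero)
  show "f \<in> Weq SD" if "iso_arrow SD f" for f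
    using that S_iso[OF that] iso_weq by (auto simp: S_weq_iff iso_arrow_def)
  show "\<exists>c d. is_pushout SD a b c d" if ab: "a \<in> Cof SD" "b \<in> Arr SD" "Src SD b = Src SD a" for a b
  proof -
    obtain c d where "c \<in> S_arr q D" "d \<in> Cof SD" "dia_src c = dia_tgt a" "dia_src d = dia_tgt b" "dia_tgt d = dia_tgt c"
      "\<forall>x \<in> Ar q. is_pushout D (dia_cmp a x) (dia_cmp b x) (dia_cmp c x) (dia_cmp d x)"
      using S_pushout_ex[OF ab(1) ab(2,3)[unfolded S_con_sel]] .
    then have "is_pushout SD a b c d"
      by (intro pointwise_pushout) (use ab in \<open>simp_all add: S_cof_iff\<close>)
    then show ?thesis by blast
  qed
  show "d \<in> Cof SD" if "a \<in> Cof SD" "is_pushout SD a b c d" for a b c d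
    using S_pushoutD(1)[OF that] .
qed (simp_all add: S_cof_iff[THEN iffD1] S_weq_iff[THEN iffD1] S_iso_cof S_cof_Cmp S_weq_Cmp S_zero_cof)

end

section \<open>Exact functors on the S-construction\<close>

lemma is_functorD:
  assumes "is_functor C D F"
  shows "is_category C" "is_category D" "A \<in> Obj C \<Longrightarrow> on_obj F A \<in> Obj D"
    "A \<in> Obj C \<Longrightarrow> on_arr F (Idn C A) = Idn D (on_obj F A)"
    "f \<in> Arr C \<Longrightarrow> on_arr F f \<in> Arr D" "f \<in> Arr C \<Longrightarrow> Src D (on_arr F f) = on_obj F (Src C f)"
    "f \<in> Arr C \<Longrightarrow> Tgt D (on_arr F f) = on_obj F (Tgt C f)"
    "f \<in> Arr C \<Longrightarrow> g \<in> Arr C \<Longrightarrow> Src C g = Tgt C f \<Longrightarrow> on_arr F (Cmp C g f) = Cmp D (on_arr F g) (on_arr F f)"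
  using assms by (auto simp: is_functor_def)

lemma is_functorI:
  assumes "is_category C" "is_category D" "\<And>A. A \<in> Obj C \<Longrightarrow> on_obj F A \<in> Obj D"
    "\<And>A. A \<in> Obj C \<Longrightarrow> on_arr F (Idn C A) = Idn D (on_obj F A)"
    "\<And>f. f \<in> Arr C \<Longrightarrow> on_arr F f \<in> Arr D" "\<And>f. f \<in> Arr C \<Longrightarrow> Src D (on_arr F f) = on_obj F (Src C f)"
    "\<And>f. f \<in> Arr C \<Longrightarrow> Tgt D (on_arr F f) = on_obj F (Tgt C f)"
    "\<And>f g. f \<in> Arr C \<Longrightarrow> g \<in> Arr C \<Longrightarrow> Src C g = Tgt C f \<Longrightarrow> on_arr F (Cmp C g f) = Cmp D (on_arr F g) (on_arr F f)"
  shows "is_functor C D F"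
  using assms unfolding is_functor_def by blast

lemma functor_iso:
  assumes F: "is_functor C D F" and f: "iso_arrow C f"
  shows "iso_arrow D (on_arr F f)"
proof -
  interpret C: cat C by (unfold_locales, rule is_functorD(1)[OF F])
  have fa: "f \<in> Arr C" using f by (simp add: iso_arrow_def)
  obtain g where g: "C.arr g (Tgt C f) (Src C f)" "Cmp C g f = Idn C (Src C f)" "Cmp C f g = Idn C (Tgt C f)"
    using C.isoE[OF f] fa by blast
  note D = is_functorD[OF F]
  have "Cmp D (on_arr F g) (on_arr F f) = Idn D (on_obj F (Src C f))"
    using D(8)[of f g] D(4)[OF C.src_obj[OF fa]] g fa by simp
  moreover have "Cmp D (on_arr F f) (on_arr F g) = Idn D (on_obj F (Tgt C f))"
    using D(8)[of g f] D(4)[OF C.tgt_obj[OF fa]] g fa by simp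
  ultimately show ?thesis
    unfolding iso_arrow_def using D(5-7) g(1) fa by (intro conjI bexI[of _ "on_arr F g"]) simp_all
qed

lemma exact_functorD:
  assumes "exact_functor C D F"
  shows "is_functor C D F" "on_obj F (Zob C) = Zob D" "f \<in> Cof C \<Longrightarrow> on_arr F f \<in> Cof D"
    "f \<in> Weq C \<Longrightarrow> on_arr F f \<in> Weq D"
    "a \<in> Cof C \<Longrightarrow> is_pushout C a b c d \<Longrightarrow> is_pushout D (on_arr F a) (on_arr F b) (on_arr F c) (on_arr F d)"
  using assms by (auto simp: exact_functor_def)

lemma exact_functorI:
  assumes "is_functor C D F" "on_obj F (Zob C) = Zob D" "\<And>f. f \<in> Cof C \<Longrightarrow> on_arr F f \<in> Cof D"
    "\<And>f. f \<in> Weq C \<Longrightarrow> on_arr F f \<in> Weq D"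
    "\<And>a b c d. a \<in> Cof C \<Longrightarrow> is_pushout C a b c d \<Longrightarrow> is_pushout D (on_arr F a) (on_arr F b) (on_arr F c) (on_arr F d)"
  shows "exact_functor C D F"
  using assms unfolding exact_functor_def by blast

text \<open>Exactness involves only the values on objects and arrows of \<open>C\<close>. The lemma
  is meant for \<open>pull\<close> and \<open>map_dia\<close>, which are defined on all raw diagrams
  and are compared with an \<open>S_fun\<close> only on objects and arrows of the
  S-construction.\<close>

lemma exact_functor_cong:
  assumes C: "prewald C" and F: "exact_functor C D F"
    and eq: "\<And>A. A \<in> Obj C \<Longrightarrow> on_obj G A = on_obj F A" "\<And>f. f \<in> Arr C \<Longrightarrow> on_arr G f = on_arr F f"
  shows "exact_functor C D G"
proof -
  interpret C: prewald C by (rule C)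
  note F1 = is_functorD[OF exact_functorD(1)[OF F]]
  show ?thesis
  proof (rule exact_functorI)
    show "is_functor C D G"
      by (rule is_functorI) (use F1 eq in \<open>simp_all add: C.src_obj C.tgt_obj\<close>)
    show "on_obj G (Zob C) = Zob D" using exact_functorD(2)[OF F] eq(1)[OF C.zob] by simp
    show "on_arr G f \<in> Cof D" if "f \<in> Cof C" for f
      using exact_functorD(3)[OF F that] eq(2)[OF C.cof_arr[OF that]] by simp
    show "on_arr G f \<in> Weq D" if "f \<in> Weq C" for f
      using exact_functorD(4)[OF F that] eq(2)[OF C.weq_arr[OF that]] by simp
    show "is_pushout D (on_arr G a) (on_arr G b) (on_arr G c) (on_arr G d)" if "a \<in> Cof C" "is_pushout C a b c d" for a b c d
      using exact_functorD(5)[OF F that] eq(2)[OF C.pushoutD(1)[OF that(2)]] eq(2)[OF C.pushoutD(2)[OF that(2)]]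
        eq(2)[OF C.pushoutD(3)[OF that(2)]] eq(2)[OF C.pushoutD(4)[OF that(2)]] by simp
  qed
qed

lemma DeltaD:
  assumes "\<theta> \<in> Delta p q"
  shows "i \<le> p \<Longrightarrow> \<theta> i \<le> q" "i \<le> j \<Longrightarrow> j \<le> p \<Longrightarrow> \<theta> i \<le> \<theta> j"
    "x \<in> Ar p \<Longrightarrow> map_prod \<theta> \<theta> x \<in> Ar q"
    "x \<in> Ar p \<Longrightarrow> y \<in> Ar p \<Longrightarrow> Ar_le x y \<Longrightarrow> Ar_le (map_prod \<theta> \<theta> x) (map_prod \<theta> \<theta> y)"
proof -
  have 1: "\<And>i. i \<le> p \<Longrightarrow> \<theta> i \<le> q" and 2: "\<And>i j. i \<le> j \<Longrightarrow> j \<le> p \<Longrightarrow> \<theta> i \<le> \<theta> j"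
    using assms by (auto simp: Delta_def mono_on_def)
  show "i \<le> p \<Longrightarrow> \<theta> i \<le> q" "i \<le> j \<Longrightarrow> j \<le> p \<Longrightarrow> \<theta> i \<le> \<theta> j" by fact+
  show "x \<in> Ar p \<Longrightarrow> map_prod \<theta> \<theta> x \<in> Ar q" using 1 2 by (cases x) (simp add: Ar_iff)
  show "x \<in> Ar p \<Longrightarrow> y \<in> Ar p \<Longrightarrow> Ar_le x y \<Longrightarrow> Ar_le (map_prod \<theta> \<theta> x) (map_prod \<theta> \<theta> y)"
    using 2 by (cases x; cases y) (auto simp: Ar_iff Ar_le_def)
qed

lemma Delta_id: "(\<lambda>i \<in> {..q}. i) \<in> Delta q q"
  by (auto simp: Delta_def mono_on_def)

lemma map_prod_id: "x \<in> Ar q \<Longrightarrow> map_prod (\<lambda>i \<in> {..q}. i) (\<lambda>i \<in> {..q}. i) x = x"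
  by (cases x) (simp add: Ar_iff)

text \<open>Restriction along \<open>\<theta>\<close> combined with the entrywise application of \<open>F\<close>: this covers both
  \<open>pull_obj\<close> (with \<open>F\<close> the same restriction one level below) and \<open>map_dia_obj\<close> (with \<open>\<theta>\<close> the identity).\<close>

definition S_fun_obj where
  "S_fun_obj p \<theta> F X = DiaO
     (\<lambda>x. if x \<in> Ar p then on_obj F (dia_ob X (map_prod \<theta> \<theta> x)) else VoidO)
     (\<lambda>x y. if x \<in> Ar p \<and> y \<in> Ar p \<and> Ar_le x y
            then on_arr F (dia_ar X (map_prod \<theta> \<theta> x) (map_prod \<theta> \<theta> y)) else VoidA)"

definition S_fun :: "nat \<Rightarrow> (nat \<Rightarrow> nat) \<Rightarrow>
    (('o, 'm) dia_obj, ('o, 'm) dia_arr, ('p, 'n) dia_obj, ('p, 'n) dia_arr) cat_functor \<Rightarrow>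
    (('o, 'm) dia_obj, ('o, 'm) dia_arr, ('p, 'n) dia_obj, ('p, 'n) dia_arr) cat_functor" where
  "S_fun p \<theta> F = \<lparr>on_obj = S_fun_obj p \<theta> F,
     on_arr = (\<lambda>t. DiaA (S_fun_obj p \<theta> F (dia_src t)) (S_fun_obj p \<theta> F (dia_tgt t))
       (\<lambda>x. if x \<in> Ar p then on_arr F (dia_cmp t (map_prod \<theta> \<theta> x)) else VoidA))\<rparr>"

lemma S_fun_obj_sel [simp]:
  "dia_ob (S_fun_obj p \<theta> F X) x = (if x \<in> Ar p then on_obj F (dia_ob X (map_prod \<theta> \<theta> x)) else VoidO)"
  "dia_ar (S_fun_obj p \<theta> F X) x y = (if x \<in> Ar p \<and> y \<in> Ar p \<and> Ar_le x y
            then on_arr F (dia_ar X (map_prod \<theta> \<theta> x) (map_prod \<theta> \<theta> y)) else VoidA)"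
  by (simp_all add: S_fun_obj_def)

lemma S_fun_sel [simp]: "on_obj (S_fun p \<theta> F) = S_fun_obj p \<theta> F"
  "dia_src (on_arr (S_fun p \<theta> F) t) = S_fun_obj p \<theta> F (dia_src t)"
  "dia_tgt (on_arr (S_fun p \<theta> F) t) = S_fun_obj p \<theta> F (dia_tgt t)"
  "dia_cmp (on_arr (S_fun p \<theta> F) t) x = (if x \<in> Ar p then on_arr F (dia_cmp t (map_prod \<theta> \<theta> x)) else VoidA)"
  by (simp_all add: S_fun_def)

text \<open>The conditions on the image at \<open>(i, j, k)\<close> come from those on the original
  at \<open>(\<theta> i, \<theta> j, \<theta> k)\<close>, because \<open>F\<close> preserves the
  zero object, cofibrations and pushouts along cofibrations.\<close>

lemma S_fun_exact:
  assumes D: "prewald D" and E: "prewald E" and F: "exact_functor D E F" and \<theta>: "\<theta> \<in> Delta p q"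
  shows "exact_functor (S_con q D) (S_con p E) (S_fun p \<theta> F)"
proof -
  interpret D: dia_prewald D q by (rule dia_prewald.intro[OF D])
  interpret E: dia_prewald E p by (rule dia_prewald.intro[OF E])
  note F1 = is_functorD[OF exact_functorD(1)[OF F]]
  note Fpo = exact_functorD(5)[OF F]
  note d = DeltaD[OF \<theta>]
  have obj: "S_fun_obj p \<theta> F X \<in> S_obj p E" if X: "X \<in> S_obj q D" for X
    unfolding S_fun_obj_def
  proof (rule S_objI)
    show "is_diagram E (Ar p) Ar_le (\<lambda>x. if x \<in> Ar p then on_obj F (dia_ob X (map_prod \<theta> \<theta> x)) else VoidO)
     (\<lambda>x y. if x \<in> Ar p \<and> y \<in> Ar p \<and> Ar_le x y
            then on_arr F (dia_ar X (map_prod \<theta> \<theta> x) (map_prod \<theta> \<theta> y)) else VoidA)"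
      unfolding is_diagram_def
    proof (intro conjI ballI impI)
      fix x y z assume xyz: "x \<in> Ar p" "y \<in> Ar p" "z \<in> Ar p" "Ar_le x y \<and> Ar_le y z"
      then have "Ar_le x z" using Ar_le_trans by blast
      then show "Cmp E (if y \<in> Ar p \<and> z \<in> Ar p \<and> Ar_le y z then on_arr F (dia_ar X (map_prod \<theta> \<theta> y) (map_prod \<theta> \<theta> z)) else VoidA)
          (if x \<in> Ar p \<and> y \<in> Ar p \<and> Ar_le x y then on_arr F (dia_ar X (map_prod \<theta> \<theta> x) (map_prod \<theta> \<theta> y)) else VoidA)
        = (if x \<in> Ar p \<and> z \<in> Ar p \<and> Ar_le x z then on_arr F (dia_ar X (map_prod \<theta> \<theta> x) (map_prod \<theta> \<theta> z)) else VoidA)"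
        using xyz F1(8)[of "dia_ar X (map_prod \<theta> \<theta> x) (map_prod \<theta> \<theta> y)" "dia_ar X (map_prod \<theta> \<theta> y) (map_prod \<theta> \<theta> z)"]
          D.ar_arr[OF X d(3,3,4)] D.ar_cmp[OF X d(3,3,3,4,4)] by simp
    qed (use F1 D.ob_obj[OF X d(3)] D.ar_arr[OF X d(3,3,4)] D.ar_idn[OF X d(3)] in simp_all)
    show "(if (i, i) \<in> Ar p then on_obj F (dia_ob X (map_prod \<theta> \<theta> (i, i))) else VoidO) = Zob E" if "i \<le> p" for i
      using that S_objD(5)[OF X d(1)[OF that]] exact_functorD(2)[OF F] by (simp add: Ar_iff)
    fix i j k assume ijk: "i \<le> j" "j \<le> k" "k \<le> p"
    note t = d(2)[OF ijk(1)] d(2)[OF ijk(2,3)] d(1)[OF ijk(3)]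
    have x: "(i, j) \<in> Ar p" "(i, k) \<in> Ar p" "(j, j) \<in> Ar p" "(j, k) \<in> Ar p"
      "Ar_le (i, j) (i, k)" "Ar_le (i, j) (j, j)" "Ar_le (i, k) (j, k)" "Ar_le (j, j) (j, k)"
      using ijk by (auto simp: Ar_le_def Ar_iff)
    have c: "dia_ar X (\<theta> i, \<theta> j) (\<theta> i, \<theta> k) \<in> Cof D" using S_objD(6)[OF X] t ijk by simp
    then show "(if (i, j) \<in> Ar p \<and> (i, k) \<in> Ar p \<and> Ar_le (i, j) (i, k)
      then on_arr F (dia_ar X (map_prod \<theta> \<theta> (i, j)) (map_prod \<theta> \<theta> (i, k))) else VoidA) \<in> Cof E"
      using exact_functorD(3)[OF F] x by simp
    show "is_pushout E
       (if (i, j) \<in> Ar p \<and> (i, k) \<in> Ar p \<and> Ar_le (i, j) (i, k)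
        then on_arr F (dia_ar X (map_prod \<theta> \<theta> (i, j)) (map_prod \<theta> \<theta> (i, k))) else VoidA)
       (if (i, j) \<in> Ar p \<and> (j, j) \<in> Ar p \<and> Ar_le (i, j) (j, j)
        then on_arr F (dia_ar X (map_prod \<theta> \<theta> (i, j)) (map_prod \<theta> \<theta> (j, j))) else VoidA)
       (if (i, k) \<in> Ar p \<and> (j, k) \<in> Ar p \<and> Ar_le (i, k) (j, k)
        then on_arr F (dia_ar X (map_prod \<theta> \<theta> (i, k)) (map_prod \<theta> \<theta> (j, k))) else VoidA)
       (if (j, j) \<in> Ar p \<and> (j, k) \<in> Ar p \<and> Ar_le (j, j) (j, k)
        then on_arr F (dia_ar X (map_prod \<theta> \<theta> (j, j)) (map_prod \<theta> \<theta> (j, k))) else VoidA)"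
      using Fpo[OF c S_objD(7)[OF X]] t ijk x by simp
  qed auto
  have arr: "on_arr (S_fun p \<theta> F) f \<in> S_arr p E" if f: "f \<in> S_arr q D" for f
  proof -
    note tf = S_arrD(2,3)[OF f]
    have "DiaA (S_fun_obj p \<theta> F (dia_src f)) (S_fun_obj p \<theta> F (dia_tgt f))
       (\<lambda>x. if x \<in> Ar p then on_arr F (dia_cmp f (map_prod \<theta> \<theta> x)) else VoidA) \<in> S_arr p E"
    proof (rule S_arrI[OF obj[OF tf(1)] obj[OF tf(2)]])
      fix x y assume xy: "x \<in> Ar p" "y \<in> Ar p" "Ar_le x y"
      note z = d(3)[OF xy(1)] d(3)[OF xy(2)] d(4)[OF xy]
      note ty = D.ar_arr[OF tf(1) z] D.ar_arr[OF tf(2) z] D.S_cmp_arr[OF f z(1)] D.S_cmp_arr[OF f z(2)]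
      have "Cmp E (on_arr F (dia_cmp f (map_prod \<theta> \<theta> y))) (on_arr F (dia_ar (dia_src f) (map_prod \<theta> \<theta> x) (map_prod \<theta> \<theta> y)))
        = on_arr F (Cmp D (dia_cmp f (map_prod \<theta> \<theta> y)) (dia_ar (dia_src f) (map_prod \<theta> \<theta> x) (map_prod \<theta> \<theta> y)))"
        by (rule F1(8)[symmetric]) (use ty in simp_all)
      also have "\<dots> = Cmp E (on_arr F (dia_ar (dia_tgt f) (map_prod \<theta> \<theta> x) (map_prod \<theta> \<theta> y))) (on_arr F (dia_cmp f (map_prod \<theta> \<theta> x)))"
        unfolding S_arrD(8)[OF f z] by (rule F1(8)) (use ty in simp_all)
      finally show "Cmp E (if y \<in> Ar p then on_arr F (dia_cmp f (map_prod \<theta> \<theta> y)) else VoidA) (dia_ar (S_fun_obj p \<theta> F (dia_src f)) x y)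
        = Cmp E (dia_ar (S_fun_obj p \<theta> F (dia_tgt f)) x y) (if x \<in> Ar p then on_arr F (dia_cmp f (map_prod \<theta> \<theta> x)) else VoidA)"
        using xy by simp
    qed (use F1 D.S_cmp_arr[OF f d(3)] in simp_all)
    then show ?thesis by (simp add: S_fun_def)
  qed
  show ?thesis
  proof (rule exact_functorI)
    show "is_functor (S_con q D) (S_con p E) (S_fun p \<theta> F)"
    proof (rule is_functorI[OF D.S_category E.S_category])
      fix X assume "X \<in> Obj (S_con q D)"
      then have X: "X \<in> S_obj q D" by simp
      show "on_arr (S_fun p \<theta> F) (Idn (S_con q D) X) = Idn (S_con p E) (on_obj (S_fun p \<theta> F) X)"
        by (rule S_arr_eqI[OF arr E.S_Idn])
          (use X D.S_Idn obj d(3) F1(4)[OF D.ob_obj[OF X d(3)]] in simp_all)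
    next
      fix f g assume "f \<in> Arr (S_con q D)" "g \<in> Arr (S_con q D)" "Src (S_con q D) g = Tgt (S_con q D) f"
      then have fg: "f \<in> S_arr q D" "g \<in> S_arr q D" "dia_src g = dia_tgt f" by simp_all
      show "on_arr (S_fun p \<theta> F) (Cmp (S_con q D) g f) = Cmp (S_con p E) (on_arr (S_fun p \<theta> F) g) (on_arr (S_fun p \<theta> F) f)"
      proof (rule S_arr_eqI[OF arr[OF D.S_Cmp[OF fg]] E.S_Cmp[OF arr[OF fg(1)] arr[OF fg(2)]]])
        fix x assume x: "x \<in> Ar p"
        show "dia_cmp (on_arr (S_fun p \<theta> F) (Cmp (S_con q D) g f)) x =
          dia_cmp (Cmp (S_con p E) (on_arr (S_fun p \<theta> F) g) (on_arr (S_fun p \<theta> F) f)) x"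
          using x d(3)[OF x] D.S_cmp_arr[OF fg(1) d(3)[OF x]] D.S_cmp_arr[OF fg(2) d(3)[OF x]] fg(3)
          by (simp add: F1(8))
      qed (use fg in simp_all)
    qed (use obj arr in simp_all)
    show "on_obj (S_fun p \<theta> F) (Zob (S_con q D)) = Zob (S_con p E)"
    proof -
      have eq: "Zob (S_con p E) = DiaO (dia_ob (Zob (S_con p E))) (dia_ar (Zob (S_con p E)))"
        by (simp add: S_con_def)
      show ?thesis
        by (subst eq) (use d(3,4) exact_functorD(2)[OF F] F1(4)[OF D.zob] in \<open>auto simp: S_fun_obj_def fun_eq_iff simp del: split_paired_All\<close>)
    qed
    show "on_arr (S_fun p \<theta> F) f \<in> Weq (S_con p E)" if "f \<in> Weq (S_con q D)" for f
      using that arr d(3) exact_functorD(4)[OF F] by (simp add: S_weq_iff)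
    show "on_arr (S_fun p \<theta> F) f \<in> Cof (S_con p E)" if "f \<in> Cof (S_con q D)" for f
      unfolding E.S_cof_iff
    proof (intro conjI allI impI)
      have f: "f \<in> S_arr q D" using that by (simp add: D.S_cof_iff)
      show "on_arr (S_fun p \<theta> F) f \<in> S_arr p E" by (rule arr[OF f])
      fix i j k assume ijk: "i \<le> j \<and> j \<le> k \<and> k \<le> p"
      then have x: "(i, j) \<in> Ar p" "(i, k) \<in> Ar p" "Ar_le (i, j) (i, k)" by (auto simp: Ar_iff Ar_le_def)
      have t: "\<theta> i \<le> \<theta> j \<and> \<theta> j \<le> \<theta> k \<and> \<theta> k \<le> q" using d(1,2) ijk by auto
      note c = that[unfolded D.S_cof_iff, THEN conjunct2, rule_format, OF t]
      show "dia_cmp (on_arr (S_fun p \<theta> F) f) (i, j) \<in> Cof E"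
        using c exact_functorD(3)[OF F] x by simp
      \<comment> \<open>\<open>F\<close> carries the pushout \<open>R\<close> together with the
        cofibration \<open>u\<close> out of it to the data that \<open>rel_cof\<close> asks for in
        \<open>E\<close>; the pushout is preserved because the transition arrow is a
        cofibration.\<close>
      obtain c' d' u where R: "is_pushout D (dia_ar (dia_src f) (\<theta> i, \<theta> j) (\<theta> i, \<theta> k)) (dia_cmp f (\<theta> i, \<theta> j)) c' d'"
        and u: "u \<in> Cof D" "D.arr u (Tgt D c') (Tgt D (dia_ar (dia_tgt f) (\<theta> i, \<theta> j) (\<theta> i, \<theta> k)))"
        "Cmp D u c' = dia_cmp f (\<theta> i, \<theta> k)" "Cmp D u d' = dia_ar (dia_tgt f) (\<theta> i, \<theta> j) (\<theta> i, \<theta> k)"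
        using D.rel_cofE[OF conjunct2[OF c]] .
      have cf: "dia_ar (dia_src f) (\<theta> i, \<theta> j) (\<theta> i, \<theta> k) \<in> Cof D"
        using S_objD(6)[OF S_arrD(2)[OF f]] t by blast
      note R' = D.pushoutD(1-8)[OF R]
      have tt: "dia_ar (dia_tgt f) (\<theta> i, \<theta> j) (\<theta> i, \<theta> k) \<in> Arr D"
        using D.ar_arr[OF S_arrD(3)[OF f] d(3)[OF x(1)] d(3)[OF x(2)] d(4)[OF x]] by simp
      have "Cmp E (on_arr F u) (on_arr F c') = on_arr F (dia_cmp f (\<theta> i, \<theta> k))"
        using F1(8)[of c' u] u R' by simp
      moreover have "Cmp E (on_arr F u) (on_arr F d') = on_arr F (dia_ar (dia_tgt f) (\<theta> i, \<theta> j) (\<theta> i, \<theta> k))"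
        using F1(8)[of d' u] u R' by simp
      ultimately show "E.rel_cof (dia_ar (dia_src (on_arr (S_fun p \<theta> F) f)) (i, j) (i, k)) (dia_cmp (on_arr (S_fun p \<theta> F) f) (i, j))
        (dia_ar (dia_tgt (on_arr (S_fun p \<theta> F) f)) (i, j) (i, k)) (dia_cmp (on_arr (S_fun p \<theta> F) f) (i, k))"
        using E.rel_cofI[OF Fpo[OF cf R] exact_functorD(3)[OF F u(1)]] x u(2) R' tt F1(5-7) by simp
    qed
    \<comment> \<open>As \<open>a\<close> is a cofibration, the given pushout is one in each entry.
      \<open>F\<close> preserves it there, and entrywise pushouts are pushouts of diagrams.\<close>
    show "is_pushout (S_con p E) (on_arr (S_fun p \<theta> F) a) (on_arr (S_fun p \<theta> F) b) (on_arr (S_fun p \<theta> F) c) (on_arr (S_fun p \<theta> F) d)"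
      if a: "a \<in> Cof (S_con q D)" and po: "is_pushout (S_con q D) a b c d" for a b c d
    proof -
      interpret SD: prewald "S_con q D" by (rule D.S_prewald)
      note po' = SD.pushoutD(1-8)[OF po, unfolded S_con_sel]
      have "dia_cmp a x \<in> Cof D" if "x \<in> Ar q" for x
        using a that by (cases x) (auto simp: D.S_cof_iff Ar_iff)
      then show ?thesis
        by (intro E.pointwise_pushout) (use po' arr D.S_pushoutD(2)[OF a po] Fpo d(3) in simp_all)
    qed
  qed
qed

section \<open>The iterated S-construction\<close>

lemma leaf_mem [simp]: "LeafA a \<in> LeafA ` S \<longleftrightarrow> a \<in> S" "LeafO A \<in> LeafO ` U \<longleftrightarrow> A \<in> U"
  by auto

lemma leaf_wald_sel [simp]:
  "Obj (leaf_wald C) = LeafO ` Obj C" "Arr (leaf_wald C) = LeafA ` Arr C"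
  "Src (leaf_wald C) (LeafA f) = LeafO (Src C f)" "Tgt (leaf_wald C) (LeafA f) = LeafO (Tgt C f)"
  "Idn (leaf_wald C) (LeafO A) = LeafA (Idn C A)"
  "Cmp (leaf_wald C) (LeafA g) (LeafA f) = LeafA (Cmp C g f)"
  "Zob (leaf_wald C) = LeafO (Zob C)" "Cof (leaf_wald C) = LeafA ` Cof C" "Weq (leaf_wald C) = LeafA ` Weq C"
  by (simp_all add: leaf_wald_def)

text \<open>\<open>LeafA\<close> is injective, so it preserves and reflects unique existence. With
  this rule the universal properties of zero objects and pushouts transfer to
  \<open>leaf_wald C\<close> by simplification.\<close>

lemma ex1_leaf: "(\<exists>!u. u \<in> LeafA ` S \<and> P u) \<longleftrightarrow> (\<exists>!v. v \<in> S \<and> P (LeafA v))"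
proof
  assume "\<exists>!u. u \<in> LeafA ` S \<and> P u"
  then obtain u where u: "u \<in> LeafA ` S \<and> P u" "\<forall>y. y \<in> LeafA ` S \<and> P y \<longrightarrow> y = u" by (rule ex1E)
  then obtain v where v: "u = LeafA v" "v \<in> S" by blast
  show "\<exists>!v. v \<in> S \<and> P (LeafA v)"
  proof (rule ex1I[of _ v])
    show "w = v" if "w \<in> S \<and> P (LeafA w)" for w
      using u(2)[rule_format, of "LeafA w"] that v by simp
  qed (use u(1) v in simp)
next
  assume "\<exists>!v. v \<in> S \<and> P (LeafA v)"
  then obtain v where v: "v \<in> S \<and> P (LeafA v)" "\<forall>y. y \<in> S \<and> P (LeafA y) \<longrightarrow> y = v" by (rule ex1E)
  show "\<exists>!u. u \<in> LeafA ` S \<and> P u"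
  proof (rule ex1I[of _ "LeafA v"])
    show "w = LeafA v" if "w \<in> LeafA ` S \<and> P w" for w
      using v(2) that by blast
  qed (use v(1) in simp)
qed

lemma leaf_category: "is_category C \<Longrightarrow> is_category (leaf_wald C)"
  unfolding is_category_def by auto

lemma leaf_pushout:
  "is_pushout (leaf_wald C) (LeafA a) (LeafA b) (LeafA c) (LeafA d) \<longleftrightarrow> is_pushout C a b c d"
  by (simp add: is_pushout_def ex1_leaf)

lemma leaf_pushoutD:
  assumes po: "is_pushout (leaf_wald C) a b c d"
  obtains a' b' c' d' where "a = LeafA a'" "b = LeafA b'" "c = LeafA c'" "d = LeafA d'" "is_pushout C a' b' c' d'"
proof -
  have "a \<in> LeafA ` Arr C" "b \<in> LeafA ` Arr C" "c \<in> LeafA ` Arr C" "d \<in> LeafA ` Arr C"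
    using po by (simp_all add: is_pushout_def)
  then obtain a' b' c' d' where eq: "a = LeafA a'" "b = LeafA b'" "c = LeafA c'" "d = LeafA d'" by blast
  show ?thesis by (rule that[OF eq]) (use po in \<open>simp add: eq leaf_pushout\<close>)
qed

lemma leaf_iso: "iso_arrow (leaf_wald C) (LeafA f) \<longleftrightarrow> iso_arrow C f"
  by (simp add: iso_arrow_def)

lemma leaf_prewald:
  assumes "prewald C"
  shows "prewald (leaf_wald C)"
proof -
  interpret prewald C by (rule assms)
  show ?thesis
  proof (unfold_locales)
    show "is_category (leaf_wald C)"
      by (rule leaf_category[OF is_cat])
    show "zero_object (leaf_wald C) (Zob (leaf_wald C))"
      using zero by (simp add: zero_object_def ex1_leaf)
    show "f \<in> Cof (leaf_wald C)" "f \<in> Weq (leaf_wald C)" if f: "iso_arrow (leaf_wald C) f" for f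
    proof -
      obtain g where "f = LeafA g" using f by (auto simp: iso_arrow_def)
      then show "f \<in> Cof (leaf_wald C)" "f \<in> Weq (leaf_wald C)" using f iso_cof iso_weq by (simp_all add: leaf_iso)
    qed
    show "\<exists>c d. is_pushout (leaf_wald C) a b c d"
      if th: "a \<in> Cof (leaf_wald C)" "b \<in> Arr (leaf_wald C)" "Src (leaf_wald C) b = Src (leaf_wald C) a" for a b
    proof -
      obtain a' b' where ab: "a = LeafA a'" "b = LeafA b'" "a' \<in> Cof C" "b' \<in> Arr C" using th(1,2) by auto
      then obtain c' d' where "is_pushout C a' b' c' d'" using po_ex[of a' b'] th(3) by auto
      then have "is_pushout (leaf_wald C) a b (LeafA c') (LeafA d')" unfolding ab leaf_pushout .
      then show ?thesis by blast
    qed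
    show "d \<in> Cof (leaf_wald C)" if "a \<in> Cof (leaf_wald C)" "is_pushout (leaf_wald C) a b c d" for a b c d
      using leaf_pushoutD[OF that(2)] that(1) po_cof by (metis leaf_mem(1) leaf_wald_sel(8))
  qed (auto simp: cof_arr weq_arr cof_cmp weq_cmp zero_cof)
qed

text \<open>Only the values of \<open>G\<close> on leaves are prescribed, so that the lemma covers
  the base case for \<open>pull\<close> and for \<open>map_dia\<close> alike.\<close>

lemma leaf_exact:
  assumes C: "prewald C" and D: "prewald D" and F: "exact_functor C D F"
    and G: "\<And>A. on_obj G (LeafO A) = LeafO (on_obj F A)" "\<And>f. on_arr G (LeafA f) = LeafA (on_arr F f)"
  shows "exact_functor (leaf_wald C) (leaf_wald D) G"
proof -
  interpret LC: prewald "leaf_wald C" by (rule leaf_prewald[OF C])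
  interpret LD: prewald "leaf_wald D" by (rule leaf_prewald[OF D])
  note F1 = is_functorD[OF exact_functorD(1)[OF F]]
  show ?thesis
  proof (rule exact_functorI)
    show "is_functor (leaf_wald C) (leaf_wald D) G"
      by (rule is_functorI[OF LC.is_cat LD.is_cat]) (use F1 G in auto)
    show "is_pushout (leaf_wald D) (on_arr G a) (on_arr G b) (on_arr G c) (on_arr G d)"
      if th: "a \<in> Cof (leaf_wald C)" "is_pushout (leaf_wald C) a b c d" for a b c d
    proof -
      obtain a' b' c' d' where eq: "a = LeafA a'" "b = LeafA b'" "c = LeafA c'" "d = LeafA d'"
        and po: "is_pushout C a' b' c' d'"
        using leaf_pushoutD[OF th(2)] .
      then show ?thesis using exact_functorD(5)[OF F _ po] th(1) by (simp add: G leaf_pushout)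
    qed
  qed (use exact_functorD[OF F] G in auto)
qed

lemma id_exact:
  assumes "prewald C"
  shows "exact_functor C C id_functor"
proof -
  interpret prewald C by (rule assms)
  show ?thesis
    by (rule exact_functorI, rule is_functorI) (simp_all add: id_functor_def is_cat src_obj)
qed

lemma S_iter_prewald: "prewald C \<Longrightarrow> prewald (S_iter n q C)"
  by (induction n) (simp_all add: leaf_prewald dia_prewald.S_prewald dia_prewald.intro)

section \<open>Restriction and entrywise functors on iterated diagrams\<close>

abbreviation pull :: "nat \<Rightarrow> (nat \<Rightarrow> nat) \<Rightarrow> (('o, 'm) dia_obj, ('o, 'm) dia_arr, ('o, 'm) dia_obj, ('o, 'm) dia_arr) cat_functor" where
  "pull p \<theta> \<equiv> \<lparr>on_obj = pull_obj p \<theta>, on_arr = pull_arr p \<theta>\<rparr>"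

lemma pull_S_fun:
  "X \<in> S_obj q D \<Longrightarrow> pull_obj p \<theta> X = on_obj (S_fun p \<theta> (pull p \<theta>)) X"
  "g \<in> S_arr q D \<Longrightarrow> pull_arr p \<theta> g = on_arr (S_fun p \<theta> (pull p \<theta>)) g"
proof -
  show ob: "pull_obj p \<theta> X = on_obj (S_fun p \<theta> (pull p \<theta>)) X" if "X \<in> S_obj q D" for X
  proof -
    obtain B f where "X = DiaO B f" using \<open>X \<in> S_obj q D\<close> by (auto simp: S_obj_def)
    then show ?thesis by (simp add: S_fun_obj_def fun_eq_iff del: split_paired_All)
  qed
  assume g: "g \<in> S_arr q D"
  obtain X Y t where g': "g = DiaA X Y t" using g by (auto simp: S_arr_def)
  show "pull_arr p \<theta> g = on_arr (S_fun p \<theta> (pull p \<theta>)) g"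
    using ob[OF S_arrD(2)[OF g]] ob[OF S_arrD(3)[OF g]]
    by (simp add: g' S_fun_def fun_eq_iff del: split_paired_All)
qed

text \<open>Induction on \<open>n\<close>: at level \<open>n + 1\<close>, one direction is reindexed
  by \<open>S_fun\<close> and the entries are restricted at level \<open>n\<close>. The step uses
  exactness and not mere functoriality of the lower restriction, since it has to preserve the
  cofibrations and pushout squares that make up a diagram.\<close>

lemma pull_exact:
  assumes C: "prewald C" and \<theta>: "\<theta> \<in> Delta p q"
  shows "exact_functor (S_iter n q C) (S_iter n p C) (pull p \<theta>)"
proof (induction n)
  case 0
  show ?case using leaf_exact[OF C C id_exact[OF C], of "pull p \<theta>"] by (simp add: id_functor_def)
next
  case (Suc n)
  have F: "exact_functor (S_con q (S_iter n q C)) (S_con p (S_iter n p C)) (S_fun p \<theta> (pull p \<theta>))"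
    by (rule S_fun_exact[OF S_iter_prewald[OF C] S_iter_prewald[OF C] Suc.IH \<theta>])
  show ?case
    unfolding S_iter.simps
    by (rule exact_functor_cong[OF _ F])
      (use S_iter_prewald[OF C, of "Suc n" q] pull_S_fun[of _ q "S_iter n q C"] in simp_all)
qed

abbreviation map_ob :: "('o, 'm, 'p, 'n) cat_functor \<Rightarrow> ('o, 'm) dia_obj \<Rightarrow> ('p, 'n) dia_obj" where
  "map_ob F \<equiv> map_dia_obj (on_obj F) (on_arr F)"

abbreviation map_ar :: "('o, 'm, 'p, 'n) cat_functor \<Rightarrow> ('o, 'm) dia_arr \<Rightarrow> ('p, 'n) dia_arr" where
  "map_ar F \<equiv> map_dia_arr (on_obj F) (on_arr F)"

abbreviation map_dia :: "('o, 'm, 'p, 'n) cat_functor \<Rightarrow> (('o, 'm) dia_obj, ('o, 'm) dia_arr, ('p, 'n) dia_obj, ('p, 'n) dia_arr) cat_functor" where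
  "map_dia F \<equiv> \<lparr>on_obj = map_ob F, on_arr = map_ar F\<rparr>"

text \<open>\<open>map_ob\<close> acts on all entries, \<open>S_fun\<close> only on those with index
  in \<open>Ar q\<close>. For objects and arrows of \<open>S_con\<close> this makes no difference,
  since their other entries are \<open>VoidO\<close> or \<open>VoidA\<close>, which are fixed by the
  map functions.\<close>

lemma map_dia_S_fun:
  "X \<in> S_obj q D \<Longrightarrow> map_ob F X = on_obj (S_fun q (\<lambda>i \<in> {..q}. i) (map_dia F)) X"
  "g \<in> S_arr q D \<Longrightarrow> map_ar F g = on_arr (S_fun q (\<lambda>i \<in> {..q}. i) (map_dia F)) g"
proof -
  define e :: "nat \<Rightarrow> nat" where "e = (\<lambda>i \<in> {..q}. i)"
  have e: "map_prod e e x = x" if "x \<in> Ar q" for x using map_prod_id[OF that] by (simp add: e_def)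
  show ob: "map_ob F X = on_obj (S_fun q (\<lambda>i \<in> {..q}. i) (map_dia F)) X" if X: "X \<in> S_obj q D" for X
  proof -
    obtain A f where X': "X = DiaO A f" using X by (auto simp: S_obj_def)
    have 1: "map_ob F (A x) = (if x \<in> Ar q then map_ob F (A (map_prod e e x)) else VoidO)" for x
      using S_objD(3)[OF X, of x] by (simp add: X' e)
    have 2: "map_ar F (f x y) = (if x \<in> Ar q \<and> y \<in> Ar q \<and> Ar_le x y
        then map_ar F (f (map_prod e e x) (map_prod e e y)) else VoidA)" for x y
      using S_objD(4)[OF X, of x y] by (auto simp: X' e)
    show ?thesis unfolding e_def[symmetric] using 1 2 by (simp add: X' S_fun_obj_def fun_eq_iff del: split_paired_All)
  qed
  assume g: "g \<in> S_arr q D"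
  obtain X Y t where g': "g = DiaA X Y t" using g by (auto simp: S_arr_def)
  have "map_ar F (t x) = (if x \<in> Ar q then map_ar F (t (map_prod e e x)) else VoidA)" for x
    using S_arrD(7)[OF g, of x] by (simp add: g' e)
  then show "map_ar F g = on_arr (S_fun q (\<lambda>i \<in> {..q}. i) (map_dia F)) g"
    unfolding e_def[symmetric]
    using ob[OF S_arrD(2)[OF g], folded e_def] ob[OF S_arrD(3)[OF g], folded e_def]
    by (simp add: g' S_fun_def fun_eq_iff del: split_paired_All)
qed

lemma map_dia_exact:
  assumes C: "prewald C" and D: "prewald D" and F: "exact_functor C D F"
  shows "exact_functor (S_iter n q C) (S_iter n q D) (map_dia F)"
proof (induction n)
  case 0
  show ?case using leaf_exact[OF C D F, of "map_dia F"] by simp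
next
  case (Suc n)
  have F: "exact_functor (S_con q (S_iter n q C)) (S_con q (S_iter n q D)) (S_fun q (\<lambda>i \<in> {..q}. i) (map_dia F))"
    by (rule S_fun_exact[OF S_iter_prewald[OF C] S_iter_prewald[OF D] Suc.IH Delta_id])
  show ?case
    unfolding S_iter.simps
    by (rule exact_functor_cong[OF _ F])
      (use S_iter_prewald[OF C, of "Suc n" q] map_dia_S_fun[of _ q "S_iter n q C"] in simp_all)
qed

text \<open>Induction on raw diagrams. As \<open>\<eta>\<close> sends \<open>Ar r\<close> into
  \<open>Ar p\<close> and preserves the order, the outer restriction never meets a default value
  produced by the inner one.\<close>

lemma pull_pull:
  fixes X :: "('o, 'm) dia_obj" and f :: "('o, 'm) dia_arr"
  assumes \<eta>: "\<eta> \<in> Delta r p"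
  shows "pull_obj r \<eta> (pull_obj p \<theta> X) = pull_obj r (compose {..r} \<theta> \<eta>) X"
    "pull_arr r \<eta> (pull_arr p \<theta> f) = pull_arr r (compose {..r} \<theta> \<eta>) f"
proof (induction X and f)
  have c: "map_prod \<theta> \<theta> (map_prod \<eta> \<eta> x) = map_prod (compose {..r} \<theta> \<eta>) (compose {..r} \<theta> \<eta>) x" if "x \<in> Ar r" for x
    using that by (cases x) (simp add: Ar_iff compose_def)
  note d = DeltaD(3,4)[OF \<eta>]
  {
    case (DiaO A f)
    note IH = DiaO(1)[OF rangeI] DiaO(2)[OF rangeI rangeI]
    show ?case using d by (simp add: fun_eq_iff IH c del: split_paired_All)
  next
    case (DiaA X Y t)
    note IH = DiaA(1,2) DiaA(3)[OF rangeI]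
    show ?case using d by (simp add: fun_eq_iff IH c del: split_paired_All)
  }
qed simp_all

text \<open>Restriction replaces the entries outside \<open>Ar q\<close> by defaults. Membership in
  the iterated S-construction ensures that they had these values before.\<close>

lemma pull_identity:
  assumes e: "\<And>x. x \<in> Ar q \<Longrightarrow> map_prod e e x = x"
  shows "X \<in> Obj (S_iter n q C) \<Longrightarrow> pull_obj q e X = X"
    "f \<in> Arr (S_iter n q C) \<Longrightarrow> pull_arr q e f = f"
proof (induction n arbitrary: X f)
  case 0
  { case 1 then show ?case by auto next case 2 then show ?case by auto }
next
  case (Suc n)
  have ob: "pull_obj q e X = X" if X: "X \<in> S_obj q (S_iter n q C)" for X
  proof -
    obtain A f where X': "X = DiaO A f" using X by (auto simp: S_obj_def)
    have dg: "is_diagram (S_iter n q C) (Ar q) Ar_le A f" using S_objD(2)[OF X] by (simp add: X')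
    have 1: "(if x \<in> Ar q then pull_obj q e (A (map_prod e e x)) else VoidO) = A x" for x
      using S_objD(3)[OF X, of x] Suc.IH(1)[of "A x"] dg by (simp add: X' e is_diagram_def)
    have 2: "(if x \<in> Ar q \<and> y \<in> Ar q \<and> Ar_le x y
      then pull_arr q e (f (map_prod e e x) (map_prod e e y)) else VoidA) = f x y" for x y
      using S_objD(4)[OF X, of x y] Suc.IH(2)[of "f x y"] dg by (auto simp: X' e is_diagram_def)
    show ?thesis using 1 2 by (simp add: X' fun_eq_iff del: split_paired_All)
  qed
  {
    case 1 then show ?case using ob by simp
  next
    case 2
    then have f: "f \<in> S_arr q (S_iter n q C)" by simp
    then obtain X Y t where f': "f = DiaA X Y t" by (auto simp: S_arr_def)
    have "(if x \<in> Ar q then pull_arr q e (t (map_prod e e x)) else VoidA) = t x" for x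
      using S_arrD(7)[OF f, of x] S_arrD(4)[OF f, of x] Suc.IH(2)[of "t x"] by (simp add: f' e)
    then show ?case using ob[OF S_arrD(2)[OF f]] ob[OF S_arrD(3)[OF f]]
      by (simp add: f' fun_eq_iff del: split_paired_All)
  }
qed

lemmas pull_id = pull_identity[OF map_prod_id]

text \<open>Applying functions to the leaves does not interact with reindexing the entries, and
  default entries stay default entries.\<close>

lemma map_dia_pull:
  "map_dia_obj F G (pull_obj p \<theta> X) = pull_obj p \<theta> (map_dia_obj F G X)"
  "map_dia_arr F G (pull_arr p \<theta> f) = pull_arr p \<theta> (map_dia_arr F G f)"
proof (induction X and f)
  case (DiaO A f)
  note IH = DiaO(1)[OF rangeI] DiaO(2)[OF rangeI rangeI]
  show ?case by (simp add: fun_eq_iff IH del: split_paired_All)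
next
  case (DiaA X Y t)
  note IH = DiaA(1,2) DiaA(3)[OF rangeI]
  show ?case by (simp add: fun_eq_iff IH del: split_paired_All)
qed simp_all

section \<open>The K-theory spectrum\<close>

text \<open>\<open>\<phi>\<close> is monotone with values in \<open>{0, 1}\<close>, so the indices
  at which a suspended diagram has the value \<open>X\<close> form a convex set. No composite
  between two copies of \<open>X\<close> passes through the zero object.\<close>

lemma cut_convex:
  assumes "\<phi> \<in> Delta q 1" "x \<in> Ar q" "y \<in> Ar q" "z \<in> Ar q" "Ar_le x y" "Ar_le y z" "cut \<phi> x" "cut \<phi> z"
  shows "cut \<phi> y"
proof -
  have "\<phi> (fst y) \<le> \<phi> (fst z)" "\<phi> (snd x) \<le> \<phi> (snd y)" "\<phi> (snd y) \<le> 1"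
    using assms DeltaD(1,2)[OF assms(1)] by (auto simp: Ar_def Ar_le_def)
  then show ?thesis using assms(7,8) by (simp add: cut_def)
qed

lemma cut_compose: "x \<in> Ar p \<Longrightarrow> cut (compose {..p} \<phi> \<theta>) x = cut \<phi> (map_prod \<theta> \<theta> x)"
  by (cases x) (simp add: cut_def compose_def Ar_iff)

text \<open>If \<open>\<phi>\<close> jumps between \<open>i\<close> and \<open>k\<close>, it does so
  either up to \<open>j\<close> or after \<open>j\<close>, but not both. This decides which opposite
  sides of a square in a suspended diagram are identities.\<close>

lemma cut_Delta:
  assumes "\<phi> \<in> Delta q 1" "i \<le> j" "j \<le> k" "k \<le> q"
  shows "cut \<phi> (i, k) \<longleftrightarrow> cut \<phi> (i, j) \<or> cut \<phi> (j, k)" "\<not> (cut \<phi> (i, j) \<and> cut \<phi> (j, k))" "\<not> cut \<phi> (i, i)"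
proof -
  have "\<phi> i \<le> \<phi> j" "\<phi> j \<le> \<phi> k" "\<phi> k \<le> 1" using DeltaD(1,2)[OF assms(1)] assms(2-) by auto
  then show "cut \<phi> (i, k) \<longleftrightarrow> cut \<phi> (i, j) \<or> cut \<phi> (j, k)" "\<not> (cut \<phi> (i, j) \<and> cut \<phi> (j, k))" "\<not> cut \<phi> (i, i)"
    by (auto simp: cut_def)
qed

section \<open>Suspended diagrams\<close>

context dia_prewald
begin

text \<open>\<open>sus_ob\<close> and \<open>sus_ar\<close> are the entries of
  \<open>susp_obj\<close> before the defaults off \<open>Ar q\<close> are put in. In this form the
  typing of the arrows holds at all indices.\<close>

definition sus_ob :: "(nat \<Rightarrow> nat) \<Rightarrow> ('o, 'm) dia_obj \<Rightarrow> nat \<times> nat \<Rightarrow> ('o, 'm) dia_obj" where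
  "sus_ob \<phi> X x = (if cut \<phi> x then X else Zob D)"

definition sus_ar :: "(nat \<Rightarrow> nat) \<Rightarrow> ('o, 'm) dia_obj \<Rightarrow> nat \<times> nat \<Rightarrow> nat \<times> nat \<Rightarrow> ('o, 'm) dia_arr" where
  "sus_ar \<phi> X x y = (if cut \<phi> x \<and> cut \<phi> y then Idn D X
     else (THE f. f \<in> Arr D \<and> Src D f = sus_ob \<phi> X x \<and> Tgt D f = sus_ob \<phi> X y))"

lemma susp_obj_eq: "susp_obj D q \<phi> X =
    DiaO (\<lambda>x. if x \<in> Ar q then sus_ob \<phi> X x else VoidO)
      (\<lambda>x y. if x \<in> Ar q \<and> y \<in> Ar q \<and> Ar_le x y then sus_ar \<phi> X x y else VoidA)"
  by (simp add: susp_obj_def sus_ob_def sus_ar_def Let_def fun_eq_iff del: split_paired_All)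

lemma susp_obj_sel [simp]:
  "dia_ob (susp_obj D q \<phi> X) x = (if x \<in> Ar q then sus_ob \<phi> X x else VoidO)"
  "dia_ar (susp_obj D q \<phi> X) x y = (if x \<in> Ar q \<and> y \<in> Ar q \<and> Ar_le x y then sus_ar \<phi> X x y else VoidA)"
  by (simp_all add: susp_obj_eq)

lemma zero_arr_unique:
  assumes "arr f A B" "arr g A B" "A = Zob D \<or> B = Zob D"
  shows "f = g"
  using assms from_zero_unique[of f B g] to_zero_unique[of f A g] by auto

lemma sus_arr: 
  assumes X: "X \<in> Obj D"
  shows "arr (sus_ar \<phi> X x y) (sus_ob \<phi> X x) (sus_ob \<phi> X y)"
proof (cases "cut \<phi> x \<and> cut \<phi> y")
  case True
  then show ?thesis using X by (simp add: sus_ar_def sus_ob_def)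
next
  case False
  have ob: "sus_ob \<phi> X x \<in> Obj D" "sus_ob \<phi> X y \<in> Obj D" using X zob by (simp_all add: sus_ob_def)
  have z: "sus_ob \<phi> X x = Zob D \<or> sus_ob \<phi> X y = Zob D" using False by (auto simp: sus_ob_def)
  then have "\<exists>f. arr f (sus_ob \<phi> X x) (sus_ob \<phi> X y)" using from_zero[OF ob(2)] to_zero[OF ob(1)] by (elim disjE) simp_all
  then have "\<exists>!f. arr f (sus_ob \<phi> X x) (sus_ob \<phi> X y)" using zero_arr_unique[OF _ _ z] by (intro ex_ex1I) blast+
  from theI'[OF this] show ?thesis by (simp only: sus_ar_def False if_False)
qed

text \<open>Unless both indices are cut, one end is \<open>Zob D\<close> and the arrow is determined
  by its type. The criterion spares evaluating the definite description in
  \<open>sus_ar\<close>.\<close>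

lemma sus_ar_eq:
  assumes X: "X \<in> Obj D" and f: "arr f (sus_ob \<phi> X x) (sus_ob \<phi> X y)"
    and c: "cut \<phi> x \<Longrightarrow> cut \<phi> y \<Longrightarrow> f = Idn D X"
  shows "f = sus_ar \<phi> X x y"
proof (cases "cut \<phi> x \<and> cut \<phi> y")
  case True
  then show ?thesis using c by (simp add: sus_ar_def)
next
  case False
  then show ?thesis by (intro zero_arr_unique[OF f sus_arr[OF X]]) (auto simp: sus_ob_def)
qed

text \<open>In each square one pair of opposite sides consists of identities: if
  \<open>\<phi>\<close> jumps between \<open>i\<close> and \<open>j\<close>, those from
  \<open>(i, j)\<close> to \<open>(i, k)\<close> and from \<open>(j, j)\<close> to
  \<open>(j, k)\<close>, otherwise the other two. A commuting square of this kind is a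
  pushout.\<close>

lemma susp_obj_S_obj:
  assumes X: "X \<in> Obj D" and \<phi>: "\<phi> \<in> Delta q 1"
  shows "susp_obj D q \<phi> X \<in> S_obj q D"
  unfolding susp_obj_eq
proof (rule S_objI)
  show "is_diagram D (Ar q) Ar_le (\<lambda>x. if x \<in> Ar q then sus_ob \<phi> X x else VoidO)
      (\<lambda>x y. if x \<in> Ar q \<and> y \<in> Ar q \<and> Ar_le x y then sus_ar \<phi> X x y else VoidA)"
    unfolding is_diagram_def
  proof (intro conjI ballI impI)
    fix x assume x: "x \<in> Ar q"
    have ob: "sus_ob \<phi> X x \<in> Obj D" using X zob by (simp add: sus_ob_def)
    then show "(if x \<in> Ar q then sus_ob \<phi> X x else VoidO) \<in> Obj D" using x by simp
    have "Idn D (sus_ob \<phi> X x) = sus_ar \<phi> X x x"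
      by (rule sus_ar_eq[OF X]) (use ob in \<open>simp_all add: sus_ob_def\<close>)
    then show "(if x \<in> Ar q \<and> x \<in> Ar q \<and> Ar_le x x then sus_ar \<phi> X x x else VoidA) = Idn D (if x \<in> Ar q then sus_ob \<phi> X x else VoidO)"
      using x by simp
  next
    fix x y z assume xyz: "x \<in> Ar q" "y \<in> Ar q" "z \<in> Ar q" "Ar_le x y \<and> Ar_le y z"
    have xz: "Ar_le x z" using xyz Ar_le_trans by blast
    have "sus_ar \<phi> X y z \<cdot> sus_ar \<phi> X x y = sus_ar \<phi> X x z"
    proof (rule sus_ar_eq[OF X])
      assume c: "cut \<phi> x" "cut \<phi> z"
      then have "cut \<phi> y" using cut_convex[OF \<phi>] xyz by blast
      then show "sus_ar \<phi> X y z \<cdot> sus_ar \<phi> X x y = Idn D X" using c X by (simp add: sus_ar_def)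
    qed (use sus_arr[OF X] in simp)
    then show "(if y \<in> Ar q \<and> z \<in> Ar q \<and> Ar_le y z then sus_ar \<phi> X y z else VoidA) \<cdot> (if x \<in> Ar q \<and> y \<in> Ar q \<and> Ar_le x y then sus_ar \<phi> X x y else VoidA)
      = (if x \<in> Ar q \<and> z \<in> Ar q \<and> Ar_le x z then sus_ar \<phi> X x z else VoidA)"
      using xyz xz by simp
  qed (use sus_arr[OF X] in simp_all)
  show "(if (i, i) \<in> Ar q then sus_ob \<phi> X (i, i) else VoidO) = Zob D" if "i \<le> q" for i
    using that cut_Delta(3)[OF \<phi>, of i i i] by (simp add: Ar_iff sus_ob_def)
  fix i j k assume ijk: "i \<le> j" "j \<le> k" "k \<le> q"
  have x: "(i, j) \<in> Ar q" "(i, k) \<in> Ar q" "(j, j) \<in> Ar q" "(j, k) \<in> Ar q"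
    "Ar_le (i, j) (i, k)" "Ar_le (i, j) (j, j)" "Ar_le (i, k) (j, k)" "Ar_le (j, j) (j, k)"
    using ijk by (auto simp: Ar_le_def Ar_iff)
  note c = cut_Delta[OF \<phi> ijk] cut_Delta(3)[OF \<phi> ijk(2) _ ijk(3), simplified]
  note t = sus_arr[OF X, of \<phi>]
  have e: "sus_ar \<phi> X x y = Idn D (sus_ob \<phi> X x)" if "cut \<phi> x = cut \<phi> y" for x y
    by (rule sus_ar_eq[OF X, symmetric]) (use that X zob in \<open>auto simp: sus_ob_def\<close>)
  have ob: "sus_ob \<phi> X x \<in> Obj D" for x using X zob by (simp add: sus_ob_def)
  have "sus_ar \<phi> X (i, j) (i, k) \<in> Cof D"
  proof (cases "cut \<phi> (i, j)")
    case True
    then show ?thesis using e[of "(i, j)" "(i, k)"] c ob idn_cof by simp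
  next
    case False
    then show ?thesis using t[of "(i, j)" "(i, k)"] by (intro zero_cof) (simp_all add: sus_ob_def)
  qed
  then show "(if (i, j) \<in> Ar q \<and> (i, k) \<in> Ar q \<and> Ar_le (i, j) (i, k) then sus_ar \<phi> X (i, j) (i, k) else VoidA) \<in> Cof D"
    using x by simp
  \<comment> \<open>\<open>\<phi>\<close> does not jump both before and after \<open>j\<close>, so
    one of the entries at \<open>(i, j)\<close> and \<open>(j, k)\<close> is \<open>Zob D\<close>,
    and there is only one arrow between them.\<close>
  have sq: "sus_ar \<phi> X (i, k) (j, k) \<cdot> sus_ar \<phi> X (i, j) (i, k) = sus_ar \<phi> X (j, j) (j, k) \<cdot> sus_ar \<phi> X (i, j) (j, j)"
    by (rule zero_arr_unique[of _ "sus_ob \<phi> X (i, j)" "sus_ob \<phi> X (j, k)"]) (use t c in \<open>auto simp: sus_ob_def\<close>)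
  have "is_pushout D (sus_ar \<phi> X (i, j) (i, k)) (sus_ar \<phi> X (i, j) (j, j)) (sus_ar \<phi> X (i, k) (j, k)) (sus_ar \<phi> X (j, j) (j, k))"
  proof (cases "cut \<phi> (i, j)")
    case True
    have "is_pushout D (sus_ar \<phi> X (i, j) (j, j)) (sus_ar \<phi> X (i, j) (i, k)) (sus_ar \<phi> X (j, j) (j, k)) (sus_ar \<phi> X (i, k) (j, k))"
      by (rule pushout_iso[OF t t t t sq[symmetric]]) (use True c e ob iso_idn in simp_all)
    then show ?thesis by (rule pushout_sym)
  next
    case False
    show ?thesis
      by (rule pushout_iso[OF t t t t sq]) (use False c e ob iso_idn in simp_all)
  qed
  then show "is_pushout D
      (if (i, j) \<in> Ar q \<and> (i, k) \<in> Ar q \<and> Ar_le (i, j) (i, k) then sus_ar \<phi> X (i, j) (i, k) else VoidA)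
      (if (i, j) \<in> Ar q \<and> (j, j) \<in> Ar q \<and> Ar_le (i, j) (j, j) then sus_ar \<phi> X (i, j) (j, j) else VoidA)
      (if (i, k) \<in> Ar q \<and> (j, k) \<in> Ar q \<and> Ar_le (i, k) (j, k) then sus_ar \<phi> X (i, k) (j, k) else VoidA)
      (if (j, j) \<in> Ar q \<and> (j, k) \<in> Ar q \<and> Ar_le (j, j) (j, k) then sus_ar \<phi> X (j, j) (j, k) else VoidA)"
    using x by simp
qed auto

lemma susp_arr_sel [simp]:
  "dia_src (susp_arr D q \<phi> f) = susp_obj D q \<phi> (Src D f)" "dia_tgt (susp_arr D q \<phi> f) = susp_obj D q \<phi> (Tgt D f)"
  "dia_cmp (susp_arr D q \<phi> f) x = (if x \<in> Ar q then (if cut \<phi> x then f else Idn D (Zob D)) else VoidA)"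
  by (simp_all add: susp_arr_def)

lemma susp_arr_S_arr:
  assumes f: "f \<in> Arr D" and \<phi>: "\<phi> \<in> Delta q 1"
  shows "susp_arr D q \<phi> f \<in> S_arr q D"
  unfolding susp_arr_def
proof (rule S_arrI)
  fix x y assume xy: "x \<in> Ar q" "y \<in> Ar q" "Ar_le x y"
  let ?t = "\<lambda>x. if cut \<phi> x then f else Idn D (Zob D)"
  have t: "arr (?t x) (sus_ob \<phi> (Src D f) x) (sus_ob \<phi> (Tgt D f) x)" for x
    using f zob by (simp add: sus_ob_def)
  note ob = src_obj[OF f] tgt_obj[OF f]
  have "?t y \<cdot> sus_ar \<phi> (Src D f) x y = sus_ar \<phi> (Tgt D f) x y \<cdot> ?t x"
  proof (cases "cut \<phi> x \<and> cut \<phi> y")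
    case True
    then show ?thesis using f by (simp add: sus_ar_def)
  next
    case False
    show ?thesis
      by (rule zero_arr_unique[of _ "sus_ob \<phi> (Src D f) x" "sus_ob \<phi> (Tgt D f) y"])
        (use t[of x] t[of y] sus_arr[OF ob(1)] sus_arr[OF ob(2)] False in \<open>simp_all add: sus_ob_def split: if_splits\<close>)
  qed
  then show "(if y \<in> Ar q then ?t y else VoidA) \<cdot> dia_ar (susp_obj D q \<phi> (Src D f)) x y =
    dia_ar (susp_obj D q \<phi> (Tgt D f)) x y \<cdot> (if x \<in> Ar q then ?t x else VoidA)"
    using xy by simp
qed (use f \<phi> src_obj tgt_obj susp_obj_S_obj zob in \<open>simp_all add: sus_ob_def\<close>)

lemma susp_functor:
  assumes \<phi>: "\<phi> \<in> Delta q 1"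
  shows "is_functor D SD \<lparr>on_obj = susp_obj D q \<phi>, on_arr = susp_arr D q \<phi>\<rparr>"
proof (rule is_functorI[OF is_cat S_category])
  fix A assume A: "A \<in> Obj D"
  have "susp_arr D q \<phi> (Idn D A) = Idn SD (susp_obj D q \<phi> A)"
    by (rule S_arr_eqI[OF susp_arr_S_arr[OF _ \<phi>] S_Idn[OF susp_obj_S_obj[OF A \<phi>]]])
      (use A in \<open>simp_all add: sus_ob_def\<close>)
  then show "on_arr \<lparr>on_obj = susp_obj D q \<phi>, on_arr = susp_arr D q \<phi>\<rparr> (Idn D A) =
    Idn SD (on_obj \<lparr>on_obj = susp_obj D q \<phi>, on_arr = susp_arr D q \<phi>\<rparr> A)" by simp
next
  fix f g assume fg: "f \<in> Arr D" "g \<in> Arr D" "Src D g = Tgt D f"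
  have "susp_arr D q \<phi> (g \<cdot> f) = Cmp SD (susp_arr D q \<phi> g) (susp_arr D q \<phi> f)"
    by (rule S_arr_eqI[OF susp_arr_S_arr[OF _ \<phi>] S_Cmp[OF susp_arr_S_arr[OF fg(1) \<phi>] susp_arr_S_arr[OF fg(2) \<phi>]]])
      (use fg zob in simp_all)
  then show "on_arr \<lparr>on_obj = susp_obj D q \<phi>, on_arr = susp_arr D q \<phi>\<rparr> (g \<cdot> f) =
    Cmp SD (on_arr \<lparr>on_obj = susp_obj D q \<phi>, on_arr = susp_arr D q \<phi>\<rparr> g) (on_arr \<lparr>on_obj = susp_obj D q \<phi>, on_arr = susp_arr D q \<phi>\<rparr> f)"
    by simp
qed (use susp_obj_S_obj susp_arr_S_arr \<phi> in simp_all)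

lemma susp_weq: "f \<in> Weq D \<Longrightarrow> \<phi> \<in> Delta q 1 \<Longrightarrow> susp_arr D q \<phi> f \<in> Weq SD"
  using susp_arr_S_arr weq_arr idn_weq[OF zob] by (simp add: S_weq_iff)

text \<open>If \<open>X\<close> is zero or \<open>\<phi>\<close> is constant, every entry is
  \<open>Zob D\<close>, whose only endomorphism is the identity. These are the two cases in which a
  structure map of the spectrum must give the base point.\<close>

lemma susp_zero:
  assumes \<phi>: "\<phi> \<in> Delta q 1" and X: "X \<in> Obj D" and "X = Zob D \<or> \<phi> 0 = \<phi> q"
  shows "susp_obj D q \<phi> X = Zob SD"
proof -
  have z: "sus_ob \<phi> X x = Zob D" if x: "x \<in> Ar q" for x
  proof -
    obtain i j where ij: "x = (i, j)" "i \<le> j" "j \<le> q" using x by (cases x) (auto simp: Ar_iff)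
    have "\<phi> 0 \<le> \<phi> i" "\<phi> i \<le> \<phi> j" "\<phi> j \<le> \<phi> q" using DeltaD(2)[OF \<phi>] ij by auto
    then show ?thesis using assms(3) by (auto simp: sus_ob_def cut_def ij)
  qed
  have "sus_ar \<phi> X x y = Idn D (Zob D)" if "x \<in> Ar q" "y \<in> Ar q" for x y
    by (rule zero_arr_unique[OF sus_arr[OF X]]) (use z that zob in simp_all)
  then show ?thesis using z by (auto simp: susp_obj_eq S_con_def fun_eq_iff simp del: split_paired_All)
qed

end

text \<open>\<open>F\<close> preserves the zero object, and the transition arrows of a suspended
  diagram are recognised by \<open>sus_ar_eq\<close>. Taking a restriction for \<open>F\<close>
  gives the compatibility of the structure maps with the simplicial operators; taking an entrywise
  functor and the identity for \<open>\<theta>\<close> gives their compatibility with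
  \<open>K_map\<close>.\<close>

lemma S_fun_susp:
  assumes D: "prewald D" and E: "prewald E" and F: "exact_functor D E F" and \<theta>: "\<theta> \<in> Delta p q"
    and \<phi>: "\<phi> \<in> Delta q 1"
  shows "X \<in> Obj D \<Longrightarrow> on_obj (S_fun p \<theta> F) (susp_obj D q \<phi> X) = susp_obj E p (compose {..p} \<phi> \<theta>) (on_obj F X)"
    "f \<in> Arr D \<Longrightarrow> on_arr (S_fun p \<theta> F) (susp_arr D q \<phi> f) = susp_arr E p (compose {..p} \<phi> \<theta>) (on_arr F f)"
proof -
  interpret D: dia_prewald D q by (rule dia_prewald.intro[OF D])
  interpret E: dia_prewald E p by (rule dia_prewald.intro[OF E])
  note F1 = is_functorD[OF exact_functorD(1)[OF F]]
  note FZ = exact_functorD(2)[OF F]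
  note d = DeltaD[OF \<theta>]
  show ob: "on_obj (S_fun p \<theta> F) (susp_obj D q \<phi> X) = susp_obj E p (compose {..p} \<phi> \<theta>) (on_obj F X)"
    if X: "X \<in> Obj D" for X
  proof -
    have o: "on_obj F (D.sus_ob \<phi> X (map_prod \<theta> \<theta> x)) = E.sus_ob (compose {..p} \<phi> \<theta>) (on_obj F X) x" if "x \<in> Ar p" for x
      using FZ by (simp add: D.sus_ob_def E.sus_ob_def cut_compose[OF that])
    have "on_arr F (D.sus_ar \<phi> X (map_prod \<theta> \<theta> x) (map_prod \<theta> \<theta> y)) = E.sus_ar (compose {..p} \<phi> \<theta>) (on_obj F X) x y"
      if x: "x \<in> Ar p" and y: "y \<in> Ar p" for x y
    proof (rule E.sus_ar_eq)
      show "E.arr (on_arr F (D.sus_ar \<phi> X (map_prod \<theta> \<theta> x) (map_prod \<theta> \<theta> y)))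
        (E.sus_ob (compose {..p} \<phi> \<theta>) (on_obj F X) x) (E.sus_ob (compose {..p} \<phi> \<theta>) (on_obj F X) y)"
        using D.sus_arr[OF X] F1 o x y by simp
    qed (use X F1 in \<open>simp_all add: cut_compose x y D.sus_ar_def\<close>)
    then show ?thesis using d o by (simp add: E.susp_obj_eq S_fun_obj_def fun_eq_iff del: split_paired_All)
  qed
  assume f: "f \<in> Arr D"
  show "on_arr (S_fun p \<theta> F) (susp_arr D q \<phi> f) = susp_arr E p (compose {..p} \<phi> \<theta>) (on_arr F f)"
    using ob D.src_obj[OF f] D.tgt_obj[OF f] F1 f d FZ D.zob
    by (auto simp: S_fun_def susp_arr_def fun_eq_iff cut_compose simp del: split_paired_All)
qed

lemma compose_Delta_id: "\<phi> \<in> Delta q r \<Longrightarrow> compose {..q} \<phi> (\<lambda>i \<in> {..q}. i) = \<phi>"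
  by (auto simp: Delta_def compose_def PiE_def extensional_def fun_eq_iff)

lemma pull_susp:
  assumes C: "prewald C" and \<theta>: "\<theta> \<in> Delta p q" and \<phi>: "\<phi> \<in> Delta q 1"
  shows "X \<in> Obj (S_iter n q C) \<Longrightarrow>
      pull_obj p \<theta> (susp_obj (S_iter n q C) q \<phi> X) = susp_obj (S_iter n p C) p (compose {..p} \<phi> \<theta>) (pull_obj p \<theta> X)"
    "f \<in> Arr (S_iter n q C) \<Longrightarrow>
      pull_arr p \<theta> (susp_arr (S_iter n q C) q \<phi> f) = susp_arr (S_iter n p C) p (compose {..p} \<phi> \<theta>) (pull_arr p \<theta> f)"
proof -
  interpret D: dia_prewald "S_iter n q C" q by (rule dia_prewald.intro[OF S_iter_prewald[OF C]])
  note S = S_fun_susp[OF S_iter_prewald[OF C] S_iter_prewald[OF C] pull_exact[OF C \<theta>] \<theta> \<phi>]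
  show "X \<in> Obj (S_iter n q C) \<Longrightarrow>
      pull_obj p \<theta> (susp_obj (S_iter n q C) q \<phi> X) = susp_obj (S_iter n p C) p (compose {..p} \<phi> \<theta>) (pull_obj p \<theta> X)"
    using S(1) pull_S_fun(1)[OF D.susp_obj_S_obj[OF _ \<phi>]] by simp
  show "f \<in> Arr (S_iter n q C) \<Longrightarrow>
      pull_arr p \<theta> (susp_arr (S_iter n q C) q \<phi> f) = susp_arr (S_iter n p C) p (compose {..p} \<phi> \<theta>) (pull_arr p \<theta> f)"
    using S(2) pull_S_fun(2)[OF D.susp_arr_S_arr[OF _ \<phi>]] by simp
qed

lemma map_dia_susp:
  assumes C: "prewald C" and D: "prewald D" and F: "exact_functor C D F" and \<phi>: "\<phi> \<in> Delta q 1"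
  shows "X \<in> Obj (S_iter n q C) \<Longrightarrow> map_ob F (susp_obj (S_iter n q C) q \<phi> X)
      = susp_obj (S_iter n q D) q \<phi> (map_ob F X)"
    "f \<in> Arr (S_iter n q C) \<Longrightarrow> map_ar F (susp_arr (S_iter n q C) q \<phi> f)
      = susp_arr (S_iter n q D) q \<phi> (map_ar F f)"
proof -
  interpret C: dia_prewald "S_iter n q C" q by (rule dia_prewald.intro[OF S_iter_prewald[OF C]])
  note S = S_fun_susp[OF S_iter_prewald[OF C] S_iter_prewald[OF D] map_dia_exact[OF C D F, of n q] Delta_id \<phi>]
  show "X \<in> Obj (S_iter n q C) \<Longrightarrow> map_ob F (susp_obj (S_iter n q C) q \<phi> X)
      = susp_obj (S_iter n q D) q \<phi> (map_ob F X)"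
    using S(1)[of X] map_dia_S_fun(1)[OF C.susp_obj_S_obj[OF _ \<phi>], of X F] by (simp add: compose_Delta_id[OF \<phi>])
  show "f \<in> Arr (S_iter n q C) \<Longrightarrow> map_ar F (susp_arr (S_iter n q C) q \<phi> f)
      = susp_arr (S_iter n q D) q \<phi> (map_ar F f)"
    using S(2)[of f] map_dia_S_fun(2)[OF C.susp_arr_S_arr[OF _ \<phi>], of f F] by (simp add: compose_Delta_id[OF \<phi>])
qed

section \<open>Simplices, structure maps and induced maps\<close>

lemma K_simplexI:
  assumes "is_diagram (S_iter n q C) {..q} (\<le>) A f"
    "\<And>i. \<not> i \<le> q \<Longrightarrow> A i = VoidO"
    "\<And>i j. i \<le> j \<Longrightarrow> j \<le> q \<Longrightarrow> f i j \<in> Weq (S_iter n q C)"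
    "\<And>i j. \<not> (i \<le> j \<and> j \<le> q) \<Longrightarrow> f i j = VoidA"
  shows "(A, f) \<in> simplices (K_level C n) q"
  using assms unfolding K_level_def by simp

lemma K_simplexD:
  assumes "(A, f) \<in> simplices (K_level C n) q"
  shows "is_diagram (S_iter n q C) {..q} (\<le>) A f"
    "\<not> i \<le> q \<Longrightarrow> A i = VoidO"
    "i \<le> j \<Longrightarrow> j \<le> q \<Longrightarrow> f i j \<in> Weq (S_iter n q C)"
    "\<not> (i \<le> j \<and> j \<le> q) \<Longrightarrow> f i j = VoidA"
proof -
  have 1: "is_diagram (S_iter n q C) {..q} (\<le>) A f"
    and A: "\<forall>i. i \<notin> {..q} \<longrightarrow> A i = VoidO"
    and f: "\<forall>i j. if i \<le> j \<and> j \<le> q then f i j \<in> Weq (S_iter n q C) else f i j = VoidA"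
    using assms unfolding K_level_def by auto
  show "is_diagram (S_iter n q C) {..q} (\<le>) A f" by (rule 1)
  show "\<not> i \<le> q \<Longrightarrow> A i = VoidO" using A by simp
  show "i \<le> j \<Longrightarrow> j \<le> q \<Longrightarrow> f i j \<in> Weq (S_iter n q C)" using f by metis
  show "\<not> (i \<le> j \<and> j \<le> q) \<Longrightarrow> f i j = VoidA" using f by metis
qed

lemma diagramD:
  fixes i j k q :: nat
  assumes "is_diagram C {..q} (\<le>) A f"
  shows "i \<le> q \<Longrightarrow> A i \<in> Obj C" "i \<le> q \<Longrightarrow> f i i = Idn C (A i)"
    "i \<le> j \<Longrightarrow> j \<le> q \<Longrightarrow> f i j \<in> Arr C" "i \<le> j \<Longrightarrow> j \<le> q \<Longrightarrow> Src C (f i j) = A i"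
    "i \<le> j \<Longrightarrow> j \<le> q \<Longrightarrow> Tgt C (f i j) = A j"
    "i \<le> j \<Longrightarrow> j \<le> k \<Longrightarrow> k \<le> q \<Longrightarrow> Cmp C (f j k) (f i j) = f i k"
  using assms le_trans[of i j q] le_trans[of j k q] by (auto simp: is_diagram_def)

lemma diagramI:
  fixes q :: nat
  assumes "\<And>i. i \<le> q \<Longrightarrow> A i \<in> Obj C" "\<And>i. i \<le> q \<Longrightarrow> f i i = Idn C (A i)"
    "\<And>i j. i \<le> j \<Longrightarrow> j \<le> q \<Longrightarrow> f i j \<in> Arr C \<and> Src C (f i j) = A i \<and> Tgt C (f i j) = A j"
    "\<And>i j k. i \<le> j \<Longrightarrow> j \<le> k \<Longrightarrow> k \<le> q \<Longrightarrow> Cmp C (f j k) (f i j) = f i k"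
  shows "is_diagram C {..q} (\<le>) A f"
  using assms by (simp add: is_diagram_def)

text \<open>A functor that preserves weak equivalences may be applied to a chain after reindexing it
  along \<open>\<theta>\<close>. Simplicial operators, suspension and \<open>K_map\<close> are all
  of this form, the last two with the identity for \<open>\<theta>\<close>.\<close>

lemma K_simplex_functor:
  assumes x: "(A, f) \<in> simplices (K_level C n) q" and F: "is_functor (S_iter n q C) (S_iter m p D) \<lparr>on_obj = FO, on_arr = FA\<rparr>"
    and W: "\<And>g. g \<in> Weq (S_iter n q C) \<Longrightarrow> FA g \<in> Weq (S_iter m p D)" and \<theta>: "\<theta> \<in> Delta p q"
  shows "(\<lambda>i. if i \<le> p then FO (A (\<theta> i)) else VoidO,
    \<lambda>i j. if i \<le> j \<and> j \<le> p then FA (f (\<theta> i) (\<theta> j)) else VoidA) \<in> simplices (K_level D m) p"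
proof -
  note dg = K_simplexD(1)[OF x] and w = K_simplexD(3)[OF x]
  note d = DeltaD(1,2)[OF \<theta>] and g = diagramD[OF dg] and F1 = is_functorD[OF F, simplified]
  show ?thesis
  proof (rule K_simplexI)
    show "is_diagram (S_iter m p D) {..p} (\<le>) (\<lambda>i. if i \<le> p then FO (A (\<theta> i)) else VoidO)
      (\<lambda>i j. if i \<le> j \<and> j \<le> p then FA (f (\<theta> i) (\<theta> j)) else VoidA)"
    proof (rule diagramI)
      fix i j k assume ijk: "i \<le> j" "j \<le> k" "k \<le> p"
      have t: "\<theta> i \<le> \<theta> j" "\<theta> j \<le> \<theta> k" "\<theta> k \<le> q" using ijk d by auto
      then have "\<theta> j \<le> q" by simp
      then show "Cmp (S_iter m p D) (if j \<le> k \<and> k \<le> p then FA (f (\<theta> j) (\<theta> k)) else VoidA)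
        (if i \<le> j \<and> j \<le> p then FA (f (\<theta> i) (\<theta> j)) else VoidA) = (if i \<le> k \<and> k \<le> p then FA (f (\<theta> i) (\<theta> k)) else VoidA)"
        using ijk F1(8)[of "f (\<theta> i) (\<theta> j)" "f (\<theta> j) (\<theta> k)"] g t by simp
    qed (use d g F1 in simp_all)
  qed (use d w W in auto)
qed

lemma K_level_sel:
  "spt (K_level C n) q =
       (\<lambda>i. if i \<le> q then Zob (S_iter n q C) else VoidO,
        \<lambda>i j. if i \<le> j \<and> j \<le> q then Idn (S_iter n q C) (Zob (S_iter n q C)) else VoidA)"
  "act (K_level C n) p q \<theta> (A, f) =
       (\<lambda>i. if i \<le> p then pull_obj p \<theta> (A (\<theta> i)) else VoidO,
        \<lambda>i j. if i \<le> j \<and> j \<le> p then pull_arr p \<theta> (f (\<theta> i) (\<theta> j)) else VoidA)"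
  by (simp_all add: K_level_def)

lemma K_level_sset:
  assumes C: "prewald C"
  shows "is_sset (K_level C n)"
  unfolding is_sset_def
proof (intro conjI allI ballI)
  fix q
  interpret S: prewald "S_iter n q C" by (rule S_iter_prewald[OF C])
  show "spt (K_level C n) q \<in> simplices (K_level C n) q"
    unfolding K_level_sel
    by (rule K_simplexI) (use S.zob S.idn_weq in \<open>auto simp: is_diagram_def\<close>)
  fix x assume x: "x \<in> simplices (K_level C n) q"
  obtain A f where x': "x = (A, f)" by (cases x)
  note dg = K_simplexD(1)[OF x[unfolded x']] and v = K_simplexD(2,4)[OF x[unfolded x']]
  show "act (K_level C n) q q (\<lambda>i\<in>{..q}. i) x = x"
    using v diagramD[OF dg] pull_id[where n = n and C = C and q = q] by (auto simp: x' K_level_sel fun_eq_iff)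
next
  fix p q \<theta> assume \<theta>: "\<theta> \<in> Delta p q"
  interpret S: prewald "S_iter n q C" by (rule S_iter_prewald[OF C])
  note P = pull_exact[OF C \<theta>, of n]
  show "act (K_level C n) p q \<theta> (spt (K_level C n) q) = spt (K_level C n) p"
    using exact_functorD(2)[OF P] is_functorD(4)[OF exact_functorD(1)[OF P] S.zob] DeltaD(1,2)[OF \<theta>]
    by (auto simp: K_level_sel fun_eq_iff)
  fix x assume x: "x \<in> simplices (K_level C n) q"
  obtain A f where x': "x = (A, f)" by (cases x)
  show "act (K_level C n) p q \<theta> x \<in> simplices (K_level C n) p"
    using K_simplex_functor[OF x[unfolded x'] exact_functorD(1)[OF P] exact_functorD(4)[OF P, simplified] \<theta>] by (simp add: x' K_level_sel)
next
  fix r p q \<eta> \<theta> x assume \<eta>: "\<eta> \<in> Delta r p" and \<theta>: "\<theta> \<in> Delta p q" and "x \<in> simplices (K_level C n) q"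
  obtain A f where x': "x = (A, f)" by (cases x)
  show "act (K_level C n) r p \<eta> (act (K_level C n) p q \<theta> x) = act (K_level C n) r q (compose {..r} \<theta> \<eta>) x"
    using DeltaD(1,2)[OF \<eta>] by (simp add: x' K_level_sel fun_eq_iff pull_pull[OF \<eta>] compose_def)
qed

lemma K_spectrum_sel:
  "level (K_spectrum C) = K_level C"
  "susp (K_spectrum C) n q \<phi> (A, f) =
       (\<lambda>i. if i \<le> q then susp_obj (S_iter n q C) q \<phi> (A i) else VoidO,
        \<lambda>i j. if i \<le> j \<and> j \<le> q then susp_arr (S_iter n q C) q \<phi> (f i j) else VoidA)"
  by (simp_all add: K_spectrum_def)

text \<open>Suspension is a functor that preserves weak equivalences, so it sends simplices to
  simplices. Compatibility with the simplicial operators is \<open>pull_susp\<close>, and the base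
  point conditions are \<open>susp_zero\<close>.\<close>

theorem K_spectrum_is_spectrum:
  assumes C: "prewald C"
  shows "is_spectrum (K_spectrum C)"
  unfolding is_spectrum_def K_spectrum_sel
proof (intro conjI allI ballI impI)
  show "is_sset (K_level C n)" for n by (rule K_level_sset[OF C])
next
  fix n q \<phi> x assume \<phi>: "\<phi> \<in> Delta q 1" and x: "x \<in> simplices (K_level C n) q"
  interpret S: dia_prewald "S_iter n q C" q by (rule dia_prewald.intro[OF S_iter_prewald[OF C]])
  obtain A f where x': "x = (A, f)" by (cases x)
  note g = diagramD[OF K_simplexD(1)[OF x[unfolded x']]]
  have "(\<lambda>i. if i \<le> q then susp_obj (S_iter n q C) q \<phi> (A ((\<lambda>i\<in>{..q}. i) i)) else VoidO,
        \<lambda>i j. if i \<le> j \<and> j \<le> q then susp_arr (S_iter n q C) q \<phi> (f ((\<lambda>i\<in>{..q}. i) i) ((\<lambda>i\<in>{..q}. i) j)) else VoidA)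
      \<in> simplices (K_level C (Suc n)) q"
    using K_simplex_functor[where m = "Suc n" and D = C and FO = "susp_obj (S_iter n q C) q \<phi>" and FA = "susp_arr (S_iter n q C) q \<phi>",
        OF x[unfolded x'] _ _ Delta_id] S.susp_functor[OF \<phi>] S.susp_weq[OF _ \<phi>] by simp
  then show "susp (K_spectrum C) n q \<phi> x \<in> simplices (K_level C (Suc n)) q"
    by (simp add: x' K_spectrum_sel cong: if_cong conj_cong)
  show "act (K_level C (Suc n)) p q \<theta> (susp (K_spectrum C) n q \<phi> x) =
      susp (K_spectrum C) n p (compose {..p} \<phi> \<theta>) (act (K_level C n) p q \<theta> x)" if \<theta>: "\<theta> \<in> Delta p q" for p \<theta>
    using DeltaD(1,2)[OF \<theta>] g pull_susp[OF C \<theta> \<phi>, where n = n]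
    by (simp add: x' K_spectrum_sel K_level_sel fun_eq_iff)
  show "susp (K_spectrum C) n q \<phi> x = spt (K_level C (Suc n)) q" if z: "\<phi> 0 = \<phi> q"
  proof -
    have 1: "susp_obj (S_iter n q C) q \<phi> (A i) = Zob S.SD" if "i \<le> q" for i
      using S.susp_zero[OF \<phi> g(1)[OF that]] z by simp
    \<comment> \<open>A constant \<open>\<phi>\<close> cuts no index, so every entry of the
      suspended arrow is the identity of the zero object.\<close>
    have 2: "susp_arr (S_iter n q C) q \<phi> (f i j) = Idn S.SD (Zob S.SD)" if "i \<le> j" "j \<le> q" for i j
    proof (rule S_arr_eqI[OF S.susp_arr_S_arr[OF g(3)[OF that] \<phi>] S.S_Idn[OF S.S_zob]])
      fix y assume y: "y \<in> Ar q"
      then obtain k l where kl: "y = (k, l)" "k \<le> l" "l \<le> q" by (cases y) (auto simp: Ar_iff)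
      have "\<phi> 0 \<le> \<phi> k" "\<phi> k \<le> \<phi> l" "\<phi> l \<le> \<phi> q" using DeltaD(2)[OF \<phi>] kl by auto
      then have "\<not> cut \<phi> y" using z by (auto simp: cut_def kl)
      then show "dia_cmp (susp_arr (S_iter n q C) q \<phi> (f i j)) y = dia_cmp (Idn S.SD (Zob S.SD)) y" using y by simp
    qed (use 1 g that in simp_all)
    show ?thesis using 1 2 by (simp add: x' K_spectrum_sel K_level_sel fun_eq_iff)
  qed
next
  fix n q \<phi> assume \<phi>: "\<phi> \<in> Delta q 1"
  interpret S: dia_prewald "S_iter n q C" q by (rule dia_prewald.intro[OF S_iter_prewald[OF C]])
  have 1: "susp_obj (S_iter n q C) q \<phi> (Zob (S_iter n q C)) = Zob S.SD"
    using S.susp_zero[OF \<phi> S.zob] by simp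
  have 2: "susp_arr (S_iter n q C) q \<phi> (Idn (S_iter n q C) (Zob (S_iter n q C))) = Idn S.SD (Zob S.SD)"
    using is_functorD(4)[OF S.susp_functor[OF \<phi>] S.zob] 1 by simp
  show "susp (K_spectrum C) n q \<phi> (spt (K_level C n) q) = spt (K_level C (Suc n)) q"
    using 1 2 by (simp add: K_spectrum_sel K_level_sel fun_eq_iff)
qed

text \<open>\<open>K_map\<close> changes only the leaves, hence commutes with restriction on raw
  diagrams. Exactness is what makes it preserve simplices and the base point and commute with
  suspension.\<close>

theorem K_map_spectrum_map:
  assumes C: "prewald C" and D: "prewald D" and F: "exact_functor C D F"
  shows "spectrum_map (K_spectrum C) (K_spectrum D) (K_map F)"
  unfolding spectrum_map_def K_spectrum_sel
proof (intro conjI allI ballI)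
  fix n q
  interpret S: prewald "S_iter n q C" by (rule S_iter_prewald[OF C])
  note P = map_dia_exact[OF C D F, of n q]
  show "K_map F n q (spt (K_level C n) q) = spt (K_level D n) q"
    using exact_functorD(2)[OF P] is_functorD(4)[OF exact_functorD(1)[OF P] S.zob]
    by (auto simp: K_map_def K_level_sel fun_eq_iff)
  fix x assume x: "x \<in> simplices (K_level C n) q"
  obtain A f where x': "x = (A, f)" by (cases x)
  note v = K_simplexD(2,4)[OF x[unfolded x']] and g = diagramD[OF K_simplexD(1)[OF x[unfolded x']]]
  have "K_map F n q x = (\<lambda>i. if i \<le> q then map_ob F (A ((\<lambda>i\<in>{..q}. i) i)) else VoidO,
    \<lambda>i j. if i \<le> j \<and> j \<le> q then map_ar F (f ((\<lambda>i\<in>{..q}. i) i) ((\<lambda>i\<in>{..q}. i) j)) else VoidA)"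
    using v by (auto simp: K_map_def x' fun_eq_iff)
  then show "K_map F n q x \<in> simplices (K_level D n) q"
    using K_simplex_functor[OF x[unfolded x'] exact_functorD(1)[OF P] exact_functorD(4)[OF P, simplified] Delta_id] by simp
  show "K_map F n p (act (K_level C n) p q \<theta> x) = act (K_level D n) p q \<theta> (K_map F n q x)" for p \<theta>
    by (simp add: x' K_map_def K_level_sel fun_eq_iff map_dia_pull)
  show "K_map F (Suc n) q (susp (K_spectrum C) n q \<phi> x) = susp (K_spectrum D) n q \<phi> (K_map F n q x)" if \<phi>: "\<phi> \<in> Delta q 1" for \<phi>
    using g map_dia_susp[OF C D F \<phi>, where n = n] by (simp add: x' K_map_def K_spectrum_sel fun_eq_iff)
qed

section \<open>Natural isomorphisms and homotopies\<close>

lemma natural_isoD: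
  assumes "natural_iso C D F G \<eta>"
  shows "A \<in> Obj C \<Longrightarrow> iso_arrow D (\<eta> A)" "A \<in> Obj C \<Longrightarrow> \<eta> A \<in> Arr D"
    "A \<in> Obj C \<Longrightarrow> Src D (\<eta> A) = on_obj F A" "A \<in> Obj C \<Longrightarrow> Tgt D (\<eta> A) = on_obj G A"
    "f \<in> Arr C \<Longrightarrow> Cmp D (\<eta> (Tgt C f)) (on_arr F f) = Cmp D (on_arr G f) (\<eta> (Src C f))"
proof -
  note n = assms[unfolded natural_iso_def]
  show iso: "A \<in> Obj C \<Longrightarrow> iso_arrow D (\<eta> A)" using n by blast
  show "A \<in> Obj C \<Longrightarrow> \<eta> A \<in> Arr D" using iso by (simp add: iso_arrow_def)
  show "A \<in> Obj C \<Longrightarrow> Src D (\<eta> A) = on_obj F A" "A \<in> Obj C \<Longrightarrow> Tgt D (\<eta> A) = on_obj G A"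
    "f \<in> Arr C \<Longrightarrow> Cmp D (\<eta> (Tgt C f)) (on_arr F f) = Cmp D (on_arr G f) (\<eta> (Src C f))"
    using n by blast+
qed

text \<open>A naturality square with invertible sides can be read backwards, so the inverses of the
  entries form an arrow of diagrams.\<close>

lemma (in dia_prewald) S_isoI:
  assumes f: "f \<in> S_arr q D" and iso: "\<And>x. x \<in> Ar q \<Longrightarrow> iso_arrow D (dia_cmp f x)"
  shows "iso_arrow SD f"
proof -
  interpret S: cat SD using S_category by unfold_locales
  note tf = S_arrD(2,3)[OF f]
  have "\<forall>x \<in> Ar q. \<exists>g. arr g (dia_ob (dia_tgt f) x) (dia_ob (dia_src f) x) \<and>
      g \<cdot> dia_cmp f x = Idn D (dia_ob (dia_src f) x) \<and> dia_cmp f x \<cdot> g = Idn D (dia_ob (dia_tgt f) x)"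
  proof
    fix x assume x: "x \<in> Ar q"
    show "\<exists>g. arr g (dia_ob (dia_tgt f) x) (dia_ob (dia_src f) x) \<and>
      g \<cdot> dia_cmp f x = Idn D (dia_ob (dia_src f) x) \<and> dia_cmp f x \<cdot> g = Idn D (dia_ob (dia_tgt f) x)"
      using isoE[OF iso[OF x] S_cmp_arr[OF f x]] by blast
  qed
  from bchoice[OF this] obtain g where g: "\<forall>x \<in> Ar q. arr (g x) (dia_ob (dia_tgt f) x) (dia_ob (dia_src f) x) \<and>
      g x \<cdot> dia_cmp f x = Idn D (dia_ob (dia_src f) x) \<and> dia_cmp f x \<cdot> g x = Idn D (dia_ob (dia_tgt f) x)"
    by (rule exE)
  note g = g[rule_format]
  define h where "h = DiaA (dia_tgt f) (dia_src f) (\<lambda>x. if x \<in> Ar q then g x else VoidA)"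
  have h: "h \<in> S_arr q D"
    unfolding h_def
  proof (rule S_arrI[OF tf(2,1)])
    fix x y assume xy: "x \<in> Ar q" "y \<in> Ar q" "Ar_le x y"
    note ty = g[OF xy(1), THEN conjunct1] g[OF xy(2), THEN conjunct1] S_cmp_arr[OF f xy(1)] S_cmp_arr[OF f xy(2)]
      ar_arr[OF tf(1) xy] ar_arr[OF tf(2) xy]
    have "g y \<cdot> dia_ar (dia_tgt f) x y = g y \<cdot> dia_ar (dia_tgt f) x y \<cdot> dia_cmp f x \<cdot> g x"
      using g[OF xy(1)] ty by simp
    also have "dia_ar (dia_tgt f) x y \<cdot> dia_cmp f x \<cdot> g x = dia_cmp f y \<cdot> dia_ar (dia_src f) x y \<cdot> g x"
      by (rule reassoc) (use S_arrD(8)[OF f xy] ty in simp_all)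
    also have "g y \<cdot> dia_cmp f y \<cdot> dia_ar (dia_src f) x y \<cdot> g x = Idn D (dia_ob (dia_src f) y) \<cdot> dia_ar (dia_src f) x y \<cdot> g x"
      by (rule reassoc') (use g[OF xy(2)] ty in simp_all)
    finally have "g y \<cdot> dia_ar (dia_tgt f) x y = dia_ar (dia_src f) x y \<cdot> g x" using ty by simp
    then show "(if y \<in> Ar q then g y else VoidA) \<cdot> dia_ar (dia_tgt f) x y = dia_ar (dia_src f) x y \<cdot> (if x \<in> Ar q then g x else VoidA)"
      using xy by simp
  qed (use g in simp_all)
  show ?thesis
  proof (rule S.isoI[of f "dia_src f" "dia_tgt f" h])
    show "Cmp SD h f = Idn SD (dia_src f)"
      by (rule S_arr_eqI[OF S_Cmp[OF f h] S_Idn[OF tf(1)]]) (use g in \<open>simp_all add: h_def\<close>)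
    show "Cmp SD f h = Idn SD (dia_tgt f)"
      by (rule S_arr_eqI[OF S_Cmp[OF h f] S_Idn[OF tf(2)]]) (use g in \<open>simp_all add: h_def\<close>)
  qed (use f h in \<open>simp_all add: h_def\<close>)
qed

text \<open>The component, at an iterated diagram, of the natural isomorphism that
  \<open>\<eta>\<close> induces on the iterated S-construction; at the leaves it is a component of
  \<open>\<eta>\<close>.\<close>

primrec iso_dia :: "('o, 'm, 'p, 'n) cat_functor \<Rightarrow> ('o, 'm, 'p, 'n) cat_functor \<Rightarrow> ('o \<Rightarrow> 'n) \<Rightarrow>
    ('o, 'm) dia_obj \<Rightarrow> ('p, 'n) dia_arr" where
  "iso_dia F G \<eta> VoidO = VoidA"
| "iso_dia F G \<eta> (LeafO A) = LeafA (\<eta> A)"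
| "iso_dia F G \<eta> (DiaO A f) = DiaA (map_ob F (DiaO A f)) (map_ob G (DiaO A f))
     (\<lambda>x. iso_dia F G \<eta> (A x))"

lemma iso_dia_sel:
  assumes "X \<in> S_obj q D"
  shows "dia_src (iso_dia F G \<eta> X) = map_ob F X"
    "dia_tgt (iso_dia F G \<eta> X) = map_ob G X"
    "dia_cmp (iso_dia F G \<eta> X) x = iso_dia F G \<eta> (dia_ob X x)"
proof -
  obtain A f where "X = DiaO A f" using assms by (auto simp: S_obj_def)
  then show "dia_src (iso_dia F G \<eta> X) = map_ob F X"
    "dia_tgt (iso_dia F G \<eta> X) = map_ob G X"
    "dia_cmp (iso_dia F G \<eta> X) x = iso_dia F G \<eta> (dia_ob X x)" by simp_all
qed

lemma map_dia_sel:
  "X \<in> S_obj q D \<Longrightarrow> dia_ob (map_dia_obj F G X) x = map_dia_obj F G (dia_ob X x)"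
  "X \<in> S_obj q D \<Longrightarrow> dia_ar (map_dia_obj F G X) x y = map_dia_arr F G (dia_ar X x y)"
  "g \<in> S_arr q D \<Longrightarrow> dia_src (map_dia_arr F G g) = map_dia_obj F G (dia_src g)"
  "g \<in> S_arr q D \<Longrightarrow> dia_tgt (map_dia_arr F G g) = map_dia_obj F G (dia_tgt g)"
  "g \<in> S_arr q D \<Longrightarrow> dia_cmp (map_dia_arr F G g) x = map_dia_arr F G (dia_cmp g x)"
  by (auto simp: S_obj_def S_arr_def)

text \<open>Induction on \<open>n\<close>. Naturality at level \<open>n\<close>, applied to the
  transition arrows of a diagram, says that the components at its entries form an arrow at level
  \<open>n + 1\<close>. Naturality of these arrows is again checked in each entry.\<close>

lemma iso_dia_natural:
  assumes C: "prewald C" and D: "prewald D" and F: "exact_functor C D F" and G: "exact_functor C D G"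
    and \<eta>: "natural_iso C D F G \<eta>"
  shows "natural_iso (S_iter n q C) (S_iter n q D) (map_dia F) (map_dia G) (iso_dia F G \<eta>)"
proof (induction n)
  case 0
  note N = natural_isoD[OF \<eta>]
  interpret C: prewald C by (rule C)
  show ?case unfolding natural_iso_def using N by (auto simp: leaf_iso C.src_obj C.tgt_obj)
next
  case (Suc n)
  interpret C: dia_prewald "S_iter n q C" q by (rule dia_prewald.intro[OF S_iter_prewald[OF C]])
  interpret D: dia_prewald "S_iter n q D" q by (rule dia_prewald.intro[OF S_iter_prewald[OF D]])
  note N = natural_isoD[OF Suc.IH, simplified]
  note mF = is_functorD[OF exact_functorD(1)[OF map_dia_exact[OF C D F, of "Suc n" q]], simplified]
    and mG = is_functorD[OF exact_functorD(1)[OF map_dia_exact[OF C D G, of "Suc n" q]], simplified]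
  have arr: "iso_dia F G \<eta> X \<in> S_arr q (S_iter n q D)" if X: "X \<in> S_obj q (S_iter n q C)" for X
  proof -
    obtain A f where X': "X = DiaO A f" using X by (auto simp: S_obj_def)
    have ob: "A x \<in> Obj (S_iter n q C)" if "x \<in> Ar q" for x using C.ob_obj[OF X that] by (simp add: X')
    show ?thesis
      unfolding X' iso_dia.simps
    proof (rule S_arrI)
      show "map_ob F (DiaO A f) \<in> S_obj q (S_iter n q D)"
        "map_ob G (DiaO A f) \<in> S_obj q (S_iter n q D)"
        by (rule mF(3)[OF X, unfolded X'] mG(3)[OF X, unfolded X'])+
      show "iso_dia F G \<eta> (A x) = VoidA" if "x \<notin> Ar q" for x
        using S_objD(3)[OF X that] by (simp add: X')
      fix x y assume xy: "x \<in> Ar q" "y \<in> Ar q" "Ar_le x y"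
      have "f x y \<in> Arr (S_iter n q C)" "Src (S_iter n q C) (f x y) = A x" "Tgt (S_iter n q C) (f x y) = A y"
        using C.ar_arr[OF X xy] by (simp_all add: X')
      then show "Cmp (S_iter n q D) (iso_dia F G \<eta> (A y)) (dia_ar (map_ob F (DiaO A f)) x y) =
        Cmp (S_iter n q D) (dia_ar (map_ob G (DiaO A f)) x y) (iso_dia F G \<eta> (A x))"
        using N(5)[of "f x y"] by simp
    qed (use N ob in simp_all)
  qed
  show ?case
    unfolding natural_iso_def
  proof (intro conjI ballI)
    fix X assume "X \<in> Obj (S_iter (Suc n) q C)"
    then have X: "X \<in> S_obj q (S_iter n q C)" by simp
    have "iso_arrow D.SD (iso_dia F G \<eta> X)"
      by (rule D.S_isoI[OF arr[OF X]]) (use N(1) C.ob_obj[OF X] in \<open>simp add: iso_dia_sel[OF X]\<close>)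
    then show "iso_arrow (S_iter (Suc n) q D) (iso_dia F G \<eta> X)" by simp
    show "Src (S_iter (Suc n) q D) (iso_dia F G \<eta> X) = on_obj (map_dia F) X"
      "Tgt (S_iter (Suc n) q D) (iso_dia F G \<eta> X) = on_obj (map_dia G) X"
      by (simp_all add: iso_dia_sel[OF X])
  next
    fix f assume "f \<in> Arr (S_iter (Suc n) q C)"
    then have f: "f \<in> S_arr q (S_iter n q C)" by simp
    note ob = S_arrD(2,3)[OF f]
    have fF: "map_ar F f \<in> S_arr q (S_iter n q D)"
      and fG: "map_ar G f \<in> S_arr q (S_iter n q D)" using mF(5) mG(5) f by auto
    have "Cmp D.SD (iso_dia F G \<eta> (dia_tgt f)) (map_ar F f) =
        Cmp D.SD (map_ar G f) (iso_dia F G \<eta> (dia_src f))"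
    proof (rule S_arr_eqI[OF D.S_Cmp[OF fF arr[OF ob(2)]] D.S_Cmp[OF arr[OF ob(1)] fG]])
      fix x assume x: "x \<in> Ar q"
      show "dia_cmp (Cmp D.SD (iso_dia F G \<eta> (dia_tgt f)) (map_ar F f)) x =
        dia_cmp (Cmp D.SD (map_ar G f) (iso_dia F G \<eta> (dia_src f))) x"
        using x N(5)[of "dia_cmp f x"] C.S_cmp_arr[OF f x] by (simp add: iso_dia_sel[OF ob(1)] iso_dia_sel[OF ob(2)] map_dia_sel(3-5)[OF f])
    qed (simp_all add: iso_dia_sel[OF ob(1)] iso_dia_sel[OF ob(2)] map_dia_sel(3-5)[OF f])
    then show "Cmp (S_iter (Suc n) q D) (iso_dia F G \<eta> (Tgt (S_iter (Suc n) q C) f)) (on_arr (map_dia F) f) =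
        Cmp (S_iter (Suc n) q D) (on_arr (map_dia G) f) (iso_dia F G \<eta> (Src (S_iter (Suc n) q C) f))" by simp
  qed
qed

lemma iso_dia_pull:
  fixes X :: "('o, 'm) dia_obj"
  shows "pull_arr p \<theta> (iso_dia F G \<eta> X) = iso_dia F G \<eta> (pull_obj p \<theta> X)"
proof -
  \<comment> \<open>The induction rule of the mutually recursive datatypes treats objects and arrows
    together; the claim made about arrows is the trivial one.\<close>
  have "pull_arr p \<theta> (iso_dia F G \<eta> X) = iso_dia F G \<eta> (pull_obj p \<theta> X)" and "True" for Y :: "('o, 'm) dia_arr"
  proof (induction X and Y)
    case (DiaO A f)
    note IH = DiaO(1)[OF rangeI]
    have m: "pull_obj p \<theta> (map_dia_obj F' G' (DiaO A f)) = map_dia_obj F' G' (pull_obj p \<theta> (DiaO A f))" for F' G'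
      by (rule map_dia_pull(1)[symmetric])
    show ?case using m[of "on_obj F" "on_arr F"] m[of "on_obj G" "on_arr G"]
      by (simp add: fun_eq_iff IH del: split_paired_All)
  qed simp_all
  then show ?thesis by blast
qed

section \<open>The homotopy of a natural isomorphism\<close>

context
  fixes C :: "('o, 'm) waldhausen" and D :: "('p, 'n) waldhausen" and F G \<eta>
  assumes C: "prewald C" and D: "prewald D" and F: "exact_functor C D F" and G: "exact_functor C D G"
    and \<eta>: "natural_iso C D F G \<eta>"
begin

text \<open>Source and target are the chosen zero object, since both functors preserve it, and
  between zero objects there is only one arrow.\<close>

lemma iso_dia_Zob: "iso_dia F G \<eta> (Zob (S_iter n q C)) = Idn (S_iter n q D) (Zob (S_iter n q D))"
proof -
  interpret SC: prewald "S_iter n q C" by (rule S_iter_prewald[OF C])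
  interpret SD: prewald "S_iter n q D" by (rule S_iter_prewald[OF D])
  note N = natural_isoD[OF iso_dia_natural[OF C D F G \<eta>], of _ n q, simplified]
  note Z = exact_functorD(2)[OF map_dia_exact[OF C D F, of n q], simplified] exact_functorD(2)[OF map_dia_exact[OF C D G, of n q], simplified]
  show ?thesis
    by (rule SD.from_zero_unique[of _ "Zob (S_iter n q D)"]) (use N(2-4)[OF SC.zob] Z SD.zob in simp_all)
qed

text \<open>At the cut indices the suspended diagram has the entry \<open>X\<close> and the
  component is the one at \<open>X\<close>; elsewhere the entry is zero and the component an
  identity by \<open>iso_dia_Zob\<close>.\<close>

lemma iso_dia_susp:
  assumes \<phi>: "\<phi> \<in> Delta q 1" and X: "X \<in> Obj (S_iter n q C)"
  shows "iso_dia F G \<eta> (susp_obj (S_iter n q C) q \<phi> X) = susp_arr (S_iter n q D) q \<phi> (iso_dia F G \<eta> X)"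
proof -
  interpret SC: dia_prewald "S_iter n q C" q by (rule dia_prewald.intro[OF S_iter_prewald[OF C]])
  note N = natural_isoD[OF iso_dia_natural[OF C D F G \<eta>], of _ n q, simplified]
  have s: "susp_obj (S_iter n q C) q \<phi> X \<in> S_obj q (S_iter n q C)" by (rule SC.susp_obj_S_obj[OF X \<phi>])
  have eq: "iso_dia F G \<eta> (susp_obj (S_iter n q C) q \<phi> X) =
      DiaA (dia_src (iso_dia F G \<eta> (susp_obj (S_iter n q C) q \<phi> X))) (dia_tgt (iso_dia F G \<eta> (susp_obj (S_iter n q C) q \<phi> X)))
        (dia_cmp (iso_dia F G \<eta> (susp_obj (S_iter n q C) q \<phi> X)))"
    by (simp add: SC.susp_obj_eq)
  have "dia_cmp (iso_dia F G \<eta> (susp_obj (S_iter n q C) q \<phi> X)) =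
      (\<lambda>x. if x \<in> Ar q then (if cut \<phi> x then iso_dia F G \<eta> X else Idn (S_iter n q D) (Zob (S_iter n q D))) else VoidA)"
    using iso_dia_Zob by (simp add: iso_dia_sel[OF s] fun_eq_iff SC.sus_ob_def del: split_paired_All)
  then show ?thesis
    using N(3,4)[OF X] map_dia_susp(1)[OF C D F \<phi> X] map_dia_susp(1)[OF C D G \<phi> X]
    by (subst eq) (simp add: susp_arr_def iso_dia_sel[OF s])
qed

text \<open>By monotonicity of \<open>\<phi>\<close> the middle case is \<open>\<phi> i = 0\<close>
  and \<open>\<phi> j = 1\<close>. The arrow inserted there is the diagonal of the naturality square
  of \<open>f i j\<close>, written with \<open>F\<close> applied first.\<close>

definition K_homotopy :: "nat \<Rightarrow> nat \<Rightarrow> (nat \<Rightarrow> nat) \<Rightarrow> ('o, 'm) ksimplex \<Rightarrow> ('p, 'n) ksimplex" where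
  "K_homotopy n q \<phi> = (\<lambda>(A, f).
     (\<lambda>i. if i \<le> q then (if \<phi> i = 0 then map_ob F (A i) else map_ob G (A i)) else VoidO,
      \<lambda>i j. if i \<le> j \<and> j \<le> q
        then (if \<phi> j = 0 then map_ar F (f i j)
              else if \<phi> i = 0 then Cmp (S_iter n q D) (iso_dia F G \<eta> (A j)) (map_ar F (f i j))
              else map_ar G (f i j))
        else VoidA))"

text \<open>Restriction and suspension are functors, so they preserve the composites inserted at the
  jump of \<open>\<phi>\<close>, and they send components of the isomorphism to components. The
  suspension coordinate \<open>\<psi>\<close> is independent of the simplex \<open>\<phi>\<close> of
  the interval.\<close>

theorem K_homotopy: "simplicial_homotopy (K_spectrum C) (K_spectrum D) (K_map F) (K_map G) K_homotopy"
  unfolding simplicial_homotopy_def K_spectrum_sel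
proof (intro conjI allI ballI)
  fix n q
  interpret SC: prewald "S_iter n q C" by (rule S_iter_prewald[OF C])
  interpret SD: dia_prewald "S_iter n q D" q by (rule dia_prewald.intro[OF S_iter_prewald[OF D]])
  note eF = exact_functorD[OF map_dia_exact[OF C D F, of n q], simplified]
    and eG = exact_functorD[OF map_dia_exact[OF C D G, of n q], simplified]
  note mF = is_functorD[OF eF(1), simplified] and mG = is_functorD[OF eG(1), simplified]
  note N = natural_isoD[OF iso_dia_natural[OF C D F G \<eta>], of _ n q, simplified]
  show "K_homotopy n q \<phi> (spt (K_level C n) q) = spt (K_level D n) q" if \<phi>: "\<phi> \<in> Delta q 1" for \<phi>
    using eF(2) eG(2) mF(4)[OF SC.zob] mG(4)[OF SC.zob] SD.zob
    by (auto simp: K_homotopy_def K_level_sel iso_dia_Zob fun_eq_iff)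
  fix x assume x: "x \<in> simplices (K_level C n) q"
  obtain A f where x': "x = (A, f)" by (cases x)
  note v = K_simplexD(2,4)[OF x[unfolded x']] and g = diagramD[OF K_simplexD(1)[OF x[unfolded x']]]
    and w = K_simplexD(3)[OF x[unfolded x']]
  show "K_homotopy n q (\<lambda>i\<in>{..q}. 0) x = K_map F n q x" "K_homotopy n q (\<lambda>i\<in>{..q}. 1) x = K_map G n q x"
    using v by (auto simp: x' K_homotopy_def K_map_def fun_eq_iff)
  fix \<phi> assume \<phi>: "\<phi> \<in> Delta q 1"
  note d = DeltaD(1,2)[OF \<phi>]
  have ob: "i \<le> q \<Longrightarrow> map_ob F (A i) \<in> Obj (S_iter n q D)"
    "i \<le> q \<Longrightarrow> map_ob G (A i) \<in> Obj (S_iter n q D)" for i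
    using mF(3) mG(3) g(1) by auto
  have aF: "i \<le> j \<Longrightarrow> j \<le> q \<Longrightarrow> SD.arr (map_ar F (f i j))
      (map_ob F (A i)) (map_ob F (A j))" for i j
    using mF(5-7)[of "f i j"] g by simp
  have aG: "i \<le> j \<Longrightarrow> j \<le> q \<Longrightarrow> SD.arr (map_ar G (f i j))
      (map_ob G (A i)) (map_ob G (A j))" for i j
    using mG(5-7)[of "f i j"] g by simp
  have a\<eta>: "i \<le> q \<Longrightarrow> SD.arr (iso_dia F G \<eta> (A i)) (map_ob F (A i)) (map_ob G (A i))" for i
    using N(2-4)[OF g(1)] by simp
  show "K_homotopy n q \<phi> x \<in> simplices (K_level D n) q"
    unfolding x' K_homotopy_def prod.case
  proof (rule K_simplexI, rule diagramI)
    fix i j assume ij: "i \<le> j" "j \<le> q"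
    have le: "\<phi> i \<le> \<phi> j" "\<phi> j \<le> 1" using d ij by auto
    let ?f = "\<lambda>i j. if i \<le> j \<and> j \<le> q
        then (if \<phi> j = 0 then map_ar F (f i j)
              else if \<phi> i = 0 then Cmp (S_iter n q D) (iso_dia F G \<eta> (A j)) (map_ar F (f i j))
              else map_ar G (f i j))
        else VoidA"
    show "?f i j \<in> Arr (S_iter n q D) \<and>
      Src (S_iter n q D) (?f i j) = (if i \<le> q then (if \<phi> i = 0 then map_ob F (A i) else map_ob G (A i)) else VoidO) \<and>
      Tgt (S_iter n q D) (?f i j) = (if j \<le> q then (if \<phi> j = 0 then map_ob F (A j) else map_ob G (A j)) else VoidO)"
      using ij le aF[OF ij] aG[OF ij] a\<eta>[OF ij(2)] by auto
    have "iso_dia F G \<eta> (A j) \<in> Weq (S_iter n q D)" using SD.iso_weq N(1)[OF g(1)[OF ij(2)]] by blast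
    then show "?f i j \<in> Weq (S_iter n q D)"
      using ij eF(4)[OF w[OF ij]] eG(4)[OF w[OF ij]] SD.weq_cmp aF[OF ij] a\<eta>[OF ij(2)] by simp
  next
    fix i j k assume ijk: "i \<le> j" "j \<le> k" "k \<le> q"
    have ij: "i \<le> j" "j \<le> q" and k: "j \<le> k" "k \<le> q" and ik: "i \<le> k" using ijk by auto
    let ?f = "\<lambda>i j. if i \<le> j \<and> j \<le> q
        then (if \<phi> j = 0 then map_ar F (f i j)
              else if \<phi> i = 0 then Cmp (S_iter n q D) (iso_dia F G \<eta> (A j)) (map_ar F (f i j))
              else map_ar G (f i j))
        else VoidA"
    have le': "\<phi> i \<le> \<phi> j" "\<phi> j \<le> \<phi> k" "\<phi> k \<le> 1" using d ij k by auto
    note ty = aF[OF ij] aF[OF k] aF[OF ik k(2)] aG[OF ij] aG[OF k] aG[OF ik k(2)] a\<eta>[OF ij(2)] a\<eta>[OF k(2)]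
    have cF: "Cmp (S_iter n q D) (map_ar F (f j k)) (map_ar F (f i j))
        = map_ar F (f i k)"
      using mF(8)[of "f i j" "f j k"] g ij k by simp
    have cG: "Cmp (S_iter n q D) (map_ar G (f j k)) (map_ar G (f i j))
        = map_ar G (f i k)"
      using mG(8)[of "f i j" "f j k"] g ij k by simp
    have nat: "Cmp (S_iter n q D) (iso_dia F G \<eta> (A k)) (map_ar F (f j k))
        = Cmp (S_iter n q D) (map_ar G (f j k)) (iso_dia F G \<eta> (A j))"
      using N(5)[of "f j k"] g k by simp
    \<comment> \<open>The case where \<open>\<phi>\<close> jumps between \<open>j\<close> and
      \<open>k\<close>: functoriality of \<open>F\<close> suffices.\<close>
    have 1: "Cmp (S_iter n q D) (Cmp (S_iter n q D) (iso_dia F G \<eta> (A k)) (map_ar F (f j k))) (map_ar F (f i j))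
        = Cmp (S_iter n q D) (iso_dia F G \<eta> (A k)) (map_ar F (f i k))"
      using ty cF by (simp add: SD.assoc)
    \<comment> \<open>The case where \<open>\<phi>\<close> jumps between \<open>i\<close> and
      \<open>j\<close>: naturality moves the isomorphism past \<open>f j k\<close>.\<close>
    have "Cmp (S_iter n q D) (map_ar G (f j k)) (Cmp (S_iter n q D) (iso_dia F G \<eta> (A j)) (map_ar F (f i j)))
        = Cmp (S_iter n q D) (iso_dia F G \<eta> (A k)) (Cmp (S_iter n q D) (map_ar F (f j k)) (map_ar F (f i j)))"
      by (rule SD.reassoc) (use ty nat in simp_all)
    then have 2: "Cmp (S_iter n q D) (map_ar G (f j k)) (Cmp (S_iter n q D) (iso_dia F G \<eta> (A j)) (map_ar F (f i j)))
        = Cmp (S_iter n q D) (iso_dia F G \<eta> (A k)) (map_ar F (f i k))"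
      unfolding cF .
    show "Cmp (S_iter n q D) (?f j k) (?f i j) = ?f i k"
      using ij k ik le' 1 2 cF cG by simp
  next
    fix i assume i: "i \<le> q"
    show "(if i \<le> q then (if \<phi> i = 0 then map_ob F (A i) else map_ob G (A i)) else VoidO) \<in> Obj (S_iter n q D)"
      using i ob by simp
    show "(if i \<le> i \<and> i \<le> q
        then (if \<phi> i = 0 then map_ar F (f i i)
              else if \<phi> i = 0 then Cmp (S_iter n q D) (iso_dia F G \<eta> (A i)) (map_ar F (f i i))
              else map_ar G (f i i))
        else VoidA) = Idn (S_iter n q D) (if i \<le> q then (if \<phi> i = 0 then map_ob F (A i) else map_ob G (A i)) else VoidO)"
      using i g mF(4) mG(4) by simp
  qed auto
  show "K_homotopy n p (compose {..p} \<phi> \<theta>) (act (K_level C n) p q \<theta> x) = act (K_level D n) p q \<theta> (K_homotopy n q \<phi> x)"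
    if \<theta>: "\<theta> \<in> Delta p q" for p \<theta>
  proof -
    note t = DeltaD(1,2)[OF \<theta>]
    note P = is_functorD(8)[OF exact_functorD(1)[OF pull_exact[OF D \<theta>, of n]], simplified]
    have c: "pull_arr p \<theta> (Cmp (S_iter n q D) (iso_dia F G \<eta> (A j)) (map_ar F (f i j)))
        = Cmp (S_iter n p D) (iso_dia F G \<eta> (pull_obj p \<theta> (A j))) (map_ar F (pull_arr p \<theta> (f i j)))"
      if "i \<le> j" "j \<le> q" for i j
      using P[of "map_ar F (f i j)" "iso_dia F G \<eta> (A j)"] aF[OF that] a\<eta>[OF that(2)]
      by (simp add: iso_dia_pull map_dia_pull)
    show ?thesis
      using t by (auto simp: x' K_homotopy_def K_level_sel fun_eq_iff compose_def map_dia_pull c)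
  qed
  show "K_homotopy (Suc n) q \<phi> (susp (K_spectrum C) n q \<psi> x) = susp (K_spectrum D) n q \<psi> (K_homotopy n q \<phi> x)"
    if \<psi>: "\<psi> \<in> Delta q 1" for \<psi>
  proof -
    note P = is_functorD(8)[OF SD.susp_functor[OF \<psi>], simplified]
    have c: "susp_arr (S_iter n q D) q \<psi> (Cmp (S_iter n q D) (iso_dia F G \<eta> (A j)) (map_ar F (f i j)))
        = Cmp SD.SD (iso_dia F G \<eta> (susp_obj (S_iter n q C) q \<psi> (A j))) (map_ar F (susp_arr (S_iter n q C) q \<psi> (f i j)))"
      if "i \<le> j" "j \<le> q" for i j
      using P[of "map_ar F (f i j)" "iso_dia F G \<eta> (A j)"] aF[OF that] a\<eta>[OF that(2)]
        iso_dia_susp[OF \<psi> g(1)[OF that(2)]] map_dia_susp(2)[OF C D F \<psi> g(3)[OF that]] by simp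
    show ?thesis
      using map_dia_susp[OF C D F \<psi>, of _ n] map_dia_susp[OF C D G \<psi>, of _ n] g c
      by (auto simp: x' K_homotopy_def K_spectrum_sel fun_eq_iff)
  qed
qed

end

section \<open>The homotopy category of spectra\<close>

lemma spectrum_mapD:
  assumes "spectrum_map E F f"
  shows "f n q (spt (level E n) q) = spt (level F n) q"
    "x \<in> simplices (level E n) q \<Longrightarrow> f n q x \<in> simplices (level F n) q"
    "x \<in> simplices (level E n) q \<Longrightarrow> \<theta> \<in> Delta p q \<Longrightarrow>
      f n p (act (level E n) p q \<theta> x) = act (level F n) p q \<theta> (f n q x)"
    "x \<in> simplices (level E n) q \<Longrightarrow> \<phi> \<in> Delta q 1 \<Longrightarrow> f (Suc n) q (susp E n q \<phi> x) = susp F n q \<phi> (f n q x)"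
  using assms unfolding spectrum_map_def by simp_all

lemma spectrum_mapI:
  assumes "\<And>n q. f n q (spt (level E n) q) = spt (level F n) q"
    "\<And>n q x. x \<in> simplices (level E n) q \<Longrightarrow> f n q x \<in> simplices (level F n) q"
    "\<And>n p q x \<theta>. x \<in> simplices (level E n) q \<Longrightarrow> \<theta> \<in> Delta p q \<Longrightarrow>
      f n p (act (level E n) p q \<theta> x) = act (level F n) p q \<theta> (f n q x)"
    "\<And>n q x \<phi>. x \<in> simplices (level E n) q \<Longrightarrow> \<phi> \<in> Delta q 1 \<Longrightarrow> f (Suc n) q (susp E n q \<phi> x) = susp F n q \<phi> (f n q x)"
  shows "spectrum_map E F f"
  using assms unfolding spectrum_map_def by simp

lemma simplicial_homotopyD:
  assumes "simplicial_homotopy E F f g H"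
  shows "\<phi> \<in> Delta q 1 \<Longrightarrow> H n q \<phi> (spt (level E n) q) = spt (level F n) q"
    "x \<in> simplices (level E n) q \<Longrightarrow> H n q (\<lambda>i \<in> {..q}. 0) x = f n q x"
    "x \<in> simplices (level E n) q \<Longrightarrow> H n q (\<lambda>i \<in> {..q}. 1) x = g n q x"
    "\<phi> \<in> Delta q 1 \<Longrightarrow> x \<in> simplices (level E n) q \<Longrightarrow> H n q \<phi> x \<in> simplices (level F n) q"
    "\<phi> \<in> Delta q 1 \<Longrightarrow> x \<in> simplices (level E n) q \<Longrightarrow> \<theta> \<in> Delta p q \<Longrightarrow>
           H n p (compose {..p} \<phi> \<theta>) (act (level E n) p q \<theta> x) = act (level F n) p q \<theta> (H n q \<phi> x)"
    "\<phi> \<in> Delta q 1 \<Longrightarrow> x \<in> simplices (level E n) q \<Longrightarrow> \<psi> \<in> Delta q 1 \<Longrightarrow>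
      H (Suc n) q \<phi> (susp E n q \<psi> x) = susp F n q \<psi> (H n q \<phi> x)"
  using assms unfolding simplicial_homotopy_def by blast+

lemma simplicial_homotopyI:
  assumes "\<And>n q \<phi>. \<phi> \<in> Delta q 1 \<Longrightarrow> H n q \<phi> (spt (level E n) q) = spt (level F n) q"
    "\<And>n q x. x \<in> simplices (level E n) q \<Longrightarrow> H n q (\<lambda>i \<in> {..q}. 0) x = f n q x"
    "\<And>n q x. x \<in> simplices (level E n) q \<Longrightarrow> H n q (\<lambda>i \<in> {..q}. 1) x = g n q x"
    "\<And>n q \<phi> x. \<phi> \<in> Delta q 1 \<Longrightarrow> x \<in> simplices (level E n) q \<Longrightarrow> H n q \<phi> x \<in> simplices (level F n) q"
    "\<And>n p q \<phi> \<theta> x. \<phi> \<in> Delta q 1 \<Longrightarrow> x \<in> simplices (level E n) q \<Longrightarrow> \<theta> \<in> Delta p q \<Longrightarrow>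
           H n p (compose {..p} \<phi> \<theta>) (act (level E n) p q \<theta> x) = act (level F n) p q \<theta> (H n q \<phi> x)"
    "\<And>n q \<phi> \<psi> x. \<phi> \<in> Delta q 1 \<Longrightarrow> x \<in> simplices (level E n) q \<Longrightarrow> \<psi> \<in> Delta q 1 \<Longrightarrow>
      H (Suc n) q \<phi> (susp E n q \<psi> x) = susp F n q \<psi> (H n q \<phi> x)"
  shows "simplicial_homotopy E F f g H"
  unfolding simplicial_homotopy_def by (intro conjI allI ballI assms)

lemma spectrum_map_id: "spectrum_map E E (\<lambda>n q x. x)"
  by (rule spectrum_mapI) simp_all

lemma spectrum_map_comp:
  assumes f: "spectrum_map E F f" and g: "spectrum_map F K g"
  shows "spectrum_map E K (\<lambda>n q. g n q \<circ> f n q)"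
  by (rule spectrum_mapI) (simp_all add: spectrum_mapD[OF f] spectrum_mapD[OF g])

lemma homotopic_refl [simp]: "homotopic E F f f"
  and homotopic_sym: "homotopic E F f g \<Longrightarrow> homotopic E F g f"
  and homotopic_trans: "homotopic E F f g \<Longrightarrow> homotopic E F g h \<Longrightarrow> homotopic E F f h"
  unfolding homotopic_def by (auto intro: equivclp_sym equivclp_trans)

lemma homotopicI:
  assumes "spectrum_map E F f" "spectrum_map E F g" "simplicial_homotopy E F f g H"
  shows "homotopic E F f g"
  using assms unfolding homotopic_def by blast

text \<open>Homotopy is a generated equivalence relation, so it suffices that \<open>T\<close>
  respects a single simplicial homotopy; induction along a zigzag does the rest.\<close>

lemma homotopic_map:
  assumes h: "homotopic E F f g"
    and step: "\<And>f g H. spectrum_map E F f \<Longrightarrow> spectrum_map E F g \<Longrightarrow> simplicial_homotopy E F f g H \<Longrightarrow>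
      homotopic E' F' (T f) (T g)"
  shows "homotopic E' F' (T f) (T g)"
  using h[unfolded homotopic_def]
proof (induction rule: equivclp_induct)
  case base
  show ?case by simp
next
  case (step y z)
  then have "homotopic E' F' (T y) (T z)" using assms(2) homotopic_sym by blast
  then show ?case using step.IH homotopic_trans by blast
qed

lemma homotopic_comp_left:
  assumes h: "homotopic E F f f'" and g: "spectrum_map F K g"
  shows "homotopic E K (\<lambda>n q. g n q \<circ> f n q) (\<lambda>n q. g n q \<circ> f' n q)"
proof (rule homotopic_map[OF h, where T = "\<lambda>f n q. g n q \<circ> f n q"])
  fix f f' H assume f: "spectrum_map E F f" "spectrum_map E F f'" and H: "simplicial_homotopy E F f f' H"
  have "simplicial_homotopy E K (\<lambda>n q. g n q \<circ> f n q) (\<lambda>n q. g n q \<circ> f' n q) (\<lambda>n q \<phi>. g n q \<circ> H n q \<phi>)"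
    by (rule simplicial_homotopyI) (simp_all add: simplicial_homotopyD[OF H] spectrum_mapD[OF g] del: One_nat_def)
  then show "homotopic E K (\<lambda>n q. g n q \<circ> f n q) (\<lambda>n q. g n q \<circ> f' n q)"
    using homotopicI spectrum_map_comp f g by blast
qed

lemma homotopic_comp_right:
  assumes h: "homotopic F K g g'" and f: "spectrum_map E F f"
  shows "homotopic E K (\<lambda>n q. g n q \<circ> f n q) (\<lambda>n q. g' n q \<circ> f n q)"
proof (rule homotopic_map[OF h, where T = "\<lambda>g n q. g n q \<circ> f n q"])
  fix g g' H assume g: "spectrum_map F K g" "spectrum_map F K g'" and H: "simplicial_homotopy F K g g' H"
  have "simplicial_homotopy E K (\<lambda>n q. g n q \<circ> f n q) (\<lambda>n q. g' n q \<circ> f n q) (\<lambda>n q \<phi>. H n q \<phi> \<circ> f n q)"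
    by (rule simplicial_homotopyI) (simp_all add: simplicial_homotopyD[OF H] spectrum_mapD[OF f] del: One_nat_def)
  then show "homotopic E K (\<lambda>n q. g n q \<circ> f n q) (\<lambda>n q. g' n q \<circ> f n q)"
    using homotopicI spectrum_map_comp f g by blast
qed

lemma homotopy_class_eq:
  assumes "homotopic E F f g"
  shows "homotopy_class E F f = homotopy_class E F g"
  using assms homotopic_sym homotopic_trans unfolding homotopy_class_def by blast

lemma homotopy_class_self: "spectrum_map E F f \<Longrightarrow> f \<in> homotopy_class E F f"
  by (simp add: homotopy_class_def)

text \<open>Composition in \<open>spectra_hcat\<close> is a union over all representatives. As
  homotopy is compatible with composition on both sides, all members of the union are the same
  class, and \<open>f\<close> and \<open>g\<close> show that the union is not empty.\<close>

lemma homotopy_class_comp: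
  assumes f: "spectrum_map E F f" and g: "spectrum_map F K g"
  shows "(\<Union>g' \<in> homotopy_class F K g. \<Union>f' \<in> homotopy_class E F f. homotopy_class E K (\<lambda>n q. g' n q \<circ> f' n q))
    = homotopy_class E K (\<lambda>n q. g n q \<circ> f n q)"
proof -
  have eq: "homotopy_class E K (\<lambda>n q. g' n q \<circ> f' n q) = homotopy_class E K (\<lambda>n q. g n q \<circ> f n q)"
    if g': "g' \<in> homotopy_class F K g" and f': "f' \<in> homotopy_class E F f" for g' f'
  proof (rule homotopy_class_eq[OF homotopic_sym])
    have "homotopic E K (\<lambda>n q. g n q \<circ> f n q) (\<lambda>n q. g' n q \<circ> f n q)"
      by (rule homotopic_comp_right[OF _ f]) (use g' in \<open>simp add: homotopy_class_def\<close>)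
    moreover have "homotopic E K (\<lambda>n q. g' n q \<circ> f n q) (\<lambda>n q. g' n q \<circ> f' n q)"
      by (rule homotopic_comp_left[where F = F]) (use g' f' in \<open>simp_all add: homotopy_class_def\<close>)
    ultimately show "homotopic E K (\<lambda>n q. g n q \<circ> f n q) (\<lambda>n q. g' n q \<circ> f' n q)" by (rule homotopic_trans)
  qed
  then show ?thesis using homotopy_class_self[OF f] homotopy_class_self[OF g] by blast
qed

lemma spectra_hcat_sel [simp]:
  "Obj spectra_hcat = {E. is_spectrum E}" "Src spectra_hcat = arrow_src" "Tgt spectra_hcat = arrow_tgt"
  "Idn spectra_hcat E = Arrow E (homotopy_class E E (\<lambda>n q x. x)) E"
  by (simp_all add: spectra_hcat_def)

lemma spectra_hcat_arr: "a \<in> Arr spectra_hcat \<longleftrightarrow> (\<exists>E F f. a = Arrow E (homotopy_class E F f) F \<and>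
    is_spectrum E \<and> is_spectrum F \<and> spectrum_map E F f)"
  by (simp add: spectra_hcat_def)

lemma spectra_hcat_cmp:
  assumes "spectrum_map E F f" "spectrum_map F K g"
  shows "Cmp spectra_hcat (Arrow F (homotopy_class F K g) K) (Arrow E (homotopy_class E F f) F) =
    Arrow E (homotopy_class E K (\<lambda>n q. g n q \<circ> f n q)) K"
  using homotopy_class_comp[OF assms] by (simp add: spectra_hcat_def)

lemma spectra_hcat_category: "is_category spectra_hcat"
  unfolding is_category_def
proof (intro conjI ballI impI)
  fix a assume "a \<in> Arr spectra_hcat"
  then obtain E F f where a: "a = Arrow E (homotopy_class E F f) F" and EF: "is_spectrum E" "is_spectrum F" and f: "spectrum_map E F f"
    unfolding spectra_hcat_arr by blast
  show "Src spectra_hcat a \<in> Obj spectra_hcat" "Tgt spectra_hcat a \<in> Obj spectra_hcat" using a EF by simp_all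
  show "Cmp spectra_hcat a (Idn spectra_hcat (Src spectra_hcat a)) = a"
    using spectra_hcat_cmp[OF spectrum_map_id f] by (simp add: a comp_def)
  show "Cmp spectra_hcat (Idn spectra_hcat (Tgt spectra_hcat a)) a = a"
    using spectra_hcat_cmp[OF f spectrum_map_id] by (simp add: a comp_def)
  fix b assume "b \<in> Arr spectra_hcat" and ab: "Src spectra_hcat b = Tgt spectra_hcat a"
  then obtain K g where b: "b = Arrow F (homotopy_class F K g) K" and K: "is_spectrum K" and g: "spectrum_map F K g"
    unfolding spectra_hcat_arr by (auto simp: a)
  note ba = spectra_hcat_cmp[OF f g]
  show "Cmp spectra_hcat b a \<in> Arr spectra_hcat"
    unfolding a b ba spectra_hcat_arr using EF K spectrum_map_comp[OF f g] by blast
  show "Src spectra_hcat (Cmp spectra_hcat b a) = Src spectra_hcat a" "Tgt spectra_hcat (Cmp spectra_hcat b a) = Tgt spectra_hcat b"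
    unfolding a b ba by simp_all
next
  fix a b c assume abc: "a \<in> Arr spectra_hcat" "b \<in> Arr spectra_hcat" "c \<in> Arr spectra_hcat"
    and eq: "Src spectra_hcat b = Tgt spectra_hcat a \<and> Src spectra_hcat c = Tgt spectra_hcat b"
  obtain E F f where a: "a = Arrow E (homotopy_class E F f) F" and f: "spectrum_map E F f"
    using abc(1) unfolding spectra_hcat_arr by blast
  obtain K g where b: "b = Arrow F (homotopy_class F K g) K" and g: "spectrum_map F K g"
    using abc(2) eq unfolding spectra_hcat_arr by (auto simp: a)
  obtain L h where c: "c = Arrow K (homotopy_class K L h) L" and h: "spectrum_map K L h"
    using abc(3) eq unfolding spectra_hcat_arr by (auto simp: b)
  show "Cmp spectra_hcat c (Cmp spectra_hcat b a) = Cmp spectra_hcat (Cmp spectra_hcat c b) a"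
    unfolding a b c spectra_hcat_cmp[OF f g] spectra_hcat_cmp[OF g h]
      spectra_hcat_cmp[OF spectrum_map_comp[OF f g] h] spectra_hcat_cmp[OF f spectrum_map_comp[OF g h]]
    by (simp add: comp_assoc)
next
  fix E :: "'a spectrum" assume "E \<in> Obj spectra_hcat"
  then show "Idn spectra_hcat E \<in> Arr spectra_hcat" unfolding spectra_hcat_arr using spectrum_map_id by auto
qed simp_all

section \<open>Finitely generated modules\<close>

lemma f1_algebraD:
  assumes "is_f1_algebra M"
  shows "\<one>\<^bsub>M\<^esub> \<in> carrier M" "absorb M \<in> carrier M"
    "m \<in> carrier M \<Longrightarrow> n \<in> carrier M \<Longrightarrow> m \<otimes>\<^bsub>M\<^esub> n \<in> carrier M"
    "m \<in> carrier M \<Longrightarrow> \<one>\<^bsub>M\<^esub> \<otimes>\<^bsub>M\<^esub> m = m" "m \<in> carrier M \<Longrightarrow> m \<otimes>\<^bsub>M\<^esub> \<one>\<^bsub>M\<^esub> = m"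
    "m \<in> carrier M \<Longrightarrow> n \<in> carrier M \<Longrightarrow> k \<in> carrier M \<Longrightarrow> m \<otimes>\<^bsub>M\<^esub> n \<otimes>\<^bsub>M\<^esub> k = m \<otimes>\<^bsub>M\<^esub> (n \<otimes>\<^bsub>M\<^esub> k)"
    "m \<in> carrier M \<Longrightarrow> m \<otimes>\<^bsub>M\<^esub> absorb M = absorb M" "m \<in> carrier M \<Longrightarrow> absorb M \<otimes>\<^bsub>M\<^esub> m = absorb M"
  using assms
  by (simp_all add: is_f1_algebra_def monoid.one_closed monoid.m_closed monoid.l_one monoid.r_one monoid.m_assoc)

lemma rmoduleD:
  assumes "is_rmodule M S"
  shows "base S \<in> carrier S" "s \<in> carrier S \<Longrightarrow> m \<in> carrier M \<Longrightarrow> ract S s m \<in> carrier S"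
    "s \<in> carrier S \<Longrightarrow> ract S s \<one>\<^bsub>M\<^esub> = s"
    "s \<in> carrier S \<Longrightarrow> m \<in> carrier M \<Longrightarrow> n \<in> carrier M \<Longrightarrow> ract S (ract S s m) n = ract S s (m \<otimes>\<^bsub>M\<^esub> n)"
    "m \<in> carrier M \<Longrightarrow> ract S (base S) m = base S" "s \<in> carrier S \<Longrightarrow> ract S s (absorb M) = base S"
    "s \<notin> carrier S \<or> m \<notin> carrier M \<Longrightarrow> ract S s m = undefined"
  using assms unfolding is_rmodule_def by blast+

lemma compose_eqD: "compose A g f = compose A g' f' \<Longrightarrow> x \<in> A \<Longrightarrow> g (f x) = g' (f' x)"
  by (metis compose_eq)

lemma compose_eq_restrictD: "compose A g f = restrict h A \<Longrightarrow> x \<in> A \<Longrightarrow> g (f x) = h x"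
  by (metis compose_eq restrict_apply')

lemma rmodule_homsD:
  assumes "f \<in> rmodule_homs M S T"
  shows "s \<in> carrier S \<Longrightarrow> f s \<in> carrier T" "f (base S) = base T"
    "s \<in> carrier S \<Longrightarrow> m \<in> carrier M \<Longrightarrow> f (ract S s m) = ract T (f s) m" "f \<in> extensional (carrier S)"
  using assms by (auto simp: rmodule_homs_def PiE_def)

lemma rmodule_homs_restrict:
  assumes "is_rmodule M S" "\<And>s. s \<in> carrier S \<Longrightarrow> f s \<in> carrier T" "f (base S) = base T"
    "\<And>s m. s \<in> carrier S \<Longrightarrow> m \<in> carrier M \<Longrightarrow> f (ract S s m) = ract T (f s) m"
  shows "restrict f (carrier S) \<in> rmodule_homs M S T"
  using assms rmoduleD(1,2)[OF assms(1)] by (auto simp: rmodule_homs_def)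

lemma rmodule_homs_eqI:
  assumes "f \<in> rmodule_homs M S T" "g \<in> rmodule_homs M S T'" "\<And>s. s \<in> carrier S \<Longrightarrow> f s = g s"
  shows "f = g"
  using assms by (auto simp: rmodule_homs_def intro: PiE_ext extensionalityI)

lemma rmodule_homs_id: "is_rmodule M S \<Longrightarrow> (\<lambda>s \<in> carrier S. s) \<in> rmodule_homs M S S"
  by (rule rmodule_homs_restrict) simp_all

lemma rmodule_homs_compose:
  assumes S: "is_rmodule M S" and f: "f \<in> rmodule_homs M S T" and g: "g \<in> rmodule_homs M T U"
  shows "compose (carrier S) g f \<in> rmodule_homs M S U"
  unfolding compose_def
  by (rule rmodule_homs_restrict[OF S]) (simp_all add: rmodule_homsD[OF f] rmodule_homsD[OF g])

lemma FG_objD: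
  assumes "S \<in> FG_obj M"
  shows "is_rmodule M S" "fin_generated M S" "base S = Pt"
  using assms by (simp_all add: FG_obj_def)

lemma FG_arr_iff: "Arrow S f T \<in> FG_arr M \<longleftrightarrow> S \<in> FG_obj M \<and> T \<in> FG_obj M \<and> f \<in> rmodule_homs M S T"
  by (auto simp: FG_arr_def)

lemma FG_arrE:
  assumes "a \<in> FG_arr M"
  obtains S f T where "a = Arrow S f T" "S \<in> FG_obj M" "T \<in> FG_obj M" "f \<in> rmodule_homs M S T"
  using assms by (auto simp: FG_arr_def)

section \<open>The category of finitely generated modules\<close>

lemma FG_sel [simp]:
  "Obj (FG M) = FG_obj M" "Arr (FG M) = FG_arr M" "Src (FG M) = arrow_src" "Tgt (FG M) = arrow_tgt"
  "Idn (FG M) S = Arrow S (\<lambda>s \<in> carrier S. s) S"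
  "Cmp (FG M) (Arrow T' g U) (Arrow S f T) = Arrow S (compose (carrier S) g f) U"
  by (simp_all add: FG_def FG_cat_def category.extend_def)

lemma FG_cof: "Cof (FG M) = {Arrow S f T | S f T. Arrow S f T \<in> FG_arr M \<and>
               (\<exists>r \<in> rmodule_homs M T S. \<forall>s \<in> carrier S. r (f s) = s) \<and>
               quot_rmodule M T (f ` carrier S) \<in> FG_obj M}"
  by (simp add: FG_def category.extend_def)

lemma FG_zob: "Zob (FG M) = \<lparr>carrier = {Pt}, base = Pt,
             ract = (\<lambda>s m. if s = Pt \<and> m \<in> carrier M then Pt else undefined)\<rparr>"
  by (simp add: FG_def category.extend_def)

lemma FG_weq: "f \<in> Weq (FG M) \<longleftrightarrow> iso_arrow (FG M) f"
  by (simp add: FG_def category.extend_def iso_arrow_def FG_cat_def)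

lemma FG_category: "is_category (FG M)"
  unfolding is_category_def FG_sel
proof (intro conjI ballI impI)
  fix a assume "a \<in> FG_arr M"
  then obtain S f T where a: "a = Arrow S f T" and ST: "S \<in> FG_obj M" "T \<in> FG_obj M" and f: "f \<in> rmodule_homs M S T"
    by (rule FG_arrE)
  show "arrow_src a \<in> FG_obj M" "arrow_tgt a \<in> FG_obj M" using a ST by simp_all
  show "Cmp (FG M) a (Arrow (arrow_src a) (\<lambda>s\<in>carrier (arrow_src a). s) (arrow_src a)) = a"
    "Cmp (FG M) (Arrow (arrow_tgt a) (\<lambda>s\<in>carrier (arrow_tgt a). s) (arrow_tgt a)) a = a"
    using rmodule_homsD(1,4)[OF f] by (auto simp: a compose_def extensional_def fun_eq_iff)
  fix b assume "b \<in> FG_arr M" and ab: "arrow_src b = arrow_tgt a"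
  then obtain g U where b: "b = Arrow T g U" and U: "U \<in> FG_obj M" and g: "g \<in> rmodule_homs M T U"
    by (auto simp: a elim!: FG_arrE)
  show "Cmp (FG M) b a \<in> FG_arr M" "arrow_src (Cmp (FG M) b a) = arrow_src a" "arrow_tgt (Cmp (FG M) b a) = arrow_tgt b"
    using ST U rmodule_homs_compose[OF FG_objD(1)[OF ST(1)] f g] by (simp_all add: a b FG_arr_iff)
next
  fix a b c assume abc: "a \<in> FG_arr M" "b \<in> FG_arr M" "c \<in> FG_arr M"
    and eq: "arrow_src b = arrow_tgt a \<and> arrow_src c = arrow_tgt b"
  obtain S f T where a: "a = Arrow S f T" and f: "f \<in> rmodule_homs M S T" using abc(1) by (rule FG_arrE)
  obtain g U where b: "b = Arrow T g U" using abc(2) eq by (auto simp: a elim!: FG_arrE)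
  obtain h V where c: "c = Arrow U h V" using abc(3) eq by (auto simp: b elim!: FG_arrE)
  show "Cmp (FG M) c (Cmp (FG M) b a) = Cmp (FG M) (Cmp (FG M) c b) a"
    using rmodule_homsD(1)[OF f] by (auto simp: a b c compose_def fun_eq_iff)
qed (auto simp: FG_arr_iff FG_objD rmodule_homs_id)

interpretation FG: cat "FG M" for M
  by unfold_locales (rule FG_category)

lemma FG_isoI:
  assumes "S \<in> FG_obj M" "T \<in> FG_obj M" and f: "f \<in> rmodule_homs M S T" and g: "g \<in> rmodule_homs M T S"
    and "\<And>s. s \<in> carrier S \<Longrightarrow> g (f s) = s" "\<And>t. t \<in> carrier T \<Longrightarrow> f (g t) = t"
  shows "iso_arrow (FG M) (Arrow S f T)"
  by (rule FG.isoI[of _ _ S T "Arrow T g S"]) (use assms in \<open>auto simp: FG_arr_iff compose_def\<close>)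

lemma FG_isoE:
  assumes "iso_arrow (FG M) (Arrow S f T)"
  obtains g where "S \<in> FG_obj M" "T \<in> FG_obj M" "f \<in> rmodule_homs M S T" "g \<in> rmodule_homs M T S"
    "\<And>s. s \<in> carrier S \<Longrightarrow> g (f s) = s" "\<And>t. t \<in> carrier T \<Longrightarrow> f (g t) = t"
proof -
  have a: "Arrow S f T \<in> FG_arr M" using assms by (simp add: iso_arrow_def)
  obtain b where b: "b \<in> FG_arr M" "arrow_src b = T" "arrow_tgt b = S" "Cmp (FG M) b (Arrow S f T) = Idn (FG M) S"
    "Cmp (FG M) (Arrow S f T) b = Idn (FG M) T"
    using assms by (auto simp: iso_arrow_def)
  obtain g where g: "b = Arrow T g S" using b(1-3) by (auto elim!: FG_arrE)
  have 1: "compose (carrier S) g f = (\<lambda>s \<in> carrier S. s)" and 2: "compose (carrier T) f g = (\<lambda>s \<in> carrier T. s)"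
    using b(4,5) by (simp_all add: g)
  show ?thesis
  proof (rule that)
    show "g (f s) = s" if "s \<in> carrier S" for s by (rule compose_eq_restrictD[OF 1 that])
    show "f (g t) = t" if "t \<in> carrier T" for t by (rule compose_eq_restrictD[OF 2 that])
  qed (use a b(1) in \<open>auto simp: FG_arr_iff g\<close>)
qed

text \<open>The action on the quotient sends whatever falls into \<open>I\<close> to
  \<open>Pt\<close>; it is associative because \<open>I\<close> is closed under the action. The
  generators of \<open>T\<close> outside \<open>I\<close> generate the quotient together with
  \<open>Pt\<close>.\<close>

lemma quot_rmodule_FG:
  assumes M: "is_f1_algebra M" and T: "T \<in> FG_obj M" and I: "I \<subseteq> carrier T" "Pt \<in> I"
    and cl: "\<And>s m. s \<in> I \<Longrightarrow> m \<in> carrier M \<Longrightarrow> ract T s m \<in> I"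
  shows "quot_rmodule M T I \<in> FG_obj M"
proof -
  note T1 = rmoduleD[OF FG_objD(1)[OF T], unfolded FG_objD(3)[OF T]] and b = FG_objD(3)[OF T]
  note M1 = f1_algebraD[OF M]
  define Q where "Q = insert Pt (carrier T - I)"
  define act where "act = (\<lambda>s m. if s \<in> Q \<and> m \<in> carrier M then (if ract T s m \<in> I then Pt else ract T s m) else undefined)"
  have eq: "quot_rmodule M T I = \<lparr>carrier = Q, base = Pt, ract = act\<rparr>"
    by (simp add: quot_rmodule_def b Q_def act_def Let_def fun_eq_iff)
  have QT: "s \<in> carrier T" if "s \<in> Q" for s using that T1(1) by (auto simp: Q_def)
  have mod: "is_rmodule M \<lparr>carrier = Q, base = Pt, ract = act\<rparr>"
    unfolding is_rmodule_def partial_object.select_convs rmodule.select_convs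
  proof (intro conjI ballI allI impI)
    show "Pt \<in> Q" by (simp add: Q_def)
    show cl': "act s m \<in> Q" if "s \<in> Q" "m \<in> carrier M" for s m
      using that T1(2)[OF QT] by (auto simp: act_def Q_def)
    show "act s \<one>\<^bsub>M\<^esub> = s" if "s \<in> Q" for s
      using that T1(3)[OF QT] M1(1) by (auto simp: act_def Q_def)
    show "act Pt m = Pt" if "m \<in> carrier M" for m using that T1(5) I by (simp add: act_def Q_def)
    show "act s (absorb M) = Pt" if "s \<in> Q" for s using that M1(2) T1(6)[OF QT] I by (simp add: act_def Q_def)
    show "act (act s m) n = act s (m \<otimes>\<^bsub>M\<^esub> n)" if s: "s \<in> Q" and mn: "m \<in> carrier M" "n \<in> carrier M" for s m n
    proof (cases "ract T s m \<in> I")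
      case True
      then have "act s m = Pt" "ract T s (m \<otimes>\<^bsub>M\<^esub> n) \<in> I"
        using s mn cl[OF True mn(2)] T1(4)[OF QT[OF s] mn] by (simp_all add: act_def)
      then show ?thesis using s mn M1(3) T1(5) I by (simp add: act_def Q_def)
    next
      case False
      then have "act s m = ract T s m" using s mn by (simp add: act_def)
      moreover have "ract T s m \<in> Q" using False T1(2)[OF QT[OF s] mn(1)] by (simp add: Q_def)
      ultimately show ?thesis using s mn M1(3) T1(4)[OF QT[OF s] mn] by (simp add: act_def)
    qed
    show "act s m = undefined" if "s \<notin> Q \<or> m \<notin> carrier M" for s m using that by (auto simp: act_def)
  qed
  obtain G where G: "finite G" "G \<subseteq> carrier T" "carrier T = (\<Union>s \<in> G. ract T s ` carrier M)"
    using FG_objD(2)[OF T] by (auto simp: fin_generated_def)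
  \<comment> \<open>\<open>Pt\<close> is added because \<open>G - I\<close> may be empty.\<close>
  have gen: "Q = (\<Union>s \<in> insert Pt (G - I). act s ` carrier M)"
  proof (intro equalityI subsetI)
    fix s assume s: "s \<in> Q"
    show "s \<in> (\<Union>s \<in> insert Pt (G - I). act s ` carrier M)"
    proof (cases "s = Pt")
      case True
      have "act Pt \<one>\<^bsub>M\<^esub> = Pt" using M1(1) T1(5) I by (simp add: act_def Q_def)
      then have "Pt \<in> act Pt ` carrier M" using M1(1) by (metis imageI)
      then show ?thesis using True by blast
    next
      case False
      then have sI: "s \<in> carrier T" "s \<notin> I" using s by (auto simp: Q_def)
      then obtain g m where g: "g \<in> G" "m \<in> carrier M" "s = ract T g m" using G(3) by blast
      then have "g \<notin> I" using sI cl by blast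
      then have "g \<in> G - I" "act g m = s" using g sI G(2) by (auto simp: act_def Q_def)
      then show ?thesis using g by blast
    qed
  next
    fix s assume "s \<in> (\<Union>s \<in> insert Pt (G - I). act s ` carrier M)"
    then obtain g m where "g \<in> insert Pt (G - I)" "m \<in> carrier M" "s = act g m" by blast
    then show "s \<in> Q" using rmoduleD(2)[OF mod, of g m] G(2) by (auto simp: Q_def)
  qed
  have "fin_generated M \<lparr>carrier = Q, base = Pt, ract = act\<rparr>"
    unfolding fin_generated_def
  proof (intro exI conjI)
    show "finite (insert Pt (G - I))" "insert Pt (G - I) \<subseteq> carrier \<lparr>carrier = Q, base = Pt, ract = act\<rparr>"
      using G(1,2) by (auto simp: Q_def)
  qed (use gen in simp)
  then show ?thesis using mod by (simp add: eq FG_obj_def)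
qed

text \<open>The image of \<open>f\<close> is a submodule containing \<open>Pt\<close>, and by
  \<open>quot_rmodule_FG\<close> the quotient of a finitely generated module by such a submodule is
  finitely generated.\<close>

lemma FG_cof_iff:
  assumes M: "is_f1_algebra M"
  shows "Arrow S f T \<in> Cof (FG M) \<longleftrightarrow> Arrow S f T \<in> FG_arr M \<and> (\<exists>r \<in> rmodule_homs M T S. \<forall>s \<in> carrier S. r (f s) = s)"
proof -
  have "quot_rmodule M T (f ` carrier S) \<in> FG_obj M" if "Arrow S f T \<in> FG_arr M"
  proof (rule quot_rmodule_FG[OF M])
    have o: "S \<in> FG_obj M" "T \<in> FG_obj M" "f \<in> rmodule_homs M S T" using that by (simp_all add: FG_arr_iff)
    note S = rmoduleD[OF FG_objD(1)[OF o(1)]] and f = rmodule_homsD[OF o(3)]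
    show "T \<in> FG_obj M" by (rule o)
    show "f ` carrier S \<subseteq> carrier T" using f by blast
    show "Pt \<in> f ` carrier S" using f(2) S(1) FG_objD(3)[OF o(2)] by (metis imageI)
    show "ract T t m \<in> f ` carrier S" if "t \<in> f ` carrier S" "m \<in> carrier M" for t m
    proof -
      obtain s where s: "s \<in> carrier S" "t = f s" using \<open>t \<in> f ` carrier S\<close> by blast
      then have "ract T t m = f (ract S s m)" using f(3)[OF s(1) \<open>m \<in> carrier M\<close>] by simp
      then show ?thesis using S(2)[OF s(1) \<open>m \<in> carrier M\<close>] by blast
    qed
  qed
  then show ?thesis by (auto simp: FG_cof)
qed

lemma FG_cofE:
  assumes M: "is_f1_algebra M" and a: "a \<in> Cof (FG M)"
  obtains S f T r where "a = Arrow S f T" "S \<in> FG_obj M" "T \<in> FG_obj M" "f \<in> rmodule_homs M S T"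
    "r \<in> rmodule_homs M T S" "\<And>s. s \<in> carrier S \<Longrightarrow> r (f s) = s"
proof -
  obtain S f T where e: "a = Arrow S f T" using a by (auto simp: FG_cof)
  show ?thesis using a FG_cof_iff[OF M, of S f T] that[OF e] by (auto simp: e FG_arr_iff)
qed

section \<open>Zero object, pushouts and the Waldhausen axioms\<close>

lemma FG_zob_obj: "is_f1_algebra M \<Longrightarrow> Zob (FG M) \<in> FG_obj M"
  using f1_algebraD[of M] unfolding FG_obj_def FG_zob is_rmodule_def fin_generated_def
  by (auto intro!: exI[of _ "{Pt}"])

lemma FG_zero:
  assumes M: "is_f1_algebra M"
  shows "zero_object (FG M) (Zob (FG M))"
  unfolding zero_object_def FG_sel
proof (intro conjI ballI)
  note Z = FG_zob_obj[OF M]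
  show "Zob (FG M) \<in> FG_obj M" by (rule Z)
  have cz: "carrier (Zob (FG M)) = {Pt}" by (simp add: FG_zob)
  fix A assume A: "A \<in> FG_obj M"
  note A1 = rmoduleD[OF FG_objD(1)[OF A]] and bA = FG_objD(3)[OF A] and bZ = FG_objD(3)[OF Z]
    and Z1 = rmoduleD[OF FG_objD(1)[OF Z]]
  show "\<exists>!f. f \<in> FG_arr M \<and> arrow_src f = Zob (FG M) \<and> arrow_tgt f = A"
  proof (rule ex_ex1I)
    have "restrict (\<lambda>s. Pt) (carrier (Zob (FG M))) \<in> rmodule_homs M (Zob (FG M)) A"
      by (rule rmodule_homs_restrict[OF FG_objD(1)[OF Z]]) (use A1 bA bZ in auto)
    then show "\<exists>f. f \<in> FG_arr M \<and> arrow_src f = Zob (FG M) \<and> arrow_tgt f = A"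
      using A Z by (intro exI[of _ "Arrow (Zob (FG M)) (restrict (\<lambda>s. Pt) (carrier (Zob (FG M)))) A"]) (simp add: FG_arr_iff)
    fix f g assume "f \<in> FG_arr M \<and> arrow_src f = Zob (FG M) \<and> arrow_tgt f = A" "g \<in> FG_arr M \<and> arrow_src g = Zob (FG M) \<and> arrow_tgt g = A"
    then obtain f' g' where fg: "f = Arrow (Zob (FG M)) f' A" "g = Arrow (Zob (FG M)) g' A"
      "f' \<in> rmodule_homs M (Zob (FG M)) A" "g' \<in> rmodule_homs M (Zob (FG M)) A"
      by (auto elim!: FG_arrE)
    have "f' = g'" by (rule rmodule_homs_eqI[OF fg(3,4)]) (use rmodule_homsD(2)[OF fg(3)] rmodule_homsD(2)[OF fg(4)] bZ in \<open>simp add: cz\<close>)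
    then show "f = g" using fg by simp
  qed
  show "\<exists>!f. f \<in> FG_arr M \<and> arrow_src f = A \<and> arrow_tgt f = Zob (FG M)"
  proof (rule ex_ex1I)
    have "restrict (\<lambda>s. Pt) (carrier A) \<in> rmodule_homs M A (Zob (FG M))"
      by (rule rmodule_homs_restrict[OF FG_objD(1)[OF A]]) (use bZ cz Z1 in auto)
    then show "\<exists>f. f \<in> FG_arr M \<and> arrow_src f = A \<and> arrow_tgt f = Zob (FG M)"
      using A Z by (intro exI[of _ "Arrow A (restrict (\<lambda>s. Pt) (carrier A)) (Zob (FG M))"]) (simp add: FG_arr_iff)
    fix f g assume "f \<in> FG_arr M \<and> arrow_src f = A \<and> arrow_tgt f = Zob (FG M)" "g \<in> FG_arr M \<and> arrow_src g = A \<and> arrow_tgt g = Zob (FG M)"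
    then obtain f' g' where fg: "f = Arrow A f' (Zob (FG M))" "g = Arrow A g' (Zob (FG M))"
      "f' \<in> rmodule_homs M A (Zob (FG M))" "g' \<in> rmodule_homs M A (Zob (FG M))"
      by (auto elim!: FG_arrE)
    have "f' = g'" by (rule rmodule_homs_eqI[OF fg(3,4)]) (use rmodule_homsD(1)[OF fg(3)] rmodule_homsD(1)[OF fg(4)] in \<open>simp add: cz\<close>)
    then show "f = g" using fg by simp
  qed
qed

text \<open>\<open>c\<close> and \<open>d\<close> are jointly surjective. A map with prescribed
  composites with \<open>c\<close> and \<open>d\<close> is therefore unique, and it is automatically
  a homomorphism, so \<open>u\<close> has to be provided only as a function.\<close>

lemma FG_pushoutI:
  assumes obj: "X \<in> FG_obj M" "Y \<in> FG_obj M" "Z \<in> FG_obj M" "P \<in> FG_obj M"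
    and homs: "a \<in> rmodule_homs M X Y" "b \<in> rmodule_homs M X Z" "c \<in> rmodule_homs M Y P" "d \<in> rmodule_homs M Z P"
    and eq: "\<And>x. x \<in> carrier X \<Longrightarrow> c (a x) = d (b x)"
    and surj: "\<And>p. p \<in> carrier P \<Longrightarrow> (\<exists>y \<in> carrier Y. p = c y) \<or> (\<exists>z \<in> carrier Z. p = d z)"
    and ex: "\<And>W c' d'. W \<in> FG_obj M \<Longrightarrow> c' \<in> rmodule_homs M Y W \<Longrightarrow> d' \<in> rmodule_homs M Z W \<Longrightarrow>
        (\<And>x. x \<in> carrier X \<Longrightarrow> c' (a x) = d' (b x)) \<Longrightarrow>
        \<exists>u. (\<forall>y \<in> carrier Y. u (c y) = c' y) \<and> (\<forall>z \<in> carrier Z. u (d z) = d' z)"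
  shows "is_pushout (FG M) (Arrow X a Y) (Arrow X b Z) (Arrow Y c P) (Arrow Z d P)"
proof (rule FG.pushoutI[of _ _ X Y _ Z _ P])
  show "Cmp (FG M) (Arrow Y c P) (Arrow X a Y) = Cmp (FG M) (Arrow Z d P) (Arrow X b Z)"
    using eq by (auto simp: compose_def fun_eq_iff)
next
  fix c' d' W assume c': "FG.arr M c' Y W" and d': "FG.arr M d' Z W"
    and eq': "Cmp (FG M) c' (Arrow X a Y) = Cmp (FG M) d' (Arrow X b Z)"
  obtain cf where cf: "c' = Arrow Y cf W" "cf \<in> rmodule_homs M Y W" "W \<in> FG_obj M" using c' by (auto elim!: FG_arrE)
  obtain df where df: "d' = Arrow Z df W" "df \<in> rmodule_homs M Z W" using d' by (auto elim!: FG_arrE)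
  have "cf (a x) = df (b x)" if "x \<in> carrier X" for x
    by (rule compose_eqD[of "carrier X"]) (use eq' that in \<open>simp_all add: cf df\<close>)
  then obtain u where u: "\<forall>y \<in> carrier Y. u (c y) = cf y" "\<forall>z \<in> carrier Z. u (d z) = df z"
    using ex[OF cf(3,2) df(2)] by blast
  have "restrict u (carrier P) \<in> rmodule_homs M P W"
  proof (rule rmodule_homs_restrict[OF FG_objD(1)[OF obj(4)]])
    note Y = rmoduleD[OF FG_objD(1)[OF obj(2)]] and Z = rmoduleD[OF FG_objD(1)[OF obj(3)]]
    note hc = rmodule_homsD[OF homs(3)] and hd = rmodule_homsD[OF homs(4)]
      and hc' = rmodule_homsD[OF cf(2)] and hd' = rmodule_homsD[OF df(2)]
    show "u (base P) = base W" using u Y(1) hc(2) hc'(2) by metis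
    fix p assume p: "p \<in> carrier P"
    show "u p \<in> carrier W" using surj[OF p] u hc'(1) hd'(1) by auto
    fix m assume m: "m \<in> carrier M"
    from surj[OF p] show "u (ract P p m) = ract W (u p) m"
    proof
      assume "\<exists>y \<in> carrier Y. p = c y"
      then obtain y where y: "y \<in> carrier Y" "p = c y" by blast
      have "u (c (ract Y y m)) = cf (ract Y y m)" using u(1) Y(2)[OF y(1) m] by blast
      then show ?thesis using hc(3)[OF y(1) m] hc'(3)[OF y(1) m] u(1) y by simp
    next
      assume "\<exists>z \<in> carrier Z. p = d z"
      then obtain z where z: "z \<in> carrier Z" "p = d z" by blast
      have "u (d (ract Z z m)) = df (ract Z z m)" using u(2) Z(2)[OF z(1) m] by blast
      then show ?thesis using hd(3)[OF z(1) m] hd'(3)[OF z(1) m] u(2) z by simp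
    qed
  qed
  moreover have "compose (carrier Y) (restrict u (carrier P)) c = cf" "compose (carrier Z) (restrict u (carrier P)) d = df"
    using u rmodule_homsD(1)[OF homs(3)] rmodule_homsD(1)[OF homs(4)] rmodule_homsD(4)[OF cf(2)] rmodule_homsD(4)[OF df(2)]
    by (auto simp: compose_def extensional_def fun_eq_iff)
  ultimately show "\<exists>u. FG.arr M u P W \<and> Cmp (FG M) u (Arrow Y c P) = c' \<and> Cmp (FG M) u (Arrow Z d P) = d'"
    using obj cf df by (intro exI[of _ "Arrow P (restrict u (carrier P)) W"]) (simp add: FG_arr_iff)
next
  fix u v W assume u: "FG.arr M u P W" and v: "FG.arr M v P W"
    and eqs: "Cmp (FG M) u (Arrow Y c P) = Cmp (FG M) v (Arrow Y c P)" "Cmp (FG M) u (Arrow Z d P) = Cmp (FG M) v (Arrow Z d P)"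
  obtain uf where uf: "u = Arrow P uf W" "uf \<in> rmodule_homs M P W" using u by (auto elim!: FG_arrE)
  obtain vf where vf: "v = Arrow P vf W" "vf \<in> rmodule_homs M P W" using v by (auto elim!: FG_arrE)
  have "uf = vf"
  proof (rule rmodule_homs_eqI[OF uf(2) vf(2)])
    fix p assume p: "p \<in> carrier P"
    have 1: "uf (c y) = vf (c y)" if "y \<in> carrier Y" for y
      by (rule compose_eqD[of "carrier Y"]) (use eqs(1) that in \<open>simp_all add: uf vf\<close>)
    have 2: "uf (d z) = vf (d z)" if "z \<in> carrier Z" for z
      by (rule compose_eqD[of "carrier Z"]) (use eqs(2) that in \<open>simp_all add: uf vf\<close>)
    show "uf p = vf p" using surj[OF p] 1 2 by auto
  qed
  then show "u = v" by (simp add: uf vf)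
qed (use obj homs in \<open>simp_all add: FG_arr_iff\<close>)

text \<open>The pushout along a split monomorphism is \<open>Z\<close> together with the complement
  of the image \<open>I\<close> of \<open>a\<close> in \<open>Y\<close>. The map
  \<open>\<kappa>\<close> from \<open>Y\<close> to it leads the elements of \<open>I\<close> back
  along the retraction \<open>r\<close> and on by \<open>b\<close>.\<close>

lemma FG_pushout_ex:
  fixes M :: "'a f1_algebra"
  assumes M: "is_f1_algebra M" and obj: "X \<in> FG_obj M" "Y \<in> FG_obj M" "Z \<in> FG_obj M"
    and a: "a \<in> rmodule_homs M X Y" and b: "b \<in> rmodule_homs M X Z" and r: "r \<in> rmodule_homs M Y X"
    and ra: "\<And>x. x \<in> carrier X \<Longrightarrow> r (a x) = x"
  shows "\<exists>c d. is_pushout (FG M) (Arrow X a Y) (Arrow X b Z) c d"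
proof -
  note X1 = rmoduleD[OF FG_objD(1)[OF obj(1)]] and Y1 = rmoduleD[OF FG_objD(1)[OF obj(2)]] and Z1 = rmoduleD[OF FG_objD(1)[OF obj(3)]]
  note bs = FG_objD(3)[OF obj(1)] FG_objD(3)[OF obj(2)] FG_objD(3)[OF obj(3)]
  note ha = rmodule_homsD[OF a] and hb = rmodule_homsD[OF b] and hr = rmodule_homsD[OF r]
  note M1 = f1_algebraD[OF M]
  define I where "I = a ` carrier X"
  have I_act: "ract Y y m \<in> I" if "y \<in> I" "m \<in> carrier M" for y m
    using that ha(3) X1(2) unfolding I_def by (metis (no_types, lifting) image_iff)
  have rI: "a (r y) = y" if "y \<in> I" for y using that ra by (auto simp: I_def)
  have PtI: "Pt \<in> I" using ha(2) X1(1) bs unfolding I_def by (metis imageI)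
  define \<kappa> :: "'a elt \<Rightarrow> 'a elt + 'a elt" where "\<kappa> = (\<lambda>y. if y \<in> I then Inl (b (r y)) else Inr y)"
  define Q where "Q = Inl ` carrier Z \<union> Inr ` (carrier Y - I)"
  \<comment> \<open>The action can lead from the complement into \<open>I\<close>; then
    \<open>\<kappa>\<close> moves the result over to \<open>Z\<close>.\<close>
  define act where "act = (\<lambda>p m. if p \<in> Q \<and> m \<in> carrier M then (case p of Inl z \<Rightarrow> Inl (ract Z z m) | Inr y \<Rightarrow> \<kappa> (ract Y y m)) else undefined)"
  define P where "P = \<lparr>carrier = Q, base = Inl Pt, ract = act\<rparr>"
  have \<kappa>Q: "\<kappa> y \<in> Q" if "y \<in> carrier Y" for y using that hb(1) hr(1) by (auto simp: \<kappa>_def Q_def)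
  \<comment> \<open>On \<open>I\<close> this is the equivariance of \<open>r\<close> and
    \<open>b\<close>, outside \<open>I\<close> it is the definition of \<open>act\<close>.\<close>
  have act\<kappa>: "act (\<kappa> y) m = \<kappa> (ract Y y m)" if "y \<in> carrier Y" "m \<in> carrier M" for y m
  proof (cases "y \<in> I")
    case True
    then show ?thesis using that \<kappa>Q[OF that(1)] I_act[OF True that(2)] hb(3)[OF hr(1)] hr(3)[OF that] by (simp add: act_def \<kappa>_def hr(1))
  next
    case False
    then show ?thesis using that \<kappa>Q[OF that(1)] by (simp add: act_def \<kappa>_def)
  qed
  have actZ: "act (Inl z) m = Inl (ract Z z m)" if "z \<in> carrier Z" "m \<in> carrier M" for z m
    using that by (simp add: act_def Q_def)
  have ZQ: "Inl z \<in> Q" if "z \<in> carrier Z" for z using that by (simp add: Q_def)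
  \<comment> \<open>Each element comes from \<open>Z\<close> or is a value of
    \<open>\<kappa>\<close>, and the action is computed in \<open>Z\<close> or in \<open>Y\<close>
    accordingly. The module axioms are inherited in this way.\<close>
  have Qcases: "(\<exists>z \<in> carrier Z. p = Inl z) \<or> (\<exists>y \<in> carrier Y. p = \<kappa> y)" if "p \<in> Q" for p
    using that by (auto simp: Q_def \<kappa>_def)
  have P: "is_rmodule M P"
    unfolding is_rmodule_def P_def partial_object.select_convs rmodule.select_convs
  proof (intro conjI ballI allI impI)
    show "Inl Pt \<in> Q" using Z1(1) bs by (simp add: Q_def)
    show "act (Inl Pt) m = Inl Pt" if "m \<in> carrier M" for m using actZ[OF Z1(1) that] Z1(5)[OF that] bs by simp
    fix p assume p: "p \<in> Q"
    show "act p m \<in> Q" if m: "m \<in> carrier M" for m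
      using Qcases[OF p] by (elim disjE bexE) (simp_all add: actZ act\<kappa> m Z1(2) Y1(2) ZQ \<kappa>Q)
    show "act p \<one>\<^bsub>M\<^esub> = p" using Qcases[OF p] actZ[OF _ M1(1)] act\<kappa>[OF _ M1(1)] Z1(3) Y1(3) by auto
    have \<kappa>Pt: "\<kappa> Pt = Inl Pt" using PtI hr(2) hb(2) bs by (simp add: \<kappa>_def)
    show "act p (absorb M) = Inl Pt" using Qcases[OF p] actZ[OF _ M1(2)] act\<kappa>[OF _ M1(2)] Z1(6) Y1(6) bs \<kappa>Pt by auto
    show "act (act p m) n = act p (m \<otimes>\<^bsub>M\<^esub> n)" if mn: "m \<in> carrier M" "n \<in> carrier M" for m n
      using Qcases[OF p]
    proof
      assume "\<exists>z \<in> carrier Z. p = Inl z"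
      then obtain z where z: "z \<in> carrier Z" "p = Inl z" by blast
      then show ?thesis using actZ[OF z(1) mn(1)] actZ[OF Z1(2)[OF z(1) mn(1)] mn(2)] actZ[OF z(1) M1(3)[OF mn]] Z1(4)[OF z(1) mn] by simp
    next
      assume "\<exists>y \<in> carrier Y. p = \<kappa> y"
      then obtain y where y: "y \<in> carrier Y" "p = \<kappa> y" by blast
      then show ?thesis using act\<kappa>[OF y(1) mn(1)] act\<kappa>[OF Y1(2)[OF y(1) mn(1)] mn(2)] act\<kappa>[OF y(1) M1(3)[OF mn]] Y1(4)[OF y(1) mn] by simp
    qed
  next
    fix p m assume "p \<notin> Q \<or> m \<notin> carrier M"
    then show "act p m = undefined" by (auto simp: act_def)
  qed
  obtain G where G: "finite G" "G \<subseteq> carrier Y" "carrier Y = (\<Union>s \<in> G. ract Y s ` carrier M)"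
    using FG_objD(2)[OF obj(2)] by (auto simp: fin_generated_def)
  obtain H where H: "finite H" "H \<subseteq> carrier Z" "carrier Z = (\<Union>s \<in> H. ract Z s ` carrier M)"
    using FG_objD(2)[OF obj(3)] by (auto simp: fin_generated_def)
  have gen: "Q = (\<Union>s \<in> \<kappa> ` G \<union> Inl ` H. act s ` carrier M)"
  proof (intro equalityI subsetI)
    fix p assume "p \<in> Q"
    from Qcases[OF this] show "p \<in> (\<Union>s \<in> \<kappa> ` G \<union> Inl ` H. act s ` carrier M)"
    proof
      assume "\<exists>z \<in> carrier Z. p = Inl z"
      then obtain z where z: "z \<in> carrier Z" "p = Inl z" by blast
      have "z \<in> (\<Union>s \<in> H. ract Z s ` carrier M)" using z(1) H(3) by simp
      then obtain h m where h: "h \<in> H" "m \<in> carrier M" "z = ract Z h m" by blast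
      then have "h \<in> carrier Z" using H(2) by blast
      then have "p = act (Inl h) m" using actZ[OF _ h(2)] h(3) z(2) by simp
      then show ?thesis using h by blast
    next
      assume "\<exists>y \<in> carrier Y. p = \<kappa> y"
      then obtain y where y: "y \<in> carrier Y" "p = \<kappa> y" by blast
      have "y \<in> (\<Union>s \<in> G. ract Y s ` carrier M)" using y(1) G(3) by simp
      then obtain g m where g: "g \<in> G" "m \<in> carrier M" "y = ract Y g m" by blast
      then have "g \<in> carrier Y" using G(2) by blast
      then have "p = act (\<kappa> g) m" using act\<kappa>[OF _ g(2)] g(3) y(2) by simp
      then show ?thesis using g by blast
    qed
  next
    fix p assume "p \<in> (\<Union>s \<in> \<kappa> ` G \<union> Inl ` H. act s ` carrier M)"
    then obtain s m where s: "s \<in> \<kappa> ` G \<union> Inl ` H" "m \<in> carrier M" "p = act s m" by blast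
    then have "s \<in> Q" using \<kappa>Q G(2) H(2) by (auto simp: Q_def)
    then show "p \<in> Q" using rmoduleD(2)[OF P, of s m] s by (simp add: P_def)
  qed
  have "fin_generated M P"
    unfolding fin_generated_def
  proof (intro exI conjI)
    show "finite (\<kappa> ` G \<union> Inl ` H)" "\<kappa> ` G \<union> Inl ` H \<subseteq> carrier P"
      using G(1,2) H(1,2) \<kappa>Q ZQ by (auto simp: P_def)
  qed (use gen in \<open>simp add: P_def\<close>)
  \<comment> \<open>The carrier of \<open>P\<close> lies in a sum type; \<open>f\<close> identifies
    it with a module on a subset of \<open>'a elt\<close>.\<close>
  from FG_all_modules[OF M P this] obtain T f where T: "T \<in> FG_obj M" and f: "f \<in> rmodule_homs M P T"
    and bij: "bij_betw f (carrier P) (carrier T)" by blast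
  note hf = rmodule_homsD[OF f]
  have cP: "carrier P = Q" "base P = Inl Pt" "ract P = act" by (simp_all add: P_def)
  define c where "c = restrict (\<lambda>y. f (\<kappa> y)) (carrier Y)"
  define d where "d = restrict (\<lambda>z. f (Inl z)) (carrier Z)"
  have "\<kappa> Pt = Inl Pt" using PtI hr(2) hb(2) bs by (simp add: \<kappa>_def)
  then have c: "c \<in> rmodule_homs M Y T"
    unfolding c_def using hf \<kappa>Q act\<kappa> bs cP
    by (intro rmodule_homs_restrict[OF FG_objD(1)[OF obj(2)]]) (auto simp flip: act\<kappa>)
  have d: "d \<in> rmodule_homs M Z T"
    unfolding d_def using hf ZQ actZ bs cP
    by (intro rmodule_homs_restrict[OF FG_objD(1)[OF obj(3)]]) (auto simp flip: actZ)
  have "is_pushout (FG M) (Arrow X a Y) (Arrow X b Z) (Arrow Y c T) (Arrow Z d T)"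
  proof (rule FG_pushoutI[OF obj T a b c d])
    show "c (a x) = d (b x)" if x: "x \<in> carrier X" for x
      using ha(1)[OF x] hb(1)[OF x] ra[OF x] x by (simp add: c_def d_def \<kappa>_def I_def)
    show "(\<exists>y \<in> carrier Y. t = c y) \<or> (\<exists>z \<in> carrier Z. t = d z)" if "t \<in> carrier T" for t
    proof -
      obtain p where p: "p \<in> Q" "t = f p" using bij \<open>t \<in> carrier T\<close> cP by (auto simp: bij_betw_def)
      show ?thesis using Qcases[OF p(1)] p(2) by (auto simp: c_def d_def)
    qed
    fix W c' d' assume W: "W \<in> FG_obj M" "c' \<in> rmodule_homs M Y W" "d' \<in> rmodule_homs M Z W"
      and eq: "\<And>x. x \<in> carrier X \<Longrightarrow> c' (a x) = d' (b x)"
    \<comment> \<open>The equation on \<open>Y\<close> needs an argument only on \<open>I\<close>: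
      there \<open>y\<close> is represented by \<open>b (r y)\<close>, and the cocone condition at
      \<open>r y\<close> gives the value \<open>c' y\<close>.\<close>
    define u where "u = (\<lambda>t. case inv_into Q f t of Inl z \<Rightarrow> d' z | Inr y \<Rightarrow> c' y)"
    have inv: "inv_into Q f (f p) = p" if "p \<in> Q" for p using bij that cP by (simp add: bij_betw_def inv_into_f_f)
    have "u (c y) = c' y" if y: "y \<in> carrier Y" for y
    proof (cases "y \<in> I")
      case True
      have "d' (b (r y)) = c' y" using eq[OF hr(1)[OF y]] rI[OF True] by simp
      then show ?thesis using True y inv[OF \<kappa>Q[OF y]] by (simp add: u_def c_def \<kappa>_def)
    next
      case False
      then show ?thesis using y inv[OF \<kappa>Q[OF y]] by (simp add: u_def c_def \<kappa>_def)
    qed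
    moreover have "u (d z) = d' z" if z: "z \<in> carrier Z" for z
      using z inv[OF ZQ[OF z]] by (simp add: u_def d_def)
    ultimately show "\<exists>u. (\<forall>y \<in> carrier Y. u (c y) = c' y) \<and> (\<forall>z \<in> carrier Z. u (d z) = d' z)" by blast
  qed
  then show ?thesis by blast
qed

text \<open>If \<open>r\<close> is a retraction of the map of \<open>a\<close>, then
  \<open>r\<close> followed by the map of \<open>b\<close>, together with the identity of
  \<open>Z\<close>, is a cocone. The arrow it induces out of the pushout is a retraction of
  \<open>d\<close>.\<close>

lemma FG_pushout_cof:
  assumes M: "is_f1_algebra M" and a: "a \<in> Cof (FG M)" and po: "is_pushout (FG M) a b c d"
  shows "d \<in> Cof (FG M)"
proof -
  obtain X f Y r where a': "a = Arrow X f Y" "X \<in> FG_obj M" "Y \<in> FG_obj M" "f \<in> rmodule_homs M X Y"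
    and r: "r \<in> rmodule_homs M Y X" "\<And>s. s \<in> carrier X \<Longrightarrow> r (f s) = s"
    using FG_cofE[OF M a] by metis
  note D = FG.pushoutD[OF po, unfolded FG_sel]
  obtain g Z where b': "b = Arrow X g Z" "Z \<in> FG_obj M" "g \<in> rmodule_homs M X Z"
    using D(2,5) a' by (auto elim!: FG_arrE)
  obtain h P where d': "d = Arrow Z h P" "P \<in> FG_obj M" "h \<in> rmodule_homs M Z P"
    using D(4,7) b' by (auto elim!: FG_arrE)
  have P: "arrow_tgt c = P" using D(8) d' by simp
  have br: "compose (carrier Y) g r \<in> rmodule_homs M Y Z"
    by (rule rmodule_homs_compose[OF FG_objD(1)[OF a'(3)] r(1) b'(3)])
  have ii: "(\<lambda>s \<in> carrier Z. s) \<in> rmodule_homs M Z Z" by (rule rmodule_homs_id[OF FG_objD(1)[OF b'(2)]])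
  have "compose (carrier X) (compose (carrier Y) g r) f = compose (carrier X) (\<lambda>s\<in>carrier Z. s) g"
    using r(2) rmodule_homsD(1)[OF a'(4)] rmodule_homsD(1)[OF b'(3)] by (auto simp: compose_def fun_eq_iff)
  then have po_eq: "Cmp (FG M) (Arrow Y (compose (carrier Y) g r) Z) a = Cmp (FG M) (Arrow Z (\<lambda>s \<in> carrier Z. s) Z) b"
    by (simp add: a' b')
  obtain u where u: "FG.arr M u (Tgt (FG M) c) Z" "Cmp (FG M) u c = Arrow Y (compose (carrier Y) g r) Z"
    "Cmp (FG M) u d = Arrow Z (\<lambda>s \<in> carrier Z. s) Z"
    by (rule FG.pushout_ex[OF po _ _ po_eq that]) (use a' b' br ii in \<open>simp_all add: FG_arr_iff\<close>)
  obtain uf where uf: "u = Arrow P uf Z" "uf \<in> rmodule_homs M P Z" using u(1) P by (auto elim!: FG_arrE)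
  have "compose (carrier Z) uf h = (\<lambda>s \<in> carrier Z. s)" using u(3) by (simp add: uf d')
  then have "uf (h s) = s" if "s \<in> carrier Z" for s by (rule compose_eq_restrictD[OF _ that])
  then show ?thesis using uf(2) d' b' by (auto simp: FG_cof_iff[OF M] FG_arr_iff)
qed

theorem FG_waldhausen:
  assumes M: "is_f1_algebra M"
  shows "is_waldhausen (FG M)"
  unfolding is_waldhausen_def
proof (intro conjI FG_category FG_zero[OF M])
  show "Cof (FG M) \<subseteq> Arr (FG M)" by (auto simp: FG_cof)
  show "Weq (FG M) \<subseteq> Arr (FG M)" by (auto simp: FG_weq iso_arrow_def)
  show "\<forall>f. iso_arrow (FG M) f \<longrightarrow> f \<in> Cof (FG M) \<and> f \<in> Weq (FG M)"
  proof (intro allI impI conjI)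
    fix a assume a: "iso_arrow (FG M) a"
    then have "a \<in> FG_arr M" by (simp add: iso_arrow_def)
    then obtain S f T where e: "a = Arrow S f T" by (rule FG_arrE)
    show "a \<in> Cof (FG M)" using a unfolding e by (elim FG_isoE) (auto simp: FG_cof_iff[OF M] FG_arr_iff)
    show "a \<in> Weq (FG M)" using a by (simp add: FG_weq)
  qed
  show "\<forall>f \<in> Cof (FG M). \<forall>g \<in> Cof (FG M). Src (FG M) g = Tgt (FG M) f \<longrightarrow> Cmp (FG M) g f \<in> Cof (FG M)"
  proof (intro ballI impI)
    fix a b assume a: "a \<in> Cof (FG M)" and b: "b \<in> Cof (FG M)" and ab: "Src (FG M) b = Tgt (FG M) a"
    obtain S f T r where a': "a = Arrow S f T" "S \<in> FG_obj M" "T \<in> FG_obj M" "f \<in> rmodule_homs M S T"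
      "r \<in> rmodule_homs M T S" "\<And>s. s \<in> carrier S \<Longrightarrow> r (f s) = s" using FG_cofE[OF M a] by metis
    obtain g U q where b': "b = Arrow T g U" "U \<in> FG_obj M" "g \<in> rmodule_homs M T U"
      "q \<in> rmodule_homs M U T" "\<And>s. s \<in> carrier T \<Longrightarrow> q (g s) = s" using FG_cofE[OF M b] ab a'(1)
      by (metis FG_sel(3,4) arrow.sel(1,3))
    have "compose (carrier U) r q \<in> rmodule_homs M U S" "compose (carrier S) g f \<in> rmodule_homs M S U"
      using rmodule_homs_compose[OF FG_objD(1)] a' b' by blast+
    moreover have "compose (carrier U) r q (compose (carrier S) g f s) = s" if "s \<in> carrier S" for s
      using that a'(6) b'(5) rmodule_homsD(1)[OF a'(4)] rmodule_homsD(1)[OF b'(3)] by (simp add: compose_def)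
    ultimately show "Cmp (FG M) b a \<in> Cof (FG M)"
      using a' b' by (auto simp: FG_cof_iff[OF M] FG_arr_iff)
  qed
  show "\<forall>f \<in> Weq (FG M). \<forall>g \<in> Weq (FG M). Src (FG M) g = Tgt (FG M) f \<longrightarrow> Cmp (FG M) g f \<in> Weq (FG M)"
  proof (intro ballI impI)
    fix f g assume "f \<in> Weq (FG M)" "g \<in> Weq (FG M)" "Src (FG M) g = Tgt (FG M) f"
    then show "Cmp (FG M) g f \<in> Weq (FG M)"
      using FG.iso_cmp[of M f g "Src (FG M) f" "Tgt (FG M) f" "Tgt (FG M) g"] by (simp add: FG_weq iso_arrow_def)
  qed
  show "\<forall>f \<in> Arr (FG M). Src (FG M) f = Zob (FG M) \<longrightarrow> f \<in> Cof (FG M)"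
  proof (intro ballI impI)
    fix a assume "a \<in> Arr (FG M)" "Src (FG M) a = Zob (FG M)"
    then obtain f T where a: "a = Arrow (Zob (FG M)) f T" "T \<in> FG_obj M" "f \<in> rmodule_homs M (Zob (FG M)) T"
      by (auto elim!: FG_arrE)
    have cz: "carrier (Zob (FG M)) = {Pt}" by (simp add: FG_zob)
    note Z = FG_zob_obj[OF M]
    \<comment> \<open>The constant map retracts every homomorphism out of the zero module.\<close>
    have "restrict (\<lambda>s. Pt) (carrier T) \<in> rmodule_homs M T (Zob (FG M))"
      by (rule rmodule_homs_restrict[OF FG_objD(1)[OF a(2)]])
        (use FG_objD(3)[OF Z] cz rmoduleD[OF FG_objD(1)[OF Z]] in auto)
    moreover have "restrict (\<lambda>s. Pt) (carrier T) (f s) = s" if "s \<in> carrier (Zob (FG M))" for s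
      using that rmodule_homsD(1)[OF a(3) that] by (simp add: cz)
    ultimately show "a \<in> Cof (FG M)"
      unfolding a(1) FG_cof_iff[OF M] FG_arr_iff using a Z
      by (intro conjI bexI[of _ "restrict (\<lambda>s. Pt) (carrier T)"] ballI) blast+
  qed
  show "\<forall>a \<in> Cof (FG M). \<forall>b \<in> Arr (FG M). Src (FG M) b = Src (FG M) a \<longrightarrow> (\<exists>c d. is_pushout (FG M) a b c d)"
  proof (intro ballI impI)
    fix a b assume a: "a \<in> Cof (FG M)" and b: "b \<in> Arr (FG M)" and ab: "Src (FG M) b = Src (FG M) a"
    obtain S f T r where a': "a = Arrow S f T" "S \<in> FG_obj M" "T \<in> FG_obj M" "f \<in> rmodule_homs M S T"
      "r \<in> rmodule_homs M T S" "\<And>s. s \<in> carrier S \<Longrightarrow> r (f s) = s" using FG_cofE[OF M a] by metis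
    obtain g U where b': "b = Arrow S g U" "U \<in> FG_obj M" "g \<in> rmodule_homs M S U"
      using b ab a' by (auto elim!: FG_arrE)
    show "\<exists>c d. is_pushout (FG M) a b c d"
      unfolding a' b' by (rule FG_pushout_ex[OF M a'(2,3) b'(2) a'(4) b'(3) a'(5,6)])
  qed
  show "\<forall>a b c d. a \<in> Cof (FG M) \<and> is_pushout (FG M) a b c d \<longrightarrow> d \<in> Cof (FG M)"
    using FG_pushout_cof[OF M] by blast
  show "\<forall>a b c d a' b' c' d' x y z w.
        a \<in> Cof (FG M) \<and> a' \<in> Cof (FG M) \<and> is_pushout (FG M) a b c d \<and> is_pushout (FG M) a' b' c' d' \<and>
        x \<in> Weq (FG M) \<and> Src (FG M) x = Src (FG M) a \<and> Tgt (FG M) x = Src (FG M) a' \<and>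
        y \<in> Weq (FG M) \<and> Src (FG M) y = Tgt (FG M) a \<and> Tgt (FG M) y = Tgt (FG M) a' \<and>
        z \<in> Weq (FG M) \<and> Src (FG M) z = Tgt (FG M) b \<and> Tgt (FG M) z = Tgt (FG M) b' \<and>
        Cmp (FG M) y a = Cmp (FG M) a' x \<and> Cmp (FG M) z b = Cmp (FG M) b' x \<and>
        w \<in> Arr (FG M) \<and> Src (FG M) w = Tgt (FG M) c \<and> Tgt (FG M) w = Tgt (FG M) c' \<and>
        Cmp (FG M) w c = Cmp (FG M) c' y \<and> Cmp (FG M) w d = Cmp (FG M) d' z
        \<longrightarrow> w \<in> Weq (FG M)"
  proof (intro allI impI, elim conjE)
    fix a b c d a' b' c' d' x y z w
    assume h: "is_pushout (FG M) a b c d" "is_pushout (FG M) a' b' c' d'"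
      "x \<in> Weq (FG M)" "Src (FG M) x = Src (FG M) a" "Tgt (FG M) x = Src (FG M) a'"
      "y \<in> Weq (FG M)" "Src (FG M) y = Tgt (FG M) a" "Tgt (FG M) y = Tgt (FG M) a'"
      "z \<in> Weq (FG M)" "Src (FG M) z = Tgt (FG M) b" "Tgt (FG M) z = Tgt (FG M) b'"
      "Cmp (FG M) y a = Cmp (FG M) a' x" "Cmp (FG M) z b = Cmp (FG M) b' x"
      "w \<in> Arr (FG M)" "Src (FG M) w = Tgt (FG M) c" "Tgt (FG M) w = Tgt (FG M) c'"
      "Cmp (FG M) w c = Cmp (FG M) c' y" "Cmp (FG M) w d = Cmp (FG M) d' z"
    have i: "iso_arrow (FG M) x" "iso_arrow (FG M) y" "iso_arrow (FG M) z" using h(3,6,9) by (simp_all only: FG_weq)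
    then have ar: "x \<in> Arr (FG M)" "y \<in> Arr (FG M)" "z \<in> Arr (FG M)" by (simp_all only: iso_arrow_def)
    \<comment> \<open>Weak equivalences are isomorphisms here, so this is
      \<open>gluing_iso\<close>.\<close>
    show "w \<in> Weq (FG M)"
      unfolding FG_weq
      by (rule FG.gluing_iso[OF h(1,2) i(1) conjI[OF ar(1) conjI[OF h(4,5)]] i(2) conjI[OF ar(2) conjI[OF h(7,8)]]
            i(3) conjI[OF ar(3) conjI[OF h(10,11)]] h(12,13) conjI[OF h(14) conjI[OF h(15,16)]] h(17,18)])
  qed
qed

section \<open>Base change\<close>

text \<open>The element \<open>s \<and> n\<close> of \<open>base_change_obj M \<alpha> N S\<close>.\<close>

definition tens :: "'a f1_algebra \<Rightarrow> ('a \<Rightarrow> 'a) \<Rightarrow> 'a f1_algebra \<Rightarrow> ('a, 'a elt) rmodule \<Rightarrow> 'a elt \<Rightarrow> 'a \<Rightarrow> 'a elt" where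
  "tens M \<alpha> N S s n = smash_code M \<alpha> N S (smash_rel M \<alpha> N S `` {(s, n)})"

text \<open>The choice of representatives is immaterial only if \<open>g (s m) n = g s (\<alpha>(m) n)\<close>.\<close>

definition tens_lift :: "'a f1_algebra \<Rightarrow> ('a \<Rightarrow> 'a) \<Rightarrow> 'a f1_algebra \<Rightarrow> ('a, 'a elt) rmodule \<Rightarrow>
    ('a elt \<Rightarrow> 'a \<Rightarrow> 'b) \<Rightarrow> 'a elt \<Rightarrow> 'b" where
  "tens_lift M \<alpha> N S g = (\<lambda>x \<in> carrier (base_change_obj M \<alpha> N S).
     case SOME p. p \<in> carrier S \<times> carrier N \<and> x = tens M \<alpha> N S (fst p) (snd p) of (s, n) \<Rightarrow> g s n)"

section \<open>Generators of a base change and balanced maps\<close>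

locale f1_hom =
  fixes M N :: "'a f1_algebra" and \<alpha> :: "'a \<Rightarrow> 'a"
  assumes M: "is_f1_algebra M" and N: "is_f1_algebra N" and \<alpha>: "\<alpha> \<in> f1_homs M N"
begin

lemma \<alpha>_closed: "m \<in> carrier M \<Longrightarrow> \<alpha> m \<in> carrier N"
  and \<alpha>_mult: "m \<in> carrier M \<Longrightarrow> m' \<in> carrier M \<Longrightarrow> \<alpha> (m \<otimes>\<^bsub>M\<^esub> m') = \<alpha> m \<otimes>\<^bsub>N\<^esub> \<alpha> m'"
  and \<alpha>_one: "\<alpha> \<one>\<^bsub>M\<^esub> = \<one>\<^bsub>N\<^esub>" and \<alpha>_absorb: "\<alpha> (absorb M) = absorb N" and \<alpha>_ext: "\<alpha> \<in> extensional (carrier M)"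
  using \<alpha> by (auto simp: f1_homs_def hom_def)

lemmas M1 = f1_algebraD[OF M] and N1 = f1_algebraD[OF N]

abbreviation BC :: "('a, 'a elt) rmodule \<Rightarrow> ('a, 'a elt) rmodule" where "BC \<equiv> base_change_obj M \<alpha> N"
abbreviation tn :: "('a, 'a elt) rmodule \<Rightarrow> 'a elt \<Rightarrow> 'a \<Rightarrow> 'a elt" where "tn \<equiv> tens M \<alpha> N"

abbreviation bf :: "('a, 'a elt) rmodule \<Rightarrow> ('a elt \<Rightarrow> 'a elt) \<Rightarrow> ('a, 'a elt) rmodule \<Rightarrow> 'a elt \<Rightarrow> 'a elt" where
  "bf \<equiv> base_change_fun M \<alpha> N"
abbreviation bc where "bc \<equiv> base_change (Arrow M \<alpha> N)"

definition balanced :: "('a, 'a elt) rmodule \<Rightarrow> ('a elt \<Rightarrow> 'a \<Rightarrow> 'c) \<Rightarrow> bool" where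
  "balanced S g \<longleftrightarrow> (\<forall>s \<in> carrier S. \<forall>m \<in> carrier M. \<forall>n \<in> carrier N. g (ract S s m) n = g s (\<alpha> m \<otimes>\<^bsub>N\<^esub> n))"

lemma balancedI: "(\<And>s m n. s \<in> carrier S \<Longrightarrow> m \<in> carrier M \<Longrightarrow> n \<in> carrier N \<Longrightarrow> g (ract S s m) n = g s (\<alpha> m \<otimes>\<^bsub>N\<^esub> n)) \<Longrightarrow> balanced S g"
  by (simp add: balanced_def)

text \<open>A balanced function has equal values on each generating pair of the relation, hence
  along every zigzag of such pairs.\<close>

lemma smash_rel_lift:
  assumes pq: "((s, n), (s', n')) \<in> smash_rel M \<alpha> N S" and g: "balanced S g"
  shows "g s n = g s' n'"
proof -
  let ?r = "\<lambda>x y. \<exists>s \<in> carrier S. \<exists>m \<in> carrier M. \<exists>n \<in> carrier N. x = (ract S s m, n) \<and> y = (s, \<alpha> m \<otimes>\<^bsub>N\<^esub> n)"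
  have "equivclp ?r (s, n) (s', n')" using pq by (simp add: smash_rel_def)
  then have "g (fst (s, n)) (snd (s, n)) = g (fst (s', n')) (snd (s', n'))"
  proof (induction rule: equivclp_induct)
    case (step y z)
    have "g (fst y) (snd y) = g (fst z) (snd z)" using step.hyps(2) g by (auto simp: balanced_def)
    then show ?case using step.IH by simp
  qed simp
  then show ?thesis by simp
qed

lemma smash_rel_equiv: "equiv (carrier S \<times> carrier N) (smash_rel M \<alpha> N S)"
proof (rule equivI)
  show "sym (smash_rel M \<alpha> N S)" by (rule symI) (auto simp: smash_rel_def intro: equivclp_sym)
  show "trans (smash_rel M \<alpha> N S)" by (rule transI) (auto simp: smash_rel_def intro: equivclp_trans)
qed (auto simp: smash_rel_def refl_on_def)

lemma smash_rel_gen: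
  assumes S: "is_rmodule M S" and "s \<in> carrier S" "m \<in> carrier M" "n \<in> carrier N"
  shows "((ract S s m, n), (s, \<alpha> m \<otimes>\<^bsub>N\<^esub> n)) \<in> smash_rel M \<alpha> N S"
  unfolding smash_rel_def using assms rmoduleD(2)[OF S] \<alpha>_closed N1(3) by (auto intro!: r_into_equivclp)

abbreviation cls :: "('a, 'a elt) rmodule \<Rightarrow> 'a elt \<Rightarrow> 'a \<Rightarrow> ('a elt \<times> 'a) set" where
  "cls S s n \<equiv> smash_rel M \<alpha> N S `` {(s, n)}"

lemma cls_eq_iff:
  "s \<in> carrier S \<Longrightarrow> n \<in> carrier N \<Longrightarrow> s' \<in> carrier S \<Longrightarrow> n' \<in> carrier N \<Longrightarrow>
    cls S s n = cls S s' n' \<longleftrightarrow> ((s, n), (s', n')) \<in> smash_rel M \<alpha> N S"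
  by (rule eq_equiv_class_iff[OF smash_rel_equiv]) simp_all

lemma cls_gen:
  assumes S: "is_rmodule M S" and "s \<in> carrier S" "m \<in> carrier M" "n \<in> carrier N"
  shows "cls S (ract S s m) n = cls S s (\<alpha> m \<otimes>\<^bsub>N\<^esub> n)"
  using equiv_class_eq[OF smash_rel_equiv smash_rel_gen[OF assms]] .

lemma smash_sel:
  "carrier (smash M \<alpha> N S) = (carrier S \<times> carrier N) // smash_rel M \<alpha> N S"
  "base (smash M \<alpha> N S) = cls S (base S) (absorb N)"
  by (simp_all add: smash_def Let_def)

lemma smash_carrier: "X \<in> carrier (smash M \<alpha> N S) \<longleftrightarrow> (\<exists>s \<in> carrier S. \<exists>n \<in> carrier N. X = cls S s n)"
  by (auto simp: smash_sel quotient_def)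

text \<open>The unions in \<open>smash\<close> and \<open>smash_map\<close> run over all
  representatives of a class. A balanced \<open>g\<close> has the same value on each of them, and
  the union is that value.\<close>

lemma Union_cls:
  assumes s: "s \<in> carrier S" "n \<in> carrier N" and g: "balanced S g"
  shows "(\<Union>(s', n') \<in> cls S s n. g s' n') = g s n"
proof -
  have "g s' n' = g s n" if "(s', n') \<in> cls S s n" for s' n'
    using smash_rel_lift[OF _ g, of s n s' n'] that by auto
  moreover have "(s, n) \<in> cls S s n" using equiv_class_self[OF smash_rel_equiv] s by blast
  ultimately show ?thesis by blast
qed

lemma smash_ract:
  assumes S: "is_rmodule M S" and s: "s \<in> carrier S" "n \<in> carrier N" "n' \<in> carrier N"
  shows "ract (smash M \<alpha> N S) (cls S s n) n' = cls S s (n \<otimes>\<^bsub>N\<^esub> n')"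
proof -
  have "balanced S (\<lambda>s n. cls S s (n \<otimes>\<^bsub>N\<^esub> n'))"
    by (rule balancedI) (use cls_gen[OF S] s(3) N1(3,6) \<alpha>_closed in simp)
  note U = Union_cls[OF s(1,2) this]
  have "cls S s n \<in> (carrier S \<times> carrier N) // smash_rel M \<alpha> N S" using s by (auto intro: quotientI)
  then show ?thesis using U s(3) by (simp add: smash_def Let_def)
qed

lemma smash_map_cls:
  assumes S: "is_rmodule M S" and T: "is_rmodule M T" and f: "f \<in> rmodule_homs M S T"
    and s: "s \<in> carrier S" "n \<in> carrier N"
  shows "smash_map M \<alpha> N S f T (cls S s n) = cls T (f s) n"
proof -
  have "balanced S (\<lambda>s n. cls T (f s) n)"
    by (rule balancedI) (simp add: rmodule_homsD[OF f] cls_gen[OF T])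
  note U = Union_cls[OF s this]
  have "cls S s n \<in> carrier (smash M \<alpha> N S)" using s by (auto simp: smash_carrier)
  then show ?thesis using U by (simp add: smash_map_def)
qed

context
  fixes S :: "('a, 'a elt) rmodule"
  assumes S: "S \<in> FG_obj M"
begin

lemmas S1 = rmoduleD[OF FG_objD(1)[OF S], unfolded FG_objD(3)[OF S]]

text \<open>The chosen representative lies in its class, so a code \<open>Ten s n\<close> determines
  the class, and \<open>Pt\<close> is set apart by its constructor. Injectivity of the code
  follows.\<close>

lemma smash_code_cases:
  assumes X: "X \<in> carrier (smash M \<alpha> N S)"
  shows "X = base (smash M \<alpha> N S) \<and> smash_code M \<alpha> N S X = Pt \<or>
    (\<exists>s \<in> carrier S. \<exists>n \<in> carrier N. smash_code M \<alpha> N S X = Ten s n \<and> X = cls S s n)"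
proof (cases "X = base (smash M \<alpha> N S)")
  case False
  obtain s n where sn: "s \<in> carrier S" "n \<in> carrier N" "X = cls S s n" using X by (auto simp: smash_carrier)
  have "(s, n) \<in> X" using equiv_class_self[OF smash_rel_equiv] sn by blast
  then have "(SOME p. p \<in> X) \<in> X" by (rule someI)
  then obtain s' n' where p: "(SOME p. p \<in> X) = (s', n')" "(s', n') \<in> X" by (metis surj_pair)
  then have r: "((s, n), (s', n')) \<in> smash_rel M \<alpha> N S" using sn by auto
  then have "s' \<in> carrier S" "n' \<in> carrier N" "X = cls S s' n'"
    using sn equiv_class_eq[OF smash_rel_equiv r] by (auto simp: smash_rel_def)
  then show ?thesis using False p(1) by (auto simp: smash_code_def)
qed (simp add: smash_code_def)

lemma smash_code_inj: "inj_on (smash_code M \<alpha> N S) (carrier (smash M \<alpha> N S))"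
proof (rule inj_onI)
  fix X Y assume X: "X \<in> carrier (smash M \<alpha> N S)" and Y: "Y \<in> carrier (smash M \<alpha> N S)"
    and eq: "smash_code M \<alpha> N S X = smash_code M \<alpha> N S Y"
  show "X = Y" using smash_code_cases[OF X] smash_code_cases[OF Y] eq by auto
qed

lemma BC_carrier: "carrier (BC S) = smash_code M \<alpha> N S ` carrier (smash M \<alpha> N S)"
  by (simp add: base_change_obj_def transport_rmodule_def)

lemma tn_closed: "s \<in> carrier S \<Longrightarrow> n \<in> carrier N \<Longrightarrow> tn S s n \<in> carrier (BC S)"
  unfolding BC_carrier tens_def using smash_carrier by blast

lemma tn_cases:
  assumes "x \<in> carrier (BC S)"
  obtains s n where "s \<in> carrier S" "n \<in> carrier N" "x = tn S s n"
  using assms unfolding BC_carrier tens_def by (auto simp: smash_carrier)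

text \<open>Here the code itself matters and not just the tensor: the chosen representative can be
  read off from the element. \<open>base_change_not_strict\<close> compares nesting depths by this
  means.\<close>

lemma tn_Ten:
  assumes "x \<in> carrier (BC S)" "x \<noteq> Pt"
  shows "\<exists>s \<in> carrier S. \<exists>n \<in> carrier N. x = Ten s n \<and> x = tn S s n"
proof -
  obtain X where "X \<in> carrier (smash M \<alpha> N S)" "x = smash_code M \<alpha> N S X" using assms(1) by (auto simp: BC_carrier)
  then show ?thesis using smash_code_cases[of X] assms(2) unfolding tens_def by metis
qed

lemma tn_gen: "s \<in> carrier S \<Longrightarrow> m \<in> carrier M \<Longrightarrow> n \<in> carrier N \<Longrightarrow> tn S (ract S s m) n = tn S s (\<alpha> m \<otimes>\<^bsub>N\<^esub> n)"
  using cls_gen[OF FG_objD(1)[OF S]] by (simp add: tens_def)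

text \<open>Codes are injective, so equal tensors have equivalent representatives. Read
  contrapositively, a balanced function can prove two tensors different.\<close>

lemma tn_eqD:
  assumes "tn S s n = tn S s' n'" "s \<in> carrier S" "n \<in> carrier N" "s' \<in> carrier S" "n' \<in> carrier N" "balanced S g"
  shows "g s n = g s' n'"
proof -
  have c: "cls S s n \<in> carrier (smash M \<alpha> N S)" "cls S s' n' \<in> carrier (smash M \<alpha> N S)" using assms(2-5) smash_carrier by blast+
  have "cls S s n = cls S s' n'" using inj_onD[OF smash_code_inj _ c] assms(1) by (simp add: tens_def)
  then show ?thesis using smash_rel_lift[OF _ assms(6)] cls_eq_iff assms(2-5) by blast
qed

lemma tn_act: "s \<in> carrier S \<Longrightarrow> n \<in> carrier N \<Longrightarrow> n' \<in> carrier N \<Longrightarrow> ract (BC S) (tn S s n) n' = tn S s (n \<otimes>\<^bsub>N\<^esub> n')"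
proof -
  assume a: "s \<in> carrier S" "n \<in> carrier N" "n' \<in> carrier N"
  have c: "cls S s n \<in> carrier (smash M \<alpha> N S)" using a smash_carrier by blast
  show ?thesis
    using a c smash_ract[OF FG_objD(1)[OF S] a] inv_into_f_f[OF smash_code_inj c]
    by (simp add: base_change_obj_def transport_rmodule_def tens_def)
qed

lemma BC_base: "base (BC S) = Pt"
  by (simp add: base_change_obj_def transport_rmodule_def smash_code_def)

text \<open>Moving the absorbing element across the tensor gives
  \<open>s \<and> 0 = s 0 \<and> 0 = Pt \<and> 0\<close> and
  \<open>Pt \<and> n = Pt 0 \<and> n = Pt \<and> 0\<close>, which is the base point.\<close>

lemma tn_Pt: "n \<in> carrier N \<Longrightarrow> tn S Pt n = Pt" "s \<in> carrier S \<Longrightarrow> tn S s (absorb N) = Pt"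
proof -
  have b: "tn S Pt (absorb N) = Pt"
    by (simp add: tens_def smash_code_def smash_sel FG_objD(3)[OF S])
  show s: "tn S s (absorb N) = Pt" if "s \<in> carrier S" for s
  proof -
    have "tn S s (absorb N) = tn S s (\<alpha> (absorb M) \<otimes>\<^bsub>N\<^esub> absorb N)" using N1(2,7) \<alpha>_absorb by simp
    also have "\<dots> = tn S (ract S s (absorb M)) (absorb N)" using tn_gen[OF that M1(2) N1(2)] by simp
    finally show ?thesis using S1(6)[OF that] b by simp
  qed
  show "tn S Pt n = Pt" if n: "n \<in> carrier N"
  proof -
    have "tn S Pt n = tn S (ract S Pt (absorb M)) n" using S1(5)[OF M1(2)] by simp
    also have "\<dots> = tn S Pt (absorb N)" using tn_gen[OF S1(1) M1(2) n] N1(8)[OF n] \<alpha>_absorb by simp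
    finally show ?thesis using b by simp
  qed
qed

lemma tn_one: "s \<in> carrier S \<Longrightarrow> n \<in> carrier N \<Longrightarrow> tn S s n = ract (BC S) (tn S s \<one>\<^bsub>N\<^esub>) n"
  using tn_act[OF _ N1(1)] N1(4) by simp

text \<open>If \<open>s = g m\<close> for a generator \<open>g\<close>, then
  \<open>s \<and> n = g \<and> \<alpha>(m) n\<close>, so the elements \<open>g \<and> 1\<close>
  generate.\<close>

lemma BC_FG: "BC S \<in> FG_obj N"
proof -
  have mod: "is_rmodule N (BC S)"
    unfolding is_rmodule_def BC_base
  proof (intro conjI ballI allI impI)
    show "Pt \<in> carrier (BC S)" using tn_closed[OF S1(1) N1(2)] tn_Pt(2)[OF S1(1)] by simp
    show "ract (BC S) Pt n = Pt" if "n \<in> carrier N" for n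
      using tn_act[OF S1(1) N1(2) that] tn_Pt(2)[OF S1(1)] N1(8)[OF that] by simp
    show "ract (BC S) x n = undefined" if "x \<notin> carrier (BC S) \<or> n \<notin> carrier N" for x n
      using that by (auto simp: base_change_obj_def transport_rmodule_def)
    fix x assume "x \<in> carrier (BC S)"
    then obtain s k where sk: "s \<in> carrier S" "k \<in> carrier N" "x = tn S s k" by (rule tn_cases)
    show "ract (BC S) x \<one>\<^bsub>N\<^esub> = x" using tn_act[OF sk(1,2) N1(1)] N1(5)[OF sk(2)] sk(3) by simp
    show "ract (BC S) x (absorb N) = Pt" using tn_act[OF sk(1,2) N1(2)] N1(7)[OF sk(2)] sk tn_Pt by simp
    fix n assume n: "n \<in> carrier N"
    show "ract (BC S) x n \<in> carrier (BC S)" using tn_act[OF sk(1,2) n] tn_closed[OF sk(1) N1(3)[OF sk(2) n]] sk(3) by simp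
    fix n' assume n': "n' \<in> carrier N"
    show "ract (BC S) (ract (BC S) x n) n' = ract (BC S) x (n \<otimes>\<^bsub>N\<^esub> n')"
      using sk n n' N1(3,6) by (simp add: tn_act)
  qed
  obtain G where G: "finite G" "G \<subseteq> carrier S" "carrier S = (\<Union>s \<in> G. ract S s ` carrier M)"
    using FG_objD(2)[OF S] by (auto simp: fin_generated_def)
  have "fin_generated N (BC S)"
    unfolding fin_generated_def
  proof (intro exI conjI)
    show "finite ((\<lambda>g. tn S g \<one>\<^bsub>N\<^esub>) ` G)" "(\<lambda>g. tn S g \<one>\<^bsub>N\<^esub>) ` G \<subseteq> carrier (BC S)"
      using G(1,2) tn_closed N1(1) by auto
    show "carrier (BC S) = (\<Union>x \<in> (\<lambda>g. tn S g \<one>\<^bsub>N\<^esub>) ` G. ract (BC S) x ` carrier N)"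
    proof (intro equalityI subsetI)
      fix x assume "x \<in> carrier (BC S)"
      then obtain s n where sn: "s \<in> carrier S" "n \<in> carrier N" "x = tn S s n" by (rule tn_cases)
      have "s \<in> (\<Union>s \<in> G. ract S s ` carrier M)" using sn(1) G(3) by simp
      then obtain g m where g: "g \<in> G" "m \<in> carrier M" "s = ract S g m" by blast
      have gS: "g \<in> carrier S" using g(1) G(2) by blast
      have "x = ract (BC S) (tn S g \<one>\<^bsub>N\<^esub>) (\<alpha> m \<otimes>\<^bsub>N\<^esub> n)"
        using tn_gen[OF gS g(2) sn(2)] tn_one[OF gS N1(3)[OF \<alpha>_closed[OF g(2)] sn(2)]] sn(3) g(3) by simp
      then show "x \<in> (\<Union>x \<in> (\<lambda>g. tn S g \<one>\<^bsub>N\<^esub>) ` G. ract (BC S) x ` carrier N)"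
        using g(1) N1(3)[OF \<alpha>_closed[OF g(2)] sn(2)] by blast
    next
      fix x assume "x \<in> (\<Union>x \<in> (\<lambda>g. tn S g \<one>\<^bsub>N\<^esub>) ` G. ract (BC S) x ` carrier N)"
      then obtain g n where g: "g \<in> G" "n \<in> carrier N" "x = ract (BC S) (tn S g \<one>\<^bsub>N\<^esub>) n" by blast
      have "g \<in> carrier S" using g(1) G(2) by blast
      then show "x \<in> carrier (BC S)" using rmoduleD(2)[OF mod tn_closed[OF _ N1(1)] g(2)] g(3) by simp
    qed
  qed
  then show ?thesis using mod BC_base by (simp add: FG_obj_def)
qed

lemma tens_lift:
  assumes g: "balanced S g" and s: "s \<in> carrier S" "n \<in> carrier N"
  shows "tens_lift M \<alpha> N S g (tn S s n) = g s n"
proof -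
  let ?P = "\<lambda>p. p \<in> carrier S \<times> carrier N \<and> tn S s n = tn S (fst p) (snd p)"
  have "?P (SOME p. ?P p)" by (rule someI[of ?P "(s, n)"]) (use s in simp)
  then obtain s' n' where p: "(SOME p. ?P p) = (s', n')" "s' \<in> carrier S" "n' \<in> carrier N" "tn S s n = tn S s' n'"
    by (cases "SOME p. ?P p") auto
  have "tens_lift M \<alpha> N S g (tn S s n) = g s' n'"
    using tn_closed[OF s] p(1) by (simp add: tens_lift_def)
  then show ?thesis using tn_eqD[OF p(4) s p(2,3) g] by simp
qed

lemma tens_lift_hom:
  assumes g: "balanced S g" and W: "W \<in> FG_obj N"
    and cl: "\<And>s n. s \<in> carrier S \<Longrightarrow> n \<in> carrier N \<Longrightarrow> g s n \<in> carrier W"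
    and act: "\<And>s n n'. s \<in> carrier S \<Longrightarrow> n \<in> carrier N \<Longrightarrow> n' \<in> carrier N \<Longrightarrow> g s (n \<otimes>\<^bsub>N\<^esub> n') = ract W (g s n) n'"
  shows "tens_lift M \<alpha> N S g \<in> rmodule_homs N (BC S) W"
proof -
  note L = tens_lift[OF g]
  have "restrict (tens_lift M \<alpha> N S g) (carrier (BC S)) \<in> rmodule_homs N (BC S) W"
  proof (rule rmodule_homs_restrict[OF FG_objD(1)[OF BC_FG]])
    \<comment> \<open>The value of the lift at the base point is
      \<open>g Pt 0 = g Pt (0 0) = (g Pt 0) 0\<close>, hence the base point of
      \<open>W\<close>.\<close>
    have "g Pt (absorb N) = ract W (g Pt (absorb N)) (absorb N)" using act[OF S1(1) N1(2) N1(2)] N1(7)[OF N1(2)] by simp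
    also have "\<dots> = base W" using rmoduleD(6)[OF FG_objD(1)[OF W]] cl[OF S1(1) N1(2)] by simp
    finally show "tens_lift M \<alpha> N S g (base (BC S)) = base W"
      using L[OF S1(1) N1(2)] tn_Pt(2)[OF S1(1)] BC_base by simp
    fix x assume "x \<in> carrier (BC S)"
    then obtain s k where sk: "s \<in> carrier S" "k \<in> carrier N" "x = tn S s k" by (rule tn_cases)
    show "tens_lift M \<alpha> N S g x \<in> carrier W" using L cl sk by simp
    show "tens_lift M \<alpha> N S g (ract (BC S) x n) = ract W (tens_lift M \<alpha> N S g x) n" if n: "n \<in> carrier N" for n
      using L[OF sk(1,2)] L[OF sk(1) N1(3)[OF sk(2) n]] tn_act[OF sk(1,2) n] act[OF sk(1,2) n] sk(3) by simp
  qed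
  then show ?thesis by (simp add: tens_lift_def)
qed

text \<open>The elements \<open>s \<and> 1\<close> generate, because
  \<open>s \<and> n = (s \<and> 1) n\<close>.\<close>

lemma tn_homs_eqI:
  assumes "f \<in> rmodule_homs N (BC S) W" "g \<in> rmodule_homs N (BC S) W"
    and "\<And>s. s \<in> carrier S \<Longrightarrow> f (tn S s \<one>\<^bsub>N\<^esub>) = g (tn S s \<one>\<^bsub>N\<^esub>)"
  shows "f = g"
proof (rule rmodule_homs_eqI[OF assms(1,2)])
  fix x assume "x \<in> carrier (BC S)"
  then obtain s n where sn: "s \<in> carrier S" "n \<in> carrier N" "x = tn S s n" by (rule tn_cases)
  then show "f x = g x"
    using rmodule_homsD(3)[OF assms(1) tn_closed[OF sn(1) N1(1)] sn(2)] rmodule_homsD(3)[OF assms(2) tn_closed[OF sn(1) N1(1)] sn(2)]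
      tn_one[OF sn(1,2)] assms(3)[OF sn(1)] by simp
qed

lemma BC_fun:
  assumes T: "T \<in> FG_obj M" and f: "f \<in> rmodule_homs M S T" and s: "s \<in> carrier S" "n \<in> carrier N"
  shows "bf S f T (tn S s n) = tn T (f s) n"
proof -
  have c: "cls S s n \<in> carrier (smash M \<alpha> N S)" using s smash_carrier by blast
  show ?thesis
    using tn_closed[OF s] inv_into_f_f[OF smash_code_inj c] smash_map_cls[OF FG_objD(1)[OF S] FG_objD(1)[OF T] f s]
    by (simp add: base_change_fun_def tens_def)
qed

end

section \<open>Functoriality of base change\<close>

lemma BC_fun_hom:
  assumes S: "S \<in> FG_obj M" and T: "T \<in> FG_obj M" and f: "f \<in> rmodule_homs M S T"
  shows "bf S f T \<in> rmodule_homs N (BC S) (BC T)"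
proof -
  note hf = rmodule_homsD[OF f]
  have b: "balanced S (\<lambda>s n. tn T (f s) n)"
    by (rule balancedI) (use hf tn_gen[OF T] in simp)
  have "tens_lift M \<alpha> N S (\<lambda>s n. tn T (f s) n) \<in> rmodule_homs N (BC S) (BC T)"
    by (rule tens_lift_hom[OF S b BC_FG[OF T]]) (use hf(1) tn_closed[OF T] tn_act[OF T] in simp_all)
  moreover have "tens_lift M \<alpha> N S (\<lambda>s n. tn T (f s) n) x = bf S f T x" if "x \<in> carrier (BC S)" for x
    using tn_cases[OF S that] tens_lift[OF S b] BC_fun[OF S T f] by metis
  moreover have "bf S f T \<in> extensional (carrier (BC S))" by (simp add: base_change_fun_def)
  ultimately have "tens_lift M \<alpha> N S (\<lambda>s n. tn T (f s) n) = bf S f T"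
    by (auto intro!: extensionalityI[of _ "carrier (BC S)"] simp: tens_lift_def)
  with \<open>tens_lift M \<alpha> N S (\<lambda>s n. tn T (f s) n) \<in> _\<close> show ?thesis by simp
qed

lemma BC_sel:
  "on_obj (bc) S = BC S"
  "on_arr (bc) (Arrow S f T) = Arrow (BC S) (bf S f T) (BC T)"
  by simp_all

lemma BC_fun_compose:
  assumes S: "S \<in> FG_obj M" and T: "T \<in> FG_obj M" and U: "U \<in> FG_obj M" and f: "f \<in> rmodule_homs M S T" and g: "g \<in> rmodule_homs M T U"
  shows "bf S (compose (carrier S) g f) U = compose (carrier (BC S)) (bf T g U) (bf S f T)"
proof (rule tn_homs_eqI[OF S])
  have gf: "compose (carrier S) g f \<in> rmodule_homs M S U" by (rule rmodule_homs_compose[OF FG_objD(1)[OF S] f g])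
  show "bf S (compose (carrier S) g f) U \<in> rmodule_homs N (BC S) (BC U)" by (rule BC_fun_hom[OF S U gf])
  show "compose (carrier (BC S)) (bf T g U) (bf S f T) \<in> rmodule_homs N (BC S) (BC U)"
    by (rule rmodule_homs_compose[OF FG_objD(1)[OF BC_FG[OF S]] BC_fun_hom[OF S T f] BC_fun_hom[OF T U g]])
  fix s assume s: "s \<in> carrier S"
  show "bf S (compose (carrier S) g f) U (tn S s \<one>\<^bsub>N\<^esub>) =
      compose (carrier (BC S)) (bf T g U) (bf S f T) (tn S s \<one>\<^bsub>N\<^esub>)"
    using BC_fun[OF S U gf s N1(1)] BC_fun[OF S T f s N1(1)] BC_fun[OF T U g rmodule_homsD(1)[OF f s] N1(1)] tn_closed[OF S s N1(1)] s
    by (simp add: compose_eq)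
qed

lemma BC_fun_id:
  assumes S: "S \<in> FG_obj M"
  shows "bf S (\<lambda>s \<in> carrier S. s) S = (\<lambda>x \<in> carrier (BC S). x)"
  by (rule tn_homs_eqI[OF S BC_fun_hom[OF S S rmodule_homs_id[OF FG_objD(1)[OF S]]] rmodule_homs_id[OF FG_objD(1)[OF BC_FG[OF S]]]])
    (use BC_fun[OF S S rmodule_homs_id[OF FG_objD(1)[OF S]] _ N1(1)] tn_closed[OF S _ N1(1)] in simp)

lemma BC_functor: "is_functor (FG M) (FG N) (bc)"
proof (rule is_functorI[OF FG_category FG_category])
  fix S assume "S \<in> Obj (FG M)"
  then have S: "S \<in> FG_obj M" by simp
  show "on_obj (bc) S \<in> Obj (FG N)" using BC_FG[OF S] by simp
  show "on_arr (bc) (Idn (FG M) S) = Idn (FG N) (on_obj (bc) S)"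
    using BC_fun_id[OF S] by simp
next
  fix a assume "a \<in> Arr (FG M)"
  then obtain S f T where a: "a = Arrow S f T" "S \<in> FG_obj M" "T \<in> FG_obj M" "f \<in> rmodule_homs M S T" by (auto elim!: FG_arrE)
  show "on_arr (bc) a \<in> Arr (FG N)"
    using BC_FG[OF a(2)] BC_FG[OF a(3)] BC_fun_hom[OF a(2-4)] by (simp add: a(1) FG_arr_iff)
  show "Src (FG N) (on_arr (bc) a) = on_obj (bc) (Src (FG M) a)"
    "Tgt (FG N) (on_arr (bc) a) = on_obj (bc) (Tgt (FG M) a)"
    by (simp_all add: a(1))
  fix b assume "b \<in> Arr (FG M)" "Src (FG M) b = Tgt (FG M) a"
  then obtain g U where b: "b = Arrow T g U" "U \<in> FG_obj M" "g \<in> rmodule_homs M T U" by (auto simp: a(1) elim!: FG_arrE)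
  show "on_arr (bc) (Cmp (FG M) b a) =
      Cmp (FG N) (on_arr (bc) b) (on_arr (bc) a)"
    using BC_fun_compose[OF a(2,3) b(2) a(4) b(3)] by (simp add: a(1) b(1))
qed

text \<open>The images of finitely generated \<open>M\<close>-modules in an \<open>N\<close>-module \<open>W\<close> are again finitely
  generated \<open>M\<close>-modules, although \<open>W\<close> itself is not in general. This replaces the restriction of
  scalars in the proof that base change preserves pushouts.\<close>

definition image_module :: "('a, 'a elt) rmodule \<Rightarrow> 'a elt set \<Rightarrow> ('a, 'a elt) rmodule" where
  "image_module W K = \<lparr>carrier = K, base = Pt, ract = (\<lambda>w m. if w \<in> K \<and> m \<in> carrier M then ract W w (\<alpha> m) else undefined)\<rparr>"

text \<open>The \<open>M\<close>-homomorphisms from \<open>S\<close> to \<open>W\<close> with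
  scalars restricted along \<open>\<alpha>\<close>. They are described inside \<open>W\<close>,
  since the restricted module need not be an object of \<open>FG M\<close>.\<close>

definition semi_homs :: "('a, 'a elt) rmodule \<Rightarrow> ('a, 'a elt) rmodule \<Rightarrow> ('a elt \<Rightarrow> 'a elt) set" where
  "semi_homs S W = {h. (\<forall>s \<in> carrier S. h s \<in> carrier W) \<and> h Pt = Pt \<and>
     (\<forall>s \<in> carrier S. \<forall>m \<in> carrier M. h (ract S s m) = ract W (h s) (\<alpha> m))}"

text \<open>One direction of the adjunction between base change and restriction of scalars: a
  homomorphism is transposed by evaluating it on the elements \<open>s \<and> 1\<close>.\<close>

lemma semi_homs_BC:
  assumes S: "S \<in> FG_obj M" and W: "W \<in> FG_obj N" and f: "f \<in> rmodule_homs N (BC S) W"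
  shows "(\<lambda>s. f (tn S s \<one>\<^bsub>N\<^esub>)) \<in> semi_homs S W"
proof -
  note hf = rmodule_homsD[OF f]
  have "f (tn S (ract S s m) \<one>\<^bsub>N\<^esub>) = ract W (f (tn S s \<one>\<^bsub>N\<^esub>)) (\<alpha> m)" if "s \<in> carrier S" "m \<in> carrier M" for s m
    using tn_gen[OF S that N1(1)] N1(5)[OF \<alpha>_closed[OF that(2)]] tn_one[OF S that(1) \<alpha>_closed[OF that(2)]]
      hf(3)[OF tn_closed[OF S that(1) N1(1)] \<alpha>_closed[OF that(2)]] by simp
  then show ?thesis
    using hf(1)[OF tn_closed[OF S _ N1(1)]] hf(2) BC_base tn_Pt(1)[OF S N1(1)] FG_objD(3)[OF W] S by (simp add: semi_homs_def)
qed

text \<open>The images of the generators of \<open>S\<close> and \<open>T\<close> generate. Two maps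
  are taken at once because the module has to receive both legs of a cocone, or two competing
  mediating maps.\<close>

lemma image_module_FG:
  assumes W: "W \<in> FG_obj N" and S: "S \<in> FG_obj M" and T: "T \<in> FG_obj M"
    and h: "h \<in> semi_homs S W" and k: "k \<in> semi_homs T W"
  shows "image_module W (h ` carrier S \<union> k ` carrier T) \<in> FG_obj M"
proof -
  note W1 = rmoduleD[OF FG_objD(1)[OF W], unfolded FG_objD(3)[OF W]]
  define K where "K = h ` carrier S \<union> k ` carrier T"
  note SS = rmoduleD[OF FG_objD(1)[OF S], unfolded FG_objD(3)[OF S]] and TT = rmoduleD[OF FG_objD(1)[OF T], unfolded FG_objD(3)[OF T]]
  have KW: "w \<in> carrier W" if "w \<in> K" for w using that h k by (auto simp: K_def semi_homs_def)
  have hh: "\<And>s m. s \<in> carrier S \<Longrightarrow> m \<in> carrier M \<Longrightarrow> ract W (h s) (\<alpha> m) = h (ract S s m)"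
    and kk: "\<And>s m. s \<in> carrier T \<Longrightarrow> m \<in> carrier M \<Longrightarrow> ract W (k s) (\<alpha> m) = k (ract T s m)"
    using h k by (simp_all add: semi_homs_def)
  have Kact: "ract W w (\<alpha> m) \<in> K" if w: "w \<in> K" and m: "m \<in> carrier M" for w m
    using w hh[OF _ m] kk[OF _ m] SS(2)[OF _ m] TT(2)[OF _ m] by (auto simp: K_def)
  have "h Pt = Pt" using h by (simp add: semi_homs_def)
  then have PtK: "Pt \<in> K" using SS(1) unfolding K_def by (metis UnI1 imageI)
  have "is_rmodule M (image_module W K)"
    unfolding is_rmodule_def image_module_def partial_object.select_convs rmodule.select_convs
    using PtK Kact M1 W1 KW \<alpha>_closed \<alpha>_mult \<alpha>_one \<alpha>_absorb by auto
  moreover have "fin_generated M (image_module W K)"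
  proof -
    obtain G where G: "finite G" "G \<subseteq> carrier S" "carrier S = (\<Union>s \<in> G. ract S s ` carrier M)"
      using FG_objD(2)[OF S] by (auto simp: fin_generated_def)
    obtain H where H: "finite H" "H \<subseteq> carrier T" "carrier T = (\<Union>s \<in> H. ract T s ` carrier M)"
      using FG_objD(2)[OF T] by (auto simp: fin_generated_def)
    have GK: "h g \<in> K" if "g \<in> G" for g using that G(2) by (auto simp: K_def)
    have HK: "k g \<in> K" if "g \<in> H" for g using that H(2) by (auto simp: K_def)
    have "K = (\<Union>w \<in> h ` G \<union> k ` H. ract (image_module W K) w ` carrier M)"
    proof (intro equalityI subsetI)
      fix w assume "w \<in> K"
      then consider s where "s \<in> carrier S" "w = h s" | s where "s \<in> carrier T" "w = k s" by (auto simp: K_def)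
      then show "w \<in> (\<Union>w \<in> h ` G \<union> k ` H. ract (image_module W K) w ` carrier M)"
      proof cases
        case 1
        have "s \<in> (\<Union>s \<in> G. ract S s ` carrier M)" using 1(1) G(3) by simp
        then obtain g m where g: "g \<in> G" "m \<in> carrier M" "s = ract S g m" by blast
        have "g \<in> carrier S" using g(1) G(2) by blast
        then have "w = ract (image_module W K) (h g) m" using hh[of g m] g 1(2) GK by (simp add: image_module_def)
        then show ?thesis using g by blast
      next
        case 2
        have "s \<in> (\<Union>s \<in> H. ract T s ` carrier M)" using 2(1) H(3) by simp
        then obtain g m where g: "g \<in> H" "m \<in> carrier M" "s = ract T g m" by blast
        have "g \<in> carrier T" using g(1) H(2) by blast
        then have "w = ract (image_module W K) (k g) m" using kk[of g m] g 2(2) HK by (simp add: image_module_def)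
        then show ?thesis using g by blast
      qed
    next
      fix w assume "w \<in> (\<Union>w \<in> h ` G \<union> k ` H. ract (image_module W K) w ` carrier M)"
      then obtain v m where v: "v \<in> h ` G \<union> k ` H" "m \<in> carrier M" "w = ract (image_module W K) v m" by blast
      have "v \<in> K" using v(1) GK HK by blast
      then show "w \<in> K" using Kact[OF _ v(2)] v by (simp add: image_module_def)
    qed
    then have gen: "carrier (image_module W K) = (\<Union>w \<in> h ` G \<union> k ` H. ract (image_module W K) w ` carrier M)"
      by (simp add: image_module_def)
    show ?thesis
      unfolding fin_generated_def
    proof (intro exI conjI)
      show "finite (h ` G \<union> k ` H)" "h ` G \<union> k ` H \<subseteq> carrier (image_module W K)"
        using G(1) H(1) GK HK by (auto simp: image_module_def)
    qed (rule gen)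
  qed
  ultimately show ?thesis by (simp add: FG_obj_def K_def image_module_def)
qed

lemma image_module_hom:
  assumes S: "S \<in> FG_obj M" and h: "h \<in> semi_homs S W" and K: "h ` carrier S \<subseteq> K"
  shows "restrict h (carrier S) \<in> rmodule_homs M S (image_module W K)"
  by (rule rmodule_homs_restrict[OF FG_objD(1)[OF S]])
    (use h K FG_objD(3)[OF S] in \<open>auto simp: semi_homs_def image_module_def\<close>)

section \<open>Exactness of base change\<close>

lemma FG_pushout_elems:
  assumes po: "is_pushout (FG M) a b c d"
  obtains X Y Z P fa fb fc fd where "a = Arrow X fa Y" "b = Arrow X fb Z" "c = Arrow Y fc P" "d = Arrow Z fd P"
    "X \<in> FG_obj M" "Y \<in> FG_obj M" "Z \<in> FG_obj M" "P \<in> FG_obj M"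
    "fa \<in> rmodule_homs M X Y" "fb \<in> rmodule_homs M X Z" "fc \<in> rmodule_homs M Y P" "fd \<in> rmodule_homs M Z P"
proof -
  note D = FG.pushoutD[OF po, unfolded FG_sel]
  obtain X fa Y where a: "a = Arrow X fa Y" "X \<in> FG_obj M" "Y \<in> FG_obj M" "fa \<in> rmodule_homs M X Y"
    using D(1) by (rule FG_arrE)
  obtain fb Z where b: "b = Arrow X fb Z" "Z \<in> FG_obj M" "fb \<in> rmodule_homs M X Z"
    using D(2,5) a by (auto elim!: FG_arrE)
  obtain fc P where c: "c = Arrow Y fc P" "P \<in> FG_obj M" "fc \<in> rmodule_homs M Y P"
    using D(3,6) a by (auto elim!: FG_arrE)
  obtain fd where d: "d = Arrow Z fd P" "fd \<in> rmodule_homs M Z P"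
    using D(4,7,8) b c by (auto elim!: FG_arrE)
  show ?thesis by (rule that[OF a(1) b(1) c(1) d(1) a(2,3) b(2) c(2) a(4) b(3) c(3) d(2)])
qed

lemma BC_pushout:
  assumes po: "is_pushout (FG M) a b c d"
  shows "is_pushout (FG N) (on_arr (bc) a) (on_arr (bc) b)
    (on_arr (bc) c) (on_arr (bc) d)"
proof -
  obtain X Y Z P fa fb fc fd where e: "a = Arrow X fa Y" "b = Arrow X fb Z" "c = Arrow Y fc P" "d = Arrow Z fd P"
    and o: "X \<in> FG_obj M" "Y \<in> FG_obj M" "Z \<in> FG_obj M" "P \<in> FG_obj M"
    and h: "fa \<in> rmodule_homs M X Y" "fb \<in> rmodule_homs M X Z" "fc \<in> rmodule_homs M Y P" "fd \<in> rmodule_homs M Z P"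
    using FG_pushout_elems[OF po] .
  note po' = po[unfolded e]
  note hc = rmodule_homsD[OF h(3)] and hd = rmodule_homsD[OF h(4)]
  have sq: "fc (fa x) = fd (fb x)" if "x \<in> carrier X" for x
    by (rule compose_eqD[of "carrier X"]) (use FG.pushoutD(9)[OF po'] that in simp_all)
  show ?thesis
    unfolding e BC_sel
  proof (rule FG.pushoutI[of _ _ "BC X" "BC Y" _ "BC Z" _ "BC P"])
    show "Cmp (FG N) (Arrow (BC Y) (bf Y fc P) (BC P)) (Arrow (BC X) (bf X fa Y) (BC Y)) =
      Cmp (FG N) (Arrow (BC Z) (bf Z fd P) (BC P)) (Arrow (BC X) (bf X fb Z) (BC Z))"
      using FG.pushoutD(9)[OF po'] BC_fun_compose[OF o(1,2,4) h(1,3)] BC_fun_compose[OF o(1,3,4) h(2,4)] by simp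
  next
    fix c' d' W assume c': "FG.arr N c' (BC Y) W" and d': "FG.arr N d' (BC Z) W"
      and eq: "Cmp (FG N) c' (Arrow (BC X) (bf X fa Y) (BC Y)) =
        Cmp (FG N) d' (Arrow (BC X) (bf X fb Z) (BC Z))"
    obtain gc where gc: "c' = Arrow (BC Y) gc W" "gc \<in> rmodule_homs N (BC Y) W" "W \<in> FG_obj N" using c' by (auto elim!: FG_arrE)
    obtain gd where gd: "d' = Arrow (BC Z) gd W" "gd \<in> rmodule_homs N (BC Z) W" using d' by (auto elim!: FG_arrE)
    note sc = semi_homs_BC[OF o(2) gc(3,2)] and sd = semi_homs_BC[OF o(3) gc(3) gd(2)]
    \<comment> \<open>The cocone is transposed to semilinear maps on \<open>Y\<close> and
      \<open>Z\<close>. The union \<open>K\<close> of their images carries an object of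
      \<open>FG M\<close>, to which the pushout over \<open>M\<close> applies.\<close>
    define hc' hd' K where "hc' = (\<lambda>y. gc (tn Y y \<one>\<^bsub>N\<^esub>))" and "hd' = (\<lambda>z. gd (tn Z z \<one>\<^bsub>N\<^esub>))"
      and "K = hc' ` carrier Y \<union> hd' ` carrier Z"
    have IM: "image_module W K \<in> FG_obj M"
      unfolding K_def hc'_def hd'_def by (rule image_module_FG[OF gc(3) o(2,3) sc sd])
    have KW: "w \<in> carrier W" if "w \<in> K" for w using that sc sd by (auto simp: K_def hc'_def hd'_def semi_homs_def)
    have rc: "restrict hc' (carrier Y) \<in> rmodule_homs M Y (image_module W K)"
      by (rule image_module_hom[OF o(2)]) (use sc in \<open>auto simp: K_def hc'_def\<close>)
    have rd: "restrict hd' (carrier Z) \<in> rmodule_homs M Z (image_module W K)"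
      by (rule image_module_hom[OF o(3)]) (use sd in \<open>auto simp: K_def hd'_def\<close>)
    have "hc' (fa x) = hd' (fb x)" if x: "x \<in> carrier X" for x
    proof -
      have "gc (bf X fa Y (tn X x \<one>\<^bsub>N\<^esub>)) = gd (bf X fb Z (tn X x \<one>\<^bsub>N\<^esub>))"
        by (rule compose_eqD[of "carrier (BC X)"]) (use eq tn_closed[OF o(1) x N1(1)] in \<open>simp_all add: gc gd\<close>)
      then show ?thesis using BC_fun[OF o(1,2) h(1) x N1(1)] BC_fun[OF o(1,3) h(2) x N1(1)] by (simp add: hc'_def hd'_def)
    qed
    then have po_eq: "Cmp (FG M) (Arrow Y (restrict hc' (carrier Y)) (image_module W K)) (Arrow X fa Y) =
        Cmp (FG M) (Arrow Z (restrict hd' (carrier Z)) (image_module W K)) (Arrow X fb Z)"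
      using rmodule_homsD(1)[OF h(1)] rmodule_homsD(1)[OF h(2)] by (auto simp: compose_def fun_eq_iff)
    obtain u where u: "FG.arr M u (Tgt (FG M) (Arrow Y fc P)) (image_module W K)"
      "Cmp (FG M) u (Arrow Y fc P) = Arrow Y (restrict hc' (carrier Y)) (image_module W K)"
      "Cmp (FG M) u (Arrow Z fd P) = Arrow Z (restrict hd' (carrier Z)) (image_module W K)"
      by (rule FG.pushout_ex[OF po' _ _ po_eq that]) (use o IM rc rd in \<open>simp_all add: FG_arr_iff\<close>)
    obtain uf where uf: "u = Arrow P uf (image_module W K)" "uf \<in> rmodule_homs M P (image_module W K)"
      using u(1) by (auto elim!: FG_arrE)
    note hu = rmodule_homsD[OF uf(2)]
    have uY: "uf (fc y) = hc' y" if "y \<in> carrier Y" for y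
      by (rule compose_eq_restrictD[OF _ that]) (use u(2) in \<open>simp add: uf\<close>)
    have uZ: "uf (fd z) = hd' z" if "z \<in> carrier Z" for z
      by (rule compose_eq_restrictD[OF _ that]) (use u(3) in \<open>simp add: uf\<close>)
    have uK: "uf p \<in> K" if "p \<in> carrier P" for p using hu(1)[OF that] by (simp add: image_module_def)
    note W1 = rmoduleD[OF FG_objD(1)[OF gc(3)]]
    \<comment> \<open>Transposing back: \<open>p \<and> n\<close> is sent to \<open>u(p) n\<close>,
      computed in \<open>W\<close>. This is balanced since \<open>u\<close> is semilinear over
      \<open>\<alpha>\<close>.\<close>
    define v where "v = tens_lift M \<alpha> N P (\<lambda>p n. ract W (uf p) n)"
    have bal: "balanced P (\<lambda>p n. ract W (uf p) n)"
      by (rule balancedI) (use hu(3) uK W1(4)[OF KW[OF uK]] \<alpha>_closed in \<open>simp add: image_module_def\<close>)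
    have v: "v \<in> rmodule_homs N (BC P) W"
      unfolding v_def
      by (rule tens_lift_hom[OF o(4) bal gc(3)]) (use W1(2)[OF KW[OF uK]] W1(4)[OF KW[OF uK]] in simp_all)
    have vt: "v (tn P p \<one>\<^bsub>N\<^esub>) = uf p" if "p \<in> carrier P" for p
      unfolding v_def using tens_lift[OF o(4) bal that N1(1)] W1(3)[OF KW[OF uK[OF that]]] by simp
    have "compose (carrier (BC Y)) v (bf Y fc P) = gc"
    proof (rule tn_homs_eqI[OF o(2) rmodule_homs_compose[OF FG_objD(1)[OF BC_FG[OF o(2)]] BC_fun_hom[OF o(2,4) h(3)] v] gc(2)])
      fix y assume y: "y \<in> carrier Y"
      show "compose (carrier (BC Y)) v (bf Y fc P) (tn Y y \<one>\<^bsub>N\<^esub>) = gc (tn Y y \<one>\<^bsub>N\<^esub>)"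
        using tn_closed[OF o(2) y N1(1)] BC_fun[OF o(2,4) h(3) y N1(1)] vt[OF hc(1)[OF y]] uY[OF y]
        by (simp add: compose_eq hc'_def)
    qed
    moreover have "compose (carrier (BC Z)) v (bf Z fd P) = gd"
    proof (rule tn_homs_eqI[OF o(3) rmodule_homs_compose[OF FG_objD(1)[OF BC_FG[OF o(3)]] BC_fun_hom[OF o(3,4) h(4)] v] gd(2)])
      fix z assume z: "z \<in> carrier Z"
      show "compose (carrier (BC Z)) v (bf Z fd P) (tn Z z \<one>\<^bsub>N\<^esub>) = gd (tn Z z \<one>\<^bsub>N\<^esub>)"
        using tn_closed[OF o(3) z N1(1)] BC_fun[OF o(3,4) h(4) z N1(1)] vt[OF hd(1)[OF z]] uZ[OF z]
        by (simp add: compose_eq hd'_def)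
    qed
    ultimately show "\<exists>u. FG.arr N u (BC P) W \<and> Cmp (FG N) u (Arrow (BC Y) (bf Y fc P) (BC P)) = c' \<and>
        Cmp (FG N) u (Arrow (BC Z) (bf Z fd P) (BC P)) = d'"
      using v BC_FG[OF o(4)] gc(3) by (intro exI[of _ "Arrow (BC P) v W"]) (simp add: gc(1) gd(1) FG_arr_iff)
  next
    fix u v W assume u: "FG.arr N u (BC P) W" and v: "FG.arr N v (BC P) W"
      and eqs: "Cmp (FG N) u (Arrow (BC Y) (bf Y fc P) (BC P)) = Cmp (FG N) v (Arrow (BC Y) (bf Y fc P) (BC P))"
        "Cmp (FG N) u (Arrow (BC Z) (bf Z fd P) (BC P)) = Cmp (FG N) v (Arrow (BC Z) (bf Z fd P) (BC P))"
    obtain gu where gu: "u = Arrow (BC P) gu W" "gu \<in> rmodule_homs N (BC P) W" "W \<in> FG_obj N" using u by (auto elim!: FG_arrE)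
    obtain gv where gv: "v = Arrow (BC P) gv W" "gv \<in> rmodule_homs N (BC P) W" using v by (auto elim!: FG_arrE)
    note su = semi_homs_BC[OF o(4) gu(3,2)] and sv = semi_homs_BC[OF o(4) gu(3) gv(2)]
    \<comment> \<open>For uniqueness both competitors are transposed into one module that contains
      both images, so that the uniqueness over \<open>M\<close> applies to them.\<close>
    define hu hv K where "hu = (\<lambda>y. gu (tn P y \<one>\<^bsub>N\<^esub>))" and "hv = (\<lambda>z. gv (tn P z \<one>\<^bsub>N\<^esub>))"
      and "K = hu ` carrier P \<union> hv ` carrier P"
    have IM: "image_module W K \<in> FG_obj M"
      unfolding K_def hu_def hv_def by (rule image_module_FG[OF gu(3) o(4,4) su sv])
    have ru: "restrict hu (carrier P) \<in> rmodule_homs M P (image_module W K)"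
      by (rule image_module_hom[OF o(4)]) (use su in \<open>auto simp: K_def hu_def\<close>)
    have rv: "restrict hv (carrier P) \<in> rmodule_homs M P (image_module W K)"
      by (rule image_module_hom[OF o(4)]) (use sv in \<open>auto simp: K_def hv_def\<close>)
    have Y: "hu (fc y) = hv (fc y)" if y: "y \<in> carrier Y" for y
    proof -
      have "gu (bf Y fc P (tn Y y \<one>\<^bsub>N\<^esub>)) = gv (bf Y fc P (tn Y y \<one>\<^bsub>N\<^esub>))"
        by (rule compose_eqD[of "carrier (BC Y)"]) (use eqs(1) tn_closed[OF o(2) y N1(1)] in \<open>simp_all add: gu gv\<close>)
      then show ?thesis using BC_fun[OF o(2,4) h(3) y N1(1)] by (simp add: hu_def hv_def)
    qed
    have Z: "hu (fd z) = hv (fd z)" if z: "z \<in> carrier Z" for z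
    proof -
      have "gu (bf Z fd P (tn Z z \<one>\<^bsub>N\<^esub>)) = gv (bf Z fd P (tn Z z \<one>\<^bsub>N\<^esub>))"
        by (rule compose_eqD[of "carrier (BC Z)"]) (use eqs(2) tn_closed[OF o(3) z N1(1)] in \<open>simp_all add: gu gv\<close>)
      then show ?thesis using BC_fun[OF o(3,4) h(4) z N1(1)] by (simp add: hu_def hv_def)
    qed
    have "Arrow P (restrict hu (carrier P)) (image_module W K) = Arrow P (restrict hv (carrier P)) (image_module W K)"
      by (rule FG.pushout_eq[OF po', of _ "image_module W K"])
        (use o IM ru rv Y Z hc(1) hd(1) in \<open>auto simp: FG_arr_iff compose_def fun_eq_iff\<close>)
    then have "restrict hu (carrier P) = restrict hv (carrier P)" by simp
    then have "hu p = hv p" if "p \<in> carrier P" for p using that by (metis restrict_apply')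
    then have "gu = gv" by (intro tn_homs_eqI[OF o(4) gu(2) gv(2)]) (simp add: hu_def hv_def)
    then show "u = v" by (simp add: gu(1) gv(1))
  qed (use o h BC_FG BC_fun_hom in \<open>simp_all add: FG_arr_iff\<close>)
qed

text \<open>Every tensor with \<open>Pt\<close> is coded by \<open>Pt\<close>, and on both sides the
  action is \<open>undefined\<close> outside its domain. This gives an equality of modules, as the
  preservation of the chosen zero object demands.\<close>

lemma BC_zob: "BC (Zob (FG M)) = Zob (FG N)"
proof -
  note Z = FG_zob_obj[OF M]
  have cZ: "carrier (Zob (FG M)) = {Pt}" by (simp add: FG_zob)
  have c: "carrier (BC (Zob (FG M))) = {Pt}"
  proof (intro equalityI subsetI)
    fix x assume "x \<in> carrier (BC (Zob (FG M)))"
    then obtain s n where "s \<in> carrier (Zob (FG M))" "n \<in> carrier N" "x = tn (Zob (FG M)) s n" by (rule tn_cases[OF Z])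
    then show "x \<in> {Pt}" using tn_Pt(1)[OF Z] by (simp add: cZ)
  next
    fix x :: "'a elt" assume "x \<in> {Pt}"
    then show "x \<in> carrier (BC (Zob (FG M)))" using rmoduleD(1)[OF FG_objD(1)[OF BC_FG[OF Z]]] BC_base[OF Z] by simp
  qed
  note R = rmoduleD[OF FG_objD(1)[OF BC_FG[OF Z]]]
  have "ract (BC (Zob (FG M))) s n = (if s = Pt \<and> n \<in> carrier N then Pt else undefined)" for s n
    using R(5)[of n] R(7)[of s n] BC_base[OF Z] by (auto simp: c)
  then show ?thesis
    by (intro rmodule.equality) (simp_all add: c BC_base[OF Z] FG_zob[of N] fun_eq_iff)
qed

text \<open>By \<open>FG_cof_iff\<close> a cofibration is a homomorphism with a retraction, and
  every functor preserves retractions and isomorphisms.\<close>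

theorem BC_exact: "exact_functor (FG M) (FG N) (bc)"
proof (rule exact_functorI[OF BC_functor])
  show "on_obj (bc) (Zob (FG M)) = Zob (FG N)" using BC_zob by simp
  show "on_arr (bc) f \<in> Weq (FG N)" if "f \<in> Weq (FG M)" for f
    using functor_iso[OF BC_functor] that by (simp only: FG_weq)
  show "on_arr (bc) a \<in> Cof (FG N)" if a: "a \<in> Cof (FG M)" for a
  proof -
    obtain S f T r where e: "a = Arrow S f T" and o: "S \<in> FG_obj M" "T \<in> FG_obj M" and f: "f \<in> rmodule_homs M S T"
      and r: "r \<in> rmodule_homs M T S" and rf: "\<And>s. s \<in> carrier S \<Longrightarrow> r (f s) = s" using FG_cofE[OF M a] by metis
    have "compose (carrier S) r f = (\<lambda>s \<in> carrier S. s)" using rf by (auto simp: compose_def fun_eq_iff)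
    then have "compose (carrier (BC S)) (bf T r S) (bf S f T) = (\<lambda>s \<in> carrier (BC S). s)"
      using BC_fun_compose[OF o o(1) f r] BC_fun_id[OF o(1)] by simp
    then have "bf T r S (bf S f T s) = s" if "s \<in> carrier (BC S)" for s
      by (rule compose_eq_restrictD[OF _ that])
    then show ?thesis unfolding e BC_sel FG_cof_iff[OF N] FG_arr_iff
      using BC_FG[OF o(1)] BC_FG[OF o(2)] BC_fun_hom[OF o f] BC_fun_hom[OF o(2,1) r] by blast
  qed
qed (rule BC_pushout)

end

section \<open>The pseudofunctor of base change\<close>

lemma f1_category_sel [simp]:
  "Obj f1_category = {M. is_f1_algebra M}" "Src f1_category = arrow_src" "Tgt f1_category = arrow_tgt"
  "Idn f1_category M = Arrow M (\<lambda>m \<in> carrier M. m) M"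
  "Cmp f1_category (Arrow M' \<beta> L) (Arrow M \<alpha> N) = Arrow M (compose (carrier M) \<beta> \<alpha>) L"
  by (simp_all add: f1_category_def)

lemma f1_category_arr [simp]: "Arrow M \<alpha> N \<in> Arr f1_category \<longleftrightarrow> f1_hom M N \<alpha>"
  by (auto simp: f1_category_def f1_hom_def)

lemma f1_category_arrE:
  assumes "a \<in> Arr f1_category"
  obtains M \<alpha> N where "a = Arrow M \<alpha> N" "f1_hom M N \<alpha>"
  using assms by (cases a) simp

lemma f1_hom_id: "is_f1_algebra M \<Longrightarrow> f1_hom M M (\<lambda>m \<in> carrier M. m)"
  using f1_algebraD[of M] by (auto simp: f1_hom_def f1_homs_def hom_def)

lemma f1_hom_compose:
  assumes "f1_hom M N \<alpha>" "f1_hom N L \<beta>"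
  shows "f1_hom M L (compose (carrier M) \<beta> \<alpha>)"
proof -
  interpret a: f1_hom M N \<alpha> by (rule assms(1))
  interpret b: f1_hom N L \<beta> by (rule assms(2))
  have "compose (carrier M) \<beta> \<alpha> \<in> f1_homs M L"
    using a.M1 a.\<alpha>_closed a.\<alpha>_mult a.\<alpha>_one a.\<alpha>_absorb b.\<alpha>_closed b.\<alpha>_mult b.\<alpha>_one b.\<alpha>_absorb
    by (auto simp: f1_homs_def hom_def compose_eq)
  then show ?thesis using a.M b.N by (simp add: f1_hom_def)
qed

lemma f1_category: "is_category f1_category"
  unfolding is_category_def f1_category_sel
proof (intro conjI ballI impI)
  fix a assume "a \<in> Arr (f1_category :: ('a f1_algebra, ('a f1_algebra, 'a \<Rightarrow> 'a) arrow) category)"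
  then obtain M N and \<alpha> :: "'a \<Rightarrow> 'a" where a: "a = Arrow M \<alpha> N" "f1_hom M N \<alpha>" by (rule f1_category_arrE)
  interpret a: f1_hom M N \<alpha> by (rule a(2))
  show "arrow_src a \<in> {M. is_f1_algebra M}" "arrow_tgt a \<in> {M. is_f1_algebra M}" using a a.M a.N by simp_all
  show "Cmp f1_category a (Arrow (arrow_src a) (\<lambda>m\<in>carrier (arrow_src a). m) (arrow_src a)) = a"
    "Cmp f1_category (Arrow (arrow_tgt a) (\<lambda>m\<in>carrier (arrow_tgt a). m) (arrow_tgt a)) a = a"
    using a.\<alpha>_closed a.\<alpha>_ext by (auto simp: a(1) compose_def extensional_def fun_eq_iff)
  fix b assume "b \<in> Arr (f1_category :: ('a f1_algebra, ('a f1_algebra, 'a \<Rightarrow> 'a) arrow) category)" "arrow_src b = arrow_tgt a"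
  then obtain L and \<beta> :: "'a \<Rightarrow> 'a" where b: "b = Arrow N \<beta> L" "f1_hom N L \<beta>" by (auto simp: a(1) elim!: f1_category_arrE)
  show "Cmp f1_category b a \<in> Arr f1_category" "arrow_src (Cmp f1_category b a) = arrow_src a"
    "arrow_tgt (Cmp f1_category b a) = arrow_tgt b"
    using f1_hom_compose[OF a(2) b(2)] by (simp_all add: a(1) b(1))
next
  fix a b c
  assume "a \<in> Arr (f1_category :: ('a f1_algebra, ('a f1_algebra, 'a \<Rightarrow> 'a) arrow) category)"
    "b \<in> Arr (f1_category :: ('a f1_algebra, ('a f1_algebra, 'a \<Rightarrow> 'a) arrow) category)"
    "c \<in> Arr (f1_category :: ('a f1_algebra, ('a f1_algebra, 'a \<Rightarrow> 'a) arrow) category)"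
    "arrow_src b = arrow_tgt a \<and> arrow_src c = arrow_tgt b"
  then obtain M N L K and \<alpha> \<beta> \<gamma> :: "'a \<Rightarrow> 'a" where "a = Arrow M \<alpha> N" "b = Arrow N \<beta> L" "c = Arrow L \<gamma> K" "f1_hom M N \<alpha>"
    by (auto elim!: f1_category_arrE)
  then show "Cmp f1_category c (Cmp f1_category b a) = Cmp f1_category (Cmp f1_category c b) a"
    using f1_hom.\<alpha>_closed by (fastforce simp: compose_def fun_eq_iff)
qed (simp_all add: f1_hom_id)

definition unit_fun :: "'a f1_algebra \<Rightarrow> ('a, 'a elt) rmodule \<Rightarrow> 'a elt \<Rightarrow> 'a elt" where
  "unit_fun M S = (\<lambda>s \<in> carrier S. tens M (\<lambda>m \<in> carrier M. m) M S s \<one>\<^bsub>M\<^esub>)"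

text \<open>\<open>(s \<and> n) \<and> l \<mapsto> s \<and> \<beta>(n) l\<close>\<close>

definition mult_fun :: "'a f1_algebra \<Rightarrow> ('a \<Rightarrow> 'a) \<Rightarrow> 'a f1_algebra \<Rightarrow> ('a \<Rightarrow> 'a) \<Rightarrow> 'a f1_algebra \<Rightarrow>
    ('a, 'a elt) rmodule \<Rightarrow> 'a elt \<Rightarrow> 'a elt" where
  "mult_fun M \<alpha> N \<beta> L S = tens_lift N \<beta> L (base_change_obj M \<alpha> N S) (\<lambda>x l.
     tens_lift M \<alpha> N S (\<lambda>s n. tens M (compose (carrier M) \<beta> \<alpha>) L S s (\<beta> n \<otimes>\<^bsub>L\<^esub> l)) x)"

definition unit_iso where
  "unit_iso M S = Arrow S (unit_fun M S) (base_change_obj M (\<lambda>m \<in> carrier M. m) M S)"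

definition mult_iso where
  "mult_iso b a S = Arrow (on_obj (base_change b) (on_obj (base_change a) S))
     (mult_fun (arrow_src a) (arrow_fun a) (arrow_tgt a) (arrow_fun b) (arrow_tgt b) S)
     (on_obj (base_change (Cmp f1_category b a)) S)"

lemma mult_iso_Arrow: "mult_iso (Arrow N \<beta> L) (Arrow M \<alpha> N) S =
    Arrow (base_change_obj N \<beta> L (base_change_obj M \<alpha> N S)) (mult_fun M \<alpha> N \<beta> L S)
      (base_change_obj M (compose (carrier M) \<beta> \<alpha>) L S)"
  by (simp add: mult_iso_def)

section \<open>The unit constraint\<close>

context
  fixes M :: "'a f1_algebra"
  assumes M: "is_f1_algebra M"
begin

interpretation i: f1_hom M M "\<lambda>m \<in> carrier M. m" by (rule f1_hom_id[OF M])

lemma id_balanced: 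
  assumes S: "S \<in> FG_obj M"
  shows "i.balanced S (ract S)"
  by (rule i.balancedI) (use rmoduleD(4)[OF FG_objD(1)[OF S]] in simp)

lemma unit_fun_hom:
  assumes S: "S \<in> FG_obj M"
  shows "unit_fun M S \<in> rmodule_homs M S (i.BC S)"
  unfolding unit_fun_def
proof (rule rmodule_homs_restrict[OF FG_objD(1)[OF S]])
  show "tens M (\<lambda>m \<in> carrier M. m) M S (base S) \<one>\<^bsub>M\<^esub> = base (i.BC S)"
    using i.tn_Pt(1)[OF S i.M1(1)] by (simp add: FG_objD(3)[OF S] FG_objD(3)[OF i.BC_FG[OF S]])
  fix s m assume s: "s \<in> carrier S" and m: "m \<in> carrier M"
  show "tens M (\<lambda>m \<in> carrier M. m) M S (ract S s m) \<one>\<^bsub>M\<^esub> = ract (i.BC S) (tens M (\<lambda>m \<in> carrier M. m) M S s \<one>\<^bsub>M\<^esub>) m"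
    using i.tn_gen[OF S s m i.M1(1)] i.tn_one[OF S s m] i.M1(5)[OF m] m by simp
qed (rule i.tn_closed[OF S _ i.M1(1)])

text \<open>The inverse sends \<open>s \<and> m\<close> to \<open>s m\<close>; the module action is
  balanced over the identity of \<open>M\<close>.\<close>

lemma unit_iso_iso:
  assumes S: "S \<in> FG_obj M"
  shows "iso_arrow (FG M) (unit_iso M S)"
  unfolding unit_iso_def
proof (rule FG_isoI[OF S i.BC_FG[OF S] unit_fun_hom[OF S]])
  note S1 = rmoduleD[OF FG_objD(1)[OF S]]
  note b = id_balanced[OF S]
  show h: "tens_lift M (\<lambda>m \<in> carrier M. m) M S (ract S) \<in> rmodule_homs M (i.BC S) S"
    by (rule i.tens_lift_hom[OF S b S]) (use S1 in simp_all)
  note L = i.tens_lift[OF S b]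
  show "tens_lift M (\<lambda>m \<in> carrier M. m) M S (ract S) (unit_fun M S s) = s" if "s \<in> carrier S" for s
    using L[OF that i.M1(1)] S1(3)[OF that] that by (simp add: unit_fun_def)
  fix x assume "x \<in> carrier (i.BC S)"
  then obtain s n where sn: "s \<in> carrier S" "n \<in> carrier M" "x = i.tn S s n" by (rule i.tn_cases[OF S])
  have "unit_fun M S (ract S s n) = i.tn S s n"
    using S1(2)[OF sn(1,2)] i.tn_gen[OF S sn(1,2) i.M1(1)] i.M1(5)[OF sn(2)] sn(2) by (simp add: unit_fun_def)
  then show "unit_fun M S (tens_lift M (\<lambda>m \<in> carrier M. m) M S (ract S) x) = x"
    using L[OF sn(1,2)] sn(3) by simp
qed

lemma unit_iso_natural: "natural_iso (FG M) (FG M) id_functor (base_change (Idn f1_category M)) (unit_iso M)"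
  unfolding natural_iso_def
proof (intro conjI ballI)
  fix S assume "S \<in> Obj (FG M)"
  then have S: "S \<in> FG_obj M" by simp
  show "iso_arrow (FG M) (unit_iso M S)" by (rule unit_iso_iso[OF S])
  show "Src (FG M) (unit_iso M S) = on_obj id_functor S" "Tgt (FG M) (unit_iso M S) = on_obj (base_change (Idn f1_category M)) S"
    by (simp_all add: unit_iso_def id_functor_def)
next
  fix a assume "a \<in> Arr (FG M)"
  then obtain S f T where a: "a = Arrow S f T" "S \<in> FG_obj M" "T \<in> FG_obj M" "f \<in> rmodule_homs M S T" by (auto elim!: FG_arrE)
  have "compose (carrier S) (unit_fun M T) f = compose (carrier S) (base_change_fun M (\<lambda>m\<in>carrier M. m) M S f T) (unit_fun M S)"
    using i.BC_fun[OF a(2-4) _ i.M1(1)] rmodule_homsD(1)[OF a(4)] by (auto simp: compose_def unit_fun_def fun_eq_iff)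
  then show "Cmp (FG M) (unit_iso M (Tgt (FG M) a)) (on_arr id_functor a) =
      Cmp (FG M) (on_arr (base_change (Idn f1_category M)) a) (unit_iso M (Src (FG M) a))"
    by (simp add: a(1) unit_iso_def id_functor_def)
qed

end

section \<open>The composition constraint\<close>

locale f1_hom_pair = a: f1_hom M N \<alpha> + b: f1_hom N L \<beta> for M N L :: "'a f1_algebra" and \<alpha> \<beta>
begin

abbreviation ba where "ba \<equiv> compose (carrier M) \<beta> \<alpha>"

sublocale c: f1_hom M L ba
  by (rule f1_hom_compose) unfold_locales

context
  fixes S :: "('a, 'a elt) rmodule"
  assumes S: "S \<in> FG_obj M"
begin

text \<open>Multiplicativity of \<open>\<beta>\<close> turns
  \<open>\<beta>(\<alpha>(m)) (\<beta>(n) l)\<close> into \<open>\<beta>(\<alpha>(m) n) l\<close>.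
  Since \<open>mult_fun\<close> is a lift within a lift, this is needed for each fixed
  \<open>l\<close>.\<close>

lemma inner_balanced:
  assumes l: "l \<in> carrier L"
  shows "a.balanced S (\<lambda>s n. c.tn S s (\<beta> n \<otimes>\<^bsub>L\<^esub> l))"
proof (rule a.balancedI)
  fix s m n assume s: "s \<in> carrier S" "m \<in> carrier M" "n \<in> carrier N"
  have cl: "\<beta> n \<in> carrier L" "\<beta> n \<otimes>\<^bsub>L\<^esub> l \<in> carrier L" using b.\<alpha>_closed s(3) b.N1(3) l by simp_all
  have "c.tn S (ract S s m) (\<beta> n \<otimes>\<^bsub>L\<^esub> l) = c.tn S s (\<beta> (\<alpha> m) \<otimes>\<^bsub>L\<^esub> (\<beta> n \<otimes>\<^bsub>L\<^esub> l))"
    using c.tn_gen[OF S s(1,2) cl(2)] s(2) by (simp add: compose_eq)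
  also have "\<dots> = c.tn S s (\<beta> (\<alpha> m \<otimes>\<^bsub>N\<^esub> n) \<otimes>\<^bsub>L\<^esub> l)"
    using b.\<alpha>_mult[OF a.\<alpha>_closed[OF s(2)] s(3)] b.N1(6)[OF b.\<alpha>_closed[OF a.\<alpha>_closed[OF s(2)]] cl(1) l] by simp
  finally show "c.tn S (ract S s m) (\<beta> n \<otimes>\<^bsub>L\<^esub> l) = c.tn S s (\<beta> (\<alpha> m \<otimes>\<^bsub>N\<^esub> n) \<otimes>\<^bsub>L\<^esub> l)" .
qed

lemmas inner_lift = a.tens_lift[OF S inner_balanced]

text \<open>For \<open>x = s \<and> n\<close> both sides are
  \<open>s \<and> \<beta>(n) \<beta>(n') l\<close>.\<close>

lemma outer_balanced:
  "b.balanced (a.BC S) (\<lambda>x l. tens_lift M \<alpha> N S (\<lambda>s n. c.tn S s (\<beta> n \<otimes>\<^bsub>L\<^esub> l)) x)"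
proof (rule b.balancedI)
  fix x n' l assume x: "x \<in> carrier (a.BC S)" and n': "n' \<in> carrier N" and l: "l \<in> carrier L"
  obtain s n where sn: "s \<in> carrier S" "n \<in> carrier N" "x = a.tn S s n" using x by (rule a.tn_cases[OF S])
  have cl: "\<beta> n' \<otimes>\<^bsub>L\<^esub> l \<in> carrier L" "n \<otimes>\<^bsub>N\<^esub> n' \<in> carrier N" using b.\<alpha>_closed n' sn(2) b.N1(3) l b.M1(3) by simp_all
  show "tens_lift M \<alpha> N S (\<lambda>s n. c.tn S s (\<beta> n \<otimes>\<^bsub>L\<^esub> l)) (ract (a.BC S) x n') =
      tens_lift M \<alpha> N S (\<lambda>s n. c.tn S s (\<beta> n \<otimes>\<^bsub>L\<^esub> (\<beta> n' \<otimes>\<^bsub>L\<^esub> l))) x"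
    using a.tn_act[OF S sn(1,2) n'] inner_lift[OF l sn(1) cl(2)] inner_lift[OF cl(1) sn(1,2)]
      b.\<alpha>_mult[OF sn(2) n'] b.N1(6)[OF b.\<alpha>_closed[OF sn(2)] b.\<alpha>_closed[OF n'] l] sn(3) by simp
qed

lemma mult_fun_tens:
  assumes "s \<in> carrier S" "n \<in> carrier N" "l \<in> carrier L"
  shows "mult_fun M \<alpha> N \<beta> L S (b.tn (a.BC S) (a.tn S s n) l) = c.tn S s (\<beta> n \<otimes>\<^bsub>L\<^esub> l)"
  using b.tens_lift[OF a.BC_FG[OF S] outer_balanced a.tn_closed[OF S assms(1,2)] assms(3)] inner_lift[OF assms(3,1,2)]
  by (simp add: mult_fun_def)

lemma mult_fun_hom: "mult_fun M \<alpha> N \<beta> L S \<in> rmodule_homs L (b.BC (a.BC S)) (c.BC S)"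
  unfolding mult_fun_def
proof (rule b.tens_lift_hom[OF a.BC_FG[OF S] outer_balanced c.BC_FG[OF S]])
  fix x l assume x: "x \<in> carrier (a.BC S)" and l: "l \<in> carrier L"
  obtain s n where sn: "s \<in> carrier S" "n \<in> carrier N" "x = a.tn S s n" using x by (rule a.tn_cases[OF S])
  have cl: "\<beta> n \<in> carrier L" using b.\<alpha>_closed[OF sn(2)] .
  show "tens_lift M \<alpha> N S (\<lambda>s n. c.tn S s (\<beta> n \<otimes>\<^bsub>L\<^esub> l)) x \<in> carrier (c.BC S)"
    using inner_lift[OF l sn(1,2)] c.tn_closed[OF S sn(1) b.N1(3)[OF cl l]] sn(3) by simp
  fix l' assume l': "l' \<in> carrier L"
  show "tens_lift M \<alpha> N S (\<lambda>s n. c.tn S s (\<beta> n \<otimes>\<^bsub>L\<^esub> (l \<otimes>\<^bsub>L\<^esub> l'))) x =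
      ract (c.BC S) (tens_lift M \<alpha> N S (\<lambda>s n. c.tn S s (\<beta> n \<otimes>\<^bsub>L\<^esub> l)) x) l'"
    using inner_lift[OF l sn(1,2)] inner_lift[OF b.N1(3)[OF l l'] sn(1,2)] c.tn_act[OF S sn(1) b.N1(3)[OF cl l] l']
      b.N1(6)[OF cl l l'] sn(3) by simp
qed

text \<open>Write \<open>s \<and> n = (s \<and> 1) n\<close> and move \<open>n\<close> across the
  outer tensor. Every double tensor thus takes the form in which the inverse of
  \<open>mult_fun\<close> produces it.\<close>

lemma tens_tens:
  assumes "s \<in> carrier S" "n \<in> carrier N" "l \<in> carrier L"
  shows "b.tn (a.BC S) (a.tn S s n) l = b.tn (a.BC S) (a.tn S s \<one>\<^bsub>N\<^esub>) (\<beta> n \<otimes>\<^bsub>L\<^esub> l)"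
  using b.tn_gen[OF a.BC_FG[OF S] a.tn_closed[OF S assms(1) b.M1(1)] assms(2,3)] a.tn_one[OF S assms(1,2)] by simp

text \<open>The inverse sends \<open>s \<and> l\<close> to \<open>(s \<and> 1) \<and> l\<close>;
  \<open>tens_tens\<close> shows that this is balanced and that it undoes
  \<open>mult_fun\<close>.\<close>

lemma mult_fun_iso: "iso_arrow (FG L) (Arrow (b.BC (a.BC S)) (mult_fun M \<alpha> N \<beta> L S) (c.BC S))"
proof (rule FG_isoI[OF b.BC_FG[OF a.BC_FG[OF S]] c.BC_FG[OF S] mult_fun_hom])
  have bal: "c.balanced S (\<lambda>s l. b.tn (a.BC S) (a.tn S s \<one>\<^bsub>N\<^esub>) l)"
  proof (rule c.balancedI)
    fix s m l assume s: "s \<in> carrier S" "m \<in> carrier M" "l \<in> carrier L"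
    show "b.tn (a.BC S) (a.tn S (ract S s m) \<one>\<^bsub>N\<^esub>) l = b.tn (a.BC S) (a.tn S s \<one>\<^bsub>N\<^esub>) (ba m \<otimes>\<^bsub>L\<^esub> l)"
      using a.tn_gen[OF S s(1,2) b.M1(1)] b.M1(5)[OF a.\<alpha>_closed[OF s(2)]] tens_tens[OF s(1) a.\<alpha>_closed[OF s(2)] s(3)] s(2)
      by (simp add: compose_eq)
  qed
  note cl = b.tn_closed[OF a.BC_FG[OF S] a.tn_closed[OF S _ b.M1(1)]] and act = b.tn_act[OF a.BC_FG[OF S] a.tn_closed[OF S _ b.M1(1)]]
  let ?g = "tens_lift M ba L S (\<lambda>s l. b.tn (a.BC S) (a.tn S s \<one>\<^bsub>N\<^esub>) l)"
  note lift = c.tens_lift[OF S bal]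
  show "?g \<in> rmodule_homs L (c.BC S) (b.BC (a.BC S))"
    by (rule c.tens_lift_hom[OF S bal b.BC_FG[OF a.BC_FG[OF S]]]) (use cl act in simp_all)
  show "?g (mult_fun M \<alpha> N \<beta> L S x) = x" if x: "x \<in> carrier (b.BC (a.BC S))" for x
  proof -
    obtain y l where yl: "y \<in> carrier (a.BC S)" "l \<in> carrier L" "x = b.tn (a.BC S) y l" using x by (rule b.tn_cases[OF a.BC_FG[OF S]])
    obtain s n where sn: "s \<in> carrier S" "n \<in> carrier N" "y = a.tn S s n" using yl(1) by (rule a.tn_cases[OF S])
    show ?thesis
      using mult_fun_tens[OF sn(1,2) yl(2)] lift[OF sn(1) b.N1(3)[OF b.\<alpha>_closed[OF sn(2)] yl(2)]] tens_tens[OF sn(1,2) yl(2)] yl(3) sn(3) by simp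
  qed
  show "mult_fun M \<alpha> N \<beta> L S (?g x) = x" if x: "x \<in> carrier (c.BC S)" for x
  proof -
    obtain s l where sl: "s \<in> carrier S" "l \<in> carrier L" "x = c.tn S s l" using x by (rule c.tn_cases[OF S])
    show ?thesis
      using lift[OF sl(1,2)] mult_fun_tens[OF sl(1) b.M1(1) sl(2)] b.\<alpha>_one b.N1(4)[OF sl(2)] sl(3) by simp
  qed
qed

end

text \<open>For a homomorphism \<open>g\<close>, both sides of the square send
  \<open>(s \<and> n) \<and> 1\<close> to \<open>g(s) \<and> \<beta>(n) 1\<close>.\<close>

lemma mult_iso_natural:
  "natural_iso (FG M) (FG L) (comp_functor (base_change (Arrow N \<beta> L)) (base_change (Arrow M \<alpha> N)))
     (base_change (Arrow M ba L)) (mult_iso (Arrow N \<beta> L) (Arrow M \<alpha> N))"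
  unfolding natural_iso_def
proof (intro conjI ballI)
  fix S assume "S \<in> Obj (FG M)"
  then have S: "S \<in> FG_obj M" by simp
  show "iso_arrow (FG L) (mult_iso (Arrow N \<beta> L) (Arrow M \<alpha> N) S)"
    unfolding mult_iso_Arrow by (rule mult_fun_iso[OF S])
  show "Src (FG L) (mult_iso (Arrow N \<beta> L) (Arrow M \<alpha> N) S) = on_obj (comp_functor (base_change (Arrow N \<beta> L)) (base_change (Arrow M \<alpha> N))) S"
    "Tgt (FG L) (mult_iso (Arrow N \<beta> L) (Arrow M \<alpha> N) S) = on_obj (base_change (Arrow M ba L)) S"
    by (simp_all add: mult_iso_Arrow comp_functor_def)
next
  fix f assume "f \<in> Arr (FG M)"
  then obtain S g T where f: "f = Arrow S g T" and S: "S \<in> FG_obj M" and T: "T \<in> FG_obj M" and g: "g \<in> rmodule_homs M S T"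
    by (auto elim!: FG_arrE)
  note aF = a.BC_fun_hom[OF S T g] and cF = c.BC_fun_hom[OF S T g]
  note bF = b.BC_fun_hom[OF a.BC_FG[OF S] a.BC_FG[OF T] aF]
  let ?bF = "base_change_fun N \<beta> L (a.BC S) (base_change_fun M \<alpha> N S g T) (a.BC T)"
  have "compose (carrier (b.BC (a.BC S))) (mult_fun M \<alpha> N \<beta> L T) ?bF
      = compose (carrier (b.BC (a.BC S))) (base_change_fun M ba L S g T) (mult_fun M \<alpha> N \<beta> L S)"
  proof (rule b.tn_homs_eqI[OF a.BC_FG[OF S]])
    show "compose (carrier (b.BC (a.BC S))) (mult_fun M \<alpha> N \<beta> L T) ?bF \<in> rmodule_homs L (b.BC (a.BC S)) (c.BC T)"
      by (rule rmodule_homs_compose[OF FG_objD(1)[OF b.BC_FG[OF a.BC_FG[OF S]]] bF mult_fun_hom[OF T]])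
    show "compose (carrier (b.BC (a.BC S))) (base_change_fun M ba L S g T) (mult_fun M \<alpha> N \<beta> L S) \<in> rmodule_homs L (b.BC (a.BC S)) (c.BC T)"
      by (rule rmodule_homs_compose[OF FG_objD(1)[OF b.BC_FG[OF a.BC_FG[OF S]]] mult_fun_hom[OF S] cF])
    fix x assume x: "x \<in> carrier (a.BC S)"
    obtain s n where sn: "s \<in> carrier S" "n \<in> carrier N" "x = a.tn S s n" using x by (rule a.tn_cases[OF S])
    have gs: "g s \<in> carrier T" using rmodule_homsD(1)[OF g sn(1)] .
    have cl: "\<beta> n \<otimes>\<^bsub>L\<^esub> \<one>\<^bsub>L\<^esub> \<in> carrier L" using b.N1(1,3) b.\<alpha>_closed[OF sn(2)] by simp
    show "compose (carrier (b.BC (a.BC S))) (mult_fun M \<alpha> N \<beta> L T) ?bF (b.tn (a.BC S) x \<one>\<^bsub>L\<^esub>) =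
        compose (carrier (b.BC (a.BC S))) (base_change_fun M ba L S g T) (mult_fun M \<alpha> N \<beta> L S) (b.tn (a.BC S) x \<one>\<^bsub>L\<^esub>)"
      using b.tn_closed[OF a.BC_FG[OF S] x b.N1(1)] b.BC_fun[OF a.BC_FG[OF S] a.BC_FG[OF T] aF x b.N1(1)]
        a.BC_fun[OF S T g sn(1,2)] mult_fun_tens[OF T gs sn(2) b.N1(1)] mult_fun_tens[OF S sn(1,2) b.N1(1)]
        c.BC_fun[OF S T g sn(1) cl] sn(3)
      by (simp add: compose_eq)
  qed
  then show "Cmp (FG L) (mult_iso (Arrow N \<beta> L) (Arrow M \<alpha> N) (Tgt (FG M) f))
        (on_arr (comp_functor (base_change (Arrow N \<beta> L)) (base_change (Arrow M \<alpha> N))) f) =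
      Cmp (FG L) (on_arr (base_change (Arrow M ba L)) f) (mult_iso (Arrow N \<beta> L) (Arrow M \<alpha> N) (Src (FG M) f))"
    by (simp add: f mult_iso_Arrow comp_functor_def)
qed

end

section \<open>Coherence and failure of strictness\<close>

lemma f1_hom_pair_intro: "f1_hom M N \<alpha> \<Longrightarrow> f1_hom N L \<beta> \<Longrightarrow> f1_hom_pair M N L \<alpha> \<beta>"
  by (simp add: f1_hom_pair_def)

text \<open>The composite sends \<open>s \<and> 1\<close> to \<open>(s \<and> 1) \<and> 1\<close>
  and then to \<open>s \<and> \<alpha>(1) 1\<close>, which is \<open>s \<and> 1\<close>.\<close>

lemma base_change_unit_right:
  assumes f: "f1_hom M N \<alpha>" and S: "S \<in> FG_obj M"
  shows "Cmp (FG N) (mult_iso (Arrow M \<alpha> N) (Arrow M (\<lambda>m \<in> carrier M. m) M) S) (on_arr (base_change (Arrow M \<alpha> N)) (unit_iso M S))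
    = Idn (FG N) (on_obj (base_change (Arrow M \<alpha> N)) S)"
proof -
  interpret a: f1_hom M N \<alpha> by (rule f)
  interpret p: f1_hom_pair M M N "\<lambda>m \<in> carrier M. m" \<alpha> by (rule f1_hom_pair_intro[OF f1_hom_id[OF a.M] f])
  \<comment> \<open>\<open>\<alpha>\<close> is extensional on \<open>carrier M\<close>, so composing
    it with the identity gives \<open>\<alpha>\<close> itself and the modules at both ends are
    equal.\<close>
  have e: "compose (carrier M) \<alpha> (\<lambda>m \<in> carrier M. m) = \<alpha>"
    using a.\<alpha>_ext by (auto simp: compose_def extensional_def fun_eq_iff)
  note u = unit_fun_hom[OF a.M S]
  let ?m = "mult_fun M (\<lambda>m \<in> carrier M. m) M \<alpha> N S" and ?u = "base_change_fun M \<alpha> N S (unit_fun M S) (p.a.BC S)"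
  note uF = a.BC_fun_hom[OF S p.a.BC_FG[OF S] u] and mF = p.mult_fun_hom[OF S, unfolded e]
  have "compose (carrier (a.BC S)) ?m ?u = (\<lambda>x \<in> carrier (a.BC S). x)"
  proof (rule a.tn_homs_eqI[OF S rmodule_homs_compose[OF FG_objD(1)[OF a.BC_FG[OF S]] uF mF] rmodule_homs_id[OF FG_objD(1)[OF a.BC_FG[OF S]]]])
    fix s assume s: "s \<in> carrier S"
    show "compose (carrier (a.BC S)) ?m ?u (a.tn S s \<one>\<^bsub>N\<^esub>) = (\<lambda>x \<in> carrier (a.BC S). x) (a.tn S s \<one>\<^bsub>N\<^esub>)"
      using a.tn_closed[OF S s a.N1(1)] a.BC_fun[OF S p.a.BC_FG[OF S] u s a.N1(1)] p.mult_fun_tens[OF S s a.M1(1) a.N1(1)]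
        a.\<alpha>_one a.N1(4)[OF a.N1(1)] s
      by (simp add: compose_eq unit_fun_def e)
  qed
  then show ?thesis by (simp add: mult_iso_Arrow unit_iso_def e)
qed

lemma base_change_unit_left:
  assumes f: "f1_hom M N \<alpha>" and S: "S \<in> FG_obj M"
  shows "Cmp (FG N) (mult_iso (Arrow N (\<lambda>m \<in> carrier N. m) N) (Arrow M \<alpha> N) S) (unit_iso N (on_obj (base_change (Arrow M \<alpha> N)) S))
    = Idn (FG N) (on_obj (base_change (Arrow M \<alpha> N)) S)"
proof -
  interpret a: f1_hom M N \<alpha> by (rule f)
  interpret p: f1_hom_pair M N N \<alpha> "\<lambda>m \<in> carrier N. m" by (rule f1_hom_pair_intro[OF f f1_hom_id[OF a.N]])
  have e: "compose (carrier M) (\<lambda>m \<in> carrier N. m) \<alpha> = \<alpha>"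
    using a.\<alpha>_ext a.\<alpha>_closed by (auto simp: compose_def extensional_def fun_eq_iff)
  note u = unit_fun_hom[OF a.N a.BC_FG[OF S]] and mF = p.mult_fun_hom[OF S, unfolded e]
  let ?m = "mult_fun M \<alpha> N (\<lambda>m \<in> carrier N. m) N S"
  have "compose (carrier (a.BC S)) ?m (unit_fun N (a.BC S)) = (\<lambda>x \<in> carrier (a.BC S). x)"
  proof (rule a.tn_homs_eqI[OF S rmodule_homs_compose[OF FG_objD(1)[OF a.BC_FG[OF S]] u mF] rmodule_homs_id[OF FG_objD(1)[OF a.BC_FG[OF S]]]])
    fix s assume s: "s \<in> carrier S"
    show "compose (carrier (a.BC S)) ?m (unit_fun N (a.BC S)) (a.tn S s \<one>\<^bsub>N\<^esub>) = (\<lambda>x \<in> carrier (a.BC S). x) (a.tn S s \<one>\<^bsub>N\<^esub>)"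
      using a.tn_closed[OF S s a.N1(1)] p.mult_fun_tens[OF S s a.N1(1) a.N1(1)] a.N1(1) a.N1(4)[OF a.N1(1)]
      by (simp add: compose_eq unit_fun_def e)
  qed
  then show ?thesis by (simp add: mult_iso_Arrow unit_iso_def e)
qed

text \<open>On \<open>((s \<and> n) \<and> l) \<and> 1\<close> the two sides are
  \<open>s \<and> \<gamma>(\<beta>(n) l) 1\<close> and
  \<open>s \<and> \<gamma>(\<beta>(n)) (\<gamma>(l) 1)\<close>, which agree because
  \<open>\<gamma>\<close> is multiplicative.\<close>

lemma base_change_assoc:
  assumes f: "f1_hom M N \<alpha>" and g: "f1_hom N L \<beta>" and h: "f1_hom L K \<gamma>" and S: "S \<in> FG_obj M"
  shows "Cmp (FG K) (mult_iso (Arrow L \<gamma> K) (Arrow M (compose (carrier M) \<beta> \<alpha>) L) S)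
      (on_arr (base_change (Arrow L \<gamma> K)) (mult_iso (Arrow N \<beta> L) (Arrow M \<alpha> N) S))
    = Cmp (FG K) (mult_iso (Arrow N (compose (carrier N) \<gamma> \<beta>) K) (Arrow M \<alpha> N) S)
      (mult_iso (Arrow L \<gamma> K) (Arrow N \<beta> L) (on_obj (base_change (Arrow M \<alpha> N)) S))"
proof -
  interpret gf: f1_hom_pair M N L \<alpha> \<beta> by (rule f1_hom_pair_intro[OF f g])
  interpret hg: f1_hom_pair N L K \<beta> \<gamma> by (rule f1_hom_pair_intro[OF g h])
  interpret h_gf: f1_hom_pair M L K gf.ba \<gamma> by (rule f1_hom_pair_intro[OF f1_hom_compose[OF f g] h])
  interpret hg_f: f1_hom_pair M N K \<alpha> hg.ba by (rule f1_hom_pair_intro[OF f f1_hom_compose[OF g h]])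
  \<comment> \<open>Composition of algebra homomorphisms is strictly associative, so both sides end
    in the same module.\<close>
  have e: "compose (carrier M) (compose (carrier N) \<gamma> \<beta>) \<alpha> = compose (carrier M) \<gamma> (compose (carrier M) \<beta> \<alpha>)"
    using gf.a.\<alpha>_closed by (auto simp: compose_def fun_eq_iff)
  note aS = gf.a.BC_FG[OF S]
  note baS = gf.b.BC_FG[OF aS]
  note m1 = hg.b.BC_fun_hom[OF baS gf.c.BC_FG[OF S] gf.mult_fun_hom[OF S]]
    and m2 = h_gf.mult_fun_hom[OF S] and m3 = hg.mult_fun_hom[OF aS] and m4 = hg_f.mult_fun_hom[OF S, unfolded e]
  let ?X = "hg.b.BC (gf.b.BC (gf.a.BC S))"
  let ?l = "compose (carrier ?X) (mult_fun M gf.ba L \<gamma> K S) (base_change_fun L \<gamma> K (gf.b.BC (gf.a.BC S)) (mult_fun M \<alpha> N \<beta> L S) (gf.c.BC S))"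
  let ?r = "compose (carrier ?X) (mult_fun M \<alpha> N hg.ba K S) (mult_fun N \<beta> L \<gamma> K (gf.a.BC S))"
  have "?l = ?r"
  proof (rule hg.b.tn_homs_eqI[OF baS rmodule_homs_compose[OF FG_objD(1)[OF hg.b.BC_FG[OF baS]] m1 m2]
        rmodule_homs_compose[OF FG_objD(1)[OF hg.b.BC_FG[OF baS]] m3 m4]])
    fix x assume x: "x \<in> carrier (gf.b.BC (gf.a.BC S))"
    obtain y l where yl: "y \<in> carrier (gf.a.BC S)" "l \<in> carrier L" "x = gf.b.tn (gf.a.BC S) y l" using x by (rule gf.b.tn_cases[OF aS])
    obtain s n where sn: "s \<in> carrier S" "n \<in> carrier N" "y = gf.a.tn S s n" using yl(1) by (rule gf.a.tn_cases[OF S])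
    note k = hg.b.N1(1)
    have cl: "\<beta> n \<in> carrier L" "\<beta> n \<otimes>\<^bsub>L\<^esub> l \<in> carrier L" "\<gamma> l \<in> carrier K" "\<gamma> l \<otimes>\<^bsub>K\<^esub> \<one>\<^bsub>K\<^esub> \<in> carrier K" "\<gamma> (\<beta> n) \<in> carrier K"
      using gf.b.\<alpha>_closed[OF sn(2)] gf.b.N1(3) yl(2) hg.b.\<alpha>_closed hg.b.N1(1,3) by simp_all
    have "?l (hg.b.tn (gf.b.BC (gf.a.BC S)) x \<one>\<^bsub>K\<^esub>) = h_gf.c.tn S s (\<gamma> (\<beta> n \<otimes>\<^bsub>L\<^esub> l) \<otimes>\<^bsub>K\<^esub> \<one>\<^bsub>K\<^esub>)"
      using hg.b.tn_closed[OF baS x k] hg.b.BC_fun[OF baS gf.c.BC_FG[OF S] gf.mult_fun_hom[OF S] x k]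
        gf.mult_fun_tens[OF S sn(1,2) yl(2)] h_gf.mult_fun_tens[OF S sn(1) cl(2) k] yl(3) sn(3)
      by (simp add: compose_eq)
    also have "\<dots> = h_gf.c.tn S s (hg.ba n \<otimes>\<^bsub>K\<^esub> (\<gamma> l \<otimes>\<^bsub>K\<^esub> \<one>\<^bsub>K\<^esub>))"
      using hg.b.\<alpha>_mult[OF cl(1) yl(2)] hg.b.N1(6)[OF cl(5,3) k] sn(2) by (simp add: compose_eq)
    also have "\<dots> = ?r (hg.b.tn (gf.b.BC (gf.a.BC S)) x \<one>\<^bsub>K\<^esub>)"
      using hg.b.tn_closed[OF baS x k] hg.mult_fun_tens[OF aS yl(1,2) k] hg_f.mult_fun_tens[OF S sn(1,2) cl(4)] yl(3) sn(3)
      by (simp add: compose_eq e)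
    finally show "?l (hg.b.tn (gf.b.BC (gf.a.BC S)) x \<one>\<^bsub>K\<^esub>) = ?r (hg.b.tn (gf.b.BC (gf.a.BC S)) x \<one>\<^bsub>K\<^esub>)" .
  qed
  then show ?thesis by (simp add: mult_iso_Arrow e)
qed

theorem base_change_pseudofunctor:
  "is_pseudofunctor (f1_category :: ('a f1_algebra, ('a f1_algebra, 'a \<Rightarrow> 'a) arrow) category) FG base_change unit_iso mult_iso"
  unfolding is_pseudofunctor_def
proof (intro conjI ballI impI f1_category)
  fix M assume "M \<in> Obj (f1_category :: ('a f1_algebra, ('a f1_algebra, 'a \<Rightarrow> 'a) arrow) category)"
  then have M: "is_f1_algebra M" by simp
  show "is_waldhausen (FG M)" by (rule FG_waldhausen[OF M])
  show "natural_iso (FG M) (FG M) id_functor (base_change (Idn f1_category M)) (unit_iso M)" by (rule unit_iso_natural[OF M])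
next
  fix f assume "f \<in> Arr (f1_category :: ('a f1_algebra, ('a f1_algebra, 'a \<Rightarrow> 'a) arrow) category)"
  then obtain M N and \<alpha> :: "'a \<Rightarrow> 'a" where f: "f = Arrow M \<alpha> N" "f1_hom M N \<alpha>" by (rule f1_category_arrE)
  show "exact_functor (FG (Src f1_category f)) (FG (Tgt f1_category f)) (base_change f)"
    using f1_hom.BC_exact[OF f(2)] by (simp only: f(1) f1_category_sel arrow.sel)
  show "Cmp (FG (Tgt f1_category f)) (mult_iso f (Idn f1_category (Src f1_category f)) S) (on_arr (base_change f) (unit_iso (Src f1_category f) S))
      = Idn (FG (Tgt f1_category f)) (on_obj (base_change f) S)" if "S \<in> Obj (FG (Src f1_category f))" for S
    using base_change_unit_right[OF f(2), of S] that by (simp only: f(1) f1_category_sel arrow.sel FG_sel(1))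
  show "Cmp (FG (Tgt f1_category f)) (mult_iso (Idn f1_category (Tgt f1_category f)) f S) (unit_iso (Tgt f1_category f) (on_obj (base_change f) S))
      = Idn (FG (Tgt f1_category f)) (on_obj (base_change f) S)" if "S \<in> Obj (FG (Src f1_category f))" for S
    using base_change_unit_left[OF f(2), of S] that by (simp only: f(1) f1_category_sel arrow.sel FG_sel(1))
  fix g assume "g \<in> Arr (f1_category :: ('a f1_algebra, ('a f1_algebra, 'a \<Rightarrow> 'a) arrow) category)" "Src f1_category g = Tgt f1_category f"
  then obtain L and \<beta> :: "'a \<Rightarrow> 'a" where g: "g = Arrow N \<beta> L" "f1_hom N L \<beta>" by (auto simp: f(1) elim!: f1_category_arrE)
  show "natural_iso (FG (Src f1_category f)) (FG (Tgt f1_category g)) (comp_functor (base_change g) (base_change f))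
      (base_change (Cmp f1_category g f)) (mult_iso g f)"
    using f1_hom_pair.mult_iso_natural[OF f1_hom_pair_intro[OF f(2) g(2)]] by (simp only: f(1) g(1) f1_category_sel arrow.sel)
next
  fix f g h S
  assume "f \<in> Arr (f1_category :: ('a f1_algebra, ('a f1_algebra, 'a \<Rightarrow> 'a) arrow) category)"
    "g \<in> Arr (f1_category :: ('a f1_algebra, ('a f1_algebra, 'a \<Rightarrow> 'a) arrow) category)"
    "h \<in> Arr (f1_category :: ('a f1_algebra, ('a f1_algebra, 'a \<Rightarrow> 'a) arrow) category)"
    "Src f1_category g = Tgt f1_category f \<and> Src f1_category h = Tgt f1_category g" and S: "S \<in> Obj (FG (Src f1_category f))"
  then obtain M N L K and \<alpha> \<beta> \<gamma> :: "'a \<Rightarrow> 'a" where fgh: "f = Arrow M \<alpha> N" "g = Arrow N \<beta> L" "h = Arrow L \<gamma> K"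
    and hom: "f1_hom M N \<alpha>" "f1_hom N L \<beta>" "f1_hom L K \<gamma>"
    by (auto elim!: f1_category_arrE)
  show "Cmp (FG (Tgt f1_category h)) (mult_iso h (Cmp f1_category g f) S) (on_arr (base_change h) (mult_iso g f S)) =
      Cmp (FG (Tgt f1_category h)) (mult_iso (Cmp f1_category h g) f S) (mult_iso h g (on_obj (base_change f) S))"
    using base_change_assoc[OF hom, of S] S by (simp only: fgh f1_category_sel arrow.sel FG_sel(1))
qed

text \<open>Each base change wraps the elements other than \<open>Pt\<close> in one more
  \<open>Ten\<close>. Over the algebra \<open>{0, 1}\<close> the twofold base change of
  \<open>{Pt, Gen x}\<close> along the identity contains a term \<open>Ten (Ten _ _) _\<close>,
  whereas in the single base change the first argument of \<open>Ten\<close> lies in the original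
  module. The two elements of the type serve as \<open>1\<close> and \<open>0\<close>.\<close>

lemma base_change_not_strict:
  fixes x y :: 'a
  assumes xy: "x \<noteq> y"
  shows "\<exists>a \<in> Arr f1_category. \<exists>b \<in> Arr f1_category. Src f1_category b = Tgt f1_category a \<and>
    (\<exists>S \<in> Obj (FG (Src f1_category (a :: ('a f1_algebra, 'a \<Rightarrow> 'a) arrow))).
      on_obj (comp_functor (base_change b) (base_change a)) S \<noteq> on_obj (base_change (Cmp f1_category b a)) S)"
proof -
  \<comment> \<open>\<open>x\<close> is the unit and \<open>y\<close> the absorbing element.\<close>
  define M where "M = \<lparr>carrier = {x, y}, mult = (\<lambda>a b. if a = x then b else y), one = x, absorb = y\<rparr>"
  have M: "is_f1_algebra M"
    using xy by (auto simp: is_f1_algebra_def M_def intro!: monoidI)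
  define S where "S = \<lparr>carrier = {Pt, Gen x}, base = Pt,
    ract = (\<lambda>s m. if s \<in> {Pt, Gen x} \<and> m \<in> {x, y} then (if m = x then s else Pt) else undefined)\<rparr>"
  have mod: "is_rmodule M S" using xy by (auto simp: is_rmodule_def M_def S_def)
  have "fin_generated M S"
    unfolding fin_generated_def using xy by (intro exI[of _ "{Gen x}"]) (auto simp: M_def S_def)
  then have S: "S \<in> FG_obj M" using mod by (simp add: FG_obj_def S_def)
  interpret i: f1_hom M M "\<lambda>m \<in> carrier M. m" by (rule f1_hom_id[OF M])
  \<comment> \<open>The action of \<open>M\<close> on \<open>T\<close> is balanced and separates
    \<open>t \<and> 1\<close> from \<open>Pt \<and> 1 = Pt\<close>.\<close>
  have unit: "i.tn T t \<one>\<^bsub>M\<^esub> \<noteq> Pt" if T: "T \<in> FG_obj M" and t: "t \<in> carrier T" "t \<noteq> Pt" for T t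
  proof
    note T1 = rmoduleD[OF FG_objD(1)[OF T], unfolded FG_objD(3)[OF T]]
    assume "i.tn T t \<one>\<^bsub>M\<^esub> = Pt"
    then have "i.tn T t \<one>\<^bsub>M\<^esub> = i.tn T Pt \<one>\<^bsub>M\<^esub>" using i.tn_Pt(1)[OF T i.M1(1)] by simp
    then have "ract T t \<one>\<^bsub>M\<^esub> = ract T Pt \<one>\<^bsub>M\<^esub>"
      by (rule i.tn_eqD[OF T _ t(1) i.M1(1) T1(1) i.M1(1) id_balanced[OF M T]])
    then show False using T1(3)[OF t(1)] T1(3)[OF T1(1)] t(2) by simp
  qed
  note BS = i.BC_FG[OF S]
  have "Gen x \<in> carrier S" by (simp add: S_def)
  define e where "e = i.tn S (Gen x) \<one>\<^bsub>M\<^esub>"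
  define e' where "e' = i.tn (i.BC S) e \<one>\<^bsub>M\<^esub>"
  have e: "e \<in> carrier (i.BC S)" "e \<noteq> Pt"
    unfolding e_def using i.tn_closed[OF S _ i.M1(1)] unit[OF S] \<open>Gen x \<in> carrier S\<close> by auto
  have e': "e' \<in> carrier (i.BC (i.BC S))" "e' \<noteq> Pt"
    unfolding e'_def using i.tn_closed[OF BS e(1) i.M1(1)] unit[OF BS e] by auto
  obtain s n where sn: "s \<in> carrier (i.BC S)" "n \<in> carrier M" "e' = Ten s n" "e' = i.tn (i.BC S) s n"
    using i.tn_Ten[OF BS e'] by blast
  \<comment> \<open>A tensor with first component \<open>Pt\<close> would be \<open>Pt\<close>. So
    \<open>s\<close>, an element of the single base change, is itself a \<open>Ten\<close> term and
    does not occur in \<open>S\<close>.\<close>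
  have "s \<noteq> Pt" using sn(2,4) e'(2) i.tn_Pt(1)[OF BS] by auto
  then obtain s' n' where "s = Ten s' n'" using i.tn_Ten[OF S sn(1)] by blast
  moreover have "s \<in> carrier S" if "e' \<in> carrier (i.BC S)"
    using i.tn_Ten[OF S that e'(2)] sn(3) by auto
  ultimately have "e' \<notin> carrier (i.BC S)" by (auto simp: S_def)
  then have ne: "i.BC (i.BC S) \<noteq> i.BC S" using e'(1) by auto
  have c: "compose (carrier M) (\<lambda>m \<in> carrier M. m) (\<lambda>m \<in> carrier M. m) = (\<lambda>m \<in> carrier M. m)"
    by (auto simp: compose_def fun_eq_iff)
  let ?a = "Arrow M (\<lambda>m \<in> carrier M. m) M"
  show ?thesis
    using S ne f1_hom_id[OF M] by (intro bexI[of _ ?a] conjI bexI[of _ S]) (simp_all add: comp_functor_def c)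
qed

section \<open>Functoriality of G\<close>

lemma exact_functor_comp:
  assumes F: "exact_functor A B F" and G: "exact_functor B C G"
  shows "exact_functor A C (comp_functor G F)"
proof -
  note F1 = is_functorD[OF exact_functorD(1)[OF F]] and G1 = is_functorD[OF exact_functorD(1)[OF G]]
  show ?thesis
  proof (rule exact_functorI)
    show "is_functor A C (comp_functor G F)"
      by (rule is_functorI[OF F1(1) G1(2)]) (use F1 G1 in \<open>simp_all add: comp_functor_def\<close>)
  qed (use exact_functorD(2-5)[OF F] exact_functorD(2-5)[OF G] in \<open>simp_all add: comp_functor_def\<close>)
qed

lemma K_map_id: "K_map id_functor = (\<lambda>n q x. x)"
proof -
  have o: "map_dia_obj (\<lambda>A. A) (\<lambda>f. f) X = X" and a: "map_dia_arr (\<lambda>A. A) (\<lambda>f. f) f = f" for X f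
    using dia_obj.map_id dia_arr.map_id unfolding id_def by blast+
  show ?thesis by (auto simp: K_map_def id_functor_def fun_eq_iff o a)
qed

text \<open>The map functions of the datatypes are functorial, so \<open>K_map\<close> respects
  composition strictly; the failure of strictness lies in \<open>base_change\<close> alone.\<close>

lemma K_map_comp: "K_map (comp_functor G F) = (\<lambda>n q. K_map G n q \<circ> K_map F n q)"
  by (auto simp: K_map_def comp_functor_def fun_eq_iff dia_obj.map_comp dia_arr.map_comp)

lemma natural_iso_homotopic:
  assumes C: "prewald C" and D: "prewald D" and F: "exact_functor C D F" and G: "exact_functor C D G"
    and \<eta>: "natural_iso C D F G \<eta>"
  shows "homotopic (K_spectrum C) (K_spectrum D) (K_map F) (K_map G)"
  by (rule homotopicI[OF K_map_spectrum_map[OF C D F] K_map_spectrum_map[OF C D G] K_homotopy[OF C D F G \<eta>]])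

text \<open>\<open>K_map\<close> turns the unit and composition isomorphisms into homotopies, and
  homotopic maps have the same class. Thus the two functor laws hold in
  \<open>spectra_hcat\<close>.\<close>

lemma G_functor_is_functor: "is_functor f1_category spectra_hcat G_functor"
proof (rule is_functorI[OF f1_category spectra_hcat_category])
  have pw: "prewald (FG M)" if "is_f1_algebra M" for M :: "'a f1_algebra"
    by (rule waldhausen_prewald[OF FG_waldhausen[OF that]])
  {
    fix M :: "'a f1_algebra" assume "M \<in> Obj f1_category"
    then have M: "is_f1_algebra M" by simp
    note W = pw[OF M]
    show "on_obj G_functor M \<in> Obj spectra_hcat"
      using K_spectrum_is_spectrum[OF W] by (simp add: G_functor_def G_spectrum_def)
    have "homotopic (G_spectrum M) (G_spectrum M) (K_map id_functor) (G_map (Idn f1_category M))"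
      unfolding G_spectrum_def G_map_def
      by (rule natural_iso_homotopic[OF W W id_exact[OF W] _ unit_iso_natural[OF M]])
        (use f1_hom.BC_exact[OF f1_hom_id[OF M]] in simp)
    then have "homotopy_class (G_spectrum M) (G_spectrum M) (G_map (Idn f1_category M)) = homotopy_class (G_spectrum M) (G_spectrum M) (\<lambda>n q x. x)"
      unfolding K_map_id by (rule homotopy_class_eq[OF homotopic_sym])
    then show "on_arr G_functor (Idn f1_category M) = Idn spectra_hcat (on_obj G_functor M)"
      by (simp add: G_functor_def)
  }
  have map: "spectrum_map (G_spectrum M) (G_spectrum N) (G_map (Arrow M \<alpha> N))" if "f1_hom M N \<alpha>"
    for M N :: "'a f1_algebra" and \<alpha>
    unfolding G_spectrum_def G_map_def
    by (rule K_map_spectrum_map[OF pw[OF f1_hom.M[OF that]] pw[OF f1_hom.N[OF that]] f1_hom.BC_exact[OF that]])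
  fix a :: "('a f1_algebra, 'a \<Rightarrow> 'a) arrow" assume "a \<in> Arr f1_category"
  then obtain M N and \<alpha> :: "'a \<Rightarrow> 'a" where a: "a = Arrow M \<alpha> N" "f1_hom M N \<alpha>" by (rule f1_category_arrE)
  note W = pw[OF f1_hom.M[OF a(2)]] pw[OF f1_hom.N[OF a(2)]]
  show "on_arr G_functor a \<in> Arr spectra_hcat"
    unfolding spectra_hcat_arr using map[OF a(2)] K_spectrum_is_spectrum[OF W(1)] K_spectrum_is_spectrum[OF W(2)]
    by (intro exI[of _ "G_spectrum M"] exI[of _ "G_spectrum N"] exI[of _ "G_map a"]) (simp add: G_functor_def a(1) G_spectrum_def)
  show "Src spectra_hcat (on_arr G_functor a) = on_obj G_functor (Src f1_category a)"
    "Tgt spectra_hcat (on_arr G_functor a) = on_obj G_functor (Tgt f1_category a)"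
    by (simp_all add: G_functor_def)
  fix b :: "('a f1_algebra, 'a \<Rightarrow> 'a) arrow" assume "b \<in> Arr f1_category" "Src f1_category b = Tgt f1_category a"
  then obtain L and \<beta> :: "'a \<Rightarrow> 'a" where b: "b = Arrow N \<beta> L" "f1_hom N L \<beta>" by (auto simp: a(1) elim!: f1_category_arrE)
  note W3 = pw[OF f1_hom.N[OF b(2)]]
  have "homotopic (G_spectrum M) (G_spectrum L) (K_map (comp_functor (base_change b) (base_change a))) (G_map (Cmp f1_category b a))"
    unfolding G_spectrum_def G_map_def a(1) b(1) f1_category_sel
    by (rule natural_iso_homotopic[OF W(1) W3 exact_functor_comp[OF f1_hom.BC_exact[OF a(2)] f1_hom.BC_exact[OF b(2)]]
          f1_hom.BC_exact[OF f1_hom_compose[OF a(2) b(2)]] f1_hom_pair.mult_iso_natural[OF f1_hom_pair_intro[OF a(2) b(2)]]])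
  then have "homotopy_class (G_spectrum M) (G_spectrum L) (G_map (Cmp f1_category b a)) =
      homotopy_class (G_spectrum M) (G_spectrum L) (\<lambda>n q. G_map b n q \<circ> G_map a n q)"
    unfolding K_map_comp G_map_def by (rule homotopy_class_eq[OF homotopic_sym])
  then show "on_arr G_functor (Cmp f1_category b a) = Cmp spectra_hcat (on_arr G_functor b) (on_arr G_functor a)"
    using spectra_hcat_cmp[OF map[OF a(2)] map[OF b(2)]] by (simp add: G_functor_def a(1) b(1))
qed

theorem corollary3p7:
  "is_functor f1_category spectra_hcat
      (G_functor :: ('a f1_algebra, ('a f1_algebra, 'a \<Rightarrow> 'a) arrow,
         'a G_simplex spectrum,
         ('a G_simplex spectrum, (nat \<Rightarrow> nat \<Rightarrow> 'a G_simplex \<Rightarrow> 'a G_simplex) set) arrow) cat_functor)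
   \<and> (\<exists>\<upsilon> \<mu>. is_pseudofunctor (f1_category :: ('a f1_algebra, ('a f1_algebra, 'a \<Rightarrow> 'a) arrow) category)
          FG base_change \<upsilon> \<mu>)
   \<and> ((\<exists>x y :: 'a. x \<noteq> y) \<longrightarrow>
        (\<exists>a \<in> Arr f1_category. \<exists>b \<in> Arr f1_category.
           Src f1_category b = Tgt f1_category a \<and>
           (\<exists>S \<in> Obj (FG (Src f1_category (a :: ('a f1_algebra, 'a \<Rightarrow> 'a) arrow))).
              on_obj (comp_functor (base_change b) (base_change a)) S
                \<noteq> on_obj (base_change (Cmp f1_category b a)) S)))"
proof (intro conjI impI exI)
  show "is_pseudofunctor (f1_category :: ('a f1_algebra, ('a f1_algebra, 'a \<Rightarrow> 'a) arrow) category)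
      FG base_change unit_iso mult_iso"
    by (rule base_change_pseudofunctor)
qed (rule G_functor_is_functor, elim exE, rule base_change_not_strict)

end
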